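(* Let $\alpha\in(0,1)$ be irrational with partial quotients $(a_n)_{n\ge1}$ and denominators $(q_n)_{n\ge 0}$. Let $(t_k)_{k\ge 1}$ be a strictly increasing sequence of positive integers and let $L_n=\sum_{k=1}^n q_{t_k}$, $n\ge 1$. Assume that $a_{t_k+1}\ge k^{\beta}$ for all $k\ge 1$, for some $\beta>1$. Then, for every real-valued centered function $\varphi$ of bounded variation on $\mathbb{T}^1$ such that, for a constant $c>0$, $$\sum_{k=1}^n \|\widehat\varphi_{q_{t_k}}\|_2^2\ \ge\ c\,n\quad\text{for all } n\ge1,$$ we have $$\frac{\|\varphi_{L_n}\|_2^2}{\sum_{k=1}^n \|\widehat\varphi_{q_{t_k}}\|_2^2}\longrightarrow 1 \quad (n\to\infty)$$ and the convergence in distribution $$\frac{\varphi_{L_n}}{\|\varphi_{L_n}\|_2}\longrightarrow \mathcal N(0,1).$$ Moreover, keeping its distribution, the process $(\varphi_{L_n})_{n\ge1}$ can be redefined on a probability space together with a standard one-dimensional Wiener process $(\zeta(t))_{t\ge0}$ such that $$\varphi_{L_n}=\zeta(\tau_n)+o(n^{\frac12-\lambda})\quad\text{a.e.},$$ where $\lambda>0$ is an absolute constant and $(\tau_n)$ is an increasing sequence of random variables such that $\tau_n/\|\varphi_{L_n}\|_2^2\to1$ a.e.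
   Context: Continued fractions: $\alpha=[0;a_1,a_2,\dots]$ and $p_n/q_n$ are its convergents, with $p_{-1}=1$, $p_0=0$, $q_{-1}=0$, $q_0=1$, $q_{n+1}=a_{n+1}q_n+q_{n-1}$, $p_{n+1}=a_{n+1}p_n+p_{n-1}$; the $q_n$ are called the denominators of $\alpha$. $\mathbb{T}^1=\mathbb{R}/\mathbb{Z}$ is identified with $[0,1)$ and endowed with Lebesgue (uniform) measure $\mu$; it is the probability space on which the functions $\varphi_{L_n}$ are viewed as random variables, and $\|\cdot\|_2$ is the norm of $L^2(\mathbb{T}^1,\mu)$. A function is centered if its integral is $0$; bounded variation is understood for the restriction to $[0,1)$ of a $1$-periodic function. For $\ell\ge1$, the ergodic sum is $\varphi_\ell(x)=\sum_{j=0}^{\ell-1}\varphi(x+j\alpha)$. If the Fourier series of $\varphi$ is $\varphi(x)=\sum_{r\ne0}\frac{\gamma_r}{r}e^{2\pi i r x}$ (i.e. $\gamma_r=r\,c_r(\varphi)$), then for $\ell\ge1$ $$\widehat\varphi_\ell(x):=\sum_{r\ne0}\frac{\gamma_{r\ell}}{r}e^{2\pi i r x},$$ equivalently $\widehat\varphi_\ell(\ell x)=\sum_{j=0}^{\ell-1}\varphi(x+\tfrac{j}{\ell})$. *)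

theory Defs
  imports "HOL-Probability.Probability"
begin

section \<open>Continued fractions\<close>

text \<open>
  The partial quotients of \<open>\<alpha> \<in> (0,1)\<close> are read off along the orbit of \<open>\<alpha>\<close> under the Gauss map
  \<open>x \<mapsto> frac (1/x)\<close>. Indexing is that of \<open>\<alpha> = [0; a\<^sub>1, a\<^sub>2, \<dots>]\<close>: only \<open>cf_quot \<alpha> n\<close>
  with \<open>n \<ge> 1\<close> is meaningful.
\<close>

fun cf_rem :: "real \<Rightarrow> nat \<Rightarrow> real" where
  "cf_rem \<alpha> 0 = \<alpha>"
| "cf_rem \<alpha> (Suc n) = frac (1 / cf_rem \<alpha> n)"

definition cf_quot :: "real \<Rightarrow> nat \<Rightarrow> nat" where
  "cf_quot \<alpha> n = nat \<lfloor>1 / cf_rem \<alpha> (n - 1)\<rfloor>"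

text \<open>
  Numerators and denominators of the convergents. The second equation is the recursion step with
  the conventional values \<open>p\<^sub>-\<^sub>1 = 1\<close>, \<open>q\<^sub>-\<^sub>1 = 0\<close> inserted.
\<close>

fun cf_num :: "real \<Rightarrow> nat \<Rightarrow> nat" where
  "cf_num \<alpha> 0 = 0"
| "cf_num \<alpha> (Suc 0) = 1"
| "cf_num \<alpha> (Suc (Suc n)) = cf_quot \<alpha> (Suc (Suc n)) * cf_num \<alpha> (Suc n) + cf_num \<alpha> n"

fun cf_den :: "real \<Rightarrow> nat \<Rightarrow> nat" where
  "cf_den \<alpha> 0 = 1"
| "cf_den \<alpha> (Suc 0) = cf_quot \<alpha> 1"
| "cf_den \<alpha> (Suc (Suc n)) = cf_quot \<alpha> (Suc (Suc n)) * cf_den \<alpha> (Suc n) + cf_den \<alpha> n"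

lemma cf_rem_irrational:
  assumes "0 < \<alpha>" "\<alpha> < 1" "\<alpha> \<notin> \<rat>"
  shows "0 < cf_rem \<alpha> n \<and> cf_rem \<alpha> n < 1 \<and> cf_rem \<alpha> n \<notin> \<rat>"
proof (induction n)
  case 0
  then show ?case using assms by simp
next
  case (Suc n)
  let ?y = "1 / cf_rem \<alpha> n"
  have "?y \<notin> \<rat>"
  proof
    assume "?y \<in> \<rat>"
    then have "inverse ?y \<in> \<rat>" by (rule Rats_inverse)
    then show False using Suc by simp
  qed
  moreover have "?y = of_int \<lfloor>?y\<rfloor> + frac ?y" by (simp add: frac_def)
  ultimately have irr: "frac ?y \<notin> \<rat>"
    by (metis Rats_add Rats_of_int)
  then have "frac ?y \<noteq> 0" by (metis Rats_0)
  then show ?case using irr frac_ge_0[of ?y] frac_lt_1[of ?y] by simp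
qed

lemma cf_quot_eq:
  assumes "0 < \<alpha>" "\<alpha> < 1" "\<alpha> \<notin> \<rat>"
  shows "real (cf_quot \<alpha> (Suc n)) = 1 / cf_rem \<alpha> n - cf_rem \<alpha> (Suc n)"
    and "1 \<le> cf_quot \<alpha> (Suc n)"
proof -
  have r: "0 < cf_rem \<alpha> n" "cf_rem \<alpha> n < 1" using cf_rem_irrational[OF assms] by auto
  then have "1 \<le> \<lfloor>1 / cf_rem \<alpha> n\<rfloor>" by (simp add: le_floor_iff)
  then have f: "int (cf_quot \<alpha> (Suc n)) = \<lfloor>1 / cf_rem \<alpha> n\<rfloor>" "1 \<le> int (cf_quot \<alpha> (Suc n))"
    unfolding cf_quot_def diff_Suc_1 by linarith+
  have "real (cf_quot \<alpha> (Suc n)) = of_int \<lfloor>1 / cf_rem \<alpha> n\<rfloor>"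
    unfolding f(1)[symmetric] by simp
  then show "real (cf_quot \<alpha> (Suc n)) = 1 / cf_rem \<alpha> n - cf_rem \<alpha> (Suc n)"
    by (simp add: frac_def)
  show "1 \<le> cf_quot \<alpha> (Suc n)" using f(2) by simp
qed

lemma cf_den_ge:
  assumes "0 < \<alpha>" "\<alpha> < 1" "\<alpha> \<notin> \<rat>"
  shows "n \<le> cf_den \<alpha> n \<and> 1 \<le> cf_den \<alpha> n"
proof (induction n rule: induct_nat_012)
  case (ge2 n)
  have "1 * cf_den \<alpha> (Suc n) \<le> cf_quot \<alpha> (Suc (Suc n)) * cf_den \<alpha> (Suc n)"
    using cf_quot_eq(2)[OF assms] by (intro mult_le_mono1)
  then show ?case using ge2 unfolding cf_den.simps by linarith
qed (use cf_quot_eq(2)[OF assms, of 0] in auto)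

lemma cf_error:
  assumes "0 < \<alpha>" "\<alpha> < 1" "\<alpha> \<notin> \<rat>"
  defines "e \<equiv> \<lambda>n. real (cf_den \<alpha> n) * \<alpha> - real (cf_num \<alpha> n)"
  shows "e (Suc n) = - cf_rem \<alpha> (Suc n) * e n"
proof (induction n)
  case 0
  show ?case using cf_quot_eq(1)[OF assms(1-3), of 0] assms(1) 
    by (simp add: e_def field_simps del: cf_rem.simps(2))
next
  case (Suc n)
  let ?x = "cf_rem \<alpha> (Suc n)"
  have x: "?x > 0" using cf_rem_irrational[OF assms(1-3)] by blast
  have "e (Suc (Suc n)) = real (cf_quot \<alpha> (Suc (Suc n))) * e (Suc n) + e n"
    by (simp add: e_def algebra_simps)
  also have "\<dots> = (1 / ?x - cf_rem \<alpha> (Suc (Suc n))) * e (Suc n) + e n"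
    by (simp only: cf_quot_eq(1)[OF assms(1-3)])
  also have "\<dots> = - cf_rem \<alpha> (Suc (Suc n)) * e (Suc n) + (e (Suc n) / ?x + e n)"
    by (simp add: algebra_simps del: cf_rem.simps)
  also have "e (Suc n) / ?x + e n = 0"
    using x by (simp add: Suc.IH del: cf_rem.simps)
  finally show ?case by simp
qed

text \<open>The definitions above do describe the continued fraction expansion of \<open>\<alpha>\<close>.\<close>

lemma cf_convergents_tendsto:
  assumes "0 < \<alpha>" "\<alpha> < 1" "\<alpha> \<notin> \<rat>"
  shows "(\<lambda>n. real (cf_num \<alpha> n) / real (cf_den \<alpha> n)) \<longlonglongrightarrow> \<alpha>"
proof -
  define e where "e = (\<lambda>n. real (cf_den \<alpha> n) * \<alpha> - real (cf_num \<alpha> n))"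
  have e: "\<bar>e n\<bar> \<le> 1" for n
  proof (induction n)
    case 0
    then show ?case using assms by (simp add: e_def)
  next
    case (Suc n)
    have "0 < cf_rem \<alpha> (Suc n)" "cf_rem \<alpha> (Suc n) < 1"
      using cf_rem_irrational[OF assms] by blast+
    then have "cf_rem \<alpha> (Suc n) * \<bar>e n\<bar> \<le> 1 * 1"
      using Suc by (intro mult_mono) auto
    then show ?case
      using cf_error[OF assms, of n] \<open>0 < cf_rem \<alpha> (Suc n)\<close>
      by (simp add: e_def abs_mult del: cf_rem.simps)
  qed
  have "(\<lambda>n. real (cf_num \<alpha> n) / real (cf_den \<alpha> n) - \<alpha>) \<longlonglongrightarrow> 0"
  proof (rule Lim_null_comparison)
    show "eventually (\<lambda>n. norm (real (cf_num \<alpha> n) / real (cf_den \<alpha> n) - \<alpha>) \<le> 1 / real n) sequentially"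
    proof (rule eventually_sequentiallyI[of 1])
      fix n :: nat
      assume n: "1 \<le> n"
      have d: "real n \<le> real (cf_den \<alpha> n)" using cf_den_ge[OF assms, of n] by simp
      have "real (cf_num \<alpha> n) / real (cf_den \<alpha> n) - \<alpha> = - (e n / real (cf_den \<alpha> n))"
        using d n by (simp add: e_def field_simps)
      then have "norm (real (cf_num \<alpha> n) / real (cf_den \<alpha> n) - \<alpha>) = \<bar>e n\<bar> / real (cf_den \<alpha> n)"
        by simp
      also have "\<dots> \<le> 1 / real n"
        using e[of n] d n by (intro frac_le) auto
      finally show "norm (real (cf_num \<alpha> n) / real (cf_den \<alpha> n) - \<alpha>) \<le> 1 / real n" .
    qed
    show "(\<lambda>n. 1 / real n) \<longlonglongrightarrow> 0" by (rule lim_1_over_n)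
  qed
  then show ?thesis by (simp add: LIM_zero_iff)
qed

section \<open>Functions on the circle\<close>

text \<open>
  The circle is the probability space \<open>[0,1)\<close> with Lebesgue measure; functions on it are
  1-periodic functions on \<open>\<real>\<close>.
\<close>

definition circle :: "real measure" where
  "circle = restrict_space lborel {0..<1}"

lemma prob_space_circle: "prob_space circle"
  by (intro prob_spaceI) (simp add: circle_def space_restrict_space emeasure_restrict_space)

definition periodic1 :: "(real \<Rightarrow> real) \<Rightarrow> bool" where
  "periodic1 \<phi> \<longleftrightarrow> (\<forall>x. \<phi> (x + 1) = \<phi> x)"

definition bounded_variation_on :: "real set \<Rightarrow> (real \<Rightarrow> real) \<Rightarrow> bool" where
  "bounded_variation_on S f \<longleftrightarrow>
     (\<exists>V. \<forall>n x. (\<forall>i\<le>n. x i \<in> S) \<longrightarrow> (\<forall>i<n. x i \<le> x (Suc i)) \<longrightarrow>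
        (\<Sum>i<n. \<bar>f (x (Suc i)) - f (x i)\<bar>) \<le> V)"

definition bv_centered :: "(real \<Rightarrow> real) \<Rightarrow> bool" where
  "bv_centered \<phi> \<longleftrightarrow>
     periodic1 \<phi> \<and> bounded_variation_on {0..<1} \<phi> \<and> (LINT x|circle. \<phi> x) = 0"

definition l2norm :: "(real \<Rightarrow> real) \<Rightarrow> real" where
  "l2norm f = sqrt (LINT x|circle. (f x)\<^sup>2)"

definition ergodic_sum :: "real \<Rightarrow> (real \<Rightarrow> real) \<Rightarrow> nat \<Rightarrow> real \<Rightarrow> real" where
  "ergodic_sum \<alpha> \<phi> l x = (\<Sum>j<l. \<phi> (x + real j * \<alpha>))"

definition fourier_coeff :: "(real \<Rightarrow> real) \<Rightarrow> int \<Rightarrow> complex" where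
  "fourier_coeff \<phi> r = (LINT x|circle. of_real (\<phi> x) * cis (- (2 * pi * of_int r * x)))"

definition fourier_gamma :: "(real \<Rightarrow> real) \<Rightarrow> int \<Rightarrow> complex" where
  "fourier_gamma \<phi> r = of_int r * fourier_coeff \<phi> r"

text \<open>
  \<open>fourier_sums f b\<close>: the real function \<open>f\<close> is the sum in \<open>L\<^sup>2\<close> of the trigonometric
  series with coefficients \<open>b r\<close>, \<open>r \<noteq> 0\<close>. This determines \<open>f\<close> on \<open>[0,1)\<close> up to null sets.
\<close>

definition fourier_sums :: "(real \<Rightarrow> real) \<Rightarrow> (int \<Rightarrow> complex) \<Rightarrow> bool" where
  "fourier_sums f b \<longleftrightarrow>
     f \<in> borel_measurable circle \<and> integrable circle (\<lambda>x. (f x)\<^sup>2) \<and>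
     (\<lambda>N. LINT x|circle.
        (cmod (of_real (f x) - (\<Sum>r\<in>{- int N..int N} - {0}. b r * cis (2 * pi * of_int r * x))))\<^sup>2)
       \<longlonglongrightarrow> 0"

text \<open>
  The function \<open>\<Sum>\<^bsub>r \<noteq> 0\<^esub> (\<gamma>\<^bsub>r l\<^esub> / r) e\<^bsup>2 \<pi> i r x\<^esup>\<close>, as an element of \<open>L\<^sup>2\<close>: \<open>SOME\<close> picks a
  representative, which is immaterial for \<open>l2norm\<close>. For \<open>\<phi>\<close> centered of bounded variation
  and \<open>l \<ge> 1\<close> one representative is \<open>\<lambda>y. \<Sum>j<l. \<phi> ((y + j) / l)\<close>.
\<close>

definition hat_sum :: "(real \<Rightarrow> real) \<Rightarrow> nat \<Rightarrow> real \<Rightarrow> real" where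
  "hat_sum \<phi> l =
     (SOME f. fourier_sums f (\<lambda>r. fourier_gamma \<phi> (r * int l) / of_int r))"

section \<open>Wiener process\<close>

definition wiener_process :: "'w measure \<Rightarrow> (real \<Rightarrow> 'w \<Rightarrow> real) \<Rightarrow> bool" where
  "wiener_process M \<zeta> \<longleftrightarrow>
     (\<forall>t\<ge>0. \<zeta> t \<in> borel_measurable M) \<and>
     (AE \<omega> in M. \<zeta> 0 \<omega> = 0) \<and>
     (AE \<omega> in M. continuous_on {0..} (\<lambda>t. \<zeta> t \<omega>)) \<and>
     (\<forall>s t. 0 \<le> s \<longrightarrow> s < t \<longrightarrow>
        distributed M lborel (\<lambda>\<omega>. \<zeta> t \<omega> - \<zeta> s \<omega>) (normal_density 0 (sqrt (t - s)))) \<and>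
     (\<forall>n s. 0 \<le> s 0 \<longrightarrow> (\<forall>i<n. s i < s (Suc i)) \<longrightarrow>
        prob_space.indep_vars M (\<lambda>_. borel) (\<lambda>i \<omega>. \<zeta> (s (Suc i)) \<omega> - \<zeta> (s i) \<omega>) {..<n})"

section \<open>Copies of a process\<close>

text \<open>\<open>Y\<close> on \<open>M\<close> and \<open>X\<close> on \<open>N\<close>, both indexed by \<open>n \<ge> 1\<close>, have the same law as processes.\<close>

definition same_law ::
  "'w measure \<Rightarrow> (nat \<Rightarrow> 'w \<Rightarrow> real) \<Rightarrow> 'v measure \<Rightarrow> (nat \<Rightarrow> 'v \<Rightarrow> real) \<Rightarrow> bool" where
  "same_law M Y N X \<longleftrightarrow>
     (\<forall>n\<ge>1. Y n \<in> borel_measurable M) \<and> (\<forall>n\<ge>1. X n \<in> borel_measurable N) \<and>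
     distr M (PiM {1..} (\<lambda>_. borel)) (\<lambda>\<omega>. \<lambda>n\<in>{1..}. Y n \<omega>) =
     distr N (PiM {1..} (\<lambda>_. borel)) (\<lambda>x. \<lambda>n\<in>{1..}. X n x)"

text \<open>
  Existence of a probability space has to be stated over a fixed type of outcomes. The joint path
  space of the three processes involved (the copy of \<open>(\<phi>\<^bsub>L n\<^esub>)\<^sub>n\<close>, the times \<open>(\<tau>\<^sub>n)\<^sub>n\<close> and \<open>\<zeta>\<close>)
  loses no generality: from any probability space carrying them, the completed measure can be transported
  along \<open>\<omega> \<mapsto> ((Y\<^sub>n \<omega>)\<^sub>n, (\<tau>\<^sub>n \<omega>)\<^sub>n, (\<zeta>\<^sub>t \<omega>)\<^sub>t)\<close>.
\<close>

type_synonym paths = "(nat \<Rightarrow> real) \<times> (nat \<Rightarrow> real) \<times> (real \<Rightarrow> real)"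

end

theory Submission
  imports Defs "HOL-Probability.Probability"
begin

text \<open>
  Let \<open>q\<^sub>k\<close> be the denominators that occur in \<open>L\<^sub>n\<close>. The ergodic sum over \<open>L\<^sub>n\<close> is a sum of \<open>n\<close> ergodic
  sums, the \<open>k\<close>-th of length \<open>q\<^sub>k\<close> and starting at a translate of \<open>x\<close>. Since the next partial quotient is
  large, \<open>\<alpha>\<close> is extremely close to a fraction with denominator \<open>q\<^sub>k\<close>, and the \<open>k\<close>-th sum differs from
  \<open>X\<^sub>k x = \<Sum>\<^sub>j \<phi> (x + c\<^sub>k + j / q\<^sub>k)\<close> by a bounded function with \<open>L\<^sup>1\<close> norm at most a constant times
  \<open>k\<close> to the power \<open>-\<beta>\<close>, which is summable (\<open>ergodic_sum_vs_rational_sum\<close>). The function \<open>X\<^sub>k\<close> has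
  period \<open>1 / q\<^sub>k\<close>, and its mean square is the given variance (\<open>hat_sum_norm\<close>). As \<open>q\<^sub>k\<^sub>+\<^sub>1 \<ge> k q\<^sub>k\<close>, the
  theorem becomes a statement about lacunary sums.

  Bounded variation enters through one estimate (\<open>oscillatory_integral_bound\<close>): a function whose
  increments are dominated by a monotone \<open>m\<close> is nearly orthogonal to every bounded function of mean zero
  and small period. Applied to functions of \<open>X\<^sub>1 + \<dots> + X\<^sub>k\<^sub>-\<^sub>1\<close> against \<open>X\<^sub>k\<close>, whose frequency is
  larger by a factor of order \<open>k\<close>, it replaces independence. It yields the second and fourth moments of the
  partial sums and a Lindeberg exchange argument with the heat kernel as test function (\<open>lindeberg\<close>).

  The comparison with a Wiener process \<open>\<zeta>\<close> uses the deterministic times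
  \<open>\<tau>\<^sub>n = \<Sum>k\<le>n. (\<parallel>X\<^sub>k\<parallel>\<^sup>2 + e\<^sub>k)\<close>, where \<open>e\<^sub>k \<rightarrow> 0\<close> is an artificial variance that supplies the smoothing for
  the Lindeberg argument. The indices are cut into blocks of polynomially growing length. Within a cell
  of the circle on which the earlier blocks are essentially constant, the sum over the next block is
  close in law to the corresponding increment of \<open>\<zeta>\<close>, and the monotone rearrangement makes the two close
  in \<open>L\<^sup>1\<close> (\<open>quantile_coupling\<close>, \<open>block_coupling\<close>). So the point \<open>x\<close> is not taken as given but is
  produced from \<open>\<zeta>\<close>: each block increment of \<open>\<zeta>\<close> selects the subcell in which \<open>x\<close> lies. Because the
  subcells are only permuted, the resulting \<open>x\<close> is uniformly distributed (\<open>upoint_distr\<close>), and the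
  process evaluated at \<open>x\<close> has the right law. Chaining controls both processes inside a block, and
  summing the errors gives the order \<open>n\<close> to the power \<open>42/85\<close> almost surely (\<open>strong_approximation\<close>).

  The variance asymptotics follow from the moment bounds, since the \<open>L\<^sup>2\<close> norm of the accumulated
  perturbation is of smaller order than the square root of \<open>n\<close> (\<open>variance_deviation\<close>). The central limit
  theorem is read off from the approximation, because \<open>\<zeta> \<tau>\<^sub>n\<close> divided by the square root of \<open>\<tau>\<^sub>n\<close> is a
  standard normal variable. A Wiener process on the required path space is obtained by Levy's midpoint
  construction.
\<close>

section \<open>Functions of bounded variation and oscillating functions\<close>

text \<open>
  Bounded variation as a domination of increments. In this form it passes to sums, to Lipschitz
  images and to affine changes of the variable, and the total growth of \<open>m\<close> is the only quantity
  that has to be followed.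
\<close>

definition dominated :: "(real \<Rightarrow> real) \<Rightarrow> (real \<Rightarrow> real) \<Rightarrow> bool" where
  "dominated F m \<longleftrightarrow> (\<forall>x y. x \<le> y \<longrightarrow> \<bar>F y - F x\<bar> \<le> m y - m x)"

lemma dominatedD: "dominated F m \<Longrightarrow> x \<le> y \<Longrightarrow> \<bar>F y - F x\<bar> \<le> m y - m x"
  by (simp add: dominated_def)

lemma dominated_mono: "dominated F m \<Longrightarrow> mono m"
  by (auto simp: dominated_def mono_def) (smt (verit))

lemma dominated_borel [measurable_dest]:
  assumes "dominated F m" shows "F \<in> borel_measurable borel"
proof -
  have m: "m \<in> borel_measurable borel"
    by (rule borel_measurable_mono[OF dominated_mono[OF assms]])
  have "mono (\<lambda>x. F x + m x)"
    using assms by (auto simp: dominated_def mono_def) (smt (verit))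
  then have "(\<lambda>x. F x + m x) \<in> borel_measurable borel" by (rule borel_measurable_mono)
  then have "(\<lambda>x. (F x + m x) - m x) \<in> borel_measurable borel" using m by measurable
  then show ?thesis by simp
qed

lemma dominated_sum:
  assumes "\<And>i. i \<in> A \<Longrightarrow> dominated (F i) (m i)"
  shows "dominated (\<lambda>x. \<Sum>i\<in>A. F i x) (\<lambda>x. \<Sum>i\<in>A. m i x)"
  unfolding dominated_def
proof (intro allI impI)
  fix x y :: real assume xy: "x \<le> y"
  have "\<bar>(\<Sum>i\<in>A. F i y) - (\<Sum>i\<in>A. F i x)\<bar> = \<bar>\<Sum>i\<in>A. F i y - F i x\<bar>" by (simp add: sum_subtractf)
  also have "\<dots> \<le> (\<Sum>i\<in>A. \<bar>F i y - F i x\<bar>)" by (rule sum_abs)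
  also have "\<dots> \<le> (\<Sum>i\<in>A. m i y - m i x)" using assms xy by (intro sum_mono dominatedD) auto
  finally show "\<bar>(\<Sum>i\<in>A. F i y) - (\<Sum>i\<in>A. F i x)\<bar> \<le> (\<Sum>i\<in>A. m i y) - (\<Sum>i\<in>A. m i x)"
    by (simp add: sum_subtractf)
qed

text \<open>
  The Lipschitz condition is imposed only on a set that contains the values of \<open>F\<close>, so that powers
  of bounded functions are covered.
\<close>

lemma dominated_lipschitz:
  assumes F: "dominated F m" and S: "\<And>x. F x \<in> S"
    and h: "\<And>u v. u \<in> S \<Longrightarrow> v \<in> S \<Longrightarrow> \<bar>h v - h u\<bar> \<le> B * \<bar>v - u\<bar>" and B: "0 \<le> B"
  shows "dominated (\<lambda>x. h (F x)) (\<lambda>x. B * m x)"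
  unfolding dominated_def
proof (intro allI impI)
  fix x y :: real assume xy: "x \<le> y"
  have "\<bar>h (F y) - h (F x)\<bar> \<le> B * \<bar>F y - F x\<bar>" using h S by auto
  also have "\<dots> \<le> B * (m y - m x)" using dominatedD[OF F xy] B by (intro mult_left_mono) auto
  finally show "\<bar>h (F y) - h (F x)\<bar> \<le> B * m y - B * m x" by (simp add: algebra_simps)
qed

lemma dominated_affine:
  assumes "dominated F m" "0 \<le> c" shows "dominated (\<lambda>x. F (c * x + d)) (\<lambda>x. m (c * x + d))"
  using assms by (auto simp: dominated_def mult_left_mono)

abbreviation ival :: "real \<Rightarrow> real \<Rightarrow> (real \<Rightarrow> real) \<Rightarrow> real" where
  "ival a b f \<equiv> set_lebesgue_integral lborel {a..<b} f"

lemma ival_eq_circle: "(LINT x|circle. f x) = ival 0 1 f"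
  by (simp add: circle_def integral_restrict_space set_lebesgue_integral_def)

lemma bounded_ival_integrable:
  fixes f :: "real \<Rightarrow> real"
  assumes "f \<in> borel_measurable borel" "\<And>x. \<bar>f x\<bar> \<le> B"
  shows "set_integrable lborel {a..<b::real} f"
proof -
  have "integrable lborel (\<lambda>x. indicator {a..<b} x * B)"
    by (cases "a \<le> b") (auto intro!: integrable_mult_left integrable_real_indicator)
  then have "set_integrable lborel {a..<b} (\<lambda>x. B)"
    by (simp add: set_integrable_def)
  then show ?thesis
    by (rule set_integrable_bound) (use assms in \<open>auto simp: set_borel_measurable_def intro!: order_trans[OF assms(2) abs_ge_self]\<close>)
qed

lemma ival_shift: "ival (a + s) (b + s) f = ival a b (\<lambda>x. f (x + s))"
proof -
  have "ival (a + s) (b + s) f = (\<integral>x. indicator {a + s..<b + s} (s + 1 * x) *\<^sub>R f (s + 1 * x) \<partial>lborel)"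
    unfolding set_lebesgue_integral_def by (subst lborel_integral_real_affine[where c=1 and t=s]) auto
  also have "\<dots> = ival a b (\<lambda>x. f (x + s))"
    unfolding set_lebesgue_integral_def
    by (intro Bochner_Integration.integral_cong) (auto simp: indicator_def add.commute)
  finally show ?thesis .
qed

lemma ival_scale:
  assumes "0 < c" shows "ival (c * a) (c * b) f = c * ival a b (\<lambda>x. f (c * x))"
proof -
  have "ival (c * a) (c * b) f = c * (\<integral>x. indicator {c * a..<c * b} (0 + c * x) *\<^sub>R f (0 + c * x) \<partial>lborel)"
    unfolding set_lebesgue_integral_def using assms
    by (subst lborel_integral_real_affine[where c=c and t=0]) auto
  also have "\<dots> = c * ival a b (\<lambda>x. f (c * x))"
    unfolding set_lebesgue_integral_def using assms
    by (intro arg_cong2[where f="(*)"] Bochner_Integration.integral_cong) (auto simp: indicator_def)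
  finally show ?thesis .
qed

lemma ival_split:
  assumes "f \<in> borel_measurable borel" "\<And>x. \<bar>f x\<bar> \<le> B" "a \<le> b" "b \<le> c"
  shows "ival a c f = ival a b f + ival b c f"
proof -
  have "{a..<c} = {a..<b} \<union> {b..<c}" using assms by auto
  then show ?thesis
    by (simp only:) (intro set_integral_Un bounded_ival_integrable[OF assms(1,2)], auto)
qed

lemma ival_cells:
  assumes "f \<in> borel_measurable borel" "\<And>x. \<bar>f x\<bar> \<le> B" "0 \<le> r"
  shows "ival 0 (real n * r) f = (\<Sum>i<n. ival 0 r (\<lambda>x. f (x + real i * r)))"
proof (induction n)
  case (Suc n)
  have "ival 0 (real (Suc n) * r) f = ival 0 (real n * r) f + ival (real n * r) (real (Suc n) * r) f"
    using assms by (intro ival_split[where B=B]) (auto simp: mult_right_mono)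
  moreover have "ival (real n * r) (real (Suc n) * r) f = ival 0 r (\<lambda>x. f (x + real n * r))"
    using ival_shift[of 0 "real n * r" r f] by (simp add: algebra_simps)
  ultimately show ?case using Suc by simp
qed (simp add: set_lebesgue_integral_def)

lemma ival_abs_le:
  assumes "\<And>x. a \<le> x \<Longrightarrow> x < b \<Longrightarrow> \<bar>f x\<bar> \<le> B" "a \<le> b"
  shows "\<bar>ival a b f\<bar> \<le> B * (b - a)"
proof (cases "set_integrable lborel {a..<b} f")
  case True
  have "\<bar>ival a b f\<bar> \<le> ival a b (\<lambda>x. \<bar>f x\<bar>)"
    using set_integral_norm_bound[OF True] by simp
  also have "\<dots> \<le> ival a b (\<lambda>x. B)"
    using True assms by (intro set_integral_mono set_integrable_abs)
      (auto simp: set_integrable_def)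
  also have "\<dots> = B * (b - a)" using assms by (simp add: set_lebesgue_integral_def)
  finally show ?thesis .
next
  case False
  have "0 \<le> B * (b - a)"
  proof (cases "a < b")
    case True
    have "0 \<le> B" using assms(1)[of a] True by fastforce
    then show ?thesis using True by simp
  qed (use assms(2) in simp)
  then show ?thesis
    using False not_integrable_integral_eq[of lborel "\<lambda>x. indicator {a..<b} x *\<^sub>R f x"]
    unfolding set_lebesgue_integral_def set_integrable_def by simp
qed

lemma periodic_nat:
  assumes "\<And>x. f (x + r) = f (x::real)" shows "f (x + real n * r) = f x"
proof (induction n)
  case (Suc n)
  then show ?case using assms[of "x + real n * r"] by (simp add: algebra_simps)
qed simp

lemma periodic_int:
  assumes "\<And>x. f (x + r) = f (x::real)" shows "f (x + of_int k * r) = f x"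
proof (cases "k \<ge> 0")
  case True
  then show ?thesis using periodic_nat[of f r x "nat k", OF assms] by simp
next
  case False
  then show ?thesis using periodic_nat[of f r "x + of_int k * r" "nat (- k)", OF assms]
    by (simp add: algebra_simps)
qed

lemma ival_periodic_shift:
  assumes f: "f \<in> borel_measurable borel" "\<And>x. \<bar>f x\<bar> \<le> B" and r: "0 < r" and per: "\<And>x. f (x + r) = f x"
  shows "ival 0 r (\<lambda>x. f (x + s)) = ival 0 r f"
proof -
  define k where "k = \<lfloor>s / r\<rfloor>"
  define u where "u = s - of_int k * r"
  have u: "0 \<le> u" "u \<le> r"
    using r floor_divide_lower[OF r, of s] floor_divide_upper[OF r, of s] by (auto simp: u_def k_def algebra_simps)
  have "f (x + s) = f (x + u)" for x
    using periodic_int[of f r "x + u" k, OF per] by (simp add: u_def add_ac)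
  then have "ival 0 r (\<lambda>x. f (x + s)) = ival 0 r (\<lambda>x. f (x + u))" by simp
  also have "\<dots> = ival u (r + u) f" using ival_shift[of 0 u r f] by simp
  also have "\<dots> = ival u r f + ival r (r + u) f" using u by (intro ival_split[OF f]) auto
  also have "ival r (r + u) f = ival 0 u (\<lambda>x. f (x + r))" using ival_shift[of 0 r u f] by (simp add: add.commute)
  also have "\<dots> = ival 0 u f" by (simp add: per)
  also have "ival u r f + \<dots> = ival 0 r f" using u ival_split[OF f, of 0 u r] by simp
  finally show ?thesis .
qed

text \<open>
  On a cell of length \<open>r\<close> the factor \<open>w\<close> integrates to zero, so \<open>F\<close> may be replaced there by its
  deviation from a constant, which the increment of \<open>m\<close> over the cell bounds. These increments
  telescope. The term \<open>S\<close> pays for the incomplete last cell.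
\<close>

lemma oscillatory_integral_bound:
  assumes w: "w \<in> borel_measurable borel" "\<And>x. \<bar>w x\<bar> \<le> B" and r: "0 < r"
    and per: "\<And>x. w (x + r) = w x" and mean: "ival 0 r w = 0"
    and F: "dominated F m" and S: "\<And>x. \<bar>F x\<bar> \<le> S"
  shows "\<bar>ival 0 1 (\<lambda>x. F x * w x)\<bar> \<le> r * B * (m 1 - m 0 + S)"
proof -
  note [measurable] = w(1) dominated_borel[OF F]
  have B0: "0 \<le> B" using w(2)[of 0] by linarith
  have S0: "0 \<le> S" using S[of 0] by linarith
  have mm: "x \<le> y \<Longrightarrow> m x \<le> m y" for x y using dominated_mono[OF F] by (auto simp: mono_def)
  have Fw: "(\<lambda>x. F x * w x) \<in> borel_measurable borel" "\<And>x. \<bar>F x * w x\<bar> \<le> S * B"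
    using w S by (auto simp: abs_mult intro!: mult_mono S0)
  define n where "n = nat \<lfloor>1 / r\<rfloor>"
  have n: "real n * r \<le> 1" "1 \<le> real n * r + r"
  proof -
    have "real n = of_int \<lfloor>1 / r\<rfloor>" using r by (simp add: n_def)
    then show "real n * r \<le> 1" "1 \<le> real n * r + r"
      using floor_divide_lower[OF r, of 1] floor_divide_upper[OF r, of 1] by (auto simp: algebra_simps)
  qed
  have cell: "\<bar>ival 0 r (\<lambda>x. F (x + real i * r) * w (x + real i * r))\<bar>
      \<le> r * B * (m (real (Suc i) * r) - m (real i * r))" for i
  proof -
    let ?z = "real i * r"
    have i1: "set_integrable lborel {0..<r} (\<lambda>x. F (x + ?z) * w x)"
      by (rule bounded_ival_integrable[where B="S * B"]) (auto simp: abs_mult intro!: mult_mono S w S0)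
    have i2: "set_integrable lborel {0..<r} (\<lambda>x. F ?z * w x)"
      by (rule bounded_ival_integrable[where B="S * B"]) (auto simp: abs_mult intro!: mult_mono S w S0)
    have "ival 0 r (\<lambda>x. F (x + ?z) * w (x + ?z)) = ival 0 r (\<lambda>x. F (x + ?z) * w x)"
      using periodic_nat[of w r, OF per] by simp
    also have "\<dots> = ival 0 r (\<lambda>x. F (x + ?z) * w x) - ival 0 r (\<lambda>x. F ?z * w x)"
      using mean by simp
    also have "\<dots> = ival 0 r (\<lambda>x. F (x + ?z) * w x - F ?z * w x)"
      using i1 i2 by (rule set_integral_diff(2)[symmetric])
    finally have e: "ival 0 r (\<lambda>x. F (x + ?z) * w (x + ?z)) = ival 0 r (\<lambda>x. F (x + ?z) * w x - F ?z * w x)" .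
    have "\<bar>ival 0 r (\<lambda>x. F (x + ?z) * w x - F ?z * w x)\<bar> \<le> ((m (real (Suc i) * r) - m ?z) * B) * (r - 0)"
    proof (rule ival_abs_le)
      fix x assume x: "0 \<le> x" "x < r"
      have "\<bar>F (x + ?z) - F ?z\<bar> \<le> m (x + ?z) - m ?z" using x by (intro dominatedD[OF F]) auto
      also have "\<dots> \<le> m (real (Suc i) * r) - m ?z" using x mm by (simp add: algebra_simps)
      finally have "\<bar>F (x + ?z) - F ?z\<bar> * \<bar>w x\<bar> \<le> (m (real (Suc i) * r) - m ?z) * B"
        using w by (intro mult_mono) auto
      then show "\<bar>F (x + ?z) * w x - F ?z * w x\<bar> \<le> (m (real (Suc i) * r) - m ?z) * B"
        by (simp add: abs_mult[symmetric] algebra_simps)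
    qed (use r in simp)
    then show ?thesis unfolding e by (simp add: mult_ac)
  qed
  have "ival 0 1 (\<lambda>x. F x * w x) = ival 0 (real n * r) (\<lambda>x. F x * w x) + ival (real n * r) 1 (\<lambda>x. F x * w x)"
    using n r by (intro ival_split[OF Fw]) auto
  moreover have "\<bar>ival 0 (real n * r) (\<lambda>x. F x * w x)\<bar> \<le> r * B * (m 1 - m 0)"
  proof -
    have "\<bar>ival 0 (real n * r) (\<lambda>x. F x * w x)\<bar> \<le> (\<Sum>i<n. r * B * (m (real (Suc i) * r) - m (real i * r)))"
      unfolding ival_cells[OF Fw less_imp_le[OF r]]
      by (rule order_trans[OF sum_abs]) (intro sum_mono cell)
    also have "\<dots> = r * B * (m (real n * r) - m 0)"
      by (simp only: sum_distrib_left[symmetric] sum_lessThan_telescope[of "\<lambda>i. m (real i * r)"]) simp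
    also have "\<dots> \<le> r * B * (m 1 - m 0)" using n r B0 mm by (intro mult_left_mono) auto
    finally show ?thesis .
  qed
  moreover have "\<bar>ival (real n * r) 1 (\<lambda>x. F x * w x)\<bar> \<le> r * B * S"
  proof -
    have "\<bar>ival (real n * r) 1 (\<lambda>x. F x * w x)\<bar> \<le> (S * B) * (1 - real n * r)"
      using Fw n by (intro ival_abs_le) auto
    also have "\<dots> \<le> (S * B) * r" using n S0 B0 by (intro mult_left_mono) auto
    finally show ?thesis by (simp add: mult_ac)
  qed
  ultimately show ?thesis by (simp add: algebra_simps)
qed

text \<open>
  On each cell of length \<open>1 / N\<close> the increment of \<open>m\<close> bounds the deviation of \<open>F\<close> from its value at the
  left endpoint, and the increments telescope.
\<close>

lemma discretisation_bound:
  assumes F: "dominated F m" and S: "\<And>x. \<bar>F x\<bar> \<le> S" and N: "N > 0"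
  shows "ival 0 1 (\<lambda>x. \<bar>F x - F (of_int \<lfloor>real N * x\<rfloor> / real N)\<bar>) \<le> (m 1 - m 0) / real N" (is ?A)
    and "\<bar>(\<Sum>i<N. F (real i / real N)) / real N - ival 0 1 F\<bar> \<le> (m 1 - m 0) / real N" (is ?B)
proof -
  note [measurable] = dominated_borel[OF F]
  let ?r = "1 / real N"
  let ?G = "\<lambda>x. \<bar>F x - F (of_int \<lfloor>real N * x\<rfloor> / real N)\<bar>"
  let ?H = "\<lambda>x. F (of_int \<lfloor>real N * x\<rfloor> / real N)"
  have mm: "x \<le> y \<Longrightarrow> m x \<le> m y" for x y using dominated_mono[OF F] by (auto simp: mono_def)
  have S0: "0 \<le> S" using S[of 0] by linarith
  have Nr: "real N * ?r = 1" using N by simp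
  have fl: "\<lfloor>real N * (x + real i * ?r)\<rfloor> = int i" if "0 \<le> x" "x < ?r" for x i
    using that N by (intro floor_unique) (auto simp: field_simps)
  have G: "?G \<in> borel_measurable borel" "\<bar>?G x\<bar> \<le> 2 * S" for x
    using S[of x] S[of "of_int \<lfloor>real N * x\<rfloor> / real N"] by (auto)
  have "ival 0 1 ?G = ival 0 (real N * ?r) ?G" using Nr by simp
  also have "\<dots> = (\<Sum>i<N. ival 0 ?r (\<lambda>x. ?G (x + real i * ?r)))"
    by (rule ival_cells[where B="2 * S"]) (use G in auto)
  also have "\<dots> \<le> (\<Sum>i<N. (m (real (Suc i) * ?r) - m (real i * ?r)) * (?r - 0))"
  proof (rule sum_mono)
    fix i
    have "\<bar>ival 0 ?r (\<lambda>x. ?G (x + real i * ?r))\<bar> \<le> (m (real (Suc i) * ?r) - m (real i * ?r)) * (?r - 0)"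
    proof (rule ival_abs_le)
      fix x assume x: "0 \<le> x" "x < ?r"
      have "\<bar>F (x + real i * ?r) - F (real i * ?r)\<bar> \<le> m (x + real i * ?r) - m (real i * ?r)"
        using x by (intro dominatedD[OF F]) auto
      also have "\<dots> \<le> m (real (Suc i) * ?r) - m (real i * ?r)" using x mm N by (simp add: field_simps)
      finally show "\<bar>?G (x + real i * ?r)\<bar> \<le> m (real (Suc i) * ?r) - m (real i * ?r)"
        using fl[OF x, of i] by simp
    qed simp
    then show "ival 0 ?r (\<lambda>x. ?G (x + real i * ?r)) \<le> (m (real (Suc i) * ?r) - m (real i * ?r)) * (?r - 0)"
      by linarith
  qed
  also have "\<dots> = (m 1 - m 0) / real N"
    using N by (simp only: sum_distrib_right[symmetric] sum_lessThan_telescope[of "\<lambda>i. m (real i * ?r)"]) simp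
  finally show A: ?A .
  have iF: "set_integrable lborel {0..<1} F" by (rule bounded_ival_integrable[where B=S]) (use S in auto)
  have iH: "set_integrable lborel {0..<1} ?H" by (rule bounded_ival_integrable[where B=S]) (use S in auto)
  have "ival 0 1 ?H = ival 0 (real N * ?r) ?H" using Nr by simp
  also have "\<dots> = (\<Sum>i<N. ival 0 ?r (\<lambda>x. ?H (x + real i * ?r)))"
    by (rule ival_cells[where B=S]) (use S in auto)
  also have "\<dots> = (\<Sum>i<N. F (real i / real N) / real N)"
  proof (rule sum.cong[OF refl])
    fix i
    have "ival 0 ?r (\<lambda>x. ?H (x + real i * ?r)) = ival 0 ?r (\<lambda>x. F (real i / real N))"
      using fl[of _ i] by (intro set_lebesgue_integral_cong) auto
    then show "ival 0 ?r (\<lambda>x. ?H (x + real i * ?r)) = F (real i / real N) / real N"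
      by (simp add: set_lebesgue_integral_def)
  qed
  finally have H: "ival 0 1 ?H = (\<Sum>i<N. F (real i / real N)) / real N" by (simp add: sum_divide_distrib)
  have "\<bar>ival 0 1 F - ival 0 1 ?H\<bar> = \<bar>ival 0 1 (\<lambda>x. F x - ?H x)\<bar>"
    using set_integral_diff(2)[OF iF iH] by simp
  also have "\<dots> \<le> ival 0 1 ?G"
    using set_integral_norm_bound[OF set_integral_diff(1)[OF iF iH]] by simp
  finally show ?B using A unfolding H by linarith
qed

text \<open>
  The summands of the lacunary sums. The quasi-periodicity of \<open>m\<close> expresses that \<open>f\<close> has variation at
  most \<open>W\<close> over one period, uniformly in the period.
\<close>

definition oscillating :: "real \<Rightarrow> real \<Rightarrow> (real \<Rightarrow> real) \<Rightarrow> (real \<Rightarrow> real) \<Rightarrow> bool" where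
  "oscillating r W f m \<longleftrightarrow> 0 < r \<and> (\<forall>x. f (x + r) = f x) \<and> dominated f m \<and>
     (\<forall>x. m (x + r) = m x + W) \<and> ival 0 r f = 0"

definition mean_square :: "real \<Rightarrow> (real \<Rightarrow> real) \<Rightarrow> real" where
  "mean_square r f = ival 0 r (\<lambda>x. (f x)\<^sup>2) / r"

context
  fixes r W :: real and f m :: "real \<Rightarrow> real"
  assumes osc: "oscillating r W f m"
begin

lemma osc_pos: "0 < r" and osc_periodic: "f (x + r) = f x" and osc_dominated: "dominated f m"
  and osc_dom_shift: "m (x + r) = m x + W" and osc_mean: "ival 0 r f = 0"
  using osc by (auto simp: oscillating_def)

lemma osc_W_nonneg: "0 \<le> W"
  using dominated_mono[OF osc_dominated] osc_dom_shift[of 0] osc_pos by (auto simp: mono_def) (smt (verit))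

lemma osc_borel: "f \<in> borel_measurable borel"
  by (rule dominated_borel[OF osc_dominated])

text \<open>
  Over one period \<open>f\<close> has mean zero and oscillates by at most \<open>W\<close>.
\<close>

lemma osc_bound: "\<bar>f x\<bar> \<le> W"
proof -
  have near: "\<bar>f y - f x\<bar> \<le> W" if "x \<le> y" "y \<le> x + r" for x y
  proof -
    have "\<bar>f y - f x\<bar> \<le> m y - m x" using that by (intro dominatedD[OF osc_dominated])
    also have "m y \<le> m (x + r)" using dominated_mono[OF osc_dominated] that by (auto simp: mono_def)
    finally show ?thesis by (simp add: osc_dom_shift)
  qed
  have bd: "\<bar>f y\<bar> \<le> \<bar>f 0\<bar> + W" for y
  proof -
    define k where "k = \<lfloor>y / r\<rfloor>"
    have "0 \<le> y - of_int k * r" "y - of_int k * r \<le> 0 + r"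
      using osc_pos floor_divide_lower[OF osc_pos, of y] floor_divide_upper[OF osc_pos, of y]
      by (auto simp: k_def algebra_simps)
    from near[OF this] show ?thesis
      using periodic_int[of f r "y - of_int k * r" k, OF osc_periodic] by simp
  qed
  have sh: "ival 0 r (\<lambda>y. f (y + x)) = 0"
    using ival_periodic_shift[OF osc_borel bd osc_pos osc_periodic] osc_mean by simp
  note [measurable] = osc_borel
  have i: "set_integrable lborel {0..<r} (\<lambda>y. f (y + x))"
    by (rule bounded_ival_integrable[where B="\<bar>f 0\<bar> + W"]) (use bd in auto)
  have "\<bar>ival 0 r (\<lambda>y. f (y + x) - f x)\<bar> \<le> W * (r - 0)"
    using near osc_pos by (intro ival_abs_le) auto
  moreover have "ival 0 r (\<lambda>y. f (y + x) - f x) = 0 - r * f x"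
    using osc_pos sh by (subst set_integral_diff(2)[OF i]) (auto simp: set_integrable_def set_lebesgue_integral_def)
  ultimately have "r * \<bar>f x\<bar> \<le> r * W" using osc_pos by (simp add: abs_mult mult.commute)
  then show ?thesis using osc_pos by simp
qed

lemma osc_square_le: "(f x)\<^sup>2 \<le> W\<^sup>2"
  using osc_bound[of x] by (metis abs_ge_zero power2_abs power_mono)

lemma mean_square_bounds: "0 \<le> mean_square r f" "mean_square r f \<le> W\<^sup>2"
proof -
  have "0 \<le> ival 0 r (\<lambda>x. (f x)\<^sup>2)" unfolding set_lebesgue_integral_def by (intro Bochner_Integration.integral_nonneg) auto
  then show "0 \<le> mean_square r f" using osc_pos by (simp add: mean_square_def)
  have "\<bar>ival 0 r (\<lambda>x. (f x)\<^sup>2)\<bar> \<le> W\<^sup>2 * (r - 0)"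
    using osc_square_le osc_pos by (intro ival_abs_le) auto
  then show "mean_square r f \<le> W\<^sup>2" using osc_pos by (simp add: mean_square_def field_simps)
qed

lemma mean_square_centred:
  "ival 0 r (\<lambda>x. (f x)\<^sup>2 - mean_square r f) = 0"
proof -
  note [measurable] = osc_borel
  have "set_integrable lborel {0..<r} (\<lambda>x. (f x)\<^sup>2)"
    by (rule bounded_ival_integrable[where B="W\<^sup>2"]) (use osc_square_le in auto)
  then show ?thesis using osc_pos
    by (subst set_integral_diff(2)) (auto simp: set_integrable_def set_lebesgue_integral_def mean_square_def)
qed

lemma osc_dom_growth: "m 1 - m 0 \<le> W * (1 / r + 1)"
proof -
  define n where "n = nat \<lceil>1 / r\<rceil>"
  have n: "1 \<le> real n * r" "real n \<le> 1 / r + 1"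
  proof -
    have "real n = of_int \<lceil>1 / r\<rceil>" using osc_pos by (simp add: n_def)
    then have "1 / r \<le> real n" "real n \<le> 1 / r + 1" by linarith+
    then show "1 \<le> real n * r" "real n \<le> 1 / r + 1"
      using osc_pos by (auto simp add: field_simps)
  qed
  have "m (real k * r) = m 0 + real k * W" for k
  proof (induction k)
    case (Suc k)
    then show ?case using osc_dom_shift[of "real k * r"] by (simp add: algebra_simps)
  qed simp
  moreover have "m 1 \<le> m (real n * r)" using dominated_mono[OF osc_dominated] n by (auto simp: mono_def)
  ultimately have "m 1 - m 0 \<le> W * real n" by (simp add: mult.commute)
  also have "\<dots> \<le> W * (1 / r + 1)" using n osc_W_nonneg by (intro mult_left_mono) auto
  finally show ?thesis .
qed

text \<open>
  Stretching a cell of length \<open>1 / N\<close> to unit length multiplies the period by \<open>N\<close> and preserves \<open>W\<close> and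
  the mean square. This makes it possible to condition on a cell and to apply the unconditional
  estimates there.
\<close>

lemma osc_rescale:
  assumes "0 < N"
  shows "oscillating (r * N) W (\<lambda>y. f ((a + y) / N)) (\<lambda>y. m ((a + y) / N))"
    and "mean_square (r * N) (\<lambda>y. f ((a + y) / N)) = mean_square r f"
proof -
  have e: "(a + (x + r * N)) / N = (a + x) / N + r" for x using assms by (simp add: field_simps)
  have g: "ival 0 (r * N) (\<lambda>y. g ((a + y) / N)) = N * ival 0 r g"
    if g: "g \<in> borel_measurable borel" "\<And>x. \<bar>g x\<bar> \<le> B" "\<And>x. g (x + r) = g x" for g B
  proof -
    have "ival 0 (r * N) (\<lambda>y. g ((a + y) / N)) = ival (N * 0) (N * r) (\<lambda>y. g ((a + y) / N))"
      by (simp add: mult.commute)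
    also have "\<dots> = N * ival 0 r (\<lambda>x. g (x + a / N))"
      using assms by (subst ival_scale) (auto simp: add_divide_distrib add.commute)
    also have "ival 0 r (\<lambda>x. g (x + a / N)) = ival 0 r g"
      by (rule ival_periodic_shift[OF g(1,2) osc_pos g(3)])
    finally show ?thesis .
  qed
  have dom: "dominated (\<lambda>y. f ((a + y) / N)) (\<lambda>y. m ((a + y) / N))"
    using dominated_affine[OF osc_dominated, of "1 / N" "a / N"] assms by (simp add: add_divide_distrib add.commute)
  show "oscillating (r * N) W (\<lambda>y. f ((a + y) / N)) (\<lambda>y. m ((a + y) / N))"
    unfolding oscillating_def using assms osc_pos dom g[OF osc_borel osc_bound osc_periodic] osc_mean
    by (auto simp: e osc_periodic osc_dom_shift)
  note [measurable] = osc_borel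
  have "ival 0 (r * N) (\<lambda>y. (f ((a + y) / N))\<^sup>2) = N * ival 0 r (\<lambda>x. (f x)\<^sup>2)"
    by (rule g[where B="W\<^sup>2"]) (use osc_square_le in \<open>auto simp: osc_periodic\<close>)
  then show "mean_square (r * N) (\<lambda>y. f ((a + y) / N)) = mean_square r f"
    using assms by (simp add: mean_square_def)
qed

end

section \<open>Ergodic sums along denominators and rational sums\<close>

lemma set_integral_sum:
  fixes f :: "'i \<Rightarrow> 'a \<Rightarrow> real"
  assumes "\<And>i. i \<in> I \<Longrightarrow> set_integrable M A (f i)"
  shows "set_integrable M A (\<lambda>x. \<Sum>i\<in>I. f i x)"
    and "(LINT x:A|M. (\<Sum>i\<in>I. f i x)) = (\<Sum>i\<in>I. LINT x:A|M. f i x)"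
  using assms unfolding set_integrable_def set_lebesgue_integral_def
  by (auto simp: sum_distrib_left Bochner_Integration.integral_sum)

text \<open>
  The dominating function is the variation \<open>v\<close> of \<open>\<phi>\<close> over \<open>[0, frac x]\<close> plus a jump of \<open>2 * V\<close> at every
  integer: one \<open>V\<close> compensates the return of \<open>v\<close> to zero, the other bounds the increment of \<open>\<phi>\<close> across
  the integer.
\<close>

lemma bv_periodic_dominated:
  assumes per: "periodic1 \<phi>" and bv: "bounded_variation_on {0..<1} \<phi>"
  obtains W m where "0 \<le> W" "dominated \<phi> m" "\<And>x. m (x + 1) = m x + W"
proof -
  obtain V where V: "\<And>n x. (\<forall>i\<le>n. x i \<in> {0..<1}) \<Longrightarrow> (\<forall>i<n. x i \<le> x (Suc i)) \<Longrightarrow>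
      (\<Sum>i<n. \<bar>\<phi> (x (Suc i)) - \<phi> (x i)\<bar>) \<le> V"
    using bv unfolding bounded_variation_on_def by blast
  define P where "P t = {(\<Sum>i<n. \<bar>\<phi> (x (Suc i)) - \<phi> (x i)\<bar>) | n x.
      (\<forall>i\<le>n. x i \<in> {0..t}) \<and> (\<forall>i<n. x i \<le> x (Suc i))}" for t :: real
  define v where "v t = Sup (P t)" for t
  have V0: "0 \<le> V" using V[of 0 "\<lambda>_. 0"] by simp
  have two: "\<bar>\<phi> y - \<phi> x\<bar> \<le> V" if "0 \<le> x" "x < 1" "0 \<le> y" "y < 1" for x y
  proof (cases "x \<le> y")
    case True
    then show ?thesis using V[of 1 "\<lambda>i. if i = 0 then x else y"] that by auto
  next
    case False
    then show ?thesis using V[of 1 "\<lambda>i. if i = 0 then y else x"] that by (auto simp: abs_minus_commute)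
  qed
  have PV: "e \<le> V" if "e \<in> P t" "t < 1" for e t
  proof -
    obtain n x where e: "e = (\<Sum>i<n. \<bar>\<phi> (x (Suc i)) - \<phi> (x i)\<bar>)" "\<forall>i\<le>n. x i \<in> {0..t}" "\<forall>i<n. x i \<le> x (Suc i)"
      using \<open>e \<in> P t\<close> unfolding P_def mem_Collect_eq by (elim exE conjE) (rule that; assumption)
    then show ?thesis using V[of n x] \<open>t < 1\<close> by fastforce
  qed
  have bdd: "bdd_above (P t)" if "t < 1" for t using PV[OF _ that] by (auto simp: bdd_above_def)
  have P0: "0 \<in> P t" if "0 \<le> t" for t
    unfolding P_def by (rule CollectI, rule exI[of _ 0], rule exI[of _ "\<lambda>_. 0"]) (use that in auto)
  have v0: "0 \<le> v t" if "0 \<le> t" "t < 1" for t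
    unfolding v_def using P0[OF that(1)] bdd[OF that(2)] by (rule cSup_upper)
  have vV: "v t \<le> V" if "0 \<le> t" "t < 1" for t
    unfolding v_def using P0[OF that(1)] PV[OF _ that(2)] by (intro cSup_least) auto
  have step: "\<bar>\<phi> t - \<phi> s\<bar> \<le> v t - v s" if st: "0 \<le> s" "s \<le> t" "t < 1" for s t
  proof -
    have "e \<le> v t - \<bar>\<phi> t - \<phi> s\<bar>" if "e \<in> P s" for e
    proof -
      obtain n x where e: "e = (\<Sum>i<n. \<bar>\<phi> (x (Suc i)) - \<phi> (x i)\<bar>)" "\<forall>i\<le>n. x i \<in> {0..s}" "\<forall>i<n. x i \<le> x (Suc i)"
        using \<open>e \<in> P s\<close> unfolding P_def mem_Collect_eq by (elim exE conjE) (rule that; assumption)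
      \<comment> \<open>appending the points \<open>s\<close> and \<open>t\<close> to a partition of \<open>[0, s]\<close>\<close>
      define y where "y i = (if i \<le> n then x i else if i = Suc n then s else t)" for i
      have "(\<Sum>i<Suc (Suc n). \<bar>\<phi> (y (Suc i)) - \<phi> (y i)\<bar>) \<in> P t"
        unfolding P_def
        by (rule CollectI, rule exI[of _ "Suc (Suc n)"], rule exI[of _ y]) (use e st in \<open>auto simp: y_def le_Suc_eq less_Suc_eq\<close>)
      then have "(\<Sum>i<Suc (Suc n). \<bar>\<phi> (y (Suc i)) - \<phi> (y i)\<bar>) \<le> v t"
        unfolding v_def using bdd[OF st(3)] by (rule cSup_upper)
      moreover have "(\<Sum>i<n. \<bar>\<phi> (y (Suc i)) - \<phi> (y i)\<bar>) = e"
        unfolding e(1) by (rule sum.cong) (auto simp: y_def)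
      ultimately show ?thesis by (simp add: y_def)
    qed
    then have "v s \<le> v t - \<bar>\<phi> t - \<phi> s\<bar>" unfolding v_def[of s] using P0[OF st(1)] by (intro cSup_least) auto
    then show ?thesis by simp
  qed
  define m where "m x = v (frac x) + 2 * V * of_int \<lfloor>x\<rfloor>" for x
  have fr: "\<phi> (frac x) = \<phi> x" for x
    using periodic_int[of \<phi> 1 "frac x" "\<lfloor>x\<rfloor>"] per by (simp add: periodic1_def frac_def)
  have "dominated \<phi> m" unfolding dominated_def
  proof (intro allI impI)
    fix x y :: real assume xy: "x \<le> y"
    note f = frac_ge_0[of x] frac_lt_1[of x] frac_ge_0[of y] frac_lt_1[of y]
    show "\<bar>\<phi> y - \<phi> x\<bar> \<le> m y - m x"
    proof (cases "\<lfloor>x\<rfloor> = \<lfloor>y\<rfloor>")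
      case True
      then have "frac x \<le> frac y" using xy by (simp add: frac_def)
      then show ?thesis using step[of "frac x" "frac y"] f True by (simp add: fr m_def)
    next
      case False
      then have "\<lfloor>x\<rfloor> + 1 \<le> \<lfloor>y\<rfloor>" using floor_mono[OF xy] by simp
      then have "1 \<le> real_of_int \<lfloor>y\<rfloor> - of_int \<lfloor>x\<rfloor>" by linarith
      then have "2 * V * 1 \<le> 2 * V * (real_of_int \<lfloor>y\<rfloor> - of_int \<lfloor>x\<rfloor>)" using V0 by (intro mult_left_mono) auto
      then show ?thesis using two[of "frac x" "frac y"] f vV[of "frac x"] v0[of "frac y"]
        by (simp add: fr m_def algebra_simps)
    qed
  qed
  moreover have "m (x + 1) = m x + 2 * V" for x
    by (simp add: m_def frac_def algebra_simps)
  ultimately show ?thesis using that[of "2 * V" m] V0 by simp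
qed

text \<open>
  The ergodic sum over \<open>q\<close> steps when \<open>\<alpha>\<close> is replaced by a reduced fraction \<open>p / q\<close>; the orbit is then a
  permutation of these points.
\<close>

definition rational_sum :: "(real \<Rightarrow> real) \<Rightarrow> nat \<Rightarrow> real \<Rightarrow> real \<Rightarrow> real" where
  "rational_sum \<phi> q c x = (\<Sum>j<q. \<phi> (x + c + real j / real q))"

lemma rational_sum_shift:
  assumes q: "0 < q" and sh: "\<And>x. g (x + 1) = g x + W"
  shows "rational_sum g q c (x + 1 / real q) = rational_sum g q c x + W"
proof -
  let ?g = "\<lambda>j. g (x + c + real j / real q)"
  have "rational_sum g q c (x + 1 / real q) = (\<Sum>j<q. ?g (Suc j))"
    unfolding rational_sum_def by (intro sum.cong) (auto simp: add_divide_distrib add_ac)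
  also have "\<dots> = (\<Sum>j<q. ?g j) + (?g q - ?g 0)"
    using sum_lessThan_telescope[of ?g q] by (simp add: sum_subtractf)
  also have "?g q - ?g 0 = W" using sh[of "x + c"] q by simp
  finally show ?thesis by (simp add: rational_sum_def)
qed

lemma dominated_periodic_bounded:
  fixes m :: "real \<Rightarrow> real"
  assumes m: "mono m" "\<And>x. m (x + 1) = m x + W"
  shows "\<bar>m x - W * x\<bar> \<le> \<bar>m 0\<bar> + 2 * \<bar>W\<bar>"
proof -
  have per: "(\<lambda>x. m x - W * x) (x + 1) = (\<lambda>x. m x - W * x) x" for x using m(2)[of x] by (simp add: algebra_simps)
  have "m x - W * x = m (frac x) - W * frac x"
    using periodic_int[of "\<lambda>x. m x - W * x" 1 "frac x" "\<lfloor>x\<rfloor>", OF per] by (simp add: frac_def)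
  moreover have "m 0 \<le> m (frac x)" "m (frac x) \<le> m 1"
    using m(1) frac_ge_0[of x] frac_lt_1[of x] by (auto simp: mono_def)
  moreover have "m 1 = m 0 + W" using m(2)[of 0] by simp
  moreover have "\<bar>W * frac x\<bar> \<le> \<bar>W\<bar> * 1" unfolding abs_mult using frac_ge_0[of x] frac_lt_1[of x] by (intro mult_left_mono) auto
  ultimately show ?thesis by linarith
qed

lemma dominated_periodic_fun_bounded:
  assumes d: "dominated F m" "\<And>x. m (x + 1) = m x + W" and per: "\<And>x. F (x + 1) = F x"
  shows "\<bar>F x\<bar> \<le> \<bar>F 0\<bar> + W"
proof -
  have "F x = F (frac x)" using periodic_int[of F 1 "frac x" "\<lfloor>x\<rfloor>", OF per] by (simp add: frac_def)
  moreover have "\<bar>F (frac x) - F 0\<bar> \<le> m (frac x) - m 0" by (intro dominatedD[OF d(1)]) simp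
  moreover have "m (frac x) \<le> m 1" using dominated_mono[OF d(1)] frac_lt_1[of x] by (auto simp: mono_def less_imp_le)
  ultimately show ?thesis using d(2)[of 0] by simp
qed

lemma rational_sum_oscillating:
  assumes per: "\<And>x. \<phi> (x + 1) = \<phi> x" and d: "dominated \<phi> m" and sh: "\<And>x. m (x + 1) = m x + W"
    and mean: "ival 0 1 \<phi> = 0" and q: "0 < q"
  shows "oscillating (1 / real q) W (rational_sum \<phi> q c) (rational_sum m q c)"
    and "mean_square (1 / real q) (rational_sum \<phi> q c) = ival 0 1 (\<lambda>y. (\<Sum>j<q. \<phi> ((y + real j) / real q))\<^sup>2)"
proof -
  note [measurable] = dominated_borel[OF d]
  note bd = dominated_periodic_fun_bounded[OF d sh per]
  have dom: "dominated (rational_sum \<phi> q c) (rational_sum m q c)"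
    unfolding rational_sum_def using dominated_affine[OF d, of 1]
    by (intro dominated_sum) (simp add: add.assoc)
  have "ival 0 (1 / real q) (rational_sum \<phi> q c) = (\<Sum>j<q. ival 0 (1 / real q) (\<lambda>x. \<phi> (x + c + real j / real q)))"
    unfolding rational_sum_def
    by (rule set_integral_sum(2)) (auto intro!: bounded_ival_integrable[OF _ bd])
  also have "\<dots> = (\<Sum>j<q. ival 0 (1 / real q) (\<lambda>x. (\<lambda>x. \<phi> (x + c)) (x + real j * (1 / real q))))"
    by (simp add: add_ac)
  also have "\<dots> = ival 0 (real q * (1 / real q)) (\<lambda>x. \<phi> (x + c))"
    by (rule ival_cells[symmetric]) (use bd in auto)
  also have "\<dots> = ival 0 1 (\<lambda>x. \<phi> (x + c))" using q by simp
  also have "\<dots> = 0" using ival_periodic_shift[where f=\<phi>, OF _ bd, of 1 c] per mean by simp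
  finally show osc: "oscillating (1 / real q) W (rational_sum \<phi> q c) (rational_sum m q c)"
    unfolding oscillating_def using q dom rational_sum_shift[OF q, of m W c] sh
      rational_sum_shift[OF q, of \<phi> 0 c] per by auto
  have "mean_square (1 / real q) (rational_sum \<phi> q c) =
      mean_square (1 / real q * real q) (\<lambda>y. rational_sum \<phi> q c ((- c * real q + y) / real q))"
    by (rule osc_rescale(2)[OF osc, symmetric]) (use q in simp)
  also have "\<dots> = ival 0 1 (\<lambda>y. (\<Sum>j<q. \<phi> ((y + real j) / real q))\<^sup>2)"
    using q by (simp add: mean_square_def rational_sum_def add_divide_distrib algebra_simps diff_divide_distrib)
  finally show "mean_square (1 / real q) (rational_sum \<phi> q c) = ival 0 1 (\<lambda>y. (\<Sum>j<q. \<phi> ((y + real j) / real q))\<^sup>2)" .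
qed

text \<open>
  An increment of \<open>F\<close> is bounded by an increment of \<open>m\<close>. Up to a linear term \<open>m\<close> is periodic, so the
  integrals of its translates differ only by the contribution of that term.
\<close>

lemma translation_L1_bound:
  assumes d: "dominated F m" "\<And>x. m (x + 1) = m x + W" and per: "\<And>x. F (x + 1) = F x"
  shows "ival 0 1 (\<lambda>x. \<bar>F (x + s) - F (x + s')\<bar>) \<le> W * \<bar>s - s'\<bar>"
proof -
  have main: "ival 0 1 (\<lambda>x. \<bar>F (x + s') - F (x + s)\<bar>) \<le> W * (s' - s)" if "s \<le> s'" for s s'
  proof -
    note [measurable] = dominated_borel[OF d(1)]
    have [measurable]: "m \<in> borel_measurable borel" using borel_measurable_mono[OF dominated_mono[OF d(1)]] .
    define g where "g x = m x - W * x" for x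
    have g1: "g \<in> borel_measurable borel" unfolding g_def by measurable
    have g2: "g (x + 1) = g x" for x using d(2)[of x] by (simp add: g_def algebra_simps)
    have g3: "\<bar>g x\<bar> \<le> \<bar>m 0\<bar> + 2 * \<bar>W\<bar>" for x
      using dominated_periodic_bounded[OF dominated_mono[OF d(1)] d(2)] by (simp add: g_def)
    note g = g1 g2 g3
    note [measurable] = g(1)
    have ig: "set_integrable lborel {0..<1} (\<lambda>x. g (x + u))" for u
      by (rule bounded_ival_integrable[OF _ g(3)]) simp
    have e: "m (x + s') - m (x + s) = g (x + s') - g (x + s) + W * (s' - s)" for x
      by (simp add: g_def algebra_simps)
    have ic: "set_integrable lborel {0..<1::real} (\<lambda>x. W * (s' - s))"
      by (rule bounded_ival_integrable) auto
    have im: "set_integrable lborel {0..<1} (\<lambda>x. m (x + s') - m (x + s))"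
      unfolding e using ig ic by (intro set_integral_add(1) set_integral_diff(1))
    have "ival 0 1 (\<lambda>x. \<bar>F (x + s') - F (x + s)\<bar>) \<le> ival 0 1 (\<lambda>x. m (x + s') - m (x + s))"
    proof (rule set_integral_mono)
      show "set_integrable lborel {0..<1} (\<lambda>x. \<bar>F (x + s') - F (x + s)\<bar>)"
        using dominated_periodic_fun_bounded[OF d per]
        by (intro set_integrable_abs set_integral_diff(1) bounded_ival_integrable) auto
    qed (use im dominatedD[OF d(1)] that in auto)
    also have "\<dots> = ival 0 1 (\<lambda>x. g (x + s')) - ival 0 1 (\<lambda>x. g (x + s)) + ival 0 1 (\<lambda>x. W * (s' - s))"
      unfolding e using ig ic by (subst set_integral_add(2)) (auto intro!: set_integral_diff)
    also have "\<dots> = W * (s' - s)"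
      using ival_periodic_shift[OF g(1,3) _ g(2), of s] ival_periodic_shift[OF g(1,3) _ g(2), of s']
      by (simp add: set_lebesgue_integral_def)
    finally show ?thesis .
  qed
  show ?thesis
  proof (cases "s \<le> s'")
    case True
    then show ?thesis using main[OF True] by (simp add: abs_minus_commute)
  next
    case False
    then show ?thesis using main[of s' s] by simp
  qed
qed

text \<open>
  Multiplication by \<open>p\<close> permutes the residues modulo \<open>q\<close>.
\<close>

lemma sum_coprime_multiples:
  fixes g :: "real \<Rightarrow> real"
  assumes q: "0 < q" and co: "coprime p q" and per: "\<And>x. g (x + 1) = g x"
  shows "(\<Sum>j<q. g (x + real j * (real p / real q))) = (\<Sum>j<q. g (x + real j / real q))"
proof -
  have "inj_on (\<lambda>j. (j * p) mod q) {..<q}"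
  proof (rule inj_onI)
    fix i j assume ij: "i \<in> {..<q}" "j \<in> {..<q}" "(i * p) mod q = (j * p) mod q"
    have *: "a = b" if "a \<le> b" "b < q" "(a * p) mod q = (b * p) mod q" for a b
    proof -
      have "q dvd (b * p - a * p)" using that by (metis mod_eq_dvd_iff_nat mult_le_mono1)
      then have "q dvd (b - a) * p" by (simp add: diff_mult_distrib)
      then have "q dvd b - a" using co by (simp add: coprime_commute coprime_dvd_mult_left_iff)
      then show ?thesis using that nat_dvd_not_less[of "b - a" q] by (cases "b - a = 0") auto
    qed
    show "i = j"
    proof (cases "i \<le> j")
      case True
      show ?thesis by (rule *[OF True _ ij(3)]) (use ij(2) in simp)
    next
      case False
      then have "j \<le> i" by simp
      then have "j = i" by (rule *[OF _ _ ij(3)[symmetric]]) (use ij(1) in simp)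
      then show ?thesis by simp
    qed
  qed
  then have bij: "bij_betw (\<lambda>j. (j * p) mod q) {..<q} {..<q}"
    unfolding bij_betw_def using q by (intro conjI endo_inj_surj) auto
  have "(\<Sum>j<q. g (x + real j * (real p / real q))) = (\<Sum>j<q. g (x + real ((j * p) mod q) / real q))"
  proof (rule sum.cong[OF refl])
    fix j
    have "real j * (real p / real q) = real ((j * p) mod q) / real q + of_int (int ((j * p) div q))"
    proof -
      have "real j * real p = real q * real ((j * p) div q) + real ((j * p) mod q)"
        by (metis mult_div_mod_eq of_nat_add of_nat_mult)
      then show ?thesis using q by (simp add: field_simps)
    qed
    then show "g (x + real j * (real p / real q)) = g (x + real ((j * p) mod q) / real q)"
      using periodic_int[of g 1 "x + real ((j * p) mod q) / real q" "int ((j * p) div q)", OF per]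
      by (simp add: add_ac)
  qed
  also have "\<dots> = (\<Sum>j<q. g (x + real j / real q))"
    by (rule sum.reindex_bij_betw[OF bij])
  finally show ?thesis .
qed

text \<open>
  Corresponding orbit points differ by at most \<open>e\<close>. For the uniform bound, every increment of \<open>\<phi>\<close> is
  estimated by the growth of \<open>m\<close> over an interval of length \<open>2 / q\<close> about \<open>j * p / q\<close>; these intervals
  cover the circle twice. For the integral bound, each of the \<open>q\<close> increments is a translation by at
  most \<open>e\<close>.
\<close>

lemma ergodic_sum_vs_rational_sum:
  assumes per: "\<And>x. \<phi> (x + 1) = \<phi> x" and d: "dominated \<phi> m" and sh: "\<And>x. m (x + 1) = m x + W"
    and q: "0 < q" and co: "coprime p q" and e: "\<bar>real q * \<alpha> - real p\<bar> \<le> e" "e \<le> 1 / real q"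
  shows "\<bar>ergodic_sum \<alpha> \<phi> q (x + c) - rational_sum \<phi> q c x\<bar> \<le> 2 * W"
    and "ival 0 1 (\<lambda>x. \<bar>ergodic_sum \<alpha> \<phi> q (x + c) - rational_sum \<phi> q c x\<bar>) \<le> W * (real q * e)"
proof -
  let ?r = "real p / real q"
  have W: "0 \<le> W" using dominated_mono[OF d] sh[of 0] by (auto simp: mono_def) (smt (verit))
  have e0: "0 \<le> e" using e by linarith
  have dist: "\<bar>real j * \<alpha> - real j * ?r\<bar> \<le> e" if "j < q" for j
  proof -
    have "real j * \<alpha> - real j * ?r = real j / real q * (real q * \<alpha> - real p)" using q by (simp add: field_simps)
    then have "\<bar>real j * \<alpha> - real j * ?r\<bar> = real j / real q * \<bar>real q * \<alpha> - real p\<bar>" by (simp add: abs_mult)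
    also have "\<dots> \<le> 1 * e" using that e e0 by (intro mult_mono) auto
    finally show ?thesis by simp
  qed
  have rs: "rational_sum \<phi> q c x = (\<Sum>j<q. \<phi> (x + c + real j * ?r))" for x
    unfolding rational_sum_def by (rule sum_coprime_multiples[where g=\<phi>, OF q co per, symmetric])
  have es: "ergodic_sum \<alpha> \<phi> q (x + c) - rational_sum \<phi> q c x =
     (\<Sum>j<q. \<phi> (x + (c + real j * \<alpha>)) - \<phi> (x + (c + real j * ?r)))" for x
    unfolding rs ergodic_sum_def by (simp add: sum_subtractf add_ac)
  let ?h = "\<lambda>z. m (z + 1 / real q) - m (z - 1 / real q)"
  have "\<bar>ergodic_sum \<alpha> \<phi> q (x + c) - rational_sum \<phi> q c x\<bar> \<le>
     (\<Sum>j<q. \<bar>\<phi> (x + (c + real j * \<alpha>)) - \<phi> (x + (c + real j * ?r))\<bar>)"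
    unfolding es by (rule sum_abs)
  also have "\<dots> \<le> (\<Sum>j<q. ?h ((x + c) + real j * ?r))"
  proof (rule sum_mono)
    fix j assume "j \<in> {..<q}"
    then have "\<bar>real j * \<alpha> - real j * ?r\<bar> \<le> 1 / real q" using dist e(2) by fastforce
    note b = this
    have mm: "x \<le> y \<Longrightarrow> m x \<le> m y" for x y using dominated_mono[OF d] by (auto simp: mono_def)
    let ?u = "x + (c + real j * \<alpha>)" and ?v = "x + (c + real j * ?r)"
    have q1: "0 \<le> 1 / real q" by simp
    have "\<bar>\<phi> ?u - \<phi> ?v\<bar> \<le> \<bar>m ?u - m ?v\<bar>"
    proof (cases "?u \<le> ?v")
      case True
      then show ?thesis using dominatedD[OF d True] by linarith
    next
      case False
      then show ?thesis using dominatedD[OF d, of ?v ?u] by linarith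
    qed
    also have "\<dots> \<le> m (?v + 1 / real q) - m (?v - 1 / real q)"
      using b q1 mm[of ?u "?v + 1 / real q"] mm[of "?v - 1 / real q" ?u] mm[of ?v "?v + 1 / real q"]
         mm[of "?v - 1 / real q" ?v] by (smt (verit))
    finally show "\<bar>\<phi> ?u - \<phi> ?v\<bar> \<le> ?h ((x + c) + real j * ?r)" by (simp add: add_ac)
  qed
  also have "\<dots> = (\<Sum>j<q. ?h ((x + c) + real j / real q))"
  proof (rule sum_coprime_multiples[OF q co])
    fix z
    have "m (z + 1 + 1 / real q) = m (z + 1 / real q) + W" "m (z + 1 - 1 / real q) = m (z - 1 / real q) + W"
      using sh[of "z + 1 / real q"] sh[of "z - 1 / real q"] by (simp_all add: algebra_simps)
    then show "?h (z + 1) = ?h z" by simp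
  qed
  also have "\<dots> = rational_sum m q c (x + 1 / real q) - rational_sum m q c (x - 1 / real q)"
    unfolding rational_sum_def sum_subtractf[symmetric] by (intro sum.cong) (auto simp: algebra_simps)
  also have "\<dots> = 2 * W"
    using rational_sum_shift[where g=m, OF q sh, of c x]
      rational_sum_shift[where g=m, OF q sh, of c "x - 1 / real q"] by simp
  finally show "\<bar>ergodic_sum \<alpha> \<phi> q (x + c) - rational_sum \<phi> q c x\<bar> \<le> 2 * W" .
  note [measurable] = dominated_borel[OF d]
  note bd = dominated_periodic_fun_bounded[OF d sh per]
  have i: "set_integrable lborel {0..<1} (\<lambda>x. \<bar>\<phi> (x + (c + real j * \<alpha>)) - \<phi> (x + (c + real j * ?r))\<bar>)" for j
    by (intro set_integrable_abs set_integral_diff(1) bounded_ival_integrable[OF _ bd]) auto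
  have "ival 0 1 (\<lambda>x. \<bar>ergodic_sum \<alpha> \<phi> q (x + c) - rational_sum \<phi> q c x\<bar>) \<le>
     ival 0 1 (\<lambda>x. \<Sum>j<q. \<bar>\<phi> (x + (c + real j * \<alpha>)) - \<phi> (x + (c + real j * ?r))\<bar>)"
    unfolding es
    by (rule set_integral_mono)
      (auto intro!: set_integrable_abs set_integral_sum(1) set_integral_diff(1) bounded_ival_integrable[OF _ bd] sum_abs)
  also have "\<dots> = (\<Sum>j<q. ival 0 1 (\<lambda>x. \<bar>\<phi> (x + (c + real j * \<alpha>)) - \<phi> (x + (c + real j * ?r))\<bar>))"
    by (rule set_integral_sum(2)) (use i in auto)
  also have "\<dots> \<le> (\<Sum>j<q. W * e)"
  proof (rule sum_mono)
    fix j assume "j \<in> {..<q}"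
    then have "W * \<bar>(c + real j * \<alpha>) - (c + real j * ?r)\<bar> \<le> W * e" using dist[of j] W by (intro mult_left_mono) auto
    then show "ival 0 1 (\<lambda>x. \<bar>\<phi> (x + (c + real j * \<alpha>)) - \<phi> (x + (c + real j * ?r))\<bar>) \<le> W * e"
      using translation_L1_bound[OF d sh per, of "c + real j * \<alpha>" "c + real j * ?r"] by linarith
  qed
  finally show "ival 0 1 (\<lambda>x. \<bar>ergodic_sum \<alpha> \<phi> q (x + c) - rational_sum \<phi> q c x\<bar>) \<le> W * (real q * e)"
    by (simp add: mult_ac)
qed

context
  fixes \<alpha> :: real assumes al: "0 < \<alpha>" "\<alpha> < 1" "\<alpha> \<notin> \<rat>"
begin

lemma cf_determinant:
  "int (cf_num \<alpha> (Suc n)) * int (cf_den \<alpha> n) - int (cf_num \<alpha> n) * int (cf_den \<alpha> (Suc n)) = (-1) ^ n"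
  by (induction n) (simp_all add: algebra_simps)

lemma cf_coprime: "coprime (cf_num \<alpha> n) (cf_den \<alpha> n)"
proof (rule coprimeI)
  fix d assume "d dvd cf_num \<alpha> n" "d dvd cf_den \<alpha> n"
  then have "int d dvd int (cf_num \<alpha> (Suc n)) * int (cf_den \<alpha> n) - int (cf_num \<alpha> n) * int (cf_den \<alpha> (Suc n))"
    by (intro dvd_diff dvd_mult dvd_mult2) auto
  then have "int d dvd (-1) ^ n" by (simp only: cf_determinant)
  then have "int d dvd 1" by (cases "even n") (auto simp: minus_one_power_iff)
  then show "is_unit d" by simp
qed

lemma cf_den_Suc: "cf_quot \<alpha> (Suc n) * cf_den \<alpha> n \<le> cf_den \<alpha> (Suc n)"
  by (cases n) auto

lemma cf_den_mono: "i \<le> j \<Longrightarrow> cf_den \<alpha> i \<le> cf_den \<alpha> j"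
proof (rule lift_Suc_mono_le[of "cf_den \<alpha>"])
  fix n
  have "1 * cf_den \<alpha> n \<le> cf_quot \<alpha> (Suc n) * cf_den \<alpha> n"
    using cf_quot_eq(2)[OF al, of n] by (intro mult_le_mono1)
  then show "cf_den \<alpha> n \<le> cf_den \<alpha> (Suc n)" using cf_den_Suc[of n] by linarith
qed

text \<open>
  By the determinant identity and the recursion for the errors, the error at \<open>n\<close> times
  \<open>q\<^sub>n\<^sub>+\<^sub>1 + x * q\<^sub>n\<close>, where \<open>x\<close> is the next remainder of the Gauss map, is \<open>1\<close> or \<open>- 1\<close>.
\<close>

lemma cf_approximation: "\<bar>real (cf_den \<alpha> n) * \<alpha> - real (cf_num \<alpha> n)\<bar> \<le> 1 / real (cf_den \<alpha> (Suc n))"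
proof -
  let ?e = "\<lambda>n. real (cf_den \<alpha> n) * \<alpha> - real (cf_num \<alpha> n)"
  let ?q = "\<lambda>n. real (cf_den \<alpha> n)"
  let ?x = "cf_rem \<alpha> (Suc n)"
  have x: "0 < ?x" using cf_rem_irrational[OF al] by blast
  have q: "?q (Suc n) \<ge> 1" "?q n \<ge> 1" using cf_den_ge[OF al, of "Suc n"] cf_den_ge[OF al, of n] by auto
  have "?e n * ?q (Suc n) - ?e (Suc n) * ?q n =
     real_of_int (int (cf_num \<alpha> (Suc n)) * int (cf_den \<alpha> n) - int (cf_num \<alpha> n) * int (cf_den \<alpha> (Suc n)))"
    by (simp add: algebra_simps del: cf_num.simps cf_den.simps)
  then have "?e n * (?q (Suc n) + ?x * ?q n) = (-1) ^ n"
    unfolding cf_determinant cf_error[OF al] by (simp add: algebra_simps del: cf_num.simps cf_den.simps cf_rem.simps)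
  then have "\<bar>?e n * (?q (Suc n) + ?x * ?q n)\<bar> = 1"
    by (simp only: power_abs) simp
  then have "\<bar>?e n\<bar> * \<bar>?q (Suc n) + ?x * ?q n\<bar> = 1" by (simp only: abs_mult)
  moreover have "0 \<le> ?q (Suc n) + ?x * ?q n" using x by simp
  ultimately have "\<bar>?e n\<bar> * (?q (Suc n) + ?x * ?q n) = 1" by (simp only: abs_of_nonneg)
  moreover have "\<bar>?e n\<bar> * ?q (Suc n) \<le> \<bar>?e n\<bar> * (?q (Suc n) + ?x * ?q n)"
    using x q by (intro mult_left_mono) auto
  ultimately have "\<bar>?e n\<bar> * ?q (Suc n) \<le> 1" by simp
  then show ?thesis using q by (simp add: field_simps del: cf_den.simps cf_num.simps)
qed

end

text \<open>
  For \<open>m = n + 2\<close> there are \<open>n\<close> terms before the last one, each at most \<open>q n\<close>, over the common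
  denominator, and \<open>n * q n \<le> q (Suc n)\<close>: together they do not exceed the last term.
\<close>

lemma sum_ratios_le:
  fixes q :: "nat \<Rightarrow> nat"
  assumes pos: "\<And>k. 1 \<le> k \<Longrightarrow> 1 \<le> q k" and gr: "\<And>k. 1 \<le> k \<Longrightarrow> k * q k \<le> q (Suc k)" and m: "1 \<le> m"
  shows "(\<Sum>k=1..<m. real (q k) / real (q m)) \<le> 4 / real m"
proof -
  consider "m = 1" | "m = 2" | n where "m = Suc (Suc n)" "1 \<le> n"
  proof (cases "m \<le> 2")
    case True
    then have "m = 1 \<or> m = 2" using m by linarith
    then show ?thesis using that by blast
  next
    case False
    then show ?thesis using that(3)[of "m - 2"] by simp
  qed
  then show ?thesis
  proof cases
    case 2
    have "real (q 1) \<le> real (q 2)" using gr[of 1] by (simp add: numeral_2_eq_2)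
    then have "real (q 1) / real (q 2) \<le> 1" using pos[of 2] by (simp add: divide_le_eq)
    moreover have "{1..<2::nat} = {1}" by auto
    ultimately show ?thesis using 2 by simp
  next
    case 3
    have mono: "q i \<le> q j" if "1 \<le> i" "i \<le> j" for i j
      using that(2,1)
    proof (induction j rule: dec_induct)
      case (step j)
      have "1 * q j \<le> j * q j" using step by (intro mult_le_mono1) auto
      then show ?case using gr[of j] step by linarith
    qed simp
    have p: "1 \<le> real (q m)" "1 \<le> real (q n)" "1 \<le> real (q (Suc n))" using 3 pos[of m] pos[of n] pos[of "Suc n"] by auto
    have a: "real n * real (q n) \<le> real (q (Suc n))" using gr[of n] 3 by (metis of_nat_le_iff of_nat_mult)
    have b: "real (Suc n) * real (q (Suc n)) \<le> real (q m)" using gr[of "Suc n"] 3 by (metis of_nat_le_iff of_nat_mult le_SucI)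
    have "{1..<m} = insert (Suc n) {1..n}" using 3 by auto
    then have "(\<Sum>k=1..<m. real (q k) / real (q m)) = real (q (Suc n)) / real (q m) + (\<Sum>k=1..n. real (q k) / real (q m))"
      by simp
    also have "(\<Sum>k=1..n. real (q k) / real (q m)) \<le> (\<Sum>k=1..n. real (q n) / real (q m))"
      using mono by (intro sum_mono divide_right_mono) auto
    also have "\<dots> = (real n * real (q n)) / real (q m)" by simp
    also have "\<dots> \<le> real (q (Suc n)) / real (q m)" using a by (intro divide_right_mono) auto
    also have "real (q (Suc n)) / real (q m) \<le> 1 / real (Suc n)" using b p by (simp add: field_simps)
    finally have "(\<Sum>k=1..<m. real (q k) / real (q m)) \<le> 2 / real (Suc n)" by simp
    also have "\<dots> \<le> 4 / real m" using 3 by (simp add: field_simps)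
    finally show ?thesis .
  qed simp
qed

section \<open>The Fourier description of the limiting variances\<close>

lemma circle_measurable: "f \<in> borel_measurable borel \<Longrightarrow> f \<in> borel_measurable circle"
  unfolding circle_def by (rule measurable_restrict_space1) simp

lemma circle_integrable:
  fixes f :: "real \<Rightarrow> 'b::{banach, second_countable_topology}"
  assumes "f \<in> borel_measurable borel" "\<And>x. norm (f x) \<le> B"
  shows "integrable circle f"
proof -
  interpret prob_space circle by (rule prob_space_circle)
  show ?thesis using assms(2) by (intro integrable_const_bound[of _ B] circle_measurable assms(1)) auto
qed

definition character :: "int \<Rightarrow> real \<Rightarrow> complex" where
  "character r x = cis (2 * pi * of_int r * x)"

lemma character_borel [measurable]: "character r \<in> borel_measurable borel"
  unfolding character_def by (intro borel_measurable_continuous_onI continuous_intros)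

lemma norm_character [simp]: "cmod (character r x) = 1" by (simp add: character_def)

lemma character_mult: "character r x * character s x = character (r + s) x"
  by (simp add: character_def cis_mult algebra_simps)

lemma character_add: "character r (x + y) = character r x * character r y"
  by (simp add: character_def cis_mult algebra_simps)

lemma cnj_character: "cnj (character r x) = character (- r) x"
  by (simp add: character_def cis_cnj)

lemma character_0 [simp]: "character 0 x = 1" by (simp add: character_def)

lemma character_periodic: "character r (x + 1) = character r x"
proof -
  have "2 * pi * of_int r * (x + 1) = 2 * pi * of_int r * x + 2 * pi * of_int r" by (simp add: algebra_simps)
  then show ?thesis unfolding character_def
    by (simp only: cis_mult[symmetric]) (simp add: cis_multiple_2pi)
qed

lemma circle_integral_Re_Im:
  assumes "f \<in> borel_measurable borel" "\<And>x. cmod (f x) \<le> B"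
  shows "(LINT x|circle. f x) = Complex (ival 0 1 (\<lambda>x. Re (f x))) (ival 0 1 (\<lambda>x. Im (f x)))"
  using circle_integrable[OF assms] by (simp add: complex_eq_iff ival_eq_circle[symmetric])

lemma circle_integral_shift:
  fixes f :: "real \<Rightarrow> complex"
  assumes f: "f \<in> borel_measurable borel" "\<And>x. cmod (f x) \<le> B" and per: "\<And>x. f (x + 1) = f x"
  shows "(LINT x|circle. f (x + s)) = (LINT x|circle. f x)"
proof -
  note [measurable] = f(1)
  have "ival 0 1 (\<lambda>x. Re (f (x + s))) = ival 0 1 (\<lambda>x. Re (f x))"
    by (rule ival_periodic_shift[where B=B]) (use f per abs_Re_le_cmod order_trans in \<open>auto intro: order_trans[OF abs_Re_le_cmod]\<close>)
  moreover have "ival 0 1 (\<lambda>x. Im (f (x + s))) = ival 0 1 (\<lambda>x. Im (f x))"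
    by (rule ival_periodic_shift[where B=B]) (use f per in \<open>auto intro: order_trans[OF abs_Im_le_cmod]\<close>)
  ultimately show ?thesis
    by (subst (1 2) circle_integral_Re_Im[where B=B]) (use f in auto)
qed

lemma character_integral: "(LINT x|circle. character r x) = (if r = 0 then 1 else 0)"
proof (cases "r = 0")
  case True
  interpret prob_space circle by (rule prob_space_circle)
  show ?thesis using True by (simp add: prob_space)
next
  case False
  \<comment> \<open>a translation by half a period changes the sign of the character\<close>
  let ?s = "1 / (2 * of_int r) :: real"
  have "character r ?s = -1" using False by (simp add: character_def)
  then have "(LINT x|circle. character r (x + ?s)) = - (LINT x|circle. character r x)"
    by (simp add: character_add)
  moreover have "(LINT x|circle. character r (x + ?s)) = (LINT x|circle. character r x)"
    by (rule circle_integral_shift[where B=1]) (auto simp: character_periodic)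
  ultimately show ?thesis using False by simp
qed

lemma fourier_coeff_character: "fourier_coeff f r = (LINT x|circle. of_real (f x) * character (- r) x)"
  by (simp add: fourier_coeff_def character_def)

lemma fourier_coeff_uminus: "fourier_coeff f (- r) = cnj (fourier_coeff f r)"
proof -
  have "cnj (fourier_coeff f r) = (LINT x|circle. cnj (of_real (f x) * character (- r) x))"
    unfolding fourier_coeff_character by (rule Bochner_Integration.integral_cnj[symmetric])
  then show ?thesis by (simp add: fourier_coeff_character cnj_character)
qed

text \<open>
  Pythagoras' theorem for the projection to the span of finitely many characters.
\<close>

lemma partial_sum_defect:
  fixes f :: "real \<Rightarrow> real"
  assumes f: "f \<in> borel_measurable borel" "\<And>x. \<bar>f x\<bar> \<le> B" and A: "finite A"
  defines "c \<equiv> fourier_coeff f"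
  shows "(LINT x|circle. (cmod (of_real (f x) - (\<Sum>r\<in>A. c r * character r x)))\<^sup>2)
     = ival 0 1 (\<lambda>x. (f x)\<^sup>2) - (\<Sum>r\<in>A. (cmod (c r))\<^sup>2)"
proof -
  note [measurable] = f(1)
  let ?S = "\<lambda>x. \<Sum>r\<in>A. c r * character r x"
  have B: "0 \<le> B" using f(2)[of 0] by linarith
  have ff: "f x * f x \<le> B * B" for x
    using mult_mono[OF f(2)[of x] f(2)[of x]] B by (simp add: abs_mult_self_eq)
  have i1: "integrable circle (\<lambda>x. complex_of_real (f x) * complex_of_real (f x))"
    by (rule circle_integrable[where B="B * B"]) (auto simp: norm_mult ff)
  have i2: "integrable circle (\<lambda>x. complex_of_real (f x) * character r x)" for r
    by (rule circle_integrable[where B="B * 1"]) (use f B in \<open>auto simp: norm_mult intro!: mult_mono\<close>)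
  have i3: "integrable circle (\<lambda>x. character r x)" for r
    by (rule circle_integrable[where B=1]) auto
  have e: "complex_of_real ((cmod (of_real (f x) - ?S x))\<^sup>2) =
      of_real (f x) * of_real (f x) - (\<Sum>r\<in>A. cnj (c r) * (of_real (f x) * character (- r) x))
      - (\<Sum>r\<in>A. c r * (of_real (f x) * character r x))
      + (\<Sum>r\<in>A. \<Sum>s\<in>A. c r * cnj (c s) * character (r - s) x)" for x
  proof -
    have "complex_of_real ((cmod (of_real (f x) - ?S x))\<^sup>2) = (of_real (f x) - ?S x) * cnj (of_real (f x) - ?S x)"
      by (simp only: complex_norm_square)
    also have "\<dots> = (of_real (f x) - ?S x) * (of_real (f x) - (\<Sum>r\<in>A. cnj (c r) * character (- r) x))"
      by (simp add: cnj_character)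
    also have "\<dots> = of_real (f x) * of_real (f x) - of_real (f x) * (\<Sum>r\<in>A. cnj (c r) * character (- r) x)
       - of_real (f x) * ?S x + ?S x * (\<Sum>r\<in>A. cnj (c r) * character (- r) x)"
      by (simp add: algebra_simps)
    also have "?S x * (\<Sum>r\<in>A. cnj (c r) * character (- r) x) =
        (\<Sum>r\<in>A. \<Sum>s\<in>A. c r * cnj (c s) * character (r - s) x)"
      unfolding sum_product using character_mult[of _ x "- _"]
      by (intro sum.cong refl) (simp add: mult_ac flip: character_mult)
    finally show ?thesis by (simp add: sum_distrib_left mult_ac)
  qed
  have "complex_of_real (LINT x|circle. (cmod (of_real (f x) - ?S x))\<^sup>2) =
      (LINT x|circle. complex_of_real ((cmod (of_real (f x) - ?S x))\<^sup>2))"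
    by (rule integral_complex_of_real[symmetric])
  also have "\<dots> = (LINT x|circle. of_real (f x) * of_real (f x)) - (\<Sum>r\<in>A. cnj (c r) * c r)
      - (\<Sum>r\<in>A. c r * c (- r)) + (\<Sum>r\<in>A. \<Sum>s\<in>A. c r * cnj (c s) * (if r - s = 0 then 1 else 0))"
  proof -
    have c': "(LINT x|circle. of_real (f x) * character r x) = c (- r)" for r
      by (simp add: c_def fourier_coeff_character)
    show ?thesis
      unfolding e
      by (subst Bochner_Integration.integral_add Bochner_Integration.integral_diff Bochner_Integration.integral_sum;
          (intro Bochner_Integration.integrable_diff Bochner_Integration.integrable_sum integrable_mult_right i1 i2 i3)?)+
         (simp add: c' character_integral)
  qed
  also have "(LINT x|circle. complex_of_real (f x) * of_real (f x)) = complex_of_real (ival 0 1 (\<lambda>x. (f x)\<^sup>2))"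
    by (simp add: ival_eq_circle[symmetric] power2_eq_square flip: of_real_mult)
  also have "(\<Sum>r\<in>A. \<Sum>s\<in>A. c r * cnj (c s) * (if r - s = 0 then 1 else 0)) = (\<Sum>r\<in>A. c r * cnj (c r))"
    using A by (intro sum.cong) (auto simp: if_distrib cong: if_cong)
  finally have "complex_of_real (LINT x|circle. (cmod (of_real (f x) - ?S x))\<^sup>2) =
      complex_of_real (ival 0 1 (\<lambda>x. (f x)\<^sup>2)) - (\<Sum>r\<in>A. c r * cnj (c r))"
    by (simp add: c_def fourier_coeff_uminus mult_ac)
  also have "\<dots> = complex_of_real (ival 0 1 (\<lambda>x. (f x)\<^sup>2) - (\<Sum>r\<in>A. (cmod (c r))\<^sup>2))"
    by (simp add: complex_norm_square flip: of_real_power)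
  finally show ?thesis by (simp only: of_real_eq_iff)
qed

text \<open>
  A chord of the unit circle is at least as long as the arc measured in units of a full turn; this
  rests on \<open>y \<le> 2 * sin y\<close> on \<open>[0, \<pi>/2]\<close>.
\<close>

lemma min_le_dist_character:
  assumes "0 \<le> d" "d < 1" shows "min d (1 - d) \<le> cmod (character 1 d - 1)"
proof -
  have *: "y \<le> 2 * sin y" if "0 \<le> y" "y \<le> pi / 2" for y :: real
  proof (cases "y = 0")
    case False
    then have y: "0 < y / 2" using that by simp
    obtain z where z: "0 < z" "z < y / 2" "sin (y / 2) - sin 0 = (y / 2 - 0) * cos z"
      using MVT2[OF y, of sin cos] by (auto intro: DERIV_sin)
    have "cos (y / 2) \<le> cos z" using z that by (intro cos_monotone_0_pi_le) auto
    then have a: "y / 2 * cos (y / 2) \<le> sin (y / 2)" using z y by (simp add: mult_left_mono)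
    have c: "0 \<le> cos (y / 2)" "0 \<le> cos y" using that by (auto intro!: cos_ge_zero)
    have "y / 2 \<le> y / 2 * (1 + cos y)" using c y by simp
    also have "1 + cos y = 2 * (cos (y / 2))\<^sup>2" using cos_double_cos[of "y / 2"] by simp
    also have "y / 2 * (2 * (cos (y / 2))\<^sup>2) = 2 * (y / 2 * cos (y / 2)) * cos (y / 2)" by (simp add: power2_eq_square)
    also have "\<dots> \<le> 2 * sin (y / 2) * cos (y / 2)" using a c by (intro mult_right_mono) auto
    also have "\<dots> = sin y" using sin_double[of "y / 2"] by simp
    finally show ?thesis by simp
  qed simp
  have n: "cmod (character 1 d - 1) = 2 * \<bar>sin (pi * d)\<bar>"
    using dist_exp_i_1[of "2 * pi * d"] by (simp add: character_def cis_conv_exp mult.commute)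
  have p: "1 \<le> pi" using pi_gt3 by simp
  show ?thesis
  proof (cases "d \<le> 1 / 2")
    case True
    have "1 * d \<le> pi * d" using p assms by (intro mult_right_mono) auto
    then show ?thesis using *[of "pi * d"] True assms by (simp add: n)
  next
    case False
    have "sin (pi * d) = sin (pi * (1 - d))" by (simp add: algebra_simps sin_diff)
    moreover have "1 * (1 - d) \<le> pi * (1 - d)" using p assms by (intro mult_right_mono) auto
    moreover have "pi * (1 - d) \<le> 2 * sin (pi * (1 - d))" using False assms by (intro *) auto
    ultimately have "1 - d \<le> 2 * sin (pi * d)" by simp
    then show ?thesis using False by (simp add: n)
  qed
qed

definition autocorrelation :: "(real \<Rightarrow> real) \<Rightarrow> real \<Rightarrow> real" where
  "autocorrelation f d = ival 0 1 (\<lambda>x. f (x + d) * f x)"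

text \<open>
  Integrating the autocorrelation of \<open>f\<close> against the Fejer kernel \<open>\<bar>D\<bar>\<^sup>2 / N\<close>, where \<open>D\<close> is a geometric
  sum of characters, gives an average of sums of the squared coefficients. The autocorrelation is
  Lipschitz at \<open>0\<close> because \<open>f\<close> has bounded variation, and \<open>\<bar>z - 1\<bar> * \<bar>D\<bar> \<le> 2\<close>, so the loss is at most a
  multiple of the integral of \<open>\<bar>D\<bar> / N\<close>, which is of order \<open>1 / sqrt N\<close>. Together with Bessel's
  inequality this is Parseval's identity.
\<close>

lemma fejer_parseval:
  assumes osc: "oscillating 1 W f m" and N: "0 < N"
  shows "ival 0 1 (\<lambda>x. (f x)\<^sup>2) - 2 * W\<^sup>2 / sqrt (real N) \<le> (\<Sum>r\<in>{- int N..int N}. (cmod (fourier_coeff f r))\<^sup>2)"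
proof -
  interpret C: prob_space circle by (rule prob_space_circle)
  interpret P: pair_sigma_finite circle circle by unfold_locales
  let ?c = "fourier_coeff f"
  let ?A = "autocorrelation f"
  let ?D = "\<lambda>d. \<Sum>j<N. character (int j) d"
  have per: "f (x + 1) = f x" for x by (rule osc_periodic[OF osc])
  have fb: "\<bar>f x\<bar> \<le> W" for x by (rule osc_bound[OF osc])
  have fb2: "\<bar>f x - f y\<bar> \<le> 2 * W" for x y using fb[of x] fb[of y] by linarith
  have W: "0 \<le> W" by (rule osc_W_nonneg[OF osc])
  note [measurable] = osc_borel[OF osc]
  have [measurable]: "f \<in> borel_measurable circle" by (intro circle_measurable osc_borel[OF osc])
  have [measurable]: "(\<lambda>x. x) \<in> borel_measurable circle" by (intro circle_measurable) simp
  have [measurable]: "character r \<in> borel_measurable circle" for r by (intro circle_measurable) simp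
  have Am [measurable]: "?A \<in> borel_measurable borel"
    unfolding autocorrelation_def set_lebesgue_integral_def by measurable
  have [measurable]: "?A \<in> borel_measurable circle" by (intro circle_measurable Am)
  have Ab: "\<bar>?A d\<bar> \<le> W * W" for d
  proof -
    have "\<bar>?A d\<bar> \<le> (W * W) * (1 - 0)"
      unfolding autocorrelation_def by (rule ival_abs_le) (auto simp: abs_mult intro!: mult_mono fb W)
    then show ?thesis by simp
  qed
  have Acirc: "complex_of_real (?A d) = (LINT x|circle. complex_of_real (f (x + d)) * complex_of_real (f x))" for d
    by (simp add: autocorrelation_def ival_eq_circle[symmetric] flip: of_real_mult)
  have coeff: "(LINT d|circle. of_real (?A d) * character r d) = of_real ((cmod (?c r))\<^sup>2)" for r
  proof -
    let ?h = "\<lambda>x d. complex_of_real (f (x + d)) * complex_of_real (f x) * character r d"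
    have int: "integrable (circle \<Otimes>\<^sub>M circle) (case_prod ?h)"
    proof -
      interpret PP: prob_space "circle \<Otimes>\<^sub>M circle" by (rule prob_space_pair) unfold_locales
      have "case_prod ?h \<in> borel_measurable (circle \<Otimes>\<^sub>M circle)" by measurable
      then show ?thesis
        by (rule PP.integrable_const_bound[of _ "W * W * 1", rotated])
           (auto simp: norm_mult intro!: AE_I2 mult_mono fb W)
    qed
    have "(LINT d|circle. of_real (?A d) * character r d) = (LINT d|circle. (LINT x|circle. ?h x d))"
      unfolding Acirc by simp
    also have "\<dots> = (LINT x|circle. (LINT d|circle. ?h x d))"
      by (rule P.Fubini_integral[OF int])
    also have "\<dots> = (LINT x|circle. of_real (f x) * character (- r) x * ?c (- r))"
    proof (rule Bochner_Integration.integral_cong[OF refl])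
      fix x
      have "(LINT d|circle. ?h x d) = (LINT d|circle. (of_real (f x) * character (- r) x) * (complex_of_real (f (d + x)) * character r (d + x)))"
        by (intro Bochner_Integration.integral_cong refl)
           (simp add: character_add add.commute mult_ac flip: character_mult,
            simp add: character_mult mult.assoc[symmetric])
      also have "\<dots> = (of_real (f x) * character (- r) x) * (LINT d|circle. complex_of_real (f (d + x)) * character r (d + x))"
        by simp
      also have "(LINT d|circle. complex_of_real (f (d + x)) * character r (d + x)) = (LINT d|circle. complex_of_real (f d) * character r d)"
        by (rule circle_integral_shift[where B="W * 1"])
           (auto simp: per character_periodic norm_mult intro!: fb)
      finally show "(LINT d|circle. ?h x d) = of_real (f x) * character (- r) x * ?c (- r)"
        by (simp add: fourier_coeff_character)
    qed
    also have "\<dots> = ?c r * ?c (- r)" by (simp add: fourier_coeff_character)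
    finally show ?thesis by (simp only: fourier_coeff_uminus complex_norm_square)
  qed
  have Dsq: "complex_of_real ((cmod (?D d))\<^sup>2) = (\<Sum>j<N. \<Sum>k<N. character (int j - int k) d)" for d
    unfolding complex_norm_square cnj_sum cnj_character sum_product character_mult by simp
  have Dm [measurable]: "?D \<in> borel_measurable borel" by measurable
  have Db: "cmod (?D d) \<le> real N" for d
    by (rule order_trans[OF norm_sum]) simp
  have intD: "ival 0 1 (\<lambda>d. (cmod (?D d))\<^sup>2) = real N"
  proof -
    have "complex_of_real (ival 0 1 (\<lambda>d. (cmod (?D d))\<^sup>2)) = (LINT d|circle. (\<Sum>j<N. \<Sum>k<N. character (int j - int k) d))"
      unfolding ival_eq_circle[symmetric] Dsq[symmetric] by (rule integral_complex_of_real[symmetric])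
    also have "\<dots> = (\<Sum>j<N. \<Sum>k<N. (if int j - int k = 0 then 1 else 0))"
      by (subst Bochner_Integration.integral_sum;
        (intro Bochner_Integration.integrable_sum circle_integrable[where B=1])?;
         simp add: character_integral Bochner_Integration.integral_sum circle_integrable[where B=1])
    also have "\<dots> = of_nat N" by simp
    finally show ?thesis by (metis of_real_eq_iff of_real_of_nat_eq)
  qed
  have intAD: "ival 0 1 (\<lambda>d. ?A d * (cmod (?D d))\<^sup>2) = (\<Sum>j<N. \<Sum>k<N. (cmod (?c (int j - int k)))\<^sup>2)"
  proof -
    have i: "integrable circle (\<lambda>d. of_real (?A d) * character r d)" for r
      by (rule circle_integrable[where B="W * W * 1"]) (auto simp: norm_mult Ab)
    have "complex_of_real (ival 0 1 (\<lambda>d. ?A d * (cmod (?D d))\<^sup>2)) =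
       (LINT d|circle. (\<Sum>j<N. \<Sum>k<N. of_real (?A d) * character (int j - int k) d))"
      unfolding sum_distrib_left[symmetric] Dsq[symmetric] ival_eq_circle[symmetric] of_real_mult[symmetric]
      by (rule integral_complex_of_real[symmetric])
    also have "\<dots> = (\<Sum>j<N. \<Sum>k<N. of_real ((cmod (?c (int j - int k)))\<^sup>2))"
      by (subst Bochner_Integration.integral_sum; (intro Bochner_Integration.integrable_sum i)?;
          simp add: Bochner_Integration.integral_sum i coeff)
    also have "\<dots> = of_real (\<Sum>j<N. \<Sum>k<N. (cmod (?c (int j - int k)))\<^sup>2)" by simp
    finally show ?thesis by (simp only: of_real_eq_iff)
  qed
  have A0: "?A 0 = ival 0 1 (\<lambda>x. (f x)\<^sup>2)" by (simp add: autocorrelation_def power2_eq_square)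
  have lip: "\<bar>?A d - ?A 0\<bar> \<le> W\<^sup>2 * cmod (character 1 d - 1)" if d: "0 \<le> d" "d < 1" for d
  proof -
    have shift1: "?A d - ?A 0 = ival 0 1 (\<lambda>x. (f (x + e) - f (x + 0)) * f x)" if "\<And>x. f (x + e) = f (x + d)" for e
    proof -
      have "set_integrable lborel {0..<1} (\<lambda>x. f (x + u) * f x)" for u
        by (rule bounded_ival_integrable[where B="W * W"]) (auto simp: abs_mult intro!: mult_mono fb W)
      from set_integral_diff(2)[OF this[of d] this[of 0]] show ?thesis
        by (simp add: autocorrelation_def that algebra_simps)
    qed
    have bnd: "\<bar>?A d - ?A 0\<bar> \<le> W\<^sup>2 * \<bar>e\<bar>" if e: "\<And>x. f (x + e) = f (x + d)" for e
    proof -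
      have i: "set_integrable lborel {0..<1} (\<lambda>x. (f (x + e) - f (x + 0)) * f x)"
        by (rule bounded_ival_integrable[where B="(2 * W) * W"])
           (auto simp: abs_mult intro!: mult_mono W fb fb2)
      have "\<bar>?A d - ?A 0\<bar> \<le> ival 0 1 (\<lambda>x. \<bar>(f (x + e) - f (x + 0)) * f x\<bar>)"
        unfolding shift1[OF e] using set_integral_norm_bound[OF i] by simp
      also have "\<dots> \<le> ival 0 1 (\<lambda>x. W * \<bar>f (x + e) - f (x + 0)\<bar>)"
      proof (rule set_integral_mono)
        show "set_integrable lborel {0..<1} (\<lambda>x. W * \<bar>f (x + e) - f (x + 0)\<bar>)"
          by (intro set_integrable_mult_right set_integrable_abs set_integral_diff(1) bounded_ival_integrable[where B=W])
            (use fb in auto)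
        show "\<bar>(f (x + e) - f (x + 0)) * f x\<bar> \<le> W * \<bar>f (x + e) - f (x + 0)\<bar>" for x
          unfolding abs_mult by (subst mult.commute) (intro mult_right_mono fb, simp)
      qed (use i in \<open>rule set_integrable_abs\<close>)
      also have "\<dots> = W * ival 0 1 (\<lambda>x. \<bar>f (x + e) - f (x + 0)\<bar>)" by simp
      also have "\<dots> \<le> W * (W * \<bar>e - 0\<bar>)"
        by (intro mult_left_mono W translation_L1_bound[OF osc_dominated[OF osc] osc_dom_shift[OF osc] per])
      finally show ?thesis by (simp add: power2_eq_square mult_ac)
    qed
    have "\<bar>?A d - ?A 0\<bar> \<le> W\<^sup>2 * min d (1 - d)"
    proof (cases "d \<le> 1 - d")
      case True
      then show ?thesis using bnd[of d] d by simp
    next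
      case False
      have "f (x + (d - 1)) = f (x + d)" for x using per[of "x + (d - 1)"] by (simp add: add_ac)
      from bnd[OF this] show ?thesis using False d by simp
    qed
    also have "\<dots> \<le> W\<^sup>2 * cmod (character 1 d - 1)"
      by (intro mult_left_mono min_le_dist_character d) simp
    finally show ?thesis .
  qed
  have geo: "cmod (character 1 d - 1) * cmod (?D d) \<le> 2" for d
  proof -
    have "character (int j) d = character 1 d ^ j" for j
      by (induction j) (simp_all add: character_mult[symmetric])
    then have "?D d = (\<Sum>j<N. character 1 d ^ j)" by simp
    then have "(character 1 d - 1) * ?D d = character 1 d ^ N - 1"
      by (simp add: power_diff_1_eq)
    then have "cmod (character 1 d - 1) * cmod (?D d) = cmod (character 1 d ^ N - 1)"
      by (metis norm_mult)
    also have "\<dots> \<le> cmod (character 1 d ^ N) + cmod 1" by (rule norm_triangle_ineq4)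
    finally show ?thesis by (simp add: norm_power)
  qed
  let ?sN = "sqrt (real N)"
  have sN: "0 < ?sN" "?sN * ?sN = real N" using N by auto
  have iD: "set_integrable lborel {0..<1} (\<lambda>d. (cmod (?D d))\<^sup>2)"
    by (rule bounded_ival_integrable[where B="(real N)\<^sup>2"]) (use Db in \<open>auto intro!: power_mono\<close>)
  have iAD: "set_integrable lborel {0..<1} (\<lambda>d. ?A d * (cmod (?D d))\<^sup>2)"
    by (rule bounded_ival_integrable[where B="(W * W) * (real N)\<^sup>2"])
       (use Db Ab in \<open>auto simp: abs_mult W intro!: power_mono mult_mono\<close>)
  have "real N * ?A 0 - (\<Sum>j<N. \<Sum>k<N. (cmod (?c (int j - int k)))\<^sup>2) =
      ival 0 1 (\<lambda>d. ?A 0 * (cmod (?D d))\<^sup>2 - ?A d * (cmod (?D d))\<^sup>2)"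
    using set_integral_diff(2)[OF set_integrable_mult_right[OF iD, of "?A 0"] iAD] intD intAD
    by (simp add: mult.commute)
  also have "\<dots> \<le> ival 0 1 (\<lambda>d. W\<^sup>2 * (?sN + 1 / ?sN * (cmod (?D d))\<^sup>2))"
  proof (rule set_integral_mono)
    show "set_integrable lborel {0..<1} (\<lambda>d. ?A 0 * (cmod (?D d))\<^sup>2 - ?A d * (cmod (?D d))\<^sup>2)"
      by (intro set_integral_diff(1) set_integrable_mult_right iD iAD)
    show "set_integrable lborel {0..<1} (\<lambda>d. W\<^sup>2 * (?sN + 1 / ?sN * (cmod (?D d))\<^sup>2))"
      by (intro set_integrable_mult_right set_integral_add(1) iD) (auto intro!: bounded_ival_integrable)
    fix d :: real assume "d \<in> {0..<1}"
    then have d: "0 \<le> d" "d < 1" by auto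
    have "?A 0 * (cmod (?D d))\<^sup>2 - ?A d * (cmod (?D d))\<^sup>2 \<le> \<bar>?A d - ?A 0\<bar> * (cmod (?D d))\<^sup>2"
      using mult_right_mono[of "?A 0 - ?A d" "\<bar>?A d - ?A 0\<bar>" "(cmod (?D d))\<^sup>2"] by (simp add: algebra_simps)
    also have "\<dots> \<le> (W\<^sup>2 * cmod (character 1 d - 1)) * (cmod (?D d))\<^sup>2"
      by (intro mult_right_mono lip[OF d]) simp
    also have "\<dots> = W\<^sup>2 * ((cmod (character 1 d - 1) * cmod (?D d)) * cmod (?D d))"
      by (simp add: power2_eq_square)
    also have "\<dots> \<le> W\<^sup>2 * (2 * cmod (?D d))"
      by (intro mult_left_mono mult_right_mono geo) auto
    also have "\<dots> \<le> W\<^sup>2 * (?sN + 1 / ?sN * (cmod (?D d))\<^sup>2)"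
    proof (intro mult_left_mono)
      have "0 \<le> (?sN - cmod (?D d))\<^sup>2" by simp
      then have "2 * cmod (?D d) * ?sN \<le> ?sN * ?sN + (cmod (?D d))\<^sup>2" by (simp add: power2_eq_square algebra_simps)
      then show "2 * cmod (?D d) \<le> ?sN + 1 / ?sN * (cmod (?D d))\<^sup>2" using sN(1) by (simp add: field_simps)
    qed simp
    finally show "?A 0 * (cmod (?D d))\<^sup>2 - ?A d * (cmod (?D d))\<^sup>2 \<le> W\<^sup>2 * (?sN + 1 / ?sN * (cmod (?D d))\<^sup>2)" .
  qed
  also have "\<dots> = W\<^sup>2 * (?sN + 1 / ?sN * real N)"
  proof -
    have "set_integrable lborel {0..<1::real} (\<lambda>d. ?sN)" by (auto intro!: bounded_ival_integrable)
    from set_integral_add(2)[OF this set_integrable_mult_right[OF iD, of "1 / ?sN"]] show ?thesis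
      using intD by (simp add: set_lebesgue_integral_def)
  qed
  also have "?sN + 1 / ?sN * real N = 2 * ?sN" using sN by (simp add: field_simps)
  finally have low: "real N * ?A 0 - W\<^sup>2 * (2 * ?sN) \<le> (\<Sum>j<N. \<Sum>k<N. (cmod (?c (int j - int k)))\<^sup>2)" by simp
  have "(\<Sum>j<N. \<Sum>k<N. (cmod (?c (int j - int k)))\<^sup>2) \<le> (\<Sum>j<N. \<Sum>r\<in>{- int N..int N}. (cmod (?c r))\<^sup>2)"
  proof (rule sum_mono)
    fix j assume j: "j \<in> {..<N}"
    have "(\<Sum>k<N. (cmod (?c (int j - int k)))\<^sup>2) = (\<Sum>r\<in>(\<lambda>k. int j - int k) ` {..<N}. (cmod (?c r))\<^sup>2)"
      by (subst sum.reindex) (auto simp: inj_on_def)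
    also have "\<dots> \<le> (\<Sum>r\<in>{- int N..int N}. (cmod (?c r))\<^sup>2)"
      using j by (intro sum_mono2) auto
    finally show "(\<Sum>k<N. (cmod (?c (int j - int k)))\<^sup>2) \<le> (\<Sum>r\<in>{- int N..int N}. (cmod (?c r))\<^sup>2)" .
  qed
  also have "\<dots> = real N * (\<Sum>r\<in>{- int N..int N}. (cmod (?c r))\<^sup>2)" by simp
  finally have "real N * ?A 0 - W\<^sup>2 * (2 * ?sN) \<le> real N * (\<Sum>r\<in>{- int N..int N}. (cmod (?c r))\<^sup>2)" using low by linarith
  moreover have "real N * (?A 0 - 2 * W\<^sup>2 / ?sN) = real N * ?A 0 - W\<^sup>2 * (2 * ?sN)"
    using sN by (simp add: field_simps)
  ultimately have "real N * (?A 0 - 2 * W\<^sup>2 / ?sN) \<le> real N * (\<Sum>r\<in>{- int N..int N}. (cmod (?c r))\<^sup>2)" by simp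
  then show ?thesis using N unfolding A0 by (simp only: mult_le_cancel_left_pos of_nat_0_less_iff)
qed

lemma fourier_sums_oscillating:
  assumes osc: "oscillating 1 W f m"
  shows "fourier_sums f (fourier_coeff f)"
proof -
  note [measurable] = osc_borel[OF osc]
  have fb: "\<bar>f x\<bar> \<le> W" for x by (rule osc_bound[OF osc])
  let ?c = "fourier_coeff f"
  have c0: "?c 0 = 0"
  proof -
    have "?c 0 = (LINT x|circle. complex_of_real (f x))" by (simp add: fourier_coeff_character)
    also have "\<dots> = of_real (LINT x|circle. f x)" by (rule integral_complex_of_real)
    also have "(LINT x|circle. f x) = 0" using osc_mean[OF osc] by (simp add: ival_eq_circle)
    finally show ?thesis by simp
  qed
  let ?E = "\<lambda>N. LINT x|circle.
      (cmod (of_real (f x) - (\<Sum>r\<in>{- int N..int N} - {0}. ?c r * cis (2 * pi * of_int r * x))))\<^sup>2"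
  have E: "?E N = ival 0 1 (\<lambda>x. (f x)\<^sup>2) - (\<Sum>r\<in>{- int N..int N}. (cmod (?c r))\<^sup>2)" for N
  proof -
    have "(\<Sum>r\<in>{- int N..int N} - {0}. (cmod (?c r))\<^sup>2) = (\<Sum>r\<in>{- int N..int N}. (cmod (?c r))\<^sup>2)"
      by (rule sum.mono_neutral_left) (auto simp: c0)
    then show ?thesis
      using partial_sum_defect[OF osc_borel[OF osc] fb, of "{- int N..int N} - {0}"]
      unfolding character_def by simp
  qed
  have "?E \<longlonglongrightarrow> 0"
  proof (rule tendsto_sandwich)
    show "\<forall>\<^sub>F N in sequentially. 0 \<le> ?E N"
      by (intro always_eventually allI Bochner_Integration.integral_nonneg) auto
    show "\<forall>\<^sub>F N in sequentially. ?E N \<le> 2 * W\<^sup>2 / sqrt (real N)"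
      using eventually_gt_at_top[of 0]
    proof eventually_elim
      case (elim N)
      show ?case using fejer_parseval[OF osc elim] unfolding E by linarith
    qed
    show "(\<lambda>N. 2 * W\<^sup>2 / sqrt (real N)) \<longlonglongrightarrow> 0"
      by (intro real_tendsto_divide_at_top[OF tendsto_const] filterlim_compose[OF sqrt_at_top] filterlim_real_sequentially)
  qed simp
  moreover have "integrable circle (\<lambda>x. (f x)\<^sup>2)"
    by (rule circle_integrable[where B="W\<^sup>2"]) (use osc_square_le[OF osc] in auto)
  ultimately show ?thesis
    unfolding fourier_sums_def using circle_measurable[OF osc_borel[OF osc]] by simp
qed

text \<open>
  Two limits in the mean of one series agree almost everywhere, so the choice of the
  representative does not influence the norm.
\<close>

lemma fourier_sums_norm_unique:
  assumes f: "fourier_sums f b" and g: "fourier_sums g b"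
  shows "l2norm f = l2norm g"
proof -
  interpret C: prob_space circle by (rule prob_space_circle)
  let ?S = "\<lambda>N x. \<Sum>r\<in>{- int N..int N} - {0}. b r * cis (2 * pi * of_int r * x)"
  let ?E = "\<lambda>f N. LINT x|circle. (cmod (of_real (f x) - ?S N x))\<^sup>2"
  have m [measurable]: "f \<in> borel_measurable circle" "g \<in> borel_measurable circle"
    and i: "integrable circle (\<lambda>x. (f x)\<^sup>2)" "integrable circle (\<lambda>x. (g x)\<^sup>2)"
    and lim: "?E f \<longlonglongrightarrow> 0" "?E g \<longlonglongrightarrow> 0"
    using f g by (auto simp: fourier_sums_def)
  have Sm [measurable]: "?S N \<in> borel_measurable circle" for N
    using circle_measurable[OF character_borel] unfolding character_def by measurable
  have Sb: "cmod (?S N x) \<le> (\<Sum>r\<in>{- int N..int N} - {0}. cmod (b r))" for N x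
    by (rule order_trans[OF norm_sum]) (simp add: norm_mult)
  have iE: "integrable circle (\<lambda>x. (cmod (of_real (h x) - ?S N x))\<^sup>2)"
    if h: "h \<in> borel_measurable circle" "integrable circle (\<lambda>x. (h x)\<^sup>2)" for h :: "real \<Rightarrow> real" and N
  proof (rule Bochner_Integration.integrable_bound)
    let ?B = "\<Sum>r\<in>{- int N..int N} - {0}. cmod (b r)"
    show "integrable circle (\<lambda>x. 2 * (h x)\<^sup>2 + 2 * ?B\<^sup>2)" using h by simp
    show "(\<lambda>x. (cmod (of_real (h x) - ?S N x))\<^sup>2) \<in> borel_measurable circle" using h(1) by measurable
    show "AE x in circle. norm ((cmod (of_real (h x) - ?S N x))\<^sup>2) \<le> norm (2 * (h x)\<^sup>2 + 2 * ?B\<^sup>2)"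
    proof (rule AE_I2)
      fix x
      have "cmod (of_real (h x) - ?S N x) \<le> \<bar>h x\<bar> + ?B"
        using norm_triangle_ineq4[of "of_real (h x)" "?S N x"] Sb[of x N] by simp
      then have "(cmod (of_real (h x) - ?S N x))\<^sup>2 \<le> (\<bar>h x\<bar> + ?B)\<^sup>2" by (intro power_mono) auto
      also have "\<dots> \<le> 2 * (h x)\<^sup>2 + 2 * ?B\<^sup>2"
        using sum_squares_bound[of "\<bar>h x\<bar>" ?B] by (simp add: power2_sum)
      finally show "norm ((cmod (of_real (h x) - ?S N x))\<^sup>2) \<le> norm (2 * (h x)\<^sup>2 + 2 * ?B\<^sup>2)" by simp
    qed
  qed
  have pt: "(f x - g x)\<^sup>2 \<le> 2 * (cmod (of_real (f x) - ?S N x))\<^sup>2 + 2 * (cmod (of_real (g x) - ?S N x))\<^sup>2" for x N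
  proof -
    let ?u = "cmod (of_real (f x) - ?S N x)" and ?v = "cmod (of_real (g x) - ?S N x)"
    have "\<bar>f x - g x\<bar> = cmod ((of_real (f x) - ?S N x) - (of_real (g x) - ?S N x))"
      by (simp flip: of_real_diff)
    also have "\<dots> \<le> ?u + ?v" by (rule norm_triangle_ineq4)
    finally have "\<bar>f x - g x\<bar>\<^sup>2 \<le> (?u + ?v)\<^sup>2" by (intro power_mono) auto
    also have "\<dots> \<le> 2 * ?u\<^sup>2 + 2 * ?v\<^sup>2" using sum_squares_bound[of ?u ?v] by (simp add: power2_sum)
    finally show ?thesis by simp
  qed
  have ifg: "integrable circle (\<lambda>x. (f x - g x)\<^sup>2)"
    by (rule Bochner_Integration.integrable_bound[where f="\<lambda>x. 2 * (cmod (of_real (f x) - ?S 0 x))\<^sup>2 + 2 * (cmod (of_real (g x) - ?S 0 x))\<^sup>2"])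
       (use iE[of f 0] iE[of g 0] m i pt[of _ 0] in \<open>auto intro!: AE_I2\<close>)
  have "(LINT x|circle. (f x - g x)\<^sup>2) \<le> 2 * ?E f N + 2 * ?E g N" for N
  proof -
    have "(LINT x|circle. (f x - g x)\<^sup>2) \<le> (LINT x|circle. 2 * (cmod (of_real (f x) - ?S N x))\<^sup>2 + 2 * (cmod (of_real (g x) - ?S N x))\<^sup>2)"
      using iE m i pt ifg by (intro integral_mono) auto
    then show ?thesis using iE[OF m(1) i(1)] iE[OF m(2) i(2)] by simp
  qed
  moreover have "(\<lambda>N. 2 * ?E f N + 2 * ?E g N) \<longlonglongrightarrow> 2 * 0 + 2 * 0"
    by (intro tendsto_intros lim)
  ultimately have "(LINT x|circle. (f x - g x)\<^sup>2) \<le> 0"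
    using LIMSEQ_le_const[of _ "2 * 0 + 2 * 0 :: real"] by fastforce
  moreover have "0 \<le> (LINT x|circle. (f x - g x)\<^sup>2)" by (intro Bochner_Integration.integral_nonneg) auto
  ultimately have "AE x in circle. (f x - g x)\<^sup>2 = 0"
    using integral_nonneg_eq_0_iff_AE[OF ifg] by simp
  then have "AE x in circle. (f x)\<^sup>2 = (g x)\<^sup>2" by eventually_elim simp
  then have "(LINT x|circle. (f x)\<^sup>2) = (LINT x|circle. (g x)\<^sup>2)"
    by (intro integral_cong_AE) auto
  then show ?thesis unfolding l2norm_def by simp
qed

lemma ival_rational_average:
  assumes g: "g \<in> borel_measurable borel" "\<And>x. \<bar>g x\<bar> \<le> B" and l: "0 < l"
  shows "ival 0 1 (\<lambda>y. \<Sum>j<l. g ((y + real j) / real l)) = real l * ival 0 1 g"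
proof -
  note [measurable] = g(1)
  have "ival 0 1 (\<lambda>y. \<Sum>j<l. g ((y + real j) / real l)) = (\<Sum>j<l. ival 0 1 (\<lambda>y. g ((y + real j) / real l)))"
    by (rule set_integral_sum(2)) (auto intro!: bounded_ival_integrable[OF _ g(2)])
  also have "\<dots> = (\<Sum>j<l. real l * ival 0 (1 / real l) (\<lambda>x. g (x + real j * (1 / real l))))"
  proof (rule sum.cong[OF refl])
    fix j
    have "ival (real l * 0) (real l * (1 / real l)) (\<lambda>y. g ((y + real j) / real l)) =
      real l * ival 0 (1 / real l) (\<lambda>x. g ((real l * x + real j) / real l))"
      using l by (intro ival_scale) simp
    moreover have "(real l * x + real j) / real l = x + real j * (1 / real l)" for x
      using l by (simp add: field_simps)
    ultimately show "ival 0 1 (\<lambda>y. g ((y + real j) / real l)) = real l * ival 0 (1 / real l) (\<lambda>x. g (x + real j * (1 / real l)))"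
      using l by simp
  qed
  also have "\<dots> = real l * ival 0 (real l * (1 / real l)) g"
    unfolding sum_distrib_left[symmetric] by (subst ival_cells[OF g]) (use l in auto)
  finally show ?thesis using l by simp
qed

text \<open>
  The character of frequency \<open>r * q\<close> takes at \<open>(y + j) / q\<close> the value of the character of frequency \<open>r\<close>
  at \<open>y\<close>. Hence \<open>y \<mapsto> \<Sum>j<q. \<phi> ((y + j) / q)\<close> has the Fourier coefficients \<open>\<gamma> (r * q) / r\<close> and represents
  \<open>hat_sum\<close>. It is a rescaled translate of the rational sum.
\<close>

lemma hat_sum_norm:
  assumes per: "\<And>x. \<phi> (x + 1) = \<phi> x" and d: "dominated \<phi> m" and sh: "\<And>x. m (x + 1) = m x + W"
    and mean: "ival 0 1 \<phi> = 0" and q: "0 < q"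
  shows "(l2norm (hat_sum \<phi> q))\<^sup>2 = mean_square (1 / real q) (rational_sum \<phi> q c)"
proof -
  note [measurable] = dominated_borel[OF d]
  note bd = dominated_periodic_fun_bounded[OF d sh per]
  define f where "f y = (\<Sum>j<q. \<phi> ((y + real j) / real q))" for y
  have f: "f = (\<lambda>y. rational_sum \<phi> q 0 ((0 + y) / real q))"
    by (auto simp: f_def rational_sum_def add_divide_distrib)
  have osc: "oscillating 1 W f (\<lambda>y. rational_sum m q 0 ((0 + y) / real q))"
    unfolding f using osc_rescale(1)[OF rational_sum_oscillating(1)[OF per d sh mean q, of 0], of "real q" 0] q
    by simp
  have coeff: "fourier_coeff f r = fourier_gamma \<phi> (r * int q) / of_int r" if r: "r \<noteq> 0" for r
  proof -
    let ?g = "\<lambda>x. of_real (\<phi> x) * character (- (r * int q)) x"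
    have gb: "cmod (?g x) \<le> \<bar>\<phi> 0\<bar> + W" for x using bd[of x] by (simp add: norm_mult)
    have ch: "character (- (r * int q)) ((y + real j) / real q) = character (- r) y" for y j
    proof -
      have "character (- (r * int q)) ((y + real j) / real q) = character (- r) (y + real j)"
      proof -
        have "2 * pi * of_int (- (r * int q)) * ((y + real j) / real q) = 2 * pi * of_int (- r) * (y + real j)"
          using q by simp
        then show ?thesis by (simp only: character_def)
      qed
      also have "\<dots> = character (- r) y"
        by (induction j) (simp_all add: character_periodic add.assoc[symmetric] add.commute[of 1])
      finally show ?thesis .
    qed
    have e: "of_real (f y) * character (- r) y = (\<Sum>j<q. ?g ((y + real j) / real q))" for y
      by (simp add: f_def ch sum_distrib_right)
    have "fourier_coeff f r = (LINT y|circle. (\<Sum>j<q. ?g ((y + real j) / real q)))"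
      unfolding fourier_coeff_character e ..
    also have "\<dots> = Complex (ival 0 1 (\<lambda>y. \<Sum>j<q. Re (?g ((y + real j) / real q)))) (ival 0 1 (\<lambda>y. \<Sum>j<q. Im (?g ((y + real j) / real q))))"
    proof -
      have b: "cmod (\<Sum>j<q. ?g ((y + real j) / real q)) \<le> (\<Sum>j<q. \<bar>\<phi> 0\<bar> + W)" for y
        by (rule order_trans[OF norm_sum sum_mono]) (rule gb)
      have ms: "(\<lambda>y. \<Sum>j<q. ?g ((y + real j) / real q)) \<in> borel_measurable borel" by measurable
      show ?thesis
        by (subst circle_integral_Re_Im[OF ms b]) (simp only: Re_sum Im_sum)
    qed
    also have "\<dots> = Complex (real q * ival 0 1 (\<lambda>x. Re (?g x))) (real q * ival 0 1 (\<lambda>x. Im (?g x)))"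
    proof -
      have "\<bar>Re (?g x)\<bar> \<le> \<bar>\<phi> 0\<bar> + W" "\<bar>Im (?g x)\<bar> \<le> \<bar>\<phi> 0\<bar> + W" for x
        using order_trans[OF abs_Re_le_cmod gb] order_trans[OF abs_Im_le_cmod gb] by auto
      then show ?thesis
        by (subst (1 2) ival_rational_average[where B="\<bar>\<phi> 0\<bar> + W"]) (use q in auto)
    qed
    also have "\<dots> = of_nat q * (LINT x|circle. ?g x)"
      by (subst circle_integral_Re_Im[OF _ gb]) (auto simp: complex_eq_iff)
    also have "\<dots> = fourier_gamma \<phi> (r * int q) / of_int r"
      using r by (simp add: fourier_gamma_def fourier_coeff_character)
    finally show ?thesis .
  qed
  have "(\<Sum>r\<in>{- int N..int N} - {0}. fourier_coeff f r * cis (2 * pi * of_int r * x)) =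
     (\<Sum>r\<in>{- int N..int N} - {0}. fourier_gamma \<phi> (r * int q) / of_int r * cis (2 * pi * of_int r * x))" for N x
    by (intro sum.cong) (auto simp: coeff)
  then have fs: "fourier_sums f (\<lambda>r. fourier_gamma \<phi> (r * int q) / of_int r)"
    using fourier_sums_oscillating[OF osc] unfolding fourier_sums_def by simp
  then have "fourier_sums (hat_sum \<phi> q) (\<lambda>r. fourier_gamma \<phi> (r * int q) / of_int r)"
    unfolding hat_sum_def
    by (rule someI[where P="\<lambda>f. fourier_sums f (\<lambda>r. fourier_gamma \<phi> (r * int q) / of_int r)"])
  then have "l2norm (hat_sum \<phi> q) = l2norm f" using fs by (rule fourier_sums_norm_unique)
  moreover have "0 \<le> ival 0 1 (\<lambda>x. (f x)\<^sup>2)"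
    unfolding ival_eq_circle[symmetric] by (intro Bochner_Integration.integral_nonneg) auto
  ultimately show ?thesis
    unfolding rational_sum_oscillating(2)[OF per d sh mean q] l2norm_def
    by (simp add: ival_eq_circle f_def)
qed

section \<open>A Lindeberg argument for lacunary sums\<close>

abbreviation gauss :: "real measure" where "gauss \<equiv> std_normal_distribution"

definition normal_cdf :: "real \<Rightarrow> real" where
  "normal_cdf z = measure gauss {..z}"

lemma prob_space_std_normal: "prob_space gauss"
  by (rule prob_space_normal_density) simp

lemma normal_cdf_bounds: "0 \<le> normal_cdf z" "normal_cdf z \<le> 1"
proof -
  interpret prob_space gauss by (rule prob_space_std_normal)
  show "0 \<le> normal_cdf z" "normal_cdf z \<le> 1" by (auto simp: normal_cdf_def)
qed

lemma isCont_normal_density: "isCont std_normal_density x"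
  unfolding std_normal_density_def by (intro continuous_intros) auto

lemma normal_cdf_diff:
  assumes "a \<le> z" shows "normal_cdf z = normal_cdf a + integral {a..z} std_normal_density"
proof -
  interpret prob_space gauss by (rule prob_space_std_normal)
  have "normal_cdf z = measure gauss ({..a} \<union> {a<..z})"
    unfolding normal_cdf_def using assms by (intro arg_cong2[where f=measure]) auto
  also have "\<dots> = normal_cdf a + measure gauss {a<..z}"
    unfolding normal_cdf_def by (rule finite_measure_Union) auto
  also have "measure gauss {a<..z} = (LBINT x:{a<..z}. std_normal_density x)"
  proof -
    have "measure gauss {a<..z} = (\<integral>x. indicator {a<..z} x \<partial>gauss)" by simp
    also have "\<dots> = (\<integral>x. std_normal_density x *\<^sub>R indicator {a<..z} x \<partial>lborel)"
      by (rule integral_density) auto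
    finally show ?thesis by (simp add: set_lebesgue_integral_def mult.commute)
  qed
  also have "\<dots> = (LBINT x:{a..z}. std_normal_density x)"
  proof (rule set_integral_cong_set)
    show "AE x in lborel. (x \<in> {a..z}) = (x \<in> {a<..z})"
      using AE_lborel_singleton[of a] by eventually_elim auto
  qed (auto simp: set_borel_measurable_def)
  also have "\<dots> = integral {a..z} std_normal_density"
    unfolding set_integrable_def
    by (intro set_borel_integral_eq_integral(2), unfold set_integrable_def, intro integrable_mult_indicator) auto
  finally show ?thesis .
qed

lemma normal_cdf_deriv: "(normal_cdf has_real_derivative std_normal_density z) (at z)"
proof -
  have c: "continuous_on {z - 1..z + 1} std_normal_density"
    by (intro continuous_at_imp_continuous_on ballI isCont_normal_density)
  have "((\<lambda>x. normal_cdf (z - 1) + integral {z - 1..x} std_normal_density) has_real_derivative std_normal_density z) (at z within {z - 1..z + 1})"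
    using integral_has_real_derivative[OF c, of z] by (auto intro!: derivative_eq_intros)
  then have "(normal_cdf has_real_derivative std_normal_density z) (at z within {z - 1..z + 1})"
    by (rule has_field_derivative_transform_within[where d=1]) (auto intro!: normal_cdf_diff[symmetric])
  moreover have "at z within {z - 1..z + 1} = at z"
    by (rule at_within_Icc_at) auto
  ultimately show ?thesis by simp
qed

lemma normal_density_deriv:
  "(std_normal_density has_real_derivative - z * std_normal_density z) (at z)"
  unfolding std_normal_density_def[abs_def]
  by (auto intro!: derivative_eq_intros simp: field_simps)

lemma normal_density_power_bound:
  assumes "k \<le> 3" shows "\<bar>z\<bar> ^ k * std_normal_density z \<le> 4"
proof -
  let ?y = "z\<^sup>2 / 2"
  have "1 + ?y + ?y\<^sup>2 / 2 \<le> exp ?y" by (rule exp_lower_Taylor_quadratic) simp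
  moreover have "\<bar>z\<bar> ^ k \<le> 4 * (1 + ?y + ?y\<^sup>2 / 2)"
  proof -
    have 1: "\<bar>z\<bar> \<le> 1 + z\<^sup>2" using sum_squares_bound[of 1 "\<bar>z\<bar>"] by simp
    have "0 \<le> (\<bar>z\<bar> - 1)\<^sup>2 * z\<^sup>2" by simp
    then have 3: "2 * \<bar>z\<bar> ^ 3 \<le> z\<^sup>2 + z ^ 4"
      by (simp add: power2_eq_square power3_eq_cube power4_eq_xxxx algebra_simps abs_mult_self_eq)
    have y4: "?y\<^sup>2 / 2 = z ^ 4 / 8" by (simp add: power2_eq_square power4_eq_xxxx)
    have nn: "0 \<le> z\<^sup>2" "0 \<le> z ^ 4" by auto
    consider "k = 0" | "k = 1" | "k = 2" | "k = 3" using assms by linarith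
    then have "2 * \<bar>z\<bar> ^ k \<le> 2 + 2 * z\<^sup>2 + z ^ 4"
    proof cases
      case 2
      have "2 * a \<le> 2 + 2 * p + q" if "a \<le> 1 + p" "0 \<le> q" for a p q :: real using that by simp
      from this[OF \<open>\<bar>z\<bar> \<le> 1 + z\<^sup>2\<close> nn(2)] show ?thesis by (simp add: 2)
    next
      case 4
      have "2 * a \<le> 2 + 2 * p + q" if "2 * a \<le> p + q" "0 \<le> p" for a p q :: real using that by simp
      from this[OF \<open>2 * \<bar>z\<bar> ^ 3 \<le> z\<^sup>2 + z ^ 4\<close> nn(1)] show ?thesis by (simp add: 4)
    qed (use nn in auto)
    moreover have "a \<le> 4 * (1 + p / 2 + q / 8)" if "2 * a \<le> 2 + 2 * p + q" "0 \<le> p" "0 \<le> q" for a p q :: real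
      using that by (simp add: field_simps)
    ultimately show ?thesis using nn unfolding y4 by blast
  qed
  moreover have "a \<le> 4 * c" if "b \<le> c" "a \<le> 4 * b" for a b c :: real using that by linarith
  ultimately have le: "\<bar>z\<bar> ^ k \<le> 4 * exp ?y" by blast
  have p: "1 / sqrt (2 * pi) \<le> 1"
    using pi_gt3 by (simp add: divide_le_eq)
  have "\<bar>z\<bar> ^ k * std_normal_density z = (1 / sqrt (2 * pi)) * (\<bar>z\<bar> ^ k * exp (- ?y))"
    by (simp add: std_normal_density_def)
  also have "\<dots> \<le> 1 * (\<bar>z\<bar> ^ k * exp (- ?y))" using p by (intro mult_right_mono) auto
  also have "\<dots> \<le> (4 * exp ?y) * exp (- ?y)" using le by (simp add: mult_right_mono)
  also have "\<dots> = 4" by (simp add: exp_minus)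
  finally show ?thesis .
qed

lemma normal_density_bounds:
  "0 \<le> std_normal_density z" "std_normal_density z \<le> 4" "\<bar>z * std_normal_density z\<bar> \<le> 4"
  "\<bar>(1 - z\<^sup>2) * std_normal_density z\<bar> \<le> 8" "\<bar>z * (1 - z\<^sup>2) * std_normal_density z\<bar> \<le> 8"
proof -
  let ?n = "std_normal_density z"
  show n: "0 \<le> ?n" by simp
  have b: "?n \<le> 4" "\<bar>z\<bar> * ?n \<le> 4" "z\<^sup>2 * ?n \<le> 4" "\<bar>z\<bar> ^ 3 * ?n \<le> 4"
    using normal_density_power_bound[of 0 z] normal_density_power_bound[of 1 z] normal_density_power_bound[of 2 z]
      normal_density_power_bound[of 3 z] by (auto simp: power_even_abs)
  show "?n \<le> 4" "\<bar>z * ?n\<bar> \<le> 4" using b by (auto simp: abs_mult)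
  have "0 \<le> z\<^sup>2 * ?n" using n by simp
  moreover have "(1 - z\<^sup>2) * ?n = ?n - z\<^sup>2 * ?n" by (simp add: left_diff_distrib)
  ultimately show "\<bar>(1 - z\<^sup>2) * ?n\<bar> \<le> 8" using b n by linarith
  have "\<bar>z * (1 - z\<^sup>2) * ?n\<bar> = \<bar>z * ?n - z ^ 3 * ?n\<bar>" by (simp add: algebra_simps power2_eq_square power3_eq_cube)
  also have "\<dots> \<le> \<bar>z * ?n\<bar> + \<bar>z ^ 3 * ?n\<bar>" by (rule abs_triangle_ineq4)
  finally show "\<bar>z * (1 - z\<^sup>2) * ?n\<bar> \<le> 8" using b n by (simp add: abs_mult power_abs)
qed

lemma lipschitz_of_deriv:
  fixes f f' :: "real \<Rightarrow> real"
  assumes "\<And>x. (f has_real_derivative f' x) (at x)" "\<And>x. \<bar>f' x\<bar> \<le> B"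
  shows "\<bar>f y - f x\<bar> \<le> B * \<bar>y - x\<bar>"
  using field_differentiable_bound[of UNIV f f' B x y] assms
  by (auto simp: has_field_derivative_at_within abs_minus_commute)

lemma taylor_third_order:
  fixes f f1 f2 f3 :: "real \<Rightarrow> real"
  assumes d: "\<And>x. (f has_real_derivative f1 x) (at x)" "\<And>x. (f1 has_real_derivative f2 x) (at x)"
    "\<And>x. (f2 has_real_derivative f3 x) (at x)" and B: "\<And>x. \<bar>f3 x\<bar> \<le> B"
  shows "\<bar>f (r + x) - f r - f1 r * x - f2 r * x\<^sup>2 / 2\<bar> \<le> B * \<bar>x\<bar> ^ 3"
proof -
  define D where "D m = (if m = 0 then (\<lambda>t. f (r + t)) else if m = 1 then (\<lambda>t. f1 (r + t))
    else if m = 2 then (\<lambda>t. f2 (r + t)) else (\<lambda>t. f3 (r + t)))" for m :: nat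
  have sh: "((\<lambda>t. g (r + t)) has_real_derivative g' (r + t)) (at t)"
    if "\<And>x. (g has_real_derivative g' x) (at x)" for g g' :: "real \<Rightarrow> real" and t
    using DERIV_shift[of g "g' (r + t)" t r] that by (simp add: add.commute)
  have "\<forall>m t. m < 3 \<and> \<bar>t\<bar> \<le> \<bar>x\<bar> \<longrightarrow> DERIV (D m) t :> D (Suc m) t"
  proof (intro allI impI)
    fix m t assume "m < (3::nat) \<and> \<bar>t\<bar> \<le> \<bar>x\<bar>"
    then consider "m = 0" | "m = 1" | "m = 2" by linarith
    then show "DERIV (D m) t :> D (Suc m) t"
      by cases (use sh[OF d(1)] sh[OF d(2)] sh[OF d(3)] in \<open>auto simp: D_def\<close>)
  qed
  from Maclaurin_bi_le[of D "\<lambda>t. f (r + t)" 3 x, OF _ this]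
  obtain t where "f (r + x) = (\<Sum>m<3. D m 0 / fact m * x ^ m) + D 3 t / fact 3 * x ^ 3"
    by (auto simp: D_def)
  then have eq: "f (r + x) - f r - f1 r * x - f2 r * x\<^sup>2 / 2 = f3 (r + t) / 6 * x ^ 3"
    by (simp add: D_def numeral_3_eq_3 lessThan_Suc fact_reduce power2_eq_square)
  have "\<bar>f (r + x) - f r - f1 r * x - f2 r * x\<^sup>2 / 2\<bar> = \<bar>f3 (r + t)\<bar> / 6 * \<bar>x\<bar> ^ 3"
    unfolding eq by (simp add: abs_mult power_abs)
  also have "\<dots> \<le> B * \<bar>x\<bar> ^ 3" using B[of "r + t"] by (intro mult_right_mono) auto
  finally show ?thesis .
qed

text \<open>
  The indicator of \<open>{..a}\<close> convolved with the centred normal law of variance \<open>u\<close>, followed by its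
  first three derivatives in \<open>r\<close>.
\<close>

definition Psi :: "real \<Rightarrow> real \<Rightarrow> real \<Rightarrow> real" where
  "Psi a u r = normal_cdf ((a - r) / sqrt u)"
definition Psi1 :: "real \<Rightarrow> real \<Rightarrow> real \<Rightarrow> real" where
  "Psi1 a u r = - (std_normal_density ((a - r) / sqrt u)) / sqrt u"
definition Psi2 :: "real \<Rightarrow> real \<Rightarrow> real \<Rightarrow> real" where
  "Psi2 a u r = - ((a - r) / sqrt u * std_normal_density ((a - r) / sqrt u)) / u"
definition Psi3 :: "real \<Rightarrow> real \<Rightarrow> real \<Rightarrow> real" where
  "Psi3 a u r = (1 - ((a - r) / sqrt u)\<^sup>2) * std_normal_density ((a - r) / sqrt u) / (u * sqrt u)"

lemma Psi_derivs:
  assumes "0 < u"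
  shows "(Psi a u has_real_derivative Psi1 a u r) (at r)"
    and "(Psi1 a u has_real_derivative Psi2 a u r) (at r)"
    and "(Psi2 a u has_real_derivative Psi3 a u r) (at r)"
proof -
  have s: "sqrt u * sqrt u = u" "sqrt u > 0" using assms by auto
  have su: "sqrt u \<noteq> 0" "u \<noteq> 0" using assms by auto
  have z: "((\<lambda>r. (a - r) / sqrt u) has_real_derivative - 1 / sqrt u) (at r)" for r
  proof -
    have "((\<lambda>r. (a - r) / sqrt u) has_real_derivative (0 - 1) / sqrt u) (at r)"
      by (intro DERIV_cdivide DERIV_diff DERIV_const DERIV_ident)
    then show ?thesis by simp
  qed
  have s3: "sqrt u * (sqrt u * t) = u * t" for t using assms by (simp add: mult.assoc[symmetric])
  have n: "((\<lambda>r. std_normal_density ((a - r) / sqrt u)) has_real_derivative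
      - ((a - r) / sqrt u) * std_normal_density ((a - r) / sqrt u) * (- 1 / sqrt u)) (at r)"
    by (rule DERIV_chain2[OF normal_density_deriv z])
  show "(Psi a u has_real_derivative Psi1 a u r) (at r)"
    unfolding Psi_def[abs_def] Psi1_def using DERIV_chain2[OF normal_cdf_deriv z, of r] by simp
  show "(Psi1 a u has_real_derivative Psi2 a u r) (at r)"
    unfolding Psi1_def[abs_def] Psi2_def
    by (rule derivative_eq_intros n refl su)+ (use s su in \<open>simp add: field_simps s3\<close>)
  show "(Psi2 a u has_real_derivative Psi3 a u r) (at r)"
    unfolding Psi2_def[abs_def] Psi3_def
    by (rule derivative_eq_intros n z refl su)+ (use s su in \<open>simp add: field_simps power2_eq_square s3\<close>)
qed

lemma Psi_bounds:
  assumes e: "0 < e" and u: "e\<^sup>2 \<le> u"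
  shows "\<bar>Psi a u r\<bar> \<le> 1" "\<bar>Psi1 a u r\<bar> \<le> 4 / e" "\<bar>Psi2 a u r\<bar> \<le> 4 / e\<^sup>2" "\<bar>Psi3 a u r\<bar> \<le> 8 / e ^ 3"
proof -
  have su: "e \<le> sqrt u" using real_le_rsqrt[OF u] .
  have u0: "0 < u" using e u by (smt (verit) zero_less_power)
  have uu: "e ^ 3 \<le> u * sqrt u"
    using mult_mono[OF u su] e u0 by (simp add: power2_eq_square power3_eq_cube)
  show "\<bar>Psi a u r\<bar> \<le> 1" using normal_cdf_bounds by (simp add: Psi_def)
  show "\<bar>Psi1 a u r\<bar> \<le> 4 / e" unfolding Psi1_def
    using e su u0 normal_density_bounds(2) by (auto simp: abs_divide intro!: frac_le)
  show "\<bar>Psi2 a u r\<bar> \<le> 4 / e\<^sup>2" unfolding Psi2_def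
    using e u u0 normal_density_bounds(3)[of "(a - r) / sqrt u"] by (simp add: abs_divide del: times_divide_eq_left) (intro frac_le, auto)
  show "\<bar>Psi3 a u r\<bar> \<le> 8 / e ^ 3" unfolding Psi3_def
    using e uu u0 normal_density_bounds(4)[of "(a - r) / sqrt u"] by (simp only: abs_divide) (intro frac_le, auto)
qed

text \<open>
  \<open>Psi\<close> solves the heat equation, so a small additional variance \<open>v\<close> acts as \<open>v / 2\<close> times the second
  derivative.
\<close>

lemma Psi_heat:
  assumes e: "0 < e" and u: "e\<^sup>2 \<le> u" and v: "0 \<le> v"
  shows "\<bar>Psi a (u + v) r - Psi a u r - v * Psi2 a u r / 2\<bar> \<le> 4 * v\<^sup>2 / e ^ 4"
proof (cases "v = 0")
  case False
  have u0: "0 < u" using e u by (smt (verit) zero_less_power)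
  define y where "y = a - r"
  have z: "((\<lambda>w. y / sqrt w) has_real_derivative - (y / sqrt w) / (2 * w)) (at w)" if "0 < w" for w
  proof -
    have "sqrt w * sqrt w = w" using that by simp
    then show ?thesis using that
      by (auto intro!: derivative_eq_intros simp: field_simps)
  qed
  have d1: "((\<lambda>w. Psi a w r) has_real_derivative Psi2 a w r / 2) (at w)" if "0 < w" for w
    unfolding Psi_def Psi2_def y_def[symmetric]
    using DERIV_chain2[OF normal_cdf_deriv z[OF that]] that by (simp add: field_simps)
  define P' where "P' w = (let z = y / sqrt w in (z * (1 - z\<^sup>2) * std_normal_density z / 2 + z * std_normal_density z) / w\<^sup>2)" for w
  have d2: "((\<lambda>w. Psi2 a w r) has_real_derivative P' w) (at w)" if "0 < w" for w
  proof -
    note n = DERIV_chain2[OF normal_density_deriv z[OF that]]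
    show ?thesis
      unfolding Psi2_def y_def[symmetric] P'_def Let_def
      by (rule derivative_eq_intros n z that refl)+
         (use that in \<open>simp_all add: field_simps power2_eq_square\<close>)
  qed
  have P'b: "\<bar>P' w\<bar> \<le> 8 / e ^ 4" if "u \<le> w" for w
  proof -
    let ?z = "y / sqrt w"
    have "e\<^sup>2 * e\<^sup>2 \<le> w * w" using u that e u0 by (intro mult_mono) auto
    then have w: "e ^ 4 \<le> w\<^sup>2" by (simp add: power2_eq_square power4_eq_xxxx mult.assoc)
    have "\<bar>?z * (1 - ?z\<^sup>2) * std_normal_density ?z / 2 + ?z * std_normal_density ?z\<bar> \<le> 8"
    proof -
      have "\<bar>A / 2 + B\<bar> \<le> 8" if "\<bar>A\<bar> \<le> 8" "\<bar>B\<bar> \<le> 4" for A B :: real using that by linarith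
      then show ?thesis using normal_density_bounds(3)[of ?z] normal_density_bounds(5)[of ?z] by blast
    qed
    then show ?thesis unfolding P'_def Let_def abs_divide using w e by (intro frac_le) auto
  qed
  have "u < u + v" using v False by simp
  obtain w where w: "u < w" "w < u + v" "Psi a (u + v) r - Psi a u r = (u + v - u) * (Psi2 a w r / 2)"
    using MVT2[OF \<open>u < u + v\<close>, of "\<lambda>w. Psi a w r" "\<lambda>w. Psi2 a w r / 2"] d1 u0 by auto
  obtain w' where w': "u < w'" "w' < w" "Psi2 a w r - Psi2 a u r = (w - u) * P' w'"
    using MVT2[OF w(1), of "\<lambda>w. Psi2 a w r" P'] d2 u0 by auto
  have eq: "Psi a (u + v) r - Psi a u r - v * Psi2 a u r / 2 = v / 2 * ((w - u) * P' w')"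
    unfolding w'(3)[symmetric] using w(3) by (simp add: algebra_simps)
  have "\<bar>Psi a (u + v) r - Psi a u r - v * Psi2 a u r / 2\<bar> = v / 2 * ((w - u) * \<bar>P' w'\<bar>)"
    unfolding eq using w(1) v by (simp add: abs_mult)
  also have "\<dots> \<le> v / 2 * (v * (8 / e ^ 4))"
    using P'b[of w'] w w' v by (intro mult_left_mono mult_mono) auto
  finally show ?thesis by (simp add: power2_eq_square)
qed simp

locale oscillating_sequence =
  fixes X m :: "nat \<Rightarrow> real \<Rightarrow> real" and r :: "nat \<Rightarrow> real" and W :: real and b :: nat
  assumes osc: "i < b \<Longrightarrow> oscillating (r i) W (X i) (m i)"
    and W_pos: "0 \<le> W"
begin

definition S :: "nat \<Rightarrow> real \<Rightarrow> real" where "S n x = (\<Sum>k<n. X k x)"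
text \<open>
  Up to constants, the bound of \<open>oscillatory_integral_bound\<close> for the correlation of \<open>X i\<close> with a
  Lipschitz function of the preceding sum: the period of \<open>X i\<close> times the number of oscillations of
  its predecessors.
\<close>

definition eta :: "nat \<Rightarrow> real" where "eta i = r i * ((\<Sum>k<i. 1 / r k + 1) + 1)"
definition var :: "nat \<Rightarrow> real" where "var i = mean_square (r i) (X i)"

lemma r_pos: "i < b \<Longrightarrow> 0 < r i" using osc osc_pos by blast

lemma eta_ge: assumes "i < b" shows "real i * r i \<le> eta i" "0 \<le> eta i" "r i \<le> eta i" "r i * (\<Sum>k<i. 1 / r k + 1) \<le> eta i"
proof -
  have a: "(\<Sum>k<i. 1 :: real) \<le> (\<Sum>k<i. 1 / r k + 1)"
    using r_pos assms by (intro sum_mono) (simp add: less_imp_le)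
  then have "real i \<le> (\<Sum>k<i. 1 / r k + 1) + 1" by simp
  from mult_left_mono[OF this, of "r i"] show "real i * r i \<le> eta i"
    using r_pos[OF assms] by (simp add: eta_def mult.commute)
  then show "0 \<le> eta i" using r_pos[OF assms] by (smt (verit) mult_nonneg_nonneg of_nat_0_le_iff)
  show "r i \<le> eta i" "r i * (\<Sum>k<i. 1 / r k + 1) \<le> eta i"
    using r_pos[OF assms] a by (auto simp: eta_def algebra_simps)
qed

lemma S_dominated: "n \<le> b \<Longrightarrow> dominated (S n) (\<lambda>x. \<Sum>k<n. m k x)"
  unfolding S_def by (intro dominated_sum osc_dominated[OF osc]) auto

lemma S_borel: "n \<le> b \<Longrightarrow> S n \<in> borel_measurable borel"
  by (rule dominated_borel[OF S_dominated])

lemma S_bound: "n \<le> b \<Longrightarrow> \<bar>S n x\<bar> \<le> real n * W"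
proof -
  assume n: "n \<le> b"
  have "\<bar>S n x\<bar> \<le> (\<Sum>k<n. \<bar>X k x\<bar>)" unfolding S_def by (rule sum_abs)
  also have "\<dots> \<le> (\<Sum>k<n. W)" using n by (intro sum_mono osc_bound[OF osc]) auto
  finally show ?thesis by simp
qed

lemma S_growth: "n \<le> b \<Longrightarrow> (\<Sum>k<n. m k 1) - (\<Sum>k<n. m k 0) \<le> W * (\<Sum>k<n. 1 / r k + 1)"
  unfolding sum_subtractf[symmetric] sum_distrib_left
  by (intro sum_mono osc_dom_growth[OF osc]) auto

lemma var_bounds: "i < b \<Longrightarrow> 0 \<le> var i" "i < b \<Longrightarrow> var i \<le> W\<^sup>2"
  unfolding var_def using mean_square_bounds[OF osc] by auto

text \<open>
  The preceding sum is dominated by a function of growth at most \<open>W * (\<Sum>k<i. 1 / r k + 1)\<close>, so it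
  varies slowly compared with \<open>w\<close>.
\<close>

lemma correlation_bound:
  assumes i: "i < b" and h: "\<And>u v. \<bar>u\<bar> \<le> real i * W \<Longrightarrow> \<bar>v\<bar> \<le> real i * W \<Longrightarrow> \<bar>h v - h u\<bar> \<le> B * \<bar>v - u\<bar>" "0 \<le> B"
    and hb: "\<And>u. \<bar>u\<bar> \<le> real i * W \<Longrightarrow> \<bar>h u\<bar> \<le> H"
    and w: "w \<in> borel_measurable borel" "\<And>x. \<bar>w x\<bar> \<le> Q" "\<And>x. w (x + r i) = w x" "ival 0 (r i) w = 0"
  shows "\<bar>ival 0 1 (\<lambda>x. h (S i x) * w x)\<bar> \<le> Q * (B * W * (r i * (\<Sum>k<i. 1 / r k + 1)) + r i * H)"
proof -
  have Q: "0 \<le> Q" using w(2)[of 0] by linarith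
  have Sb: "\<bar>S i x\<bar> \<le> real i * W" for x using i by (intro S_bound) auto
  have "dominated (\<lambda>x. h (S i x)) (\<lambda>x. B * (\<Sum>k<i. m k x))"
    by (rule dominated_lipschitz[where S="{u. \<bar>u\<bar> \<le> real i * W}"]) (use i S_dominated[of i] Sb h in auto)
  from oscillatory_integral_bound[OF w(1,2) r_pos[OF i] w(3,4) this, of H]
  have "\<bar>ival 0 1 (\<lambda>x. h (S i x) * w x)\<bar> \<le> r i * Q * (B * ((\<Sum>k<i. m k 1) - (\<Sum>k<i. m k 0)) + H)"
    using hb[OF Sb] by (simp add: right_diff_distrib)
  also have "\<dots> \<le> r i * Q * (B * (W * (\<Sum>k<i. 1 / r k + 1)) + H)"
    using S_growth[of i] i h(2) r_pos[OF i] Q by (intro mult_left_mono add_right_mono) auto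
  finally show ?thesis by (simp add: algebra_simps)
qed

lemma S_Suc: "S (Suc i) x = S i x + X i x" by (simp add: S_def)

text \<open>
  Exchange of one summand for a normal variable of the same variance. The Taylor expansion of
  \<open>Psi a u\<close> accounts for the summand and the heat equation for the normal variable; the second-order
  terms cancel up to the fluctuation of \<open>(X i)\<^sup>2\<close> about its mean. This fluctuation and \<open>X i\<close> itself
  have mean zero and period \<open>r i\<close>, so \<open>correlation_bound\<close> applies to both.
\<close>

lemma lindeberg_step:
  assumes i: "i < b" and e: "1 \<le> e" and u: "e\<^sup>2 \<le> u"
  shows "\<bar>ival 0 1 (\<lambda>x. Psi a u (S (Suc i) x)) - ival 0 1 (\<lambda>x. Psi a (u + var i) (S i x))\<bar>
    \<le> (4 * W ^ 4 + 16 * W ^ 3 + 8 * W\<^sup>2 + 4 * W) * (eta i / e + 1 / e ^ 3)"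
proof -
  have e0: "0 < e" using e by simp
  have u0: "0 < u" using e0 u by (smt (verit) zero_less_power)
  note oi = osc[OF i]
  note Xb = osc_bound[OF oi] and Xs = osc_square_le[OF oi]
  note v = var_bounds[OF i]
  have Sm [measurable]: "S i \<in> borel_measurable borel" "X i \<in> borel_measurable borel"
    using S_borel i osc_borel[OF oi] by auto
  have Pm [measurable]: "Psi a u \<in> borel_measurable borel" "Psi1 a u \<in> borel_measurable borel" "Psi2 a u \<in> borel_measurable borel" if "0 < u" for u
    using Psi_derivs[OF that]
    by (auto intro!: borel_measurable_continuous_onI continuous_at_imp_continuous_on DERIV_isCont)
  note Pmu [measurable] = Pm[OF u0]
  have uv: "0 < u + var i" "e\<^sup>2 \<le> u + var i" using u0 u v by auto
  note [measurable] = Pm(1)[OF uv(1)]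
  note Pb = Psi_bounds[OF e0 u]
  let ?c = "var i"
  have int1: "set_integrable lborel {0..<1} (\<lambda>x. Psi a u (S (Suc i) x))"
    by (rule bounded_ival_integrable[where B=1]) (auto simp: S_Suc Pb)
  have int2: "set_integrable lborel {0..<1} (\<lambda>x. Psi a (u + ?c) (S i x))"
    by (rule bounded_ival_integrable[where B=1]) (auto simp: Psi_bounds[OF e0 uv(2)])
  have int3: "set_integrable lborel {0..<1} (\<lambda>x. Psi1 a u (S i x) * X i x)"
  proof (rule bounded_ival_integrable[where B="4 / e * W"])
    show "\<bar>Psi1 a u (S i x) * X i x\<bar> \<le> 4 / e * W" for x
      unfolding abs_mult using Pb Xb e0 by (intro mult_mono) auto
  qed measurable
  have int4: "set_integrable lborel {0..<1} (\<lambda>x. Psi2 a u (S i x) * ((X i x)\<^sup>2 - ?c))"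
  proof (rule bounded_ival_integrable[where B="4 / e\<^sup>2 * W\<^sup>2"])
    fix x
    have "\<bar>(X i x)\<^sup>2 - ?c\<bar> \<le> W\<^sup>2" using Xs[of x] v by (simp add: abs_le_iff) (smt (verit) zero_le_power2)
    then show "\<bar>Psi2 a u (S i x) * ((X i x)\<^sup>2 - ?c)\<bar> \<le> 4 / e\<^sup>2 * W\<^sup>2"
      unfolding abs_mult using Pb e0 by (intro mult_mono) auto
  qed measurable
  let ?R = "\<lambda>x. Psi a u (S (Suc i) x) - Psi a (u + ?c) (S i x) - Psi1 a u (S i x) * X i x
       - 1 / 2 * (Psi2 a u (S i x) * ((X i x)\<^sup>2 - ?c))"
  have Rb: "\<bar>?R x\<bar> \<le> 8 / e ^ 3 * W ^ 3 + 4 * W ^ 4 / e ^ 4" for x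
  proof -
    have "\<bar>Psi a u (S i x + X i x) - Psi a u (S i x) - Psi1 a u (S i x) * X i x - Psi2 a u (S i x) * (X i x)\<^sup>2 / 2\<bar>
      \<le> 8 / e ^ 3 * \<bar>X i x\<bar> ^ 3"
      by (rule taylor_third_order[OF Psi_derivs[OF u0] Pb(4)])
    also have "\<dots> \<le> 8 / e ^ 3 * W ^ 3" using Xb e0 by (intro mult_left_mono power_mono) auto
    finally have 1: "\<bar>Psi a u (S i x + X i x) - Psi a u (S i x) - Psi1 a u (S i x) * X i x - Psi2 a u (S i x) * (X i x)\<^sup>2 / 2\<bar>
      \<le> 8 / e ^ 3 * W ^ 3" .
    have "\<bar>Psi a (u + ?c) (S i x) - Psi a u (S i x) - ?c * Psi2 a u (S i x) / 2\<bar> \<le> 4 * ?c\<^sup>2 / e ^ 4"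
      by (rule Psi_heat[OF e0 u v(1)])
    also have "?c\<^sup>2 \<le> (W\<^sup>2)\<^sup>2" using v by (intro power_mono) auto
    then have "4 * ?c\<^sup>2 / e ^ 4 \<le> 4 * W ^ 4 / e ^ 4" using e0 by (intro divide_right_mono) auto
    finally have 2: "\<bar>Psi a (u + ?c) (S i x) - Psi a u (S i x) - ?c * Psi2 a u (S i x) / 2\<bar> \<le> 4 * W ^ 4 / e ^ 4" .
    have "S (Suc i) x = S i x + X i x" by (simp add: S_def)
    then have "?R x = (Psi a u (S i x + X i x) - Psi a u (S i x) - Psi1 a u (S i x) * X i x - Psi2 a u (S i x) * (X i x)\<^sup>2 / 2)
       - (Psi a (u + ?c) (S i x) - Psi a u (S i x) - ?c * Psi2 a u (S i x) / 2)"
      by (simp add: algebra_simps)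
    then show ?thesis using 1 2 by linarith
  qed
  have "ival 0 1 ?R = ival 0 1 (\<lambda>x. Psi a u (S (Suc i) x)) - ival 0 1 (\<lambda>x. Psi a (u + ?c) (S i x))
     - ival 0 1 (\<lambda>x. Psi1 a u (S i x) * X i x) - 1 / 2 * ival 0 1 (\<lambda>x. Psi2 a u (S i x) * ((X i x)\<^sup>2 - ?c))"
    using int1 int2 int3 int4 by (simp add: set_integral_diff set_integrable_mult_right del: times_divide_eq_left)
  moreover have "\<bar>ival 0 1 ?R\<bar> \<le> (8 / e ^ 3 * W ^ 3 + 4 * W ^ 4 / e ^ 4) * (1 - 0)"
    by (rule ival_abs_le) (use Rb in auto)
  moreover have c1: "\<bar>ival 0 1 (\<lambda>x. Psi1 a u (S i x) * X i x)\<bar>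
     \<le> W * (4 / e\<^sup>2 * W * (r i * (\<Sum>k<i. 1 / r k + 1)) + r i * (4 / e))"
    by (rule correlation_bound[OF i])
       (use lipschitz_of_deriv[OF Psi_derivs(2)[OF u0] Pb(3)] Pb(2) Sm(2) Xb osc_periodic[OF oi] osc_mean[OF oi] in auto)
  moreover have c2: "\<bar>ival 0 1 (\<lambda>x. Psi2 a u (S i x) * ((X i x)\<^sup>2 - ?c))\<bar>
     \<le> W\<^sup>2 * (8 / e ^ 3 * W * (r i * (\<Sum>k<i. 1 / r k + 1)) + r i * (4 / e\<^sup>2))"
  proof (rule correlation_bound[OF i])
    show "\<bar>(X i x)\<^sup>2 - ?c\<bar> \<le> W\<^sup>2" for x using Xs[of x] v by (simp add: abs_le_iff) (smt (verit) zero_le_power2)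
    show "ival 0 (r i) (\<lambda>x. (X i x)\<^sup>2 - ?c) = 0" unfolding var_def by (rule mean_square_centred[OF oi])
  qed (use lipschitz_of_deriv[OF Psi_derivs(3)[OF u0] Pb(4)] Pb(3) osc_periodic[OF oi] e0 in auto)
  ultimately have main: "\<bar>ival 0 1 (\<lambda>x. Psi a u (S (Suc i) x)) - ival 0 1 (\<lambda>x. Psi a (u + ?c) (S i x))\<bar>
     \<le> (8 / e ^ 3 * W ^ 3 + 4 * W ^ 4 / e ^ 4)
      + W * (4 / e\<^sup>2 * W * (r i * (\<Sum>k<i. 1 / r k + 1)) + r i * (4 / e))
      + W\<^sup>2 * (8 / e ^ 3 * W * (r i * (\<Sum>k<i. 1 / r k + 1)) + r i * (4 / e\<^sup>2))"
  proof -
    have "\<bar>t - t'\<bar> \<le> A + B + C"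
      if "R = t - t' - p - 1 / 2 * q" "\<bar>R\<bar> \<le> A * (1 - 0)" "\<bar>p\<bar> \<le> B" "\<bar>q\<bar> \<le> C" for t t' p q R A B C :: real
      using that by (simp add: abs_le_iff)
    then show ?thesis using \<open>ival 0 1 ?R = _\<close> \<open>\<bar>ival 0 1 ?R\<bar> \<le> _\<close> c1 c2 by blast
  qed
  have e2: "1 / e\<^sup>2 \<le> 1 / e" "1 / e ^ 3 \<le> 1 / e" "1 / e ^ 4 \<le> 1 / e ^ 3"
    using e power_increasing[of 1 2 e] power_increasing[of 1 3 e] power_increasing[of 3 4 e]
    by (auto intro!: divide_left_mono mult_pos_pos zero_less_power)
  note g = eta_ge[OF i]
  let ?T = "r i * (\<Sum>k<i. 1 / r k + 1)"
  have T0: "0 \<le> ?T" using r_pos[OF i] r_pos i by (intro mult_nonneg_nonneg sum_nonneg) (auto simp: less_imp_le)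
  have a1: "1 / e\<^sup>2 * ?T \<le> eta i / e" "1 / e ^ 3 * ?T \<le> eta i / e" "1 / e * r i \<le> eta i / e" "1 / e\<^sup>2 * r i \<le> eta i / e"
    using mult_mono[OF e2(1) g(4)] mult_mono[OF e2(2) g(4)] mult_mono[OF e2(1) g(3)] mult_mono[OF order_refl[of "1/e"] g(3)]
      e0 T0 r_pos[OF i] by auto
  have W4: "0 \<le> W ^ k" for k using W_pos by simp
  have "(8 / e ^ 3 * W ^ 3 + 4 * W ^ 4 / e ^ 4)
      + W * (4 / e\<^sup>2 * W * ?T + r i * (4 / e)) + W\<^sup>2 * (8 / e ^ 3 * W * ?T + r i * (4 / e\<^sup>2))
     = 8 * W ^ 3 * (1 / e ^ 3) + 4 * W ^ 4 * (1 / e ^ 4) + 4 * W\<^sup>2 * (1 / e\<^sup>2 * ?T) + 4 * W * (1 / e * r i)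
       + 8 * W ^ 3 * (1 / e ^ 3 * ?T) + 4 * W\<^sup>2 * (1 / e\<^sup>2 * r i)"
    by (simp add: power2_eq_square power3_eq_cube algebra_simps)
  also have "\<dots> \<le> 8 * W ^ 3 * (1 / e ^ 3) + 4 * W ^ 4 * (1 / e ^ 3) + 4 * W\<^sup>2 * (eta i / e) + 4 * W * (eta i / e)
       + 8 * W ^ 3 * (eta i / e) + 4 * W\<^sup>2 * (eta i / e)"
    using a1 e2 W4 W_pos by (intro add_mono mult_left_mono) auto
  also have "\<dots> \<le> (4 * W ^ 4 + 16 * W ^ 3 + 8 * W\<^sup>2 + 4 * W) * (eta i / e + 1 / e ^ 3)"
  proof -
    have a: "0 \<le> eta i / e" and b: "0 \<le> 1 / e ^ 3" using g e0 by auto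
    note nn = mult_nonneg_nonneg[OF W4[of 4] a] mult_nonneg_nonneg[OF W4[of 3] a]
      mult_nonneg_nonneg[OF W4[of 3] b] mult_nonneg_nonneg[OF W4[of 2] b] mult_nonneg_nonneg[OF W_pos b]
    have "8 * w3 * B + 4 * w4 * B + 4 * w2 * A + 4 * w1 * A + 8 * w3 * A + 4 * w2 * A \<le> (4 * w4 + 16 * w3 + 8 * w2 + 4 * w1) * (A + B)"
      if "0 \<le> w4 * A" "0 \<le> w3 * A" "0 \<le> w3 * B" "0 \<le> w2 * B" "0 \<le> w1 * B" for A B w1 w2 w3 w4 :: real
      using that by (simp add: algebra_simps)
    from this[OF nn] show ?thesis .
  qed
  finally show ?thesis using main by linarith
qed

text \<open>
  The initial variance \<open>e\<^sup>2\<close> remains present throughout the exchanges, so that all test functions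
  are uniformly smooth.
\<close>

lemma lindeberg:
  assumes e: "1 \<le> e"
  shows "\<bar>ival 0 1 (\<lambda>x. Psi a (e\<^sup>2) (S b x)) - normal_cdf (a / sqrt (e\<^sup>2 + (\<Sum>i<b. var i)))\<bar>
    \<le> (4 * W ^ 4 + 16 * W ^ 3 + 8 * W\<^sup>2 + 4 * W) * (\<Sum>i<b. eta i / e + 1 / e ^ 3)"
proof -
  let ?C = "4 * W ^ 4 + 16 * W ^ 3 + 8 * W\<^sup>2 + 4 * W"
  define U where "U n = e\<^sup>2 + (\<Sum>i=n..<b. var i)" for n
  have "\<bar>ival 0 1 (\<lambda>x. Psi a (U n) (S n x)) - ival 0 1 (\<lambda>x. Psi a (U 0) (S 0 x))\<bar> \<le> ?C * (\<Sum>i<n. eta i / e + 1 / e ^ 3)" if "n \<le> b" for n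
    using that
  proof (induction n)
    case (Suc n)
    have "U n = U (Suc n) + var n" using Suc.prems by (simp add: U_def sum.atLeast_Suc_lessThan)
    moreover have "e\<^sup>2 \<le> U (Suc n)" unfolding U_def by (auto intro!: sum_nonneg var_bounds)
    ultimately have "\<bar>ival 0 1 (\<lambda>x. Psi a (U (Suc n)) (S (Suc n) x)) - ival 0 1 (\<lambda>x. Psi a (U n) (S n x))\<bar>
       \<le> ?C * (eta n / e + 1 / e ^ 3)"
      using lindeberg_step[of n e "U (Suc n)" a] Suc.prems e by simp
    then show ?case using Suc by (simp add: distrib_left)
  qed simp
  from this[of b] show ?thesis
    by (simp add: U_def S_def[of 0] Psi_def[of a _ 0] set_lebesgue_integral_def lessThan_atLeast0)
qed

lemma S_power_integrable:
  assumes "n \<le> b" shows "set_integrable lborel {0..<1} (\<lambda>x. (S n x) ^ k)"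
proof -
  note [measurable] = S_borel[OF assms]
  show ?thesis
    by (rule bounded_ival_integrable[where B="(real n * W) ^ k"])
       (use S_bound[OF assms] in \<open>auto simp: power_abs intro!: power_mono\<close>)
qed

lemma second_moment_step:
  assumes i: "i < b"
  shows "\<bar>ival 0 1 (\<lambda>x. (S (Suc i) x)\<^sup>2) - ival 0 1 (\<lambda>x. (S i x)\<^sup>2) - var i\<bar> \<le> 5 * W\<^sup>2 * eta i"
proof -
  note oi = osc[OF i] and g = eta_ge[OF i]
  note Xb = osc_bound[OF oi] and Xs = osc_square_le[OF oi]
  have Sm [measurable]: "S i \<in> borel_measurable borel" "X i \<in> borel_measurable borel"
    using S_borel i osc_borel[OF oi] by auto
  have Sb: "\<bar>S i x\<bar> \<le> real i * W" for x using i by (intro S_bound) auto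
  have v: "\<bar>(X i x)\<^sup>2 - var i\<bar> \<le> W\<^sup>2" for x using Xs[of x] var_bounds[OF i] by (simp add: abs_le_iff) (smt (verit) zero_le_power2)
  have i1: "set_integrable lborel {0..<1} (\<lambda>x. S i x * X i x)"
    by (rule bounded_ival_integrable[where B="real i * W * W"]) (auto simp: abs_mult W_pos intro!: mult_mono Sb Xb)
  have i2: "set_integrable lborel {0..<1} (\<lambda>x. (X i x)\<^sup>2 - var i)"
    by (rule bounded_ival_integrable[where B="W\<^sup>2"]) (use v in auto)
  have i3: "set_integrable lborel {0..<1::real} (\<lambda>x. var i)"
    by (rule bounded_ival_integrable[where B="\<bar>var i\<bar>"]) auto
  have i0: "set_integrable lborel {0..<1} (\<lambda>x. (S i x)\<^sup>2)" using S_power_integrable i by simp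
  have pt: "(S (Suc i) x)\<^sup>2 = (S i x)\<^sup>2 + 2 * (S i x * X i x) + ((X i x)\<^sup>2 - var i) + var i" for x
    by (simp add: S_Suc power2_sum algebra_simps)
  have j1: "set_integrable lborel {0..<1} (\<lambda>x. 2 * (S i x * X i x))" using i1 by (rule set_integrable_mult_right)
  note j2 = set_integral_add[OF i0 j1]
  note j3 = set_integral_add[OF j2(1) i2]
  note j4 = set_integral_add[OF j3(1) i3]
  have "ival 0 1 (\<lambda>x. (S (Suc i) x)\<^sup>2) = ival 0 1 (\<lambda>x. (S i x)\<^sup>2) + 2 * ival 0 1 (\<lambda>x. S i x * X i x)
      + ival 0 1 (\<lambda>x. (X i x)\<^sup>2 - var i) + ival 0 1 (\<lambda>x. var i)"
    by (simp only: pt j4(2) j3(2) j2(2) set_integral_mult_right)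
  moreover have "ival 0 1 (\<lambda>x. var i) = var i" by (simp add: set_lebesgue_integral_def)
  moreover have "\<bar>ival 0 1 (\<lambda>x. S i x * X i x)\<bar> \<le> W * (1 * W * (r i * (\<Sum>k<i. 1 / r k + 1)) + r i * (real i * W))"
    by (rule correlation_bound[OF i, where h="\<lambda>x. x"])
      (use Sm(2) Xb osc_periodic[OF oi] osc_mean[OF oi] in auto)
  moreover have "\<dots> \<le> W * (1 * W * eta i + eta i * W)"
    using g W_pos by (intro mult_left_mono add_mono) (auto simp: mult_ac intro!: mult_left_mono)
  moreover have "\<bar>ival 0 1 (\<lambda>x. (\<lambda>_. 1) (S i x) * ((X i x)\<^sup>2 - var i))\<bar> \<le> W\<^sup>2 * (0 * W * (r i * (\<Sum>k<i. 1 / r k + 1)) + r i * 1)"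
    by (rule correlation_bound[OF i, where h="\<lambda>x. 1"])
      (use v osc_periodic[OF oi] mean_square_centred[OF oi] in \<open>auto simp: var_def\<close>)
  moreover have "W\<^sup>2 * (0 * W * (r i * (\<Sum>k<i. 1 / r k + 1)) + r i * 1) \<le> W\<^sup>2 * eta i"
    using g by (simp add: mult_left_mono)
  ultimately show ?thesis by (simp add: power2_eq_square algebra_simps)
qed

lemma second_moment:
  assumes "n \<le> b"
  shows "\<bar>ival 0 1 (\<lambda>x. (S n x)\<^sup>2) - (\<Sum>i<n. var i)\<bar> \<le> 5 * W\<^sup>2 * (\<Sum>i<n. eta i)"
  using assms
proof (induction n)
  case 0
  then show ?case by (simp add: S_def set_lebesgue_integral_def)
next
  case (Suc n)
  then show ?case using second_moment_step[of n] by (simp add: distrib_left)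
qed

text \<open>
  In the expansion of \<open>(S + X) ^ 4\<close> the term \<open>S ^ 3 * X\<close> is small by near orthogonality, and the
  remaining mixed terms are controlled by the second moment.
\<close>

lemma fourth_moment:
  assumes H: "\<And>i. i < b \<Longrightarrow> eta i \<le> H / real (Suc i)" and n: "n \<le> b"
  shows "ival 0 1 (\<lambda>x. (S n x)\<^sup>2) \<le> W\<^sup>2 * (1 + 5 * H) * real n" (is ?A)
    and "ival 0 1 (\<lambda>x. (S n x) ^ 4) \<le> (16 * W ^ 4 * H + (6 * W\<^sup>2 + 4 * W ^ 3) * (W\<^sup>2 * (1 + 5 * H)) + 4 * W ^ 3 + W ^ 4) * (real n)\<^sup>2" (is ?B)
proof -
  let ?M = "W\<^sup>2 * (1 + 5 * H)"
  have A: "ival 0 1 (\<lambda>x. (S n x)\<^sup>2) \<le> ?M * real n" if n: "n \<le> b" for n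
  proof -
    have "(\<Sum>i<n. var i) \<le> (\<Sum>i<n. W\<^sup>2)" using n var_bounds by (intro sum_mono) auto
    moreover have "(\<Sum>i<n. eta i) \<le> (\<Sum>i<n. H)"
    proof (rule sum_mono)
      fix i assume "i \<in> {..<n}"
      then have i: "i < b" using n by simp
      have "0 \<le> H / real (Suc i)" using H[OF i] eta_ge(2)[OF i] by linarith
      then have "0 \<le> H" by (simp add: zero_le_divide_iff)
      then have "H / real (Suc i) \<le> H / 1" by (intro divide_left_mono) auto
      then show "eta i \<le> H" using H[OF i] by simp
    qed
    then have "5 * W\<^sup>2 * (\<Sum>i<n. eta i) \<le> 5 * W\<^sup>2 * (real n * H)" by (intro mult_left_mono) auto
    ultimately show ?thesis using second_moment[OF n] by (simp add: algebra_simps)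
  qed
  show ?A by (rule A[OF n])
  let ?D = "16 * W ^ 4 * H + (6 * W\<^sup>2 + 4 * W ^ 3) * ?M + 4 * W ^ 3 + W ^ 4"
  have "ival 0 1 (\<lambda>x. (S n x) ^ 4) \<le> (\<Sum>i<n. ?D * real (Suc i))" if "n \<le> b" for n
    using that
  proof (induction n)
    case 0
    then show ?case by (simp add: S_def set_lebesgue_integral_def)
  next
    case (Suc i)
    then have i: "i < b" by simp
    note oi = osc[OF i] and g = eta_ge[OF i]
    note Xb = osc_bound[OF oi]
    have "0 \<le> H / real (Suc i)" using H[OF i] eta_ge(2)[OF i] by linarith
    then have H0: "0 \<le> H" by (simp add: zero_le_divide_iff)
    have M0: "0 \<le> ?M" using H0 by simp
    have Sm [measurable]: "S i \<in> borel_measurable borel" "X i \<in> borel_measurable borel"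
      using S_borel i osc_borel[OF oi] by auto
    have Sb: "\<bar>S i x\<bar> \<le> real i * W" for x using i by (intro S_bound) auto
    have iS: "set_integrable lborel {0..<1} (\<lambda>x. S i x ^ k)" for k using S_power_integrable i by simp
    have iS': "set_integrable lborel {0..<1} (\<lambda>x. S (Suc i) x ^ 4)" using S_power_integrable i by simp
    have i3: "set_integrable lborel {0..<1} (\<lambda>x. S i x ^ 3 * X i x)"
      by (rule bounded_ival_integrable[where B="(real i * W) ^ 3 * W"])
         (auto simp: abs_mult power_abs W_pos intro!: mult_mono power_mono Sb Xb)
    have ic: "set_integrable lborel {0..<1::real} (\<lambda>x. c)" for c :: real
      by (rule bounded_ival_integrable[where B="\<bar>c\<bar>"]) auto
    have pt: "S (Suc i) x ^ 4 \<le> S i x ^ 4 + 4 * (S i x ^ 3 * X i x) + (6 * W\<^sup>2 + 4 * W ^ 3) * (S i x)\<^sup>2 + (4 * W ^ 3 + W ^ 4)" for x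
    proof -
      let ?s = "S i x" and ?x = "X i x"
      have "(?s + ?x) ^ 4 = ?s ^ 4 + 4 * (?s ^ 3 * ?x) + 6 * (?s\<^sup>2 * ?x\<^sup>2) + 4 * (?s * ?x ^ 3) + ?x ^ 4"
        by (simp add: power4_eq_xxxx power3_eq_cube power2_eq_square algebra_simps)
      moreover have "?s\<^sup>2 * ?x\<^sup>2 \<le> ?s\<^sup>2 * W\<^sup>2" using osc_square_le[OF oi, of x] by (intro mult_left_mono) auto
      moreover have "?s * ?x ^ 3 \<le> (?s\<^sup>2 + 1) * W ^ 3"
      proof -
        have s: "\<bar>?s\<bar> \<le> ?s\<^sup>2 + 1" using sum_squares_bound[of 1 "\<bar>?s\<bar>"] by simp
        have "?s * ?x ^ 3 \<le> \<bar>?s * ?x ^ 3\<bar>" by (rule abs_ge_self)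
        also have "\<dots> = \<bar>?s\<bar> * \<bar>?x\<bar> ^ 3" by (simp only: abs_mult power_abs)
        also have "\<dots> \<le> (?s\<^sup>2 + 1) * W ^ 3" by (intro mult_mono power_mono s Xb) auto
        finally show ?thesis .
      qed
      moreover have "?x ^ 4 \<le> W ^ 4" using power_mono[OF Xb[of x], of 4] by (simp add: power_even_abs)
      ultimately show ?thesis by (simp add: S_Suc algebra_simps)
    qed
    have j1: "set_integrable lborel {0..<1} (\<lambda>x. 4 * (S i x ^ 3 * X i x))" using i3 by (rule set_integrable_mult_right)
    have j2: "set_integrable lborel {0..<1} (\<lambda>x. (6 * W\<^sup>2 + 4 * W ^ 3) * (S i x)\<^sup>2)" using iS by (rule set_integrable_mult_right)
    note k1 = set_integral_add[OF iS[of 4] j1]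
    note k2 = set_integral_add[OF k1(1) j2]
    note k3 = set_integral_add[OF k2(1) ic[of "4 * W ^ 3 + W ^ 4"]]
    have "ival 0 1 (\<lambda>x. S (Suc i) x ^ 4) \<le> ival 0 1 (\<lambda>x. S i x ^ 4 + 4 * (S i x ^ 3 * X i x) + (6 * W\<^sup>2 + 4 * W ^ 3) * (S i x)\<^sup>2 + (4 * W ^ 3 + W ^ 4))"
      by (rule set_integral_mono[OF iS' k3(1) pt])
    also have "\<dots> = ival 0 1 (\<lambda>x. S i x ^ 4) + 4 * ival 0 1 (\<lambda>x. S i x ^ 3 * X i x) + (6 * W\<^sup>2 + 4 * W ^ 3) * ival 0 1 (\<lambda>x. (S i x)\<^sup>2) + (4 * W ^ 3 + W ^ 4)"
    proof -
      have "ival 0 1 (\<lambda>x. 4 * W ^ 3 + W ^ 4) = 4 * W ^ 3 + W ^ 4" by (simp add: set_lebesgue_integral_def)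
      then show ?thesis by (simp only: k1(2) k2(2) k3(2) set_integral_mult_right)
    qed
    also have "\<dots> \<le> ival 0 1 (\<lambda>x. S i x ^ 4) + 4 * (4 * W ^ 4 * H * real i) + (6 * W\<^sup>2 + 4 * W ^ 3) * (?M * real i) + (4 * W ^ 3 + W ^ 4)"
    proof -
      have "\<bar>ival 0 1 (\<lambda>x. S i x ^ 3 * X i x)\<bar> \<le> W * (3 * (real i * W)\<^sup>2 * W * (r i * (\<Sum>k<i. 1 / r k + 1)) + r i * (real i * W) ^ 3)"
      proof (rule correlation_bound[OF i, where h="\<lambda>x. x ^ 3"])
        fix u v :: real assume uv: "\<bar>u\<bar> \<le> real i * W" "\<bar>v\<bar> \<le> real i * W"
        have "\<bar>v ^ 3 - u ^ 3\<bar> = \<bar>v * v + v * u + u * u\<bar> * \<bar>v - u\<bar>"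
          unfolding abs_mult[symmetric] by (simp add: power3_eq_cube algebra_simps)
        also have "\<dots> \<le> 3 * (real i * W)\<^sup>2 * \<bar>v - u\<bar>"
        proof (rule mult_right_mono)
          have "\<bar>v * v + v * u + u * u\<bar> \<le> \<bar>v\<bar> * \<bar>v\<bar> + \<bar>v\<bar> * \<bar>u\<bar> + \<bar>u\<bar> * \<bar>u\<bar>"
            unfolding abs_mult[symmetric] by linarith
          also have "\<dots> \<le> (real i * W) * (real i * W) + (real i * W) * (real i * W) + (real i * W) * (real i * W)"
            using uv W_pos by (intro add_mono mult_mono) auto
          also have "\<dots> = 3 * (real i * W)\<^sup>2" by (simp add: power2_eq_square)
          finally show "\<bar>v * v + v * u + u * u\<bar> \<le> 3 * (real i * W)\<^sup>2" .
        qed simp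
        finally show "\<bar>v ^ 3 - u ^ 3\<bar> \<le> 3 * (real i * W)\<^sup>2 * \<bar>v - u\<bar>" .
      qed (use Sm(2) Xb osc_periodic[OF oi] osc_mean[OF oi] in \<open>auto simp: power_abs intro!: power_mono\<close>)
      also have "r i * (real i * W) ^ 3 = W * (real i * W)\<^sup>2 * (real i * r i)"
        by (simp add: power3_eq_cube power2_eq_square)
      also have "W * (3 * (real i * W)\<^sup>2 * W * (r i * (\<Sum>k<i. 1 / r k + 1)) + W * (real i * W)\<^sup>2 * (real i * r i))
        \<le> W * (3 * (real i * W)\<^sup>2 * W * eta i + W * (real i * W)\<^sup>2 * eta i)"
        using g W_pos by (intro mult_left_mono add_mono) auto
      also have "\<dots> = 4 * W ^ 4 * (real i)\<^sup>2 * eta i"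
        by (simp add: power4_eq_xxxx power2_eq_square algebra_simps)
      also have "\<dots> \<le> 4 * W ^ 4 * (real i)\<^sup>2 * (H / real (Suc i))" using H[OF i] by (intro mult_left_mono) auto
      also have "\<dots> = 4 * W ^ 4 * H * (real i * (real i / real (Suc i)))" by (simp add: power2_eq_square)
      also have "\<dots> \<le> 4 * W ^ 4 * H * (real i * 1)" using H0 by (intro mult_left_mono) auto
      finally have c3: "ival 0 1 (\<lambda>x. S i x ^ 3 * X i x) \<le> 4 * W ^ 4 * H * real i" by simp
      have c2: "ival 0 1 (\<lambda>x. (S i x)\<^sup>2) \<le> ?M * real i" using A[of i] i by simp
      have "s + 4 * i3 + c * i2 + d \<le> s + 4 * j3 + c * j2 + d" if "i3 \<le> j3" "i2 \<le> j2" "0 \<le> c" for s i3 j3 c i2 j2 d :: real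
        using mult_left_mono[OF that(2,3)] that(1) by linarith
      note gen = this
      have "0 \<le> 6 * W\<^sup>2 + 4 * W ^ 3" using W_pos by simp
      from gen[OF c3 c2 this] show ?thesis .
    qed
    also have "\<dots> \<le> ival 0 1 (\<lambda>x. S i x ^ 4) + ?D * real (Suc i)"
      using H0 M0 W_pos by (simp add: algebra_simps)
    finally show ?case using Suc.IH i by simp
  qed
  from this[OF n] have "ival 0 1 (\<lambda>x. (S n x) ^ 4) \<le> (\<Sum>i<n. ?D * real (Suc i))" .
  also have "\<dots> \<le> (\<Sum>i<n. ?D * real n)"
  proof (cases "n = 0")
    case False
    then have b0: "0 < b" using n by simp
    have H0: "0 \<le> H" using H[OF b0] eta_ge(2)[OF b0] by simp
    then have "0 \<le> ?D" using W_pos by (intro add_nonneg_nonneg mult_nonneg_nonneg) auto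
    then show ?thesis by (intro sum_mono mult_left_mono) auto
  qed simp
  finally show ?B by (simp add: power2_eq_square mult_ac)
qed

end

section \<open>Chaining and quantile coupling\<close>

text \<open>
  The binary expansion of \<open>n\<close> leads from \<open>0\<close> to \<open>n\<close> with at most one step on every dyadic level.
\<close>

lemma chaining:
  fixes S d :: "nat \<Rightarrow> real"
  assumes "\<And>l i :: nat. l < r \<Longrightarrow> i < 2 ^ (r - l) \<Longrightarrow> \<bar>S ((i + 1) * 2 ^ l) - S (i * 2 ^ l)\<bar> \<le> d l" and "n < 2 ^ r"
  shows "\<bar>S n - S 0\<bar> \<le> (\<Sum>l<r. d l)"
  using assms
proof (induction r arbitrary: S n)
  case (Suc r)
  show ?case
  proof (cases "n < 2 ^ r")
    case True
    have "\<bar>S n - S 0\<bar> \<le> (\<Sum>l<r. d l)"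
    proof (rule Suc.IH[OF _ True])
      fix l i :: nat assume l: "l < r" and i: "i < 2 ^ (r - l)"
      have "(2::nat) ^ (r - l) \<le> 2 ^ (Suc r - l)" by (rule power_increasing) auto
      then show "\<bar>S ((i + 1) * 2 ^ l) - S (i * 2 ^ l)\<bar> \<le> d l" using Suc.prems(1)[of l i] l i by linarith
    qed
    moreover have "0 \<le> d r" using Suc.prems(1)[of r 0] by simp
    ultimately show ?thesis by simp
  next
    case False
    let ?S = "\<lambda>m. S (2 ^ r + m)"
    have "\<bar>?S (n - 2 ^ r) - ?S 0\<bar> \<le> (\<Sum>l<r. d l)"
    proof (rule Suc.IH)
      show "n - 2 ^ r < 2 ^ r" using Suc.prems(2) by simp
      fix l i :: nat assume l: "l < r" and i: "i < 2 ^ (r - l)"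
      have e: "2 ^ r = 2 ^ (r - l) * (2::nat) ^ l" using l by (simp flip: power_add)
      have "2 ^ (r - l) + i < (2::nat) ^ (Suc r - l)" using i l by (simp add: Suc_diff_le)
      from Suc.prems(1)[OF _ this] l
      have "\<bar>S ((2 ^ (r - l) + i + 1) * 2 ^ l) - S ((2 ^ (r - l) + i) * 2 ^ l)\<bar> \<le> d l" by simp
      then show "\<bar>?S ((i + 1) * 2 ^ l) - ?S (i * 2 ^ l)\<bar> \<le> d l" unfolding e by (simp add: algebra_simps)
    qed
    moreover have "2 ^ r + (n - 2 ^ r) = n" using False by simp
    moreover have "\<bar>S (2 ^ r) - S 0\<bar> \<le> d r" using Suc.prems(1)[of r 0] by simp
    ultimately show ?thesis by simp
  qed
qed simp

lemma power4_sum_le: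
  fixes d :: "nat \<Rightarrow> real"
  assumes "\<And>l. 0 \<le> d l"
  shows "(\<Sum>l<r. d l) ^ 4 \<le> real r ^ 3 * (\<Sum>l<r. d l ^ 4)"
proof -
  have cs: "(\<Sum>l<r. f l)\<^sup>2 \<le> real r * (\<Sum>l<r. (f l)\<^sup>2)" for f :: "nat \<Rightarrow> real"
    using Cauchy_Schwarz_ineq_sum[of "\<lambda>_. 1" f "{..<r}"] by simp
  have "(\<Sum>l<r. d l) ^ 4 = ((\<Sum>l<r. d l)\<^sup>2)\<^sup>2" by simp
  also have "\<dots> \<le> (real r * (\<Sum>l<r. (d l)\<^sup>2))\<^sup>2" by (intro power_mono cs) simp
  also have "\<dots> = (real r)\<^sup>2 * (\<Sum>l<r. (d l)\<^sup>2)\<^sup>2" by (simp add: power_mult_distrib)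
  also have "\<dots> \<le> (real r)\<^sup>2 * (real r * (\<Sum>l<r. ((d l)\<^sup>2)\<^sup>2))" by (intro mult_left_mono cs) simp
  finally show ?thesis by (simp add: power2_eq_square[of "real r"] power3_eq_cube mult.assoc)
qed

text \<open>
  A bound for the maximum of \<open>(S n - S 0) ^ 4\<close> over \<open>n < 2 ^ r\<close> that is linear in fourth powers of
  increments and can therefore be integrated term by term.
\<close>

definition chain_sum :: "nat \<Rightarrow> (nat \<Rightarrow> real) \<Rightarrow> real" where
  "chain_sum r S = real r ^ 3 * (\<Sum>l<r. \<Sum>i<2 ^ (r - l). (S ((i + 1) * 2 ^ l) - S (i * 2 ^ l)) ^ 4)"

lemma chain_sum_nonneg: "0 \<le> chain_sum r S"
  unfolding chain_sum_def by (intro mult_nonneg_nonneg sum_nonneg) auto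

lemma chain_sum_bound:
  assumes "n < 2 ^ r" shows "(S n - S 0) ^ 4 \<le> chain_sum r S"
proof -
  define d where "d l = root 4 (\<Sum>i<2 ^ (r - l). (S ((i + 1) * 2 ^ l) - S (i * 2 ^ l)) ^ 4)" for l
  have d4: "d l ^ 4 = (\<Sum>i<2 ^ (r - l). (S ((i + 1) * 2 ^ l) - S (i * 2 ^ l)) ^ 4)" and d0: "0 \<le> d l" for l
    unfolding d_def by (auto intro!: sum_nonneg real_root_pow_pos2)
  have "\<bar>S n - S 0\<bar> \<le> (\<Sum>l<r. d l)"
  proof (rule chaining[OF _ assms])
    fix l i assume "l < r" "i < (2::nat) ^ (r - l)"
    have "\<bar>S ((i + 1) * 2 ^ l) - S (i * 2 ^ l)\<bar> ^ 4 = (S ((i + 1) * 2 ^ l) - S (i * 2 ^ l)) ^ 4"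
      by (simp add: power_even_abs)
    also have "\<dots> \<le> d l ^ 4"
      unfolding d4 by (rule member_le_sum[where f="\<lambda>i. (S ((i + 1) * 2 ^ l) - S (i * 2 ^ l)) ^ 4"]) (use \<open>i < _\<close> in auto)
    finally show "\<bar>S ((i + 1) * 2 ^ l) - S (i * 2 ^ l)\<bar> \<le> d l" using d0 power_mono_iff[of "\<bar>S ((i + 1) * 2 ^ l) - S (i * 2 ^ l)\<bar>" "d l" 4] by simp
  qed
  then have "\<bar>S n - S 0\<bar> ^ 4 \<le> (\<Sum>l<r. d l) ^ 4" by (intro power_mono) auto
  also have "\<dots> \<le> real r ^ 3 * (\<Sum>l<r. d l ^ 4)" by (rule power4_sum_le[OF d0])
  finally show ?thesis unfolding chain_sum_def d4 by (simp add: power_even_abs)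
qed

lemma chain_sum_integral:
  assumes int: "\<And>u v. u \<le> v \<Longrightarrow> integrable M (\<lambda>x. (Y v x - Y u x) ^ 4)"
    and C: "\<And>u v. u \<le> v \<Longrightarrow> (\<integral>x. (Y v x - Y u x) ^ 4 \<partial>M) \<le> C * (real (v - u))\<^sup>2" and C0: "0 \<le> C"
  shows "integrable M (\<lambda>x. chain_sum r (\<lambda>n. Y (u + n) x))"
    and "(\<integral>x. chain_sum r (\<lambda>n. Y (u + n) x) \<partial>M) \<le> C * real r ^ 3 * 4 ^ r"
proof -
  have i: "integrable M (\<lambda>x. (Y (u + (i + 1) * 2 ^ l) x - Y (u + i * 2 ^ l) x) ^ 4)" for i l
    by (rule int) auto
  then show "integrable M (\<lambda>x. chain_sum r (\<lambda>n. Y (u + n) x))"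
    unfolding chain_sum_def by (intro integrable_mult_right Bochner_Integration.integrable_sum)
  have "(\<integral>x. chain_sum r (\<lambda>n. Y (u + n) x) \<partial>M) =
     real r ^ 3 * (\<Sum>l<r. \<Sum>i<2 ^ (r - l). (\<integral>x. (Y (u + (i + 1) * 2 ^ l) x - Y (u + i * 2 ^ l) x) ^ 4 \<partial>M))"
    unfolding chain_sum_def using i by (simp add: Bochner_Integration.integral_sum)
  also have "\<dots> \<le> real r ^ 3 * (\<Sum>l<r. \<Sum>i<(2::nat) ^ (r - l). C * (2 ^ l)\<^sup>2)"
  proof (intro mult_left_mono sum_mono)
    fix l i
    have "u + (i + 1) * 2 ^ l - (u + i * 2 ^ l) = 2 ^ l" by simp
    then show "(\<integral>x. (Y (u + (i + 1) * 2 ^ l) x - Y (u + i * 2 ^ l) x) ^ 4 \<partial>M) \<le> C * (2 ^ l)\<^sup>2"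
      using C[of "u + i * 2 ^ l" "u + (i + 1) * 2 ^ l"] by simp
  qed simp
  also have "(\<Sum>l<r. \<Sum>i<(2::nat) ^ (r - l). C * (2 ^ l)\<^sup>2) = (\<Sum>l<r. C * (2 ^ r * 2 ^ l))"
  proof (rule sum.cong[OF refl])
    fix l assume "l \<in> {..<r}"
    then have "(2::real) ^ r = 2 ^ (r - l) * 2 ^ l" by (simp flip: power_add)
    then show "(\<Sum>i<(2::nat) ^ (r - l). C * (2 ^ l)\<^sup>2) = C * (2 ^ r * 2 ^ l)"
      by (simp add: power2_eq_square)
  qed
  also have "\<dots> = C * 2 ^ r * (\<Sum>l<r. 2 ^ l)" by (simp add: sum_distrib_left mult_ac)
  also have "(\<Sum>l<r. (2::real) ^ l) = 2 ^ r - 1" by (simp add: sum_gp_strict)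
  also have "real r ^ 3 * (C * 2 ^ r * (2 ^ r - 1)) \<le> real r ^ 3 * (C * 2 ^ r * 2 ^ r)"
    using C0 by (intro mult_left_mono) auto
  also have "(C * 2 ^ r * 2 ^ r) = C * 4 ^ r"
    by (simp add: mult.assoc flip: power_mult_distrib)
  finally show "(\<integral>x. chain_sum r (\<lambda>n. Y (u + n) x) \<partial>M) \<le> C * real r ^ 3 * 4 ^ r" by (simp add: mult_ac)
qed

lemma AE_summable_of_integrals:
  fixes f :: "nat \<Rightarrow> 'a \<Rightarrow> real"
  assumes i: "\<And>n. integrable M (f n)" and nn: "\<And>n x. 0 \<le> f n x" and s: "summable (\<lambda>n. \<integral>x. f n x \<partial>M)"
  shows "AE x in M. summable (\<lambda>n. f n x)"
proof -
  have m [measurable]: "f n \<in> borel_measurable M" for n using i by auto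
  have "(\<integral>\<^sup>+x. (\<Sum>n. ennreal (f n x)) \<partial>M) = (\<Sum>n. \<integral>\<^sup>+x. ennreal (f n x) \<partial>M)"
    by (rule nn_integral_suminf) simp
  also have "\<dots> = (\<Sum>n. ennreal (\<integral>x. f n x \<partial>M))"
    using i nn by (simp add: nn_integral_eq_integral)
  also have "\<dots> = ennreal (\<Sum>n. \<integral>x. f n x \<partial>M)"
    using s nn by (intro suminf_ennreal2) auto
  finally have "(\<integral>\<^sup>+x. (\<Sum>n. ennreal (f n x)) \<partial>M) \<noteq> \<infinity>" by simp
  then have "AE x in M. (\<Sum>n. ennreal (f n x)) \<noteq> \<infinity>"
    by (intro nn_integral_PInf_AE) auto
  then show ?thesis
    by eventually_elim (use nn in \<open>auto intro: summable_suminf_not_top\<close>)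
qed

lemma normal_cdf_strict_mono: "x < y \<Longrightarrow> normal_cdf x < normal_cdf y"
  by (rule DERIV_pos_imp_increasing) (auto intro!: exI normal_cdf_deriv normal_density_pos)

lemma normal_cdf_strict_bounds: "0 < normal_cdf z" "normal_cdf z < 1"
  using normal_cdf_strict_mono[of "z - 1" z] normal_cdf_strict_mono[of z "z + 1"]
    normal_cdf_bounds[of "z - 1"] normal_cdf_bounds[of "z + 1"] by auto

lemma normal_cdf_borel [measurable]: "normal_cdf \<in> borel_measurable borel"
  by (rule borel_measurable_mono) (auto simp: mono_def order_le_less dest: normal_cdf_strict_mono)

lemma normal_measure_lessThan: "measure gauss {..<z} = normal_cdf z"
proof -
  interpret prob_space gauss by (rule prob_space_std_normal)
  have "emeasure gauss {z} = 0"
    by (subst emeasure_density) (auto simp: nn_integral_cmult_indicator mult.commute intro!: AE_iff_nn_integral[THEN iffD1] nn_integral_0_iff_AE[THEN iffD2] AE_I[where N="{z}"])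
  then have "measure gauss {z} = 0" by (simp add: measure_def)
  moreover have "{..z} = {..<z} \<union> {z}" by auto
  ultimately show ?thesis unfolding normal_cdf_def
    by (simp only:) (subst finite_measure_Union, auto)
qed

lemma normal_cdf_uniform:
  assumes "0 \<le> c" "c \<le> 1"
  shows "measure gauss {z. normal_cdf z < c} = c"
proof -
  interpret real_distribution gauss by (rule real_dist_normal_dist)
  have cdf: "cdf gauss = normal_cdf" by (simp add: cdf_def2 normal_cdf_def fun_eq_iff)
  consider "c = 0" | "c = 1" | "0 < c" "c < 1" using assms by linarith
  then show ?thesis
  proof cases
    case 1
    then have "{z. normal_cdf z < c} = {}" using normal_cdf_bounds by (auto simp: not_less)
    then show ?thesis using 1 by simp
  next
    case 2
    then have "{z. normal_cdf z < c} = space gauss" using normal_cdf_strict_bounds by auto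
    then show ?thesis using 2 prob_space by simp
  next
    case 3
    have "eventually (\<lambda>z. normal_cdf z < c) at_bot"
      using order_tendstoD(2)[OF cdf_lim_at_bot] 3 unfolding cdf by simp
    moreover have "eventually (\<lambda>z. c < normal_cdf z) at_top"
      using order_tendstoD(1)[OF cdf_lim_at_top, of c] 3 prob_space unfolding cdf by simp
    ultimately obtain z1 z2 where z: "normal_cdf z1 < c" "c < normal_cdf z2"
      using eventually_happens'[of at_bot] eventually_happens'[of at_top] by fastforce
    then have "z1 < z2" using normal_cdf_strict_mono[of z2 z1] by (cases z1 z2 rule: linorder_cases) auto
    then obtain z0 where z0: "normal_cdf z0 = c"
      using IVT'[of normal_cdf z1 c z2] z
      by (auto simp: less_le intro!: continuous_at_imp_continuous_on DERIV_isCont[OF normal_cdf_deriv])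
    have "{z. normal_cdf z < c} = {..<z0}"
    proof safe
      fix z assume "normal_cdf z < c"
      then show "z < z0" using normal_cdf_strict_mono[of z0 z] z0 by (cases z z0 rule: linorder_cases) auto
    next
      fix z assume "z < z0"
      then show "normal_cdf z < c" using normal_cdf_strict_mono[of z z0] z0 by simp
    qed
    then show ?thesis using normal_measure_lessThan[of z0] z0 by simp
  qed
qed

text \<open>
  Turns a standard normal variable into an index that is uniformly distributed below \<open>M\<close> and
  nondecreasing in the variable.
\<close>

definition quantile_index :: "nat \<Rightarrow> real \<Rightarrow> nat" where
  "quantile_index M z = nat \<lfloor>real M * normal_cdf z\<rfloor>"

lemma quantile_index_borel [measurable]: "quantile_index M \<in> measurable borel (count_space UNIV)"
  unfolding quantile_index_def by measurable

lemma quantile_index_less_iff: "0 < M \<Longrightarrow> quantile_index M z < k \<longleftrightarrow> normal_cdf z < real k / real M"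
  using normal_cdf_bounds[of z] unfolding quantile_index_def
  by (auto simp: nat_less_iff floor_less_iff field_simps)

lemma quantile_index_less: "0 < M \<Longrightarrow> quantile_index M z < M"
  using quantile_index_less_iff[of M z M] normal_cdf_strict_bounds[of z] by simp

lemma quantile_index_prob_less:
  assumes "0 < M" "k \<le> M"
  shows "measure gauss {z. quantile_index M z < k} = real k / real M"
  unfolding quantile_index_less_iff[OF assms(1)] using assms by (intro normal_cdf_uniform) auto

lemma quantile_index_prob:
  assumes M: "0 < M" and k: "k < M"
  shows "measure gauss {z. quantile_index M z = k} = 1 / real M"
proof -
  interpret prob_space gauss by (rule prob_space_std_normal)
  have "{z. quantile_index M z < Suc k} = {z. quantile_index M z < k} \<union> {z. quantile_index M z = k}" by auto
  moreover have "measure gauss ({z. quantile_index M z < k} \<union> {z. quantile_index M z = k}) =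
     measure gauss {z. quantile_index M z < k} + measure gauss {z. quantile_index M z = k}"
    by (rule finite_measure_Union) auto
  ultimately show ?thesis
    using quantile_index_prob_less[OF M, of "Suc k"] quantile_index_prob_less[OF M, of k] k by (simp add: add_divide_distrib)
qed

lemma quantile_index_integral:
  fixes f :: "nat \<Rightarrow> real"
  assumes M: "0 < M"
  shows "(\<integral>z. f (quantile_index M z) \<partial>gauss) = (\<Sum>i<M. f i) / real M"
    and "integrable gauss (\<lambda>z. f (quantile_index M z))"
proof -
  interpret prob_space gauss by (rule prob_space_std_normal)
  have e: "f (quantile_index M z) = (\<Sum>i<M. f i * indicator {z. quantile_index M z = i} z)" for z
    using quantile_index_less[OF M, of z] by (simp add: indicator_def sum.delta' if_distrib cong: if_cong)
  have i: "integrable gauss (\<lambda>z. f i * indicator {z. quantile_index M z = i} z)" for i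
    by (intro integrable_mult_right integrable_real_indicator) (auto simp: less_top[symmetric])
  show "integrable gauss (\<lambda>z. f (quantile_index M z))"
    unfolding e by (intro Bochner_Integration.integrable_sum i)
  have "(\<integral>z. f (quantile_index M z) \<partial>gauss) =
      (\<Sum>i<M. f i * measure gauss {z. quantile_index M z = i})"
    unfolding e by (subst Bochner_Integration.integral_sum[OF i]) simp
  also have "\<dots> = (\<Sum>i<M. f i) / real M"
    using quantile_index_prob[OF M] by (simp add: sum_divide_distrib)
  finally show "(\<integral>z. f (quantile_index M z) \<partial>gauss) = (\<Sum>i<M. f i) / real M" .
qed

lemma sorting_permutation:
  fixes s :: "nat \<Rightarrow> real"
  obtains p where "bij_betw p {..<M} {..<M}" "\<And>i j. i \<le> j \<Longrightarrow> j < M \<Longrightarrow> s (p i) \<le> s (p j)"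
proof -
  let ?xs = "sort_key s [0..<M]"
  have len: "length ?xs = M" and set: "set ?xs = {..<M}" and dist: "distinct ?xs" by auto
  have "bij_betw (\<lambda>i. ?xs ! i) {..<M} {..<M}"
    using bij_betw_nth[OF dist, of "{..<M}" "{..<M}"] len set by simp
  moreover have "s (?xs ! i) \<le> s (?xs ! j)" if "i \<le> j" "j < M" for i j
    using sorted_nth_mono[OF sorted_sort_key[of s "[0..<M]"], of i j] that by simp
  ultimately show ?thesis using that by blast
qed

lemma clamp_dist:
  fixes x y A :: real
  assumes "0 < A"
  shows "\<bar>x - y\<bar> \<le> \<bar>max (-A) (min A x) - max (-A) (min A y)\<bar> + x\<^sup>2 / A + y\<^sup>2 / A"
proof -
  have *: "\<bar>x - max (-A) (min A x)\<bar> \<le> x\<^sup>2 / A" for x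
  proof (cases "\<bar>x\<bar> \<le> A")
    case True
    then have "max (-A) (min A x) = x" by (auto simp: max_def min_def)
    then show ?thesis using assms by simp
  next
    case False
    then have "\<bar>x - max (-A) (min A x)\<bar> \<le> \<bar>x\<bar>" using assms by (auto simp: max_def min_def)
    also have "\<bar>x\<bar> * A \<le> \<bar>x\<bar> * \<bar>x\<bar>" using False by (intro mult_left_mono) auto
    then have "\<bar>x\<bar> \<le> x\<^sup>2 / A" using assms by (simp add: field_simps power2_eq_square abs_mult_self_eq)
    finally show ?thesis .
  qed
  have "\<bar>x - y\<bar> \<le> \<bar>c - d\<bar> + p + q" if "\<bar>x - c\<bar> \<le> p" "\<bar>y - d\<bar> \<le> q" for c d p q using that by linarith
  from this[OF *[of x] *[of y]] show ?thesis .
qed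

text \<open>
  Layer-cake formula: a level \<open>a\<close> contributes exactly when it separates the two numbers.
\<close>

lemma clamp_layer_cake:
  fixes x y A :: real
  assumes "0 < A"
  shows "ennreal \<bar>max (-A) (min A x) - max (-A) (min A y)\<bar> =
     (\<integral>\<^sup>+a. ennreal \<bar>indicator {x..} a - indicator {y..} a :: real\<bar> * indicator {-A..<A} a \<partial>lborel)"
proof -
  have *: "ennreal \<bar>max (-A) (min A x) - max (-A) (min A y)\<bar> =
     (\<integral>\<^sup>+a. ennreal \<bar>indicator {x..} a - indicator {y..} a :: real\<bar> * indicator {-A..<A} a \<partial>lborel)"
    if xy: "x \<le> y" for x y
  proof -
    have "(\<integral>\<^sup>+a. ennreal \<bar>indicator {x..} a - indicator {y..} a :: real\<bar> * indicator {-A..<A} a \<partial>lborel) =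
      (\<integral>\<^sup>+a. indicator {max (-A) (min A x)..<max (-A) (min A y)} a \<partial>lborel)"
      using xy assms by (intro nn_integral_cong) (auto simp: indicator_def max_def min_def)
    also have "\<dots> = ennreal (max (-A) (min A y) - max (-A) (min A x))"
      using xy by (simp add: max_def min_def)
    finally show ?thesis using xy by (simp add: max_def min_def abs_minus_commute)
  qed
  show ?thesis
  proof (cases "x \<le> y")
    case False
    then show ?thesis using *[of y x] by (simp add: abs_minus_commute)
  qed (rule *)
qed

lemma std_normal_abs_moment: "integrable gauss (\<lambda>z. \<bar>z\<bar>)" "(\<integral>z. \<bar>z\<bar> \<partial>gauss) \<le> 1"
  and std_normal_second_moment: "integrable gauss (\<lambda>z. z\<^sup>2)" "(\<integral>z. z\<^sup>2 \<partial>gauss) = 1"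
proof -
  interpret prob_space gauss by (rule prob_space_std_normal)
  show i2: "integrable gauss (\<lambda>z. z\<^sup>2)" by (rule integrable_std_normal_distribution_moment)
  show m2: "(\<integral>z. z\<^sup>2 \<partial>gauss) = 1"
    using std_normal_distribution_even_moments(1)[of 1] by simp
  show i1: "integrable gauss (\<lambda>z. \<bar>z\<bar>)"
    using integrable_abs[OF integrable_std_normal_distribution_moment[of 1]] by simp
  have "(\<integral>z. \<bar>z\<bar> \<partial>gauss) \<le> (\<integral>z. (1 + z\<^sup>2) / 2 \<partial>gauss)"
  proof (rule integral_mono)
    show "\<bar>z\<bar> \<le> (1 + z\<^sup>2) / 2" for z :: real using sum_squares_bound[of 1 "\<bar>z\<bar>"] by simp
  qed (use i1 i2 in auto)
  also have "\<dots> = 1" using i2 m2 prob_space by simp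
  finally show "(\<integral>z. \<bar>z\<bar> \<partial>gauss) \<le> 1" .
qed

text \<open>
  Replacing a unit mass at \<open>s\<close> by a normal law of standard deviation \<open>e\<close> moves the mass by \<open>e * \<bar>z\<bar>\<close> on
  average.
\<close>

lemma smoothing_cost:
  assumes e: "0 < e"
  shows "(\<integral>\<^sup>+a. ennreal \<bar>indicator {s..} a - normal_cdf ((a - s) / e)\<bar> * indicator {-A..<A} a \<partial>lborel) \<le> ennreal e"
proof (cases "0 < A")
  case A: True
  let ?g = "gauss"
  interpret prob_space ?g by (rule prob_space_std_normal)
  interpret P: pair_sigma_finite ?g lborel by unfold_locales
  have "ennreal \<bar>indicator {s..} a - normal_cdf ((a - s) / e)\<bar> \<le>
      (\<integral>\<^sup>+z. ennreal \<bar>indicator {s..} a - indicator {s + e * z..} a\<bar> \<partial>?g)" for a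
  proof -
    have eq: "indicator {s + e * z..} a = (indicator {..(a - s) / e} z :: real)" for z
      using e by (auto simp: indicator_def field_simps)
    have i: "integrable ?g (\<lambda>z. indicator {..(a - s) / e} z :: real)" by (auto simp: less_top[symmetric])
    have "indicator {s..} a - normal_cdf ((a - s) / e) = (\<integral>z. indicator {s..} a - indicator {..(a - s) / e} z \<partial>?g)"
      using i prob_space by (simp add: normal_cdf_def)
    also have "\<bar>\<dots>\<bar> \<le> (\<integral>z. \<bar>indicator {s..} a - indicator {..(a - s) / e} z\<bar> \<partial>?g)"
      by (rule integral_abs_bound)
    finally have "ennreal \<bar>indicator {s..} a - normal_cdf ((a - s) / e)\<bar> \<le> ennreal (\<integral>z. \<bar>indicator {s..} a - indicator {..(a - s) / e} z\<bar> \<partial>?g)"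
      by (rule ennreal_leI)
    also have "\<dots> = (\<integral>\<^sup>+z. ennreal \<bar>indicator {s..} a - indicator {..(a - s) / e} z\<bar> \<partial>?g)"
      using i by (intro nn_integral_eq_integral[symmetric]) auto
    finally show ?thesis unfolding eq .
  qed
  then have "(\<integral>\<^sup>+a. ennreal \<bar>indicator {s..} a - normal_cdf ((a - s) / e)\<bar> * indicator {-A..<A} a \<partial>lborel) \<le>
      (\<integral>\<^sup>+a. (\<integral>\<^sup>+z. ennreal \<bar>indicator {s..} a - indicator {s + e * z..} a\<bar> \<partial>?g) * indicator {-A..<A} a \<partial>lborel)"
    by (intro nn_integral_mono mult_right_mono) auto
  also have "\<dots> = (\<integral>\<^sup>+a. (\<integral>\<^sup>+z. ennreal \<bar>indicator {s..} a - indicator {s + e * z..} a\<bar> * indicator {-A..<A} a \<partial>?g) \<partial>lborel)"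
    by (intro nn_integral_cong nn_integral_multc[symmetric]) (simp add: indicator_def)
  also have "\<dots> = (\<integral>\<^sup>+z. (\<integral>\<^sup>+a. ennreal \<bar>indicator {s..} a - indicator {s + e * z..} a\<bar> * indicator {-A..<A} a \<partial>lborel) \<partial>?g)"
  proof (rule P.Fubini')
    have [measurable]: "Measurable.pred (?g \<Otimes>\<^sub>M lborel) (\<lambda>(z, a). s + e * z \<le> a)" by measurable
    show "(\<lambda>(z, a). ennreal \<bar>indicator {s..} a - indicator {s + e * z..} a\<bar> * indicator {-A..<A} a) \<in> borel_measurable (?g \<Otimes>\<^sub>M lborel)"
      unfolding indicator_def atLeast_iff by measurable
  qed
  also have "\<dots> = (\<integral>\<^sup>+z. ennreal \<bar>max (-A) (min A s) - max (-A) (min A (s + e * z))\<bar> \<partial>?g)"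
    by (simp add: clamp_layer_cake[OF A])
  also have "\<dots> \<le> (\<integral>\<^sup>+z. ennreal (e * \<bar>z\<bar>) \<partial>?g)"
  proof (intro nn_integral_mono ennreal_leI)
    fix z
    have "\<bar>max (-A) (min A s) - max (-A) (min A (s + e * z))\<bar> \<le> \<bar>e * z\<bar>" by (auto simp: max_def min_def)
    then show "\<bar>max (-A) (min A s) - max (-A) (min A (s + e * z))\<bar> \<le> e * \<bar>z\<bar>" using e by (simp add: abs_mult)
  qed
  also have "\<dots> = ennreal (e * (\<integral>z. \<bar>z\<bar> \<partial>?g))"
    using e std_normal_abs_moment(1) by (subst nn_integral_eq_integral) auto
  also have "\<dots> \<le> ennreal e"
    using mult_left_mono[OF std_normal_abs_moment(2), of e] e by (intro ennreal_leI) auto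
  finally show ?thesis .
next
  case False
  then have "{-A..<A} = {}" by auto
  then show ?thesis by simp
qed

text \<open>
  Both \<open>s (p (quantile_index M z))\<close> and \<open>sg * z\<close> are nondecreasing in \<open>z\<close>, so their sublevel sets are
  nested, and after truncation at height \<open>A\<close> their \<open>L\<^sup>1\<close> distance is the integral over \<open>{-A..<A}\<close> of the
  difference of the distribution functions. Smoothing the discrete one costs \<open>e\<close>, and the hypothesis
  bounds the remaining difference by \<open>d\<close> on an interval of length \<open>2 * A\<close>. Chebyshev's inequality
  bounds the loss by truncation by \<open>Q / A\<close> for each of the two variables.
\<close>

lemma quantile_coupling:
  fixes s :: "nat \<Rightarrow> real"
  assumes M: "0 < M" and sg: "0 < sg" and e: "0 < e" and A: "0 < A"
    and smooth: "\<And>a. \<bar>(\<Sum>i<M. normal_cdf ((a - s i) / e)) / real M - normal_cdf (a / sg)\<bar> \<le> d"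
    and sq: "(\<Sum>i<M. (s i)\<^sup>2) / real M \<le> Q" "sg\<^sup>2 \<le> Q"
    and p: "bij_betw p {..<M} {..<M}" "\<And>i j. i \<le> j \<Longrightarrow> j < M \<Longrightarrow> s (p i) \<le> s (p j)"
  shows "integrable gauss (\<lambda>z. \<bar>s (p (quantile_index M z)) - sg * z\<bar>)"
    and "(\<integral>z. \<bar>s (p (quantile_index M z)) - sg * z\<bar> \<partial>gauss) \<le> e + 2 * A * d + 2 * Q / A"
proof -
  let ?g = "gauss"
  interpret prob_space ?g by (rule prob_space_std_normal)
  interpret P: pair_sigma_finite ?g lborel by unfold_locales
  define T where "T z = s (p (quantile_index M z))" for z
  have d0: "0 \<le> d" using smooth[of 0] by linarith
  have T_meas [measurable]: "T \<in> borel_measurable borel"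
    unfolding T_def by measurable
  have T2: "(\<integral>z. (T z)\<^sup>2 \<partial>?g) \<le> Q" "integrable ?g (\<lambda>z. (T z)\<^sup>2)"
    using quantile_index_integral[OF M, of "\<lambda>i. (s (p i))\<^sup>2"] sq(1)
      sum.reindex_bij_betw[OF p(1), of "\<lambda>i. (s i)\<^sup>2"] by (simp_all add: T_def)
  define F where "F a = real (card {i. i < M \<and> s i \<le> a}) / real M" for a
  \<comment> \<open>\<open>T\<close> is a nondecreasing function of \<open>z\<close> with distribution function \<open>F\<close>\<close>
  have T_le: "T z \<le> a \<longleftrightarrow> quantile_index M z < card {i. i < M \<and> s i \<le> a}" for z a
  proof -
    let ?J = "{j. j < M \<and> s (p j) \<le> a}"
    have "card {i. i < M \<and> s i \<le> a} = card ?J"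
    proof (rule bij_betw_same_card[symmetric, of p])
      show "bij_betw p ?J {i. i < M \<and> s i \<le> a}"
        using p(1) by (auto simp: bij_betw_def inj_on_def image_iff Set.image_iff)
    qed
    moreover have J: "?J = {..<card ?J}"
    proof -
      define J where "J = ?J"
      have down: "i \<in> J" if "i \<le> j" "j \<in> J" for i j using that p(2)[of i j] by (auto simp: J_def)
      have fin: "finite J" by (simp add: J_def)
      have "J = {..<card J}"
      proof (cases "J = {}")
        case False
        define m where "m = Max J"
        have "m \<in> J" unfolding m_def using Max_in[OF fin False] .
        then have J: "J = {..m}" using down[of _ m] Max_ge[OF fin] unfolding m_def by auto
        then show ?thesis by (simp add: lessThan_Suc_atMost)
      qed simp
      then show ?thesis by (simp only: J_def)
    qed
    moreover have "T z \<le> a \<longleftrightarrow> quantile_index M z \<in> ?J" using quantile_index_less[OF M, of z] by (simp add: T_def)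
    moreover have "quantile_index M z \<in> ?J \<longleftrightarrow> quantile_index M z < card ?J"
      using eqset_imp_iff[OF J, of "quantile_index M z"] by (simp only: lessThan_iff)
    ultimately show ?thesis by simp
  qed
  have cM: "card {i. i < M \<and> s i \<le> a} \<le> M" for a
    using card_mono[of "{..<M}" "{i. i < M \<and> s i \<le> a}"] by auto
  have down: "measure ?g {z. T z \<le> a} = F a" for a
    unfolding T_le F_def by (rule quantile_index_prob_less[OF M cM])
  have sgz: "{z. sg * z \<le> a} = {..a / sg}" for a using sg by (auto simp: field_simps)
  have diff: "(\<integral>\<^sup>+z. ennreal \<bar>indicator {T z..} a - indicator {sg * z..} a :: real\<bar> \<partial>?g) = ennreal \<bar>F a - normal_cdf (a / sg)\<bar>" for a
  proof -
    let ?B = "{z. T z \<le> a}" and ?D = "{..a / sg}"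
    have [measurable]: "?B \<in> sets borel" by measurable
    have iB: "integrable ?g (\<lambda>z. indicator ?B z :: real)" and iD: "integrable ?g (\<lambda>z. indicator ?D z :: real)"
      by (auto simp: less_top[symmetric])
    have ind: "\<bar>indicator {T z..} a - indicator {sg * z..} a :: real\<bar> = \<bar>indicator ?B z - indicator ?D z\<bar>" for z
      using sgz[of a] by (auto simp: indicator_def)
    have T_mono: "T y \<le> a" if "T z \<le> a" "y \<le> z" for y z
    proof -
      have "normal_cdf y \<le> normal_cdf z" using that(2) normal_cdf_strict_mono[of y z] by (cases "y = z") auto
      then have "quantile_index M y \<le> quantile_index M z"
        unfolding quantile_index_def by (intro nat_mono floor_mono mult_left_mono) auto
      then show ?thesis using that(1) unfolding T_le by simp
    qed
    have nested: "?B \<subseteq> ?D \<or> ?D \<subseteq> ?B"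
    proof (rule ccontr)
      assume "\<not> ?thesis"
      then obtain y z where "y \<in> ?B" "y \<notin> ?D" "z \<in> ?D" "z \<notin> ?B" by blast
      then show False using T_mono[of y z] by auto
    qed
    have "(\<integral>z. \<bar>indicator ?B z - indicator ?D z\<bar> \<partial>?g) = \<bar>measure ?g ?B - measure ?g ?D\<bar>"
    proof (cases "?B \<subseteq> ?D")
      case True
      then have "(\<integral>z. \<bar>indicator ?B z - indicator ?D z\<bar> \<partial>?g) = (\<integral>z. (indicator ?D z - indicator ?B z :: real) \<partial>?g)"
        by (intro Bochner_Integration.integral_cong) (auto simp: indicator_def)
      also have "\<dots> = measure ?g ?D - measure ?g ?B" using iB iD by simp
      moreover have "measure ?g ?B \<le> measure ?g ?D" using True by (intro finite_measure_mono) auto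
      ultimately show ?thesis by simp
    next
      case False
      then have sub: "?D \<subseteq> ?B" using nested by blast
      then have "(\<integral>z. \<bar>indicator ?B z - indicator ?D z\<bar> \<partial>?g) = (\<integral>z. (indicator ?B z - indicator ?D z :: real) \<partial>?g)"
        by (intro Bochner_Integration.integral_cong) (auto simp: indicator_def)
      also have "\<dots> = measure ?g ?B - measure ?g ?D" using iB iD by simp
      moreover have "measure ?g ?D \<le> measure ?g ?B" using sub by (intro finite_measure_mono) auto
      ultimately show ?thesis by simp
    qed
    then show ?thesis
      unfolding ind using iB iD down[of a]
      by (subst nn_integral_eq_integral) (auto simp: normal_cdf_def)
  qed
  have Fs: "F a = (\<Sum>i<M. indicator {s i..} a) / real M" for a
  proof -
    have "(\<Sum>i<M. indicator {s i..} a :: real) = (\<Sum>i\<in>{i. i < M \<and> s i \<le> a}. 1)"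
      by (rule sum.mono_neutral_cong_right) (auto simp: indicator_def)
    then show ?thesis by (simp add: F_def)
  qed
  let ?c = "\<lambda>x. max (-A) (min A x)"
  have "(\<integral>\<^sup>+z. ennreal \<bar>?c (T z) - ?c (sg * z)\<bar> \<partial>?g) =
      (\<integral>\<^sup>+z. (\<integral>\<^sup>+a. ennreal \<bar>indicator {T z..} a - indicator {sg * z..} a :: real\<bar> * indicator {-A..<A} a \<partial>lborel) \<partial>?g)"
    by (simp add: clamp_layer_cake[OF A])
  also have "\<dots> = (\<integral>\<^sup>+a. (\<integral>\<^sup>+z. ennreal \<bar>indicator {T z..} a - indicator {sg * z..} a :: real\<bar> * indicator {-A..<A} a \<partial>?g) \<partial>lborel)"
  proof (rule P.Fubini'[symmetric])
    have [measurable]: "Measurable.pred (?g \<Otimes>\<^sub>M lborel) (\<lambda>(z, a). sg * z \<le> a)" "Measurable.pred (?g \<Otimes>\<^sub>M lborel) (\<lambda>(z, a). T z \<le> a)"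
      by measurable
    show "(\<lambda>(z, a). ennreal \<bar>indicator {T z..} a - indicator {sg * z..} a :: real\<bar> * indicator {-A..<A} a) \<in> borel_measurable (?g \<Otimes>\<^sub>M lborel)"
      unfolding indicator_def atLeast_iff by measurable
  qed
  also have "\<dots> = (\<integral>\<^sup>+a. ennreal \<bar>F a - normal_cdf (a / sg)\<bar> * indicator {-A..<A} a \<partial>lborel)"
  proof (intro nn_integral_cong)
    fix a
    have [measurable]: "Measurable.pred ?g (\<lambda>z. T z \<le> a)" "Measurable.pred ?g (\<lambda>z. sg * z \<le> a)" by measurable
    show "(\<integral>\<^sup>+z. ennreal \<bar>indicator {T z..} a - indicator {sg * z..} a :: real\<bar> * indicator {-A..<A} a \<partial>?g) =
        ennreal \<bar>F a - normal_cdf (a / sg)\<bar> * indicator {-A..<A} a"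
      unfolding diff[symmetric] by (rule nn_integral_multc) (simp add: indicator_def)
  qed
  also have "\<dots> \<le> (\<integral>\<^sup>+a. (\<Sum>i<M. ennreal (1 / real M) * (ennreal \<bar>indicator {s i..} a - normal_cdf ((a - s i) / e)\<bar> * indicator {-A..<A} a))
       + ennreal d * indicator {-A..<A} a \<partial>lborel)"
  proof (rule nn_integral_mono)
    fix a
    have "\<bar>F a - normal_cdf (a / sg)\<bar> \<le> \<bar>F a - (\<Sum>i<M. normal_cdf ((a - s i) / e)) / real M\<bar> + d"
      using smooth[of a] by linarith
    also have "F a - (\<Sum>i<M. normal_cdf ((a - s i) / e)) / real M = (\<Sum>i<M. 1 / real M * (indicator {s i..} a - normal_cdf ((a - s i) / e)))"
      by (simp add: Fs sum_subtractf diff_divide_distrib sum_divide_distrib)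
    also have "\<bar>\<dots>\<bar> \<le> (\<Sum>i<M. 1 / real M * \<bar>indicator {s i..} a - normal_cdf ((a - s i) / e)\<bar>)"
      by (rule order_trans[OF sum_abs]) (simp add: abs_mult)
    finally have "ennreal \<bar>F a - normal_cdf (a / sg)\<bar> \<le> ennreal ((\<Sum>i<M. 1 / real M * \<bar>indicator {s i..} a - normal_cdf ((a - s i) / e)\<bar>) + d)"
      by (intro ennreal_leI) simp
    also have "\<dots> = (\<Sum>i<M. ennreal (1 / real M) * ennreal \<bar>indicator {s i..} a - normal_cdf ((a - s i) / e)\<bar>) + ennreal d"
    proof -
      let ?u = "\<lambda>i. \<bar>indicator {s i..} a - normal_cdf ((a - s i) / e)\<bar>"
      have "(\<Sum>i<M. ennreal (1 / real M) * ennreal (?u i)) = (\<Sum>i<M. ennreal (1 / real M * ?u i))"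
        by (intro sum.cong refl ennreal_mult[symmetric]) auto
      also have "\<dots> = ennreal (\<Sum>i<M. 1 / real M * ?u i)" by (rule sum_ennreal) simp
      finally show ?thesis using ennreal_plus[OF sum_nonneg d0, of "{..<M}" "\<lambda>i. 1 / real M * ?u i"] by simp
    qed
    finally show "ennreal \<bar>F a - normal_cdf (a / sg)\<bar> * indicator {-A..<A} a \<le>
       (\<Sum>i<M. ennreal (1 / real M) * (ennreal \<bar>indicator {s i..} a - normal_cdf ((a - s i) / e)\<bar> * indicator {-A..<A} a))
       + ennreal d * indicator {-A..<A} a"
      by (cases "a \<in> {-A..<A}") auto
  qed
  also have "\<dots> = (\<Sum>i<M. ennreal (1 / real M) * (\<integral>\<^sup>+a. ennreal \<bar>indicator {s i..} a - normal_cdf ((a - s i) / e)\<bar> * indicator {-A..<A} a \<partial>lborel))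
       + ennreal d * (\<integral>\<^sup>+a. indicator {-A..<A} a \<partial>lborel)"
    by (simp add: nn_integral_add nn_integral_sum nn_integral_cmult del: nn_integral_indicator)
  also have "\<dots> \<le> (\<Sum>i<M. ennreal (1 / real M) * ennreal e) + ennreal d * ennreal (2 * A)"
    using A by (intro add_mono sum_mono mult_left_mono smoothing_cost[OF e]) auto
  also have "\<dots> = ennreal (e + 2 * A * d)"
  proof -
    have "(\<Sum>i<M. ennreal (1 / real M) * ennreal e) = (\<Sum>i<M. ennreal (1 / real M * e))"
      using e by (intro sum.cong refl ennreal_mult[symmetric]) auto
    also have "\<dots> = ennreal (\<Sum>i<M. 1 / real M * e)" using e by (intro sum_ennreal) auto
    also have "(\<Sum>i<M. 1 / real M * e) = e" using M by simp
    finally have "(\<Sum>i<M. ennreal (1 / real M) * ennreal e) = ennreal e" .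
    moreover have "ennreal d * ennreal (2 * A) = ennreal (2 * A * d)"
      using A d0 by (subst ennreal_mult[symmetric]) (auto simp: mult_ac)
    ultimately show ?thesis using A d0 e by (simp add: ennreal_plus)
  qed
  finally have clamp: "(\<integral>\<^sup>+z. ennreal \<bar>?c (T z) - ?c (sg * z)\<bar> \<partial>?g) \<le> ennreal (e + 2 * A * d)" .
  have nn: "0 \<le> e + 2 * A * d" using e A d0 by simp
  have cint: "integrable ?g (\<lambda>z. \<bar>?c (T z) - ?c (sg * z)\<bar>)"
  proof (rule integrable_const_bound[of _ "2 * A"])
    show "AE z in ?g. norm \<bar>?c (T z) - ?c (sg * z)\<bar> \<le> 2 * A" using A by (auto simp: max_def min_def)
  qed simp
  have clamp': "(\<integral>z. \<bar>?c (T z) - ?c (sg * z)\<bar> \<partial>?g) \<le> e + 2 * A * d"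
    using clamp nn by (subst (asm) nn_integral_eq_integral[OF cint]) auto
  let ?bd = "\<lambda>z. \<bar>?c (T z) - ?c (sg * z)\<bar> + (T z)\<^sup>2 / A + (sg * z)\<^sup>2 / A"
  have z2: "integrable ?g (\<lambda>z. (sg * z)\<^sup>2 / A)" "(\<integral>z. (sg * z)\<^sup>2 / A \<partial>?g) = sg\<^sup>2 / A"
    using std_normal_second_moment by (simp_all add: power_mult_distrib)
  have ibd: "integrable ?g ?bd"
    by (rule Bochner_Integration.integrable_add[OF Bochner_Integration.integrable_add[OF cint integrable_divide_zero[OF T2(2)]] z2(1)])
  show int: "integrable ?g (\<lambda>z. \<bar>s (p (quantile_index M z)) - sg * z\<bar>)"
    unfolding T_def[symmetric]
    by (rule Bochner_Integration.integrable_bound[OF ibd]) (use clamp_dist[OF A] in \<open>auto intro!: AE_I2 order_trans[OF _ abs_ge_self]\<close>)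
  have "(\<integral>z. \<bar>T z - sg * z\<bar> \<partial>?g) \<le> (\<integral>z. ?bd z \<partial>?g)"
    using int ibd clamp_dist[OF A] unfolding T_def[symmetric] by (intro integral_mono) auto
  also have "\<dots> = (\<integral>z. \<bar>?c (T z) - ?c (sg * z)\<bar> \<partial>?g) + (\<integral>z. (T z)\<^sup>2 \<partial>?g) / A + sg\<^sup>2 / A"
    using cint T2(2) z2 by simp
  also have "\<dots> \<le> (e + 2 * A * d) + Q / A + Q / A"
    using clamp' T2(1) sq(2) A by (intro add_mono divide_right_mono) auto
  finally show "(\<integral>z. \<bar>s (p (quantile_index M z)) - sg * z\<bar> \<partial>?g) \<le> e + 2 * A * d + 2 * Q / A"
    by (simp add: T_def)
qed

section \<open>Construction of Brownian motion\<close>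

text \<open>
  The coordinates are substituted one at a time; the rotation by 45 degrees preserves \<open>x\<^sup>2 + y\<^sup>2\<close>
  and hence the product density.
\<close>

lemma gauss_rotation:
  assumes [measurable]: "A \<in> sets borel" "B \<in> sets borel"
  shows "emeasure (gauss \<Otimes>\<^sub>M gauss) {w \<in> space (gauss \<Otimes>\<^sub>M gauss). (fst w + snd w) / sqrt 2 \<in> A \<and> (fst w - snd w) / sqrt 2 \<in> B}
     = emeasure gauss A * emeasure gauss B" (is "emeasure _ ?E = _")
proof -
  interpret g: prob_space gauss by (rule prob_space_std_normal)
  let ?n = std_normal_density
  define f where "f x y = (indicator A x * indicator B y :: ennreal)" for x y :: real
  have fm [measurable]: "case_prod f \<in> borel_measurable (lborel \<Otimes>\<^sub>M lborel)"
    unfolding f_def by measurable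
  have f2 [measurable]: "(\<lambda>z. f (g z) (h z)) \<in> borel_measurable K" if [measurable]: "g \<in> borel_measurable K" "h \<in> borel_measurable K" for g h :: "_ \<Rightarrow> real" and K
    unfolding f_def by measurable
  have nm [measurable]: "?n \<in> borel_measurable borel" by simp
  have s2: "sqrt 2 * sqrt 2 = (2::real)" by simp
  have Em: "?E \<in> sets (gauss \<Otimes>\<^sub>M gauss)" by measurable
  have "emeasure (gauss \<Otimes>\<^sub>M gauss) ?E = (\<integral>\<^sup>+w. indicator ?E w \<partial>(gauss \<Otimes>\<^sub>M gauss))" using Em by simp
  also have "\<dots> = (\<integral>\<^sup>+v. (\<integral>\<^sup>+u. indicator ?E (v, u) \<partial>gauss) \<partial>gauss)"
    by (rule g.nn_integral_fst[symmetric]) (use Em in measurable)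
  also have "\<dots> = (\<integral>\<^sup>+v. (\<integral>\<^sup>+u. f ((v + u) / sqrt 2) ((v - u) / sqrt 2) \<partial>gauss) \<partial>gauss)"
    by (intro nn_integral_cong) (auto simp: f_def indicator_def space_pair_measure)
  also have "\<dots> = (\<integral>\<^sup>+v. (\<integral>\<^sup>+u. ?n v * (?n u * f ((v + u) / sqrt 2) ((v - u) / sqrt 2)) \<partial>lborel) \<partial>lborel)"
    by (simp add: nn_integral_density nn_integral_cmult)
  also have "\<dots> = (\<integral>\<^sup>+u. (\<integral>\<^sup>+v. ?n v * (?n u * f ((v + u) / sqrt 2) ((v - u) / sqrt 2)) \<partial>lborel) \<partial>lborel)"
    by (rule lborel_pair.Fubini'[symmetric]) measurable
  also have "\<dots> = (\<integral>\<^sup>+u. ennreal (sqrt 2) * (\<integral>\<^sup>+x. ?n (- u + sqrt 2 * x) * (?n u * f x (x - sqrt 2 * u)) \<partial>lborel) \<partial>lborel)"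
  proof (intro nn_integral_cong)
    fix u
    have e2: "(- u + sqrt 2 * x - u) / sqrt 2 = x - sqrt 2 * u" for x
    proof -
      have "- u + sqrt 2 * x - u = sqrt 2 * (x - sqrt 2 * u)" using s2 by (simp add: algebra_simps)
      then show ?thesis by simp
    qed
    have e1: "(- u + sqrt 2 * x + u) / sqrt 2 = x" for x by simp
    have a2: "ennreal \<bar>sqrt 2\<bar> = ennreal (sqrt 2)" by simp
    have hm: "(\<lambda>v. ?n v * (?n u * f ((v + u) / sqrt 2) ((v - u) / sqrt 2))) \<in> borel_measurable borel" by measurable
    from nn_integral_real_affine[OF hm, of "sqrt 2" "- u"]
    show "(\<integral>\<^sup>+v. ?n v * (?n u * f ((v + u) / sqrt 2) ((v - u) / sqrt 2)) \<partial>lborel) =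
       ennreal (sqrt 2) * (\<integral>\<^sup>+x. ?n (- u + sqrt 2 * x) * (?n u * f x (x - sqrt 2 * u)) \<partial>lborel)"
      unfolding e1 e2 a2 by simp
  qed
  also have "\<dots> = (\<integral>\<^sup>+u. (\<integral>\<^sup>+x. ennreal (sqrt 2) * (?n (- u + sqrt 2 * x) * (?n u * f x (x - sqrt 2 * u))) \<partial>lborel) \<partial>lborel)"
    by (simp add: nn_integral_cmult)
  also have "\<dots> = (\<integral>\<^sup>+x. (\<integral>\<^sup>+u. ennreal (sqrt 2) * (?n (- u + sqrt 2 * x) * (?n u * f x (x - sqrt 2 * u))) \<partial>lborel) \<partial>lborel)"
    by (rule lborel_pair.Fubini') measurable
  also have "\<dots> = (\<integral>\<^sup>+x. (\<integral>\<^sup>+y. ?n x * (?n y * f x y) \<partial>lborel) \<partial>lborel)"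
  proof (rule nn_integral_cong)
    fix x
    have arg: "x - sqrt 2 * (x / sqrt 2 + - 1 / sqrt 2 * y) = y" for y
      by (simp add: algebra_simps)
    have nn: "ennreal (1 / sqrt 2) * (ennreal (sqrt 2) * (ennreal (?n (- (x / sqrt 2 + - 1 / sqrt 2 * y) + sqrt 2 * x)) * (ennreal (?n (x / sqrt 2 + - 1 / sqrt 2 * y)) * c))) =
        ennreal (?n x) * (ennreal (?n y) * c)" for y c
    proof -
      let ?p = "x / sqrt 2 + - 1 / sqrt 2 * y"
      have a: "- ?p + sqrt 2 * x = (x + y) / sqrt 2"
      proof -
        have "sqrt 2 * x = 2 * x / sqrt 2" using s2 by (simp add: field_simps)
        then show ?thesis by (simp add: add_divide_distrib diff_divide_distrib)
      qed
      have b: "?p = (x - y) / sqrt 2" by (simp add: diff_divide_distrib)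
      have "((x + y) / sqrt 2)\<^sup>2 + ((x - y) / sqrt 2)\<^sup>2 = x\<^sup>2 + y\<^sup>2"
        by (simp add: power_divide power2_sum power2_diff field_simps)
      then have "?n ((x + y) / sqrt 2) * ?n ((x - y) / sqrt 2) = ?n x * ?n y"
        by (simp add: std_normal_density_def mult_exp_exp add_divide_distrib[symmetric] diff_divide_distrib[symmetric] mult_ac)
      then have "?n (- ?p + sqrt 2 * x) * ?n ?p = ?n x * ?n y" by (subst a, subst b)
      then have m1: "ennreal (?n (- ?p + sqrt 2 * x)) * ennreal (?n ?p) = ennreal (?n x) * ennreal (?n y)"
        by (simp only: ennreal_mult[OF normal_density_nonneg normal_density_nonneg, symmetric])
      have m2: "ennreal (1 / sqrt 2) * ennreal (sqrt 2) = 1" by (subst ennreal_mult[symmetric]) auto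
      have "r1 * (r2 * (P * (Q * c))) = u * (v * c)" if "r1 * r2 = 1" "P * Q = u * v" for r1 r2 P Q u v :: ennreal
      proof -
        have "r1 * (r2 * (P * (Q * c))) = (r1 * r2) * ((P * Q) * c)" by (simp only: mult_ac)
        then show ?thesis by (simp only: that mult_1 mult.assoc)
      qed
      from this[OF m2 m1] show ?thesis .
    qed
    have "(\<integral>\<^sup>+u. ennreal (sqrt 2) * (?n (- u + sqrt 2 * x) * (?n u * f x (x - sqrt 2 * u))) \<partial>lborel) =
      ennreal (1 / sqrt 2) * (\<integral>\<^sup>+y. ennreal (sqrt 2) * (?n (- (x / sqrt 2 + - 1 / sqrt 2 * y) + sqrt 2 * x) * (?n (x / sqrt 2 + - 1 / sqrt 2 * y) * f x (x - sqrt 2 * (x / sqrt 2 + - 1 / sqrt 2 * y)))) \<partial>lborel)"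
    proof -
      have hm: "(\<lambda>u. ennreal (sqrt 2) * (?n (- u + sqrt 2 * x) * (?n u * f x (x - sqrt 2 * u)))) \<in> borel_measurable borel" by measurable
      have a2: "ennreal \<bar>- 1 / sqrt 2\<bar> = ennreal (1 / sqrt 2)" by simp
      show ?thesis using nn_integral_real_affine[OF hm, of "- 1 / sqrt 2" "x / sqrt 2"] unfolding a2 by simp
    qed
    also have "\<dots> = (\<integral>\<^sup>+y. ennreal (1 / sqrt 2) * (ennreal (sqrt 2) * (?n (- (x / sqrt 2 + - 1 / sqrt 2 * y) + sqrt 2 * x) * (?n (x / sqrt 2 + - 1 / sqrt 2 * y) * f x y))) \<partial>lborel)"
      unfolding arg by (rule nn_integral_cmult[symmetric]) measurable
    also have "\<dots> = (\<integral>\<^sup>+y. ?n x * (?n y * f x y) \<partial>lborel)" unfolding nn ..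
    finally show "(\<integral>\<^sup>+u. ennreal (sqrt 2) * (?n (- u + sqrt 2 * x) * (?n u * f x (x - sqrt 2 * u))) \<partial>lborel) = (\<integral>\<^sup>+y. ?n x * (?n y * f x y) \<partial>lborel)" .
  qed
  also have "\<dots> = (\<integral>\<^sup>+x. (\<integral>\<^sup>+y. f x y \<partial>gauss) \<partial>gauss)"
    by (simp add: nn_integral_density nn_integral_cmult)
  also have "\<dots> = (\<integral>\<^sup>+x. indicator A x * emeasure gauss B \<partial>gauss)"
    unfolding f_def by (intro nn_integral_cong) (subst nn_integral_cmult, auto)
  also have "\<dots> = emeasure gauss A * emeasure gauss B" by (simp add: nn_integral_multc)
  finally show ?thesis .
qed

lemma gauss_rotation_sets:
  assumes [measurable]: "A \<in> sets borel" "B \<in> sets borel"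
  shows "{w \<in> space (gauss \<Otimes>\<^sub>M gauss). (fst w + snd w) / sqrt 2 \<in> A \<and> (fst w - snd w) / sqrt 2 \<in> B} \<in> sets (gauss \<Otimes>\<^sub>M gauss)"
  by measurable

definition noise_space :: "(nat \<times> nat \<Rightarrow> real) measure" where
  "noise_space = PiM UNIV (\<lambda>_. gauss)"

text \<open>
  Levy's construction in the form of a measure preserving map. Row \<open>0\<close> of the noise holds the
  increments of the path over unit intervals, and row \<open>n\<close> is consumed by the \<open>n\<close>-th refinement. One
  refinement rotates each pair \<open>(w (0, k), w (1, k))\<close> by 45 degrees, which yields the two half
  increments up to normalisation, and shifts the remaining rows. Since a rotation preserves the
  Gaussian law, the increments on every dyadic scale are again independent standard normal
  variables.
\<close>

definition refine :: "(nat \<times> nat \<Rightarrow> real) \<Rightarrow> nat \<times> nat \<Rightarrow> real" where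
  "refine w = (\<lambda>(l, k). if l = 0 then (if even k then w (0, k div 2) + w (1, k div 2) else w (0, k div 2) - w (1, k div 2)) / sqrt 2
     else w (Suc l, k))"

interpretation noise: product_prob_space "\<lambda>_. gauss" "UNIV :: (nat \<times> nat) set"
  by (rule product_prob_spaceI) (rule prob_space_std_normal)

interpretation noise_prob: prob_space noise_space
  unfolding noise_space_def by unfold_locales

lemma space_noise [simp]: "space noise_space = UNIV"
  by (auto simp: noise_space_def space_PiM)

lemma noise_coordinate [measurable]: "(\<lambda>w. w p) \<in> borel_measurable noise_space"
  unfolding noise_space_def by (rule measurable_compose[OF measurable_component_singleton]) auto

lemma noise_coordinate_gauss [measurable]: "(\<lambda>w. w p) \<in> measurable noise_space gauss"
  unfolding noise_space_def by (rule measurable_component_singleton) simp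

lemma sets_noise: "sets noise_space = sets (PiM UNIV (\<lambda>_. borel))"
  unfolding noise_space_def by (rule sets_PiM_cong) auto

lemma measurable_noiseI:
  assumes "\<And>p. (\<lambda>x. f x p) \<in> borel_measurable K" shows "f \<in> measurable K noise_space"
  unfolding measurable_cong_sets[OF refl sets_noise]
  by (rule measurable_PiM_single') (use assms in \<open>auto simp: space_PiM\<close>)

lemma refine_measurable [measurable]: "refine \<in> measurable noise_space noise_space"
proof (rule measurable_noiseI)
  fix p :: "nat \<times> nat"
  show "(\<lambda>w. refine w p) \<in> borel_measurable noise_space"
    by (cases p) (auto simp: refine_def)
qed

lemma noise_coordinates_prob:
  assumes "finite J" "\<And>j. j \<in> J \<Longrightarrow> A j \<in> sets borel"
  shows "emeasure noise_space {w. \<forall>j\<in>J. w j \<in> A j} = (\<Prod>j\<in>J. emeasure gauss (A j))"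
  using noise.emeasure_PiM_Collect[of J A] assms by (simp add: noise_space_def space_PiM)

lemma noise_indep: "noise_prob.indep_vars (\<lambda>_. borel) (\<lambda>p w. w p) UNIV"
proof -
  have d: "distr noise_space borel (\<lambda>w. w p) = gauss" for p
  proof -
    have "distr noise_space gauss (\<lambda>w. w p) = gauss" unfolding noise_space_def by (rule noise.PiM_component) simp
    moreover have "distr noise_space gauss (\<lambda>w. w p) = distr noise_space borel (\<lambda>w. w p)" by (rule distr_cong) auto
    ultimately show ?thesis by simp
  qed
  have "distr noise_space (PiM UNIV (\<lambda>_. borel)) (\<lambda>w. \<lambda>p\<in>UNIV. w p) = distr noise_space noise_space (\<lambda>w. w)"
    by (rule distr_cong) (auto simp: sets_noise)
  also have "\<dots> = PiM UNIV (\<lambda>p. distr noise_space borel (\<lambda>w. w p))"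
    by (simp add: distr_id2 d) (simp add: noise_space_def)
  finally show ?thesis
    by (subst noise_prob.indep_vars_iff_distr_eq_PiM) auto
qed

lemma noise_pair_distr:
  assumes "p \<noteq> q"
  shows "distr noise_space (gauss \<Otimes>\<^sub>M gauss) (\<lambda>w. (w p, w q)) = gauss \<Otimes>\<^sub>M gauss"
proof -
  have sf: "sigma_finite_measure gauss"
    using prob_space_std_normal by (simp add: prob_space_imp_sigma_finite)
  show ?thesis
  proof (rule pair_measure_eqI[OF sf sf, symmetric])
    fix A B assume AB: "A \<in> sets gauss" "B \<in> sets gauss"
    have "emeasure (distr noise_space (gauss \<Otimes>\<^sub>M gauss) (\<lambda>w. (w p, w q))) (A \<times> B) = emeasure noise_space {w. \<forall>j\<in>{p, q}. w j \<in> (if j = p then A else B)}"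
      using AB assms by (subst emeasure_distr) (auto intro!: arg_cong[where f="emeasure noise_space"])
    also have "\<dots> = emeasure gauss A * emeasure gauss B"
      using AB assms by (subst noise_coordinates_prob) auto
    finally show "emeasure gauss A * emeasure gauss B = emeasure (distr noise_space (gauss \<Otimes>\<^sub>M gauss) (\<lambda>w. (w p, w q))) (A \<times> B)" ..
  qed simp
qed

text \<open>
  \<open>refine\<close> computes the coordinates in \<open>children g\<close> from those in \<open>sources g\<close>. Different groups have
  disjoint sources, so independence has to be checked only within a group, where it is the
  rotation invariance.
\<close>

definition children :: "nat \<times> nat \<Rightarrow> (nat \<times> nat) set" where
  "children = (\<lambda>(l, k). if l = 0 then {(0, 2 * k), (0, 2 * k + 1)} else {(l, k)})"
definition sources :: "nat \<times> nat \<Rightarrow> (nat \<times> nat) set" where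
  "sources = (\<lambda>(l, k). if l = 0 then {(0, k), (1, k)} else {(Suc l, k)})"

lemma refine_distr: "distr noise_space noise_space refine = noise_space"
proof -
  have "distr noise_space noise_space refine = PiM UNIV (\<lambda>_. gauss)"
  proof (rule noise.PiM_eq)
    show "sets (distr noise_space noise_space refine) = sets (PiM UNIV (\<lambda>_. gauss))" by (simp add: noise_space_def)
    fix J :: "(nat \<times> nat) set" and F :: "nat \<times> nat \<Rightarrow> real set"
    assume J: "finite J" "\<And>j. j \<in> J \<Longrightarrow> F j \<in> sets gauss"
    define F' where "F' j = (if j \<in> J then F j else UNIV)" for j
    have F' [measurable]: "F' j \<in> sets borel" for j using J by (auto simp: F'_def)
    define par where "par = (\<lambda>(l, k). if l = 0 then (0, k div 2) else (l :: nat, k :: nat))"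
    define G where "G = par ` J"
    have par: "j \<in> children (par j)" for j
    proof (cases j)
      case (Pair l k)
      have "k = 2 * (k div 2) \<or> k = 2 * (k div 2) + 1" by presburger
      then show ?thesis by (auto simp: Pair par_def children_def)
    qed
    have fG: "finite G" using J by (simp add: G_def)
    have JG: "J \<subseteq> \<Union> (children ` G)"
      using par by (auto simp: G_def)
    have fch: "finite (children g)" for g by (auto simp: children_def split: prod.splits)
    have disj: "\<forall>g\<in>G. \<forall>h\<in>G. g \<noteq> h \<longrightarrow> children g \<inter> children h = {}"
      by (auto simp: children_def split: prod.splits if_splits)
    have loc: "refine (restrict w (sources g)) j = refine w j" if "j \<in> children g" for w g j
      using that by (auto simp: children_def sources_def refine_def restrict_def split: prod.splits if_splits)
    define E where "E g = {v \<in> space (PiM (sources g) (\<lambda>_. borel)). \<forall>j\<in>children g. refine v j \<in> F' j}" for g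
    have Em: "E g \<in> sets (PiM (sources g) (\<lambda>_. borel))" for g
    proof -
      have "(\<lambda>v. refine v j) \<in> borel_measurable (PiM (sources g) (\<lambda>_. borel))" if "j \<in> children g" for j
        using that by (cases g) (auto simp: children_def sources_def refine_def split: if_splits)
      then show ?thesis unfolding E_def by (intro sets.sets_Collect_finite_All fch) (auto intro: measurable_sets_Collect)
    qed
    have prE: "noise_prob.prob ((\<lambda>w. restrict w (sources g)) -` E g \<inter> space noise_space) = (\<Prod>j\<in>children g. measure gauss (F' j))" for g
    proof -
      obtain l k where g: "g = (l, k)" by (cases g)
      have e: "(\<lambda>w. restrict w (sources g)) -` E g \<inter> space noise_space = {w. \<forall>j\<in>children g. refine w j \<in> F' j}"
        using loc by (auto simp: E_def space_PiM)
      have "emeasure noise_space {w. \<forall>j\<in>children g. refine w j \<in> F' j} = (\<Prod>j\<in>children g. emeasure gauss (F' j))"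
      proof (cases "l = 0")
        case True
        define R where "R = {w \<in> space (gauss \<Otimes>\<^sub>M gauss). (fst w + snd w) / sqrt 2 \<in> F' (0, 2 * k) \<and> (fst w - snd w) / sqrt 2 \<in> F' (0, 2 * k + 1)}"
        have R: "emeasure (gauss \<Otimes>\<^sub>M gauss) R = emeasure gauss (F' (0, 2 * k)) * emeasure gauss (F' (0, 2 * k + 1))"
          unfolding R_def by (rule gauss_rotation) (rule F')+
        have Rm: "R \<in> sets (gauss \<Otimes>\<^sub>M gauss)"
          unfolding R_def by (rule gauss_rotation_sets) (rule F')+
        have pm: "(\<lambda>w. (w (0, k), w (1, k))) \<in> measurable noise_space (gauss \<Otimes>\<^sub>M gauss)"
          by (intro measurable_Pair noise_coordinate_gauss)
        have neq: "(0 :: nat, k) \<noteq> (1, k)" by simp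
        have "{w. \<forall>j\<in>children g. refine w j \<in> F' j} = (\<lambda>w. (w (0, k), w (1, k))) -` R \<inter> space noise_space"
          using True by (auto simp: R_def g children_def refine_def space_pair_measure)
        also have "emeasure noise_space \<dots> = emeasure (distr noise_space (gauss \<Otimes>\<^sub>M gauss) (\<lambda>w. (w (0, k), w (1, k)))) R"
          by (rule emeasure_distr[symmetric, OF pm Rm])
        also have "\<dots> = emeasure gauss (F' (0, 2 * k)) * emeasure gauss (F' (0, 2 * k + 1))"
          unfolding noise_pair_distr[OF neq] by (rule R)
        finally show ?thesis using True by (simp add: g children_def)
      next
        case False
        have "{w. \<forall>j\<in>children g. refine w j \<in> F' j} = {w. \<forall>j\<in>{(Suc l, k)}. w j \<in> F' (l, k)}"
          using False by (auto simp: g children_def refine_def)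
        then show ?thesis using False noise_coordinates_prob[of "{(Suc l, k)}" "\<lambda>_. F' (l, k)"] by (simp add: g children_def)
      qed
      then have "ennreal (noise_prob.prob {w. \<forall>j\<in>children g. refine w j \<in> F' j}) = ennreal (\<Prod>j\<in>children g. measure gauss (F' j))"
        by (simp add: noise_prob.emeasure_eq_measure noise.M.emeasure_eq_measure prod_ennreal)
      then show ?thesis unfolding e by (subst (asm) ennreal_inj) (auto intro!: prod_nonneg)
    qed
    have ind: "noise_prob.indep_vars (\<lambda>g. PiM (sources g) (\<lambda>_. borel)) (\<lambda>g w. restrict (\<lambda>i. w i) (sources g)) UNIV"
      by (rule noise_prob.indep_vars_restrict[OF noise_indep])
         (auto simp: disjoint_family_on_def sources_def split: prod.splits if_splits)
    have ev: "refine -` prod_emb UNIV (\<lambda>_. gauss) J (\<Pi>\<^sub>E j\<in>J. F j) \<inter> space noise_space = (\<Inter>g\<in>G. (\<lambda>w. restrict w (sources g)) -` E g \<inter> space noise_space)" if "G \<noteq> {}"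
    proof -
      have "(\<forall>j\<in>J. refine w j \<in> F j) \<longleftrightarrow> (\<forall>g\<in>G. \<forall>j\<in>children g. refine w j \<in> F' j)" for w
        using JG by (auto simp: F'_def)
      then show ?thesis using that loc
        by (auto simp: prod_emb_def E_def space_PiM restrict_def PiE_iff extensional_def)
    qed
    have mm: "prod_emb UNIV (\<lambda>_. gauss) J (\<Pi>\<^sub>E j\<in>J. F j) \<in> sets noise_space"
      unfolding noise_space_def by (rule sets_PiM_I) (use J in auto)
    show "emeasure (distr noise_space noise_space refine) (prod_emb UNIV (\<lambda>_. gauss) J (\<Pi>\<^sub>E j\<in>J. F j)) = (\<Prod>j\<in>J. emeasure gauss (F j))"
    proof (cases "J = {}")
      case True
      have "prod_emb UNIV (\<lambda>_. gauss) {} (\<Pi>\<^sub>E j\<in>{}. F j) = (UNIV :: (nat \<times> nat \<Rightarrow> real) set)"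
        by (auto simp: prod_emb_def space_PiM restrict_def)
      then show ?thesis
        using True prob_space.emeasure_space_1[OF noise_prob.prob_space_distr[OF refine_measurable]] by simp
    next
      case False
      then have G0: "G \<noteq> {}" by (simp add: G_def)
      have "emeasure (distr noise_space noise_space refine) (prod_emb UNIV (\<lambda>_. gauss) J (\<Pi>\<^sub>E j\<in>J. F j)) =
         noise_prob.prob (\<Inter>g\<in>G. (\<lambda>w. restrict w (sources g)) -` E g \<inter> space noise_space)"
        by (simp only: emeasure_distr[OF refine_measurable mm] ev[OF G0] noise_prob.emeasure_eq_measure)
      also have "\<dots> = (\<Prod>g\<in>G. noise_prob.prob ((\<lambda>w. restrict w (sources g)) -` E g \<inter> space noise_space))"
        by (simp only: noise_prob.indep_varsD[OF ind G0 fG subset_UNIV Em])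
      also have "\<dots> = (\<Prod>g\<in>G. \<Prod>j\<in>children g. measure gauss (F' j))" unfolding prE ..
      also have "\<dots> = (\<Prod>j\<in>\<Union> (children ` G). measure gauss (F' j))"
        by (subst prod.UNION_disjoint) (use fG fch disj in auto)
      also have "(\<Prod>j\<in>\<Union> (children ` G). measure gauss (F' j)) = (\<Prod>j\<in>J. measure gauss (F j))"
      proof (rule prod.mono_neutral_cong_right)
        have "measure gauss UNIV = 1" using prob_space.prob_space[OF prob_space_std_normal] by simp
        then show "\<forall>i\<in>\<Union> (children ` G) - J. measure gauss (F' i) = 1" by (simp add: F'_def)
      qed (use fG fch JG in \<open>auto simp: F'_def\<close>)
      also have "ennreal (\<Prod>j\<in>J. measure gauss (F j)) = (\<Prod>j\<in>J. emeasure gauss (F j))"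
        using finite_measure.emeasure_eq_measure[OF prob_space.finite_measure[OF prob_space_std_normal]]
        by (simp add: prod_ennreal)
      finally show ?thesis .
    qed
  qed
  then show ?thesis by (simp add: noise_space_def)
qed

definition level :: "nat \<Rightarrow> (nat \<times> nat \<Rightarrow> real) \<Rightarrow> nat \<times> nat \<Rightarrow> real" where
  "level n = refine ^^ n"

lemma level_measurable [measurable]: "level n \<in> measurable noise_space noise_space"
  by (induction n) (auto simp: level_def intro: measurable_comp refine_measurable)

lemma level_distr: "distr noise_space noise_space (level n) = noise_space"
proof (induction n)
  case 0
  then show ?case by (simp add: level_def distr_id)
next
  case (Suc n)
  have "distr noise_space noise_space (level (Suc n)) = distr (distr noise_space noise_space (level n)) noise_space refine"
    by (subst distr_distr) (auto simp: level_def comp_def level_measurable[unfolded level_def])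
  then show ?case by (simp add: Suc refine_distr)
qed

lemma level_Suc:
  "level (Suc n) w (0, 2 * k) = (level n w (0, k) + level n w (1, k)) / sqrt 2"
  "level (Suc n) w (0, 2 * k + 1) = (level n w (0, k) - level n w (1, k)) / sqrt 2"
  by (simp_all add: level_def refine_def)

definition ramp :: "real \<Rightarrow> real" where "ramp u = max 0 (min 1 u)"

text \<open>
  The piecewise linear path with the increments of scale \<open>n\<close>.
\<close>

definition interp :: "nat \<Rightarrow> real \<Rightarrow> (nat \<times> nat \<Rightarrow> real) \<Rightarrow> real" where
  "interp n t w = (1 / sqrt 2) ^ n * (\<Sum>k<nat \<lceil>2 ^ n * t\<rceil>. level n w (0, k) * ramp (2 ^ n * t - real k))"

lemma interp_eq:
  assumes "2 ^ n * t \<le> real K"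
  shows "interp n t w = (1 / sqrt 2) ^ n * (\<Sum>k<K. level n w (0, k) * ramp (2 ^ n * t - real k))"
proof -
  have "nat \<lceil>2 ^ n * t\<rceil> \<le> K" using assms by (simp add: nat_le_iff ceiling_le_iff)
  moreover have "ramp (2 ^ n * t - real k) = 0" if "nat \<lceil>2 ^ n * t\<rceil> \<le> k" for k
  proof -
    have "2 ^ n * t \<le> real k" using that by (simp add: nat_le_iff ceiling_le_iff)
    then show ?thesis by (simp add: ramp_def)
  qed
  ultimately show ?thesis unfolding interp_def
    by (intro arg_cong2[where f="(*)"] refl sum.mono_neutral_left) auto
qed

text \<open>
  A refinement adds to the path one tent on every dyadic interval, with the coefficient taken from
  row \<open>1\<close>.
\<close>

lemma interp_Suc:
  assumes K: "2 ^ n * t \<le> real K"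
  shows "interp (Suc n) t w - interp n t w =
    (1 / sqrt 2) ^ n / 2 * (\<Sum>k<K. level n w (1, k) * (ramp (2 * (2 ^ n * t - real k)) - ramp (2 * (2 ^ n * t - real k) - 1)))"
proof -
  let ?u = "\<lambda>k. 2 ^ n * t - real k"
  have r: "ramp (2 * u) + ramp (2 * u - 1) = 2 * ramp u" for u by (auto simp: ramp_def max_def min_def)
  have two: "(\<Sum>i<2 * K. f i) = (\<Sum>k<K. f (2 * k) + f (2 * k + 1))" for f :: "nat \<Rightarrow> real"
    by (induction K) auto
  have s: "(1 / sqrt 2) ^ Suc n / sqrt 2 = (1 / sqrt 2) ^ n / (2::real)" by simp
  have "interp (Suc n) t w = (1 / sqrt 2) ^ Suc n * (\<Sum>k<2 * K. level (Suc n) w (0, k) * ramp (2 ^ Suc n * t - real k))"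
    using K by (intro interp_eq) simp
  also have "\<dots> = (1 / sqrt 2) ^ Suc n * (\<Sum>k<K. (level n w (0, k) + level n w (1, k)) / sqrt 2 * ramp (2 * ?u k) +
      (level n w (0, k) - level n w (1, k)) / sqrt 2 * ramp (2 * ?u k - 1))"
    unfolding two level_Suc by (simp add: algebra_simps)
  also have "\<dots> = (1 / sqrt 2) ^ Suc n / sqrt 2 * (\<Sum>k<K. (level n w (0, k) + level n w (1, k)) * ramp (2 * ?u k) +
      (level n w (0, k) - level n w (1, k)) * ramp (2 * ?u k - 1))"
  proof -
    have "a / sqrt 2 * p + b / sqrt 2 * q = (a * p + b * q) / sqrt 2" for a b p q :: real
      by (simp add: add_divide_distrib)
    then show ?thesis by (simp only: sum_divide_distrib[symmetric]) simp
  qed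
  also have "\<dots> = (1 / sqrt 2) ^ n / 2 * (\<Sum>k<K. level n w (0, k) * (2 * ramp (?u k)) + level n w (1, k) * (ramp (2 * ?u k) - ramp (2 * ?u k - 1)))"
    unfolding s r[symmetric] by (simp add: algebra_simps)
  also have "\<dots> = (1 / sqrt 2) ^ n * (\<Sum>k<K. level n w (0, k) * ramp (?u k)) +
      (1 / sqrt 2) ^ n / 2 * (\<Sum>k<K. level n w (1, k) * (ramp (2 * ?u k) - ramp (2 * ?u k - 1)))"
    by (simp add: sum.distrib distrib_left sum_distrib_left mult_ac)
  also have "(1 / sqrt 2) ^ n * (\<Sum>k<K. level n w (0, k) * ramp (?u k)) = interp n t w"
    using interp_eq[OF K] by simp
  finally show ?thesis by simp
qed

text \<open>
  At any time at most one of the tents is different from zero.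
\<close>

lemma interp_step_bound:
  assumes K: "2 ^ n * t \<le> real K" and B: "\<And>k. k < K \<Longrightarrow> \<bar>level n w (1, k)\<bar> \<le> B" "0 \<le> B"
  shows "\<bar>interp (Suc n) t w - interp n t w\<bar> \<le> (1 / sqrt 2) ^ n * B"
proof -
  define q where "q k = ramp (2 * (2 ^ n * t - real k)) - ramp (2 * (2 ^ n * t - real k) - 1)" for k
  have q01: "0 \<le> q k" "q k \<le> 1" for k by (auto simp: q_def ramp_def max_def min_def)
  have q0: "q k = 0" if "k \<noteq> nat \<lfloor>2 ^ n * t\<rfloor>" for k
  proof -
    have "2 ^ n * t < real k \<or> real k + 1 \<le> 2 ^ n * t \<or> 2 ^ n * t < 0" using that
      by (metis floor_eq2 nat_int not_less of_int_of_nat_eq)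
    then show ?thesis by (auto simp: q_def ramp_def max_def min_def)
  qed
  have "\<bar>\<Sum>k<K. level n w (1, k) * q k\<bar> \<le> (\<Sum>k<K. B * q k)"
    using B(1) q01 by (intro order_trans[OF sum_abs] sum_mono) (auto simp: abs_mult intro!: mult_right_mono)
  also have "\<dots> \<le> (\<Sum>k<K. if k = nat \<lfloor>2 ^ n * t\<rfloor> then B else 0)"
    using q0 q01 B(2) by (intro sum_mono) (auto simp: mult_left_le)
  also have "\<dots> \<le> B" using B(2) by (simp add: sum.delta)
  finally have "\<bar>\<Sum>k<K. level n w (1, k) * q k\<bar> \<le> B" .
  then have "(1 / sqrt 2) ^ n / 2 * \<bar>\<Sum>k<K. level n w (1, k) * q k\<bar> \<le> (1 / sqrt 2) ^ n / 2 * B"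
    by (intro mult_left_mono) auto
  also have "\<dots> \<le> (1 / sqrt 2) ^ n * B" using B(2) by (intro mult_right_mono) auto
  finally show ?thesis unfolding interp_Suc[OF K] q_def[symmetric] by (simp add: abs_mult)
qed

lemma interp_dyadic:
  assumes m: "n \<le> m"
  shows "interp m (real j / 2 ^ n) w = (1 / sqrt 2) ^ n * (\<Sum>k<j. level n w (0, k))"
  using m
proof (induction m rule: dec_induct)
  case base
  have "ramp (real j - real k) = 1" if "k < j" for k using that by (auto simp: ramp_def)
  then show ?case using interp_eq[of n "real j / 2 ^ n" j w] by simp
next
  case (step m)
  have e: "2 ^ m * (real j / 2 ^ n) = real (2 ^ (m - n) * j)"
  proof -
    have "(2::real) ^ m = 2 ^ (m - n) * 2 ^ n" using step by (simp flip: power_add)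
    then show ?thesis by simp
  qed
  have z: "ramp (2 * (real a - real k)) - ramp (2 * (real a - real k) - 1) = 0" if "k < a" for a k :: nat
  proof -
    have "real (Suc k) \<le> real a" using that by (simp only: of_nat_le_iff Suc_le_eq)
    then have "1 \<le> real a - real k" by simp
    then show ?thesis by (simp add: ramp_def)
  qed
  let ?K = "2 ^ (m - n) * j"
  have "(\<Sum>k<?K. level m w (1, k) * (ramp (2 * (real ?K - real k)) - ramp (2 * (real ?K - real k) - 1))) = 0"
  proof (intro sum.neutral ballI)
    fix k assume "k \<in> {..<?K}"
    then have "k < ?K" by simp
    then show "level m w (1, k) * (ramp (2 * (real ?K - real k)) - ramp (2 * (real ?K - real k) - 1)) = 0"
      by (simp only: z mult_zero_right)
  qed
  then have "interp (Suc m) (real j / 2 ^ n) w - interp m (real j / 2 ^ n) w = 0"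
    using interp_Suc[of m "real j / 2 ^ n" ?K w] unfolding e by (simp only: order_refl mult_zero_right)
  then show ?case using step.IH by simp
qed

lemma interp_continuous: "continuous_on {0..T} (\<lambda>t. interp n t w)"
proof -
  define K where "K = nat \<lceil>2 ^ n * T\<rceil>"
  have c: "continuous_on {0..T} (\<lambda>t. (1 / sqrt 2) ^ n * (\<Sum>k<K. level n w (0, k) * ramp (2 ^ n * t - real k)))"
    unfolding ramp_def by (intro continuous_intros)
  have e: "interp n t w = (1 / sqrt 2) ^ n * (\<Sum>k<K. level n w (0, k) * ramp (2 ^ n * t - real k))" if "t \<in> {0..T}" for t
  proof (rule interp_eq)
    have "2 ^ n * t \<le> 2 ^ n * T" using that by simp
    then show "2 ^ n * t \<le> real K" unfolding K_def by linarith
  qed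
  show ?thesis by (rule continuous_on_eq[OF c]) (simp only: e)
qed

lemma interp_measurable [measurable]: "(\<lambda>w. interp n t w) \<in> borel_measurable noise_space"
proof -
  have "(\<lambda>w. level n w p) \<in> borel_measurable noise_space" for p
    using measurable_compose[OF level_measurable noise_coordinate] .
  then show ?thesis unfolding interp_def by measurable
qed

text \<open>
  The limit of the interpolations as a telescoping series; where the series diverges, the value is
  arbitrary.
\<close>

definition brownian :: "real \<Rightarrow> (nat \<times> nat \<Rightarrow> real) \<Rightarrow> real" where
  "brownian t w = interp 0 t w + (\<Sum>n. interp (Suc n) t w - interp n t w)"

lemma brownian_measurable [measurable]: "brownian t \<in> borel_measurable noise_space"
  unfolding brownian_def[abs_def] by measurable

lemma brownian_dyadic: "brownian (real j / 2 ^ n) w = (1 / sqrt 2) ^ n * (\<Sum>k<j. level n w (0, k))"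
proof -
  let ?t = "real j / 2 ^ n"
  have "(\<Sum>m. interp (Suc m) ?t w - interp m ?t w) = (\<Sum>m<n. interp (Suc m) ?t w - interp m ?t w)"
    by (rule suminf_finite) (auto simp: interp_dyadic not_less)
  also have "\<dots> = interp n ?t w - interp 0 ?t w" by (rule sum_lessThan_telescope)
  finally show ?thesis using interp_dyadic[of n n j w] by (simp add: brownian_def)
qed

text \<open>
  The eighth moments force the coefficients used up to time \<open>n\<close> in step \<open>n\<close> to be of order at most \<open>2\<close>
  to the power \<open>n / 4\<close>, which the normalisation \<open>2\<close> to the power \<open>- n / 2\<close> outweighs.
\<close>

definition tame :: "(nat \<times> nat \<Rightarrow> real) \<Rightarrow> bool" where
  "tame w \<longleftrightarrow> summable (\<lambda>n. (\<Sum>k<n * 2 ^ n. level n w (1, k) ^ 8) / 4 ^ n)"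

lemma level_coordinate_distr: "distr noise_space borel (\<lambda>w. level n w p) = gauss"
proof -
  have "distr noise_space borel (\<lambda>w. level n w p) = distr (distr noise_space noise_space (level n)) borel (\<lambda>w. w p)"
    by (subst distr_distr) (auto simp: comp_def)
  also have "\<dots> = distr noise_space gauss (\<lambda>w. w p)" unfolding level_distr by (rule distr_cong) auto
  also have "\<dots> = gauss" unfolding noise_space_def by (rule noise.PiM_component) simp
  finally show ?thesis .
qed

lemma AE_tame: "AE w in noise_space. tame w"
  unfolding tame_def
proof (rule AE_summable_of_integrals)
  let ?c = "\<integral>z. z ^ 8 \<partial>gauss"
  have [measurable]: "(\<lambda>w. level n w p) \<in> borel_measurable noise_space" for n p
    using measurable_compose[OF level_measurable noise_coordinate] .
  have i: "integrable noise_space (\<lambda>w. level n w p ^ 8)" for n p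
    using integrable_std_normal_distribution_moment[of 8] unfolding level_coordinate_distr[of n p, symmetric]
    by (subst (asm) integrable_distr_eq) auto
  have e: "(\<integral>w. level n w p ^ 8 \<partial>noise_space) = ?c" for n p
    by (subst level_coordinate_distr[of n p, symmetric]) (simp add: integral_distr)
  show "integrable noise_space (\<lambda>w. (\<Sum>k<n * 2 ^ n. level n w (1, k) ^ 8) / 4 ^ n)" for n
    using i by (intro integrable_divide_zero Bochner_Integration.integrable_sum)
  show "0 \<le> (\<Sum>k<n * 2 ^ n. level n w (1, k) ^ 8) / 4 ^ n" for n w
    by (intro divide_nonneg_pos sum_nonneg) auto
  have "(\<integral>w. (\<Sum>k<n * 2 ^ n. level n w (1, k) ^ 8) / 4 ^ n \<partial>noise_space) = ?c * (real n * (1 / 2) ^ n)" for n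
  proof -
    have "(4::real) ^ n = 2 ^ n * 2 ^ n" by (simp flip: power_mult_distrib)
    then show ?thesis using i e by (simp add: Bochner_Integration.integral_sum power_one_over field_simps)
  qed
  moreover have "summable (\<lambda>n. real n * (1 / 2 :: real) ^ n)"
    using summable_Suc_iff[of "\<lambda>n. real n * (1 / 2 :: real) ^ n"] geometric_deriv_sums[of "1 / 2 :: real"]
    by (auto simp: sums_iff intro!: summable_mult2[of "\<lambda>n. real (Suc n) * (1 / 2 :: real) ^ n" "1 / 2"] dest: summable_mult2[of _ "1 / 2"])

  ultimately show "summable (\<lambda>n. \<integral>w. (\<Sum>k<n * 2 ^ n. level n w (1, k) ^ 8) / 4 ^ n \<partial>noise_space)"
    by (simp add: summable_mult)
qed

lemma tame_uniform_limit:
  assumes "tame w"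
  shows "uniform_limit {0..real T} (\<lambda>n t. interp n t w) (\<lambda>t. brownian t w) sequentially"
proof -
  obtain D where D: "\<And>n. \<bar>(\<Sum>k<n * 2 ^ n. level n w (1, k) ^ 8) / 4 ^ n\<bar> \<le> D"
    using summable_imp_bounded[OF assms[unfolded tame_def]] by (auto simp: bounded_iff)
  define a where "a = sqrt (sqrt (2::real))"
  have a2: "a ^ 2 = sqrt 2" by (simp add: a_def)
  have "a ^ 4 = (a ^ 2) ^ 2" by (simp flip: power_mult)
  then have a4: "a ^ 4 = 2" by (simp add: a2)
  have a: "0 < a" "1 < a" "a ^ 4 = 2" "a ^ 2 = sqrt 2" using a2 a4 by (auto simp: a_def)
  define C where "C = root 8 \<bar>D\<bar>"
  have C: "0 \<le> C" "C ^ 8 = \<bar>D\<bar>" by (auto simp: C_def)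
  have lv: "\<bar>level n w (1, k)\<bar> \<le> C * a ^ n" if "k < n * 2 ^ n" for n k
  proof -
    have "level n w (1, k) ^ 8 \<le> (\<Sum>k<n * 2 ^ n. level n w (1, k) ^ 8)"
      by (rule member_le_sum[where f="\<lambda>k. level n w (1, k) ^ 8"]) (use that in auto)
    also have "\<dots> \<le> \<bar>D\<bar> * 4 ^ n"
    proof -
      have "x \<le> \<bar>D\<bar> * p" if "\<bar>x / p\<bar> \<le> D" "0 < p" for x p :: real
      proof -
        have "x / p \<le> \<bar>D\<bar>" using that(1) by linarith
        then show ?thesis using that(2) by (simp add: field_simps)
      qed
      from this[OF D[of n]] show ?thesis by simp
    qed
    also have "(4::real) ^ n = (a ^ n) ^ 8"
    proof -
      have "a ^ 8 = (a ^ 4) ^ 2" by (simp flip: power_mult)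
      then have "a ^ 8 = 4" using a by simp
      then show ?thesis by (metis power_mult mult.commute)
    qed
    finally have "\<bar>level n w (1, k)\<bar> ^ 8 \<le> (C * a ^ n) ^ 8" using C by (simp add: power_mult_distrib power_even_abs)
    then show ?thesis using C a power_mono_iff[of "\<bar>level n w (1, k)\<bar>" "C * a ^ n" 8] by simp
  qed
  have step: "\<bar>interp (Suc n) t w - interp n t w\<bar> \<le> C * (1 / a) ^ n" if "n \<ge> T" "t \<in> {0..real T}" for n t
  proof -
    have "2 ^ n * t \<le> 2 ^ n * real n" using that by (intro mult_left_mono) auto
    then have "2 ^ n * t \<le> real (n * 2 ^ n)" by (simp add: mult.commute)
    then have "\<bar>interp (Suc n) t w - interp n t w\<bar> \<le> (1 / sqrt 2) ^ n * (C * a ^ n)"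
      by (rule interp_step_bound) (use lv C a in auto)
    also have "\<dots> = C * (a / sqrt 2) ^ n" by (simp add: power_divide)
    also have "a / sqrt 2 = 1 / a" using a by (simp add: power2_eq_square field_simps)
    finally show ?thesis .
  qed
  have "uniform_limit {0..real T} (\<lambda>n t. \<Sum>i<n. interp (Suc i) t w - interp i t w) (\<lambda>t. \<Sum>i. interp (Suc i) t w - interp i t w) sequentially"
  proof (rule Weierstrass_m_test_ev)
    show "\<forall>\<^sub>F n in sequentially. \<forall>t\<in>{0..real T}. norm (interp (Suc n) t w - interp n t w) \<le> C * (1 / a) ^ n"
      using eventually_ge_at_top[of T] by eventually_elim (use step in auto)
    show "summable (\<lambda>n. C * (1 / a) ^ n)" using a by (intro summable_mult summable_geometric) auto
  qed
  then have "uniform_limit {0..real T} (\<lambda>n t. interp 0 t w + (\<Sum>i<n. interp (Suc i) t w - interp i t w)) (\<lambda>t. brownian t w) sequentially"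
    unfolding brownian_def by (intro uniform_limit_intros)
  moreover have "interp 0 t w + (\<Sum>i<n. interp (Suc i) t w - interp i t w) = interp n t w" for n t
    using sum_lessThan_telescope[of "\<lambda>n. interp n t w" n] by simp
  ultimately show ?thesis by (simp only:)
qed

lemma tame_continuous:
  assumes "tame w" shows "continuous_on {0..} (\<lambda>t. brownian t w)"
  unfolding continuous_on_eq_continuous_within
proof
  fix t :: real assume t: "t \<in> {0..}"
  define T where "T = nat \<lceil>t\<rceil> + 1"
  have T: "t < real T" unfolding T_def by linarith
  have "continuous_on {0..real T} (\<lambda>t. brownian t w)"
    by (rule uniform_limit_theorem[OF _ tame_uniform_limit[OF assms]]) (auto intro: always_eventually interp_continuous)
  then have "continuous (at t within {0..real T}) (\<lambda>t. brownian t w)"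
    using t T by (simp add: continuous_on_eq_continuous_within)
  moreover have "at t within {0..real T} = at t within {0..}"
    by (rule at_within_nhd[of t "{..<real T}"]) (use T in auto)
  ultimately show "continuous (at t within {0..}) (\<lambda>t. brownian t w)" by simp
qed

lemma brownian_dyadic_limit:
  assumes "tame w" "0 \<le> t"
  shows "(\<lambda>n. brownian (real (nat \<lfloor>2 ^ n * t\<rfloor>) / 2 ^ n) w) \<longlonglongrightarrow> brownian t w"
proof -
  let ?d = "\<lambda>n. real (nat \<lfloor>2 ^ n * t\<rfloor>) / 2 ^ n"
  have fl: "real (nat \<lfloor>2 ^ n * t\<rfloor>) = of_int \<lfloor>2 ^ n * t\<rfloor>" for n using assms(2) by simp
  have "?d \<longlonglongrightarrow> t"
  proof (rule tendsto_sandwich)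
    have "t - (1 / 2) ^ n \<le> ?d n" "?d n \<le> t" for n
    proof -
      have "2 ^ n * t - 1 \<le> of_int \<lfloor>2 ^ n * t\<rfloor>" "of_int \<lfloor>2 ^ n * t\<rfloor> \<le> 2 ^ n * t" by linarith+
      then have d: "(2 ^ n * t - 1) / 2 ^ n \<le> ?d n" "?d n \<le> 2 ^ n * t / 2 ^ n"
        unfolding fl by (intro divide_right_mono; simp)+
      have e: "2 ^ n * t / 2 ^ n = t" "(2 ^ n * t - 1) / 2 ^ n = t - (1 / 2) ^ n"
        by (simp_all add: diff_divide_distrib power_one_over)
      show "t - (1 / 2) ^ n \<le> ?d n" "?d n \<le> t" using d unfolding e by auto
    qed
    then show "\<forall>\<^sub>F n in sequentially. t - (1 / 2) ^ n \<le> ?d n" "\<forall>\<^sub>F n in sequentially. ?d n \<le> t" by auto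
    have "(\<lambda>n. t - (1 / 2) ^ n) \<longlonglongrightarrow> t - 0" by (intro tendsto_intros LIMSEQ_realpow_zero) auto
    then show "(\<lambda>n. t - (1 / 2) ^ n) \<longlonglongrightarrow> t" by simp
  qed simp
  then show ?thesis
    using continuous_on_tendsto_compose[OF tame_continuous[OF assms(1)], of ?d t sequentially] assms(2) by auto
qed

section \<open>A Wiener process on the path space\<close>

lemma gauss_scaled:
  assumes "0 < c"
  shows "distributed gauss lborel (\<lambda>z. c * z) (normal_density 0 c)"
proof -
  have "distributed gauss lborel (\<lambda>z. z) (normal_density 0 1)"
    unfolding distributed_def by (auto simp: distr_id2)
  from noise.M.normal_density_affine[OF this, of c 0] assms show ?thesis by simp
qed

lemma noise_sum_distr:
  assumes I: "finite I"
  shows "distr noise_space borel (\<lambda>w. \<Sum>p\<in>I. w p) = distr gauss borel (\<lambda>z. sqrt (real (card I)) * z)"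
proof (cases "I = {}")
  case True
  have "distr noise_space borel (\<lambda>w. 0 :: real) = return borel 0" by (rule noise_prob.distr_const) simp
  moreover have "distr gauss borel (\<lambda>z. 0 :: real) = return borel 0" by (rule noise.M.distr_const) simp
  ultimately show ?thesis using True by simp
next
  case False
  have c: "0 < sqrt (real (card I))" using I False by (simp add: card_gt_0_iff)
  have d: "distributed noise_space lborel (\<lambda>w. w p) (normal_density 0 1)" for p
  proof -
    have "distr noise_space lborel (\<lambda>w. w p) = distr noise_space gauss (\<lambda>w. w p)" by (rule distr_cong) auto
    also have "\<dots> = gauss" unfolding noise_space_def by (rule noise.PiM_component) simp
    finally show ?thesis unfolding distributed_def by auto
  qed
  have "distributed noise_space lborel (\<lambda>w. \<Sum>p\<in>I. w p) (normal_density (\<Sum>p\<in>I. 0) (sqrt (\<Sum>p\<in>I. 1\<^sup>2)))"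
    by (rule noise_prob.sum_indep_normal) (use I False d noise_prob.indep_vars_subset[OF noise_indep] in auto)
  then have "distr noise_space lborel (\<lambda>w. \<Sum>p\<in>I. w p) = density lborel (normal_density 0 (sqrt (real (card I))))"
    by (simp add: distributed_def)
  also have "\<dots> = distr gauss lborel (\<lambda>z. sqrt (real (card I)) * z)"
    using gauss_scaled[OF c] by (simp add: distributed_def)
  finally have "distr noise_space lborel (\<lambda>w. \<Sum>p\<in>I. w p) = distr gauss lborel (\<lambda>z. sqrt (real (card I)) * z)" .
  moreover have "distr noise_space lborel (\<lambda>w. \<Sum>p\<in>I. w p) = distr noise_space borel (\<lambda>w. \<Sum>p\<in>I. w p)" by (rule distr_cong) auto
  moreover have "distr gauss lborel (\<lambda>z. sqrt (real (card I)) * z) = distr gauss borel (\<lambda>z. sqrt (real (card I)) * z)" by (rule distr_cong) auto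
  ultimately show ?thesis by simp
qed

text \<open>
  Increments between dyadic times are sums over disjoint sets of coordinates of \<open>level n w\<close>, and
  \<open>level n\<close> preserves the law of the noise.
\<close>

lemma brownian_dyadic_increments:
  fixes h :: "nat \<Rightarrow> real \<Rightarrow> real" and a :: "nat \<Rightarrow> nat"
  assumes mono: "\<And>i. i < m \<Longrightarrow> a i \<le> a (Suc i)" and h: "\<And>i. continuous_on UNIV (h i)" "\<And>i x. 0 \<le> h i x" "\<And>i x. h i x \<le> 1"
  shows "(\<integral>w. (\<Prod>i<m. h i (brownian (real (a (Suc i)) / 2 ^ n) w - brownian (real (a i) / 2 ^ n) w)) \<partial>noise_space)
    = (\<Prod>i<m. \<integral>z. h i (sqrt (real (a (Suc i)) / 2 ^ n - real (a i) / 2 ^ n) * z) \<partial>gauss)"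
proof (cases "m = 0")
  case True
  then show ?thesis using noise_prob.prob_space by simp
next
  case m: False
  let ?s = "(1 / sqrt 2) ^ n :: real"
  have hm [measurable]: "h i \<in> borel_measurable borel" for i using h(1) by (rule borel_measurable_continuous_onI)
  define K where "K i = {0 :: nat} \<times> {a i..<a (Suc i)}" for i
  have amono: "a i \<le> a j" if "i \<le> j" "j \<le> m" for i j
    using that
  proof (induction j rule: dec_induct)
    case (step j)
    then show ?case using mono[of j] by simp
  qed simp
  have disj: "disjoint_family_on K {..<m}"
    unfolding disjoint_family_on_def
  proof (intro ballI impI)
    fix i j assume ij: "i \<in> {..<m}" "j \<in> {..<m}" "i \<noteq> j"
    consider "Suc i \<le> j" | "Suc j \<le> i" using ij by linarith
    then show "K i \<inter> K j = {}"
      by cases (use amono[of "Suc i" j] amono[of "Suc j" i] ij in \<open>auto simp: K_def\<close>)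
  qed
  have fK: "finite (K i)" and cK: "card (K i) = a (Suc i) - a i" for i by (auto simp: K_def)
  define Z where "Z i w = ?s * (\<Sum>p\<in>K i. w p)" for i and w :: "nat \<times> nat \<Rightarrow> real"
  have Zm [measurable]: "Z i \<in> borel_measurable noise_space" for i
    unfolding Z_def by measurable
  have incr: "brownian (real (a (Suc i)) / 2 ^ n) w - brownian (real (a i) / 2 ^ n) w = Z i (level n w)" if "i < m" for i w
  proof -
    have "(\<Sum>k<a (Suc i). level n w (0, k)) = (\<Sum>k<a i. level n w (0, k)) + (\<Sum>k\<in>{a i..<a (Suc i)}. level n w (0, k))"
      using sum.atLeastLessThan_concat[of 0 "a i" "a (Suc i)" "\<lambda>k. level n w (0, k)"] mono[OF that]
      by (simp add: lessThan_atLeast0)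
    moreover have "(\<Sum>p\<in>K i. level n w p) = (\<Sum>k\<in>{a i..<a (Suc i)}. level n w (0, k))"
      unfolding K_def by (rule sum.reindex_cong[of "\<lambda>k. (0, k)"]) (auto simp: inj_on_def)
    ultimately show ?thesis by (simp add: brownian_dyadic Z_def algebra_simps)
  qed
  have ind: "noise_prob.indep_vars (\<lambda>_. borel) (\<lambda>i w. h i (Z i w)) {..<m}"
  proof -
    have "noise_prob.indep_vars (\<lambda>i. PiM (K i) (\<lambda>_. borel)) (\<lambda>i w. restrict (\<lambda>p. w p) (K i)) {..<m}"
      by (rule noise_prob.indep_vars_restrict[OF noise_indep _ disj]) auto
    then have "noise_prob.indep_vars (\<lambda>_. borel) (\<lambda>i w. (\<lambda>v. h i (?s * (\<Sum>p\<in>K i. v p))) (restrict (\<lambda>p. w p) (K i))) {..<m}"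
      by (rule noise_prob.indep_vars_compose2) measurable
    then show ?thesis by (simp add: Z_def)
  qed
  have int: "integrable noise_space (\<lambda>w. h i (Z i w))" for i
    by (rule noise_prob.integrable_const_bound[of _ 1]) (use h in auto)
  have marg: "(\<integral>w. h i (Z i w) \<partial>noise_space) = (\<integral>z. h i (sqrt (real (a (Suc i)) / 2 ^ n - real (a i) / 2 ^ n) * z) \<partial>gauss)" if "i < m" for i
  proof -
    have "(\<integral>w. h i (Z i w) \<partial>noise_space) = (\<integral>y. h i (?s * y) \<partial>distr noise_space borel (\<lambda>w. \<Sum>p\<in>K i. w p))"
      unfolding Z_def by (subst integral_distr) auto
    also have "\<dots> = (\<integral>z. h i (?s * (sqrt (real (card (K i))) * z)) \<partial>gauss)"
      unfolding noise_sum_distr[OF fK] by (subst integral_distr) auto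
    also have "\<dots> = (\<integral>z. h i (sqrt (real (a (Suc i)) / 2 ^ n - real (a i) / 2 ^ n) * z) \<partial>gauss)"
    proof -
      have "real (a (Suc i)) / 2 ^ n - real (a i) / 2 ^ n = (1 / 2) ^ n * real (card (K i))"
        using mono[OF that] by (simp add: cK of_nat_diff power_one_over diff_divide_distrib)
      then have "sqrt (real (a (Suc i)) / 2 ^ n - real (a i) / 2 ^ n) = sqrt ((1 / 2) ^ n) * sqrt (real (card (K i)))"
        by (simp only: real_sqrt_mult)
      also have "sqrt ((1 / 2) ^ n) = ?s" by (simp add: real_sqrt_power real_sqrt_divide)
      finally show ?thesis by (simp add: mult.assoc)
    qed
    finally show ?thesis .
  qed
  have "(\<integral>w. (\<Prod>i<m. h i (brownian (real (a (Suc i)) / 2 ^ n) w - brownian (real (a i) / 2 ^ n) w)) \<partial>noise_space)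
     = (\<integral>w. (\<Prod>i<m. h i (Z i (level n w))) \<partial>noise_space)"
    by (intro Bochner_Integration.integral_cong prod.cong refl) (simp add: incr)
  also have "\<dots> = (\<integral>w. (\<Prod>i<m. h i (Z i w)) \<partial>distr noise_space noise_space (level n))"
    by (rule integral_distr[symmetric]) measurable
  also have "\<dots> = (\<Prod>i<m. \<integral>w. h i (Z i w) \<partial>noise_space)"
    unfolding level_distr by (rule noise_prob.indep_vars_lebesgue_integral) (use ind int in auto)
  also have "\<dots> = (\<Prod>i<m. \<integral>z. h i (sqrt (real (a (Suc i)) / 2 ^ n - real (a i) / 2 ^ n) * z) \<partial>gauss)"
    by (rule prod.cong) (auto simp: marg)
  finally show ?thesis .
qed

text \<open>
  Continuity of the paths extends the product formula from dyadic to arbitrary times.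
\<close>

lemma brownian_increments_test:
  fixes h :: "nat \<Rightarrow> real \<Rightarrow> real"
  assumes s: "0 \<le> s 0" "\<And>i. i < m \<Longrightarrow> s i \<le> s (Suc i)"
    and h: "\<And>i. continuous_on UNIV (h i)" "\<And>i x. 0 \<le> h i x" "\<And>i x. h i x \<le> 1"
  shows "(\<integral>w. (\<Prod>i<m. h i (brownian (s (Suc i)) w - brownian (s i) w)) \<partial>noise_space)
    = (\<Prod>i<m. \<integral>z. h i (sqrt (s (Suc i) - s i) * z) \<partial>gauss)"
proof -
  have hm [measurable]: "h i \<in> borel_measurable borel" for i using h(1) by (rule borel_measurable_continuous_onI)
  have hc: "isCont (h i) x" for i x using h(1) by (simp add: continuous_on_eq_continuous_at)
  have s0: "0 \<le> s i" if "i \<le> m" for i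
    using that by (induction i) (use s in \<open>auto intro: order_trans\<close>)
  define a where "a n i = nat \<lfloor>2 ^ n * s i\<rfloor>" for n i
  have am: "a n i \<le> a n (Suc i)" if "i < m" for n i
    unfolding a_def using s(2)[OF that] by (intro nat_mono floor_mono mult_left_mono) auto
  have alim: "(\<lambda>n. real (a n i) / 2 ^ n) \<longlonglongrightarrow> s i" if "i \<le> m" for i
  proof (rule tendsto_sandwich)
    have fl: "real (a n i) = of_int \<lfloor>2 ^ n * s i\<rfloor>" for n using s0[OF that] by (simp add: a_def)
    have "s i - (1 / 2) ^ n \<le> real (a n i) / 2 ^ n \<and> real (a n i) / 2 ^ n \<le> s i" for n
    proof -
      have "2 ^ n * s i - 1 \<le> of_int \<lfloor>2 ^ n * s i\<rfloor>" "of_int \<lfloor>2 ^ n * s i\<rfloor> \<le> 2 ^ n * s i" by linarith+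
      then have d: "(2 ^ n * s i - 1) / 2 ^ n \<le> real (a n i) / 2 ^ n" "real (a n i) / 2 ^ n \<le> 2 ^ n * s i / 2 ^ n"
        unfolding fl by (intro divide_right_mono; simp)+
      have e: "2 ^ n * s i / 2 ^ n = s i" "(2 ^ n * s i - 1) / 2 ^ n = s i - (1 / 2) ^ n"
        by (simp_all add: diff_divide_distrib power_one_over)
      show ?thesis using d unfolding e by auto
    qed
    then show "\<forall>\<^sub>F n in sequentially. s i - (1 / 2) ^ n \<le> real (a n i) / 2 ^ n" "\<forall>\<^sub>F n in sequentially. real (a n i) / 2 ^ n \<le> s i" by auto
    have "(\<lambda>n. s i - (1 / 2) ^ n) \<longlonglongrightarrow> s i - 0" by (intro tendsto_intros LIMSEQ_realpow_zero) auto
    then show "(\<lambda>n. s i - (1 / 2) ^ n) \<longlonglongrightarrow> s i" by simp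
  qed simp
  have pb: "norm (\<Prod>i<m. h i (x i)) \<le> 1" for x
  proof -
    have "0 \<le> (\<Prod>i<m. h i (x i))" "(\<Prod>i<m. h i (x i)) \<le> 1" using h by (auto intro!: prod_nonneg prod_le_1)
    then show ?thesis by simp
  qed
  have "(\<lambda>n. \<integral>w. (\<Prod>i<m. h i (brownian (real (a n (Suc i)) / 2 ^ n) w - brownian (real (a n i) / 2 ^ n) w)) \<partial>noise_space)
     \<longlonglongrightarrow> (\<integral>w. (\<Prod>i<m. h i (brownian (s (Suc i)) w - brownian (s i) w)) \<partial>noise_space)"
  proof (rule integral_dominated_convergence[where w="\<lambda>_. 1"])
    show "AE w in noise_space. (\<lambda>n. \<Prod>i<m. h i (brownian (real (a n (Suc i)) / 2 ^ n) w - brownian (real (a n i) / 2 ^ n) w))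
        \<longlonglongrightarrow> (\<Prod>i<m. h i (brownian (s (Suc i)) w - brownian (s i) w))"
      using AE_tame
    proof eventually_elim
      case (elim w)
      show ?case
      proof (intro tendsto_prod isCont_tendsto_compose[OF hc] tendsto_diff)
        fix i assume "i \<in> {..<m}"
        then show "(\<lambda>n. brownian (real (a n (Suc i)) / 2 ^ n) w) \<longlonglongrightarrow> brownian (s (Suc i)) w"
          "(\<lambda>n. brownian (real (a n i) / 2 ^ n) w) \<longlonglongrightarrow> brownian (s i) w"
          unfolding a_def by (auto intro!: brownian_dyadic_limit elim s0)
      qed
    qed
  qed (use pb in auto)
  moreover have "(\<lambda>n. \<Prod>i<m. \<integral>z. h i (sqrt (real (a n (Suc i)) / 2 ^ n - real (a n i) / 2 ^ n) * z) \<partial>gauss)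
     \<longlonglongrightarrow> (\<Prod>i<m. \<integral>z. h i (sqrt (s (Suc i) - s i) * z) \<partial>gauss)"
  proof (rule tendsto_prod)
    fix i assume i: "i \<in> {..<m}"
    show "(\<lambda>n. \<integral>z. h i (sqrt (real (a n (Suc i)) / 2 ^ n - real (a n i) / 2 ^ n) * z) \<partial>gauss)
      \<longlonglongrightarrow> (\<integral>z. h i (sqrt (s (Suc i) - s i) * z) \<partial>gauss)"
    proof (rule integral_dominated_convergence[where w="\<lambda>_. 1"])
      show "AE z in gauss. (\<lambda>n. h i (sqrt (real (a n (Suc i)) / 2 ^ n - real (a n i) / 2 ^ n) * z)) \<longlonglongrightarrow> h i (sqrt (s (Suc i) - s i) * z)"
        using i by (intro AE_I2 isCont_tendsto_compose[OF hc] tendsto_mult tendsto_real_sqrt tendsto_diff alim tendsto_const) auto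
    qed (use h in auto)
  qed
  moreover have "(\<integral>w. (\<Prod>i<m. h i (brownian (real (a n (Suc i)) / 2 ^ n) w - brownian (real (a n i) / 2 ^ n) w)) \<partial>noise_space)
    = (\<Prod>i<m. \<integral>z. h i (sqrt (real (a n (Suc i)) / 2 ^ n - real (a n i) / 2 ^ n) * z) \<partial>gauss)" for n
    by (rule brownian_dyadic_increments) (use am h in auto)
  ultimately show ?thesis by (simp add: LIMSEQ_unique)
qed

lemma cutoff_tendsto:
  "(\<lambda>k. max 0 (min 1 (1 - real k * (x - a)))) \<longlonglongrightarrow> (indicator {..a} x :: real)"
proof (cases "x \<le> a")
  case True
  have "max 0 (min 1 (1 - real k * (x - a))) = 1" for k
  proof -
    have "real k * (x - a) \<le> 0" using True by (intro mult_nonneg_nonpos) auto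
    then show ?thesis by simp
  qed
  then show ?thesis using True by simp
next
  case False
  then obtain k0 where k0: "1 < real k0 * (x - a)" using reals_Archimedean3[of "x - a"] by auto
  have "\<forall>\<^sub>F k in sequentially. max 0 (min 1 (1 - real k * (x - a))) = indicator {..a} x"
    using eventually_ge_at_top[of k0]
  proof eventually_elim
    case (elim k)
    have "real k0 * (x - a) \<le> real k * (x - a)" using elim False by (intro mult_right_mono) auto
    then have "1 < real k * (x - a)" using k0 by linarith
    then have "max 0 (min 1 (1 - real k * (x - a))) = 0" by linarith
    then show ?case using False by simp
  qed
  then show ?thesis by (rule tendsto_eventually)
qed

lemma brownian_increments_cdf:
  assumes s: "0 \<le> s 0" "\<And>i. i < m \<Longrightarrow> s i \<le> s (Suc i)"
  shows "noise_prob.prob {w. \<forall>i<m. brownian (s (Suc i)) w - brownian (s i) w \<le> a i}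
    = (\<Prod>i<m. measure gauss {z. sqrt (s (Suc i) - s i) * z \<le> a i})"
proof -
  let ?h = "\<lambda>k i x. max 0 (min 1 (1 - real k * (x - a i)))"
  let ?X = "\<lambda>i w. brownian (s (Suc i)) w - brownian (s i) w"
  have eq: "(\<integral>w. (\<Prod>i<m. ?h k i (?X i w)) \<partial>noise_space) = (\<Prod>i<m. \<integral>z. ?h k i (sqrt (s (Suc i) - s i) * z) \<partial>gauss)" for k
    by (rule brownian_increments_test[OF s]) (auto intro!: continuous_intros)
  have pb: "norm (\<Prod>i<m. ?h k i (x i)) \<le> 1" for x k
  proof -
    have "0 \<le> (\<Prod>i<m. ?h k i (x i))" "(\<Prod>i<m. ?h k i (x i)) \<le> 1" by (auto intro!: prod_nonneg prod_le_1)
    then show ?thesis by simp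
  qed
  have "(\<lambda>k. \<integral>w. (\<Prod>i<m. ?h k i (?X i w)) \<partial>noise_space) \<longlonglongrightarrow> (\<integral>w. (\<Prod>i<m. indicator {..a i} (?X i w)) \<partial>noise_space)"
    by (rule integral_dominated_convergence[where w="\<lambda>_. 1"]) (use pb in \<open>auto intro!: tendsto_prod cutoff_tendsto\<close>)
  moreover have "(\<lambda>k. \<Prod>i<m. \<integral>z. ?h k i (sqrt (s (Suc i) - s i) * z) \<partial>gauss)
     \<longlonglongrightarrow> (\<Prod>i<m. \<integral>z. indicator {..a i} (sqrt (s (Suc i) - s i) * z) \<partial>gauss)"
    by (intro tendsto_prod integral_dominated_convergence[where w="\<lambda>_. 1"]) (auto intro!: cutoff_tendsto)
  ultimately have lim: "(\<integral>w. (\<Prod>i<m. indicator {..a i} (?X i w)) \<partial>noise_space) = (\<Prod>i<m. \<integral>z. (indicator {..a i} (sqrt (s (Suc i) - s i) * z) :: real) \<partial>gauss)"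
    unfolding eq by (rule LIMSEQ_unique)
  have "(\<Prod>i<m. indicator {..a i} (?X i w)) = (indicator {w. \<forall>i<m. ?X i w \<le> a i} w :: real)" for w
    by (auto simp: indicator_def)
  moreover have "indicator {..a i} (sqrt (s (Suc i) - s i) * z) = (indicator {z. sqrt (s (Suc i) - s i) * z \<le> a i} z :: real)" for i z
    by (auto simp: indicator_def)
  ultimately show ?thesis using lim by simp
qed

text \<open>
  The joint distribution functions of the increments factorise. For independence, half-lines
  together with the whole line form an intersection-stable generator; the whole line is reached as
  an increasing union of half-lines.
\<close>

theorem wiener_process_brownian: "wiener_process noise_space brownian"
  unfolding wiener_process_def
proof (intro conjI allI impI)
  show "AE w in noise_space. brownian 0 w = 0"
    using brownian_dyadic[of 0 0] by simp
  show "AE w in noise_space. continuous_on {0..} (\<lambda>t. brownian t w)"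
    using AE_tame by eventually_elim (rule tame_continuous)
next
  fix s t :: real assume st: "0 \<le> s" "s < t"
  have c: "0 < sqrt (t - s)" using st by simp
  let ?X = "\<lambda>w. brownian t w - brownian s w"
  have "distr noise_space borel ?X = distr gauss borel (\<lambda>z. sqrt (t - s) * z)"
  proof (rule cdf_unique)
    show "real_distribution (distr noise_space borel ?X)" by (rule noise_prob.real_distribution_distr) simp
    show "real_distribution (distr gauss borel (\<lambda>z. sqrt (t - s) * z))" by (rule noise.M.real_distribution_distr) simp
    show "cdf (distr noise_space borel ?X) = cdf (distr gauss borel (\<lambda>z. sqrt (t - s) * z))"
    proof
      fix a
      have "noise_prob.prob {w. ?X w \<le> a} = measure gauss {z. sqrt (t - s) * z \<le> a}"
        using brownian_increments_cdf[of "\<lambda>i. if i = 0 then s else t" 1 "\<lambda>_. a"] st by simp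
      then show "cdf (distr noise_space borel ?X) a = cdf (distr gauss borel (\<lambda>z. sqrt (t - s) * z)) a"
        by (simp add: cdf_def2 measure_distr vimage_def)
    qed
  qed
  moreover have "distr noise_space lborel ?X = distr noise_space borel ?X" by (rule distr_cong) auto
  moreover have "distr gauss lborel (\<lambda>z. sqrt (t - s) * z) = distr gauss borel (\<lambda>z. sqrt (t - s) * z)" by (rule distr_cong) auto
  ultimately show "distributed noise_space lborel ?X (normal_density 0 (sqrt (t - s)))"
    using gauss_scaled[OF c] by (simp add: distributed_def)
next
  fix n :: nat and s :: "nat \<Rightarrow> real" assume s: "0 \<le> s 0" "\<forall>i<n. s i < s (Suc i)"
  let ?X = "\<lambda>i w. brownian (s (Suc i)) w - brownian (s i) w"
  show "noise_prob.indep_vars (\<lambda>_. borel) ?X {..<n}"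
  proof (cases "n = 0")
    case True
    then show ?thesis by (simp add: noise_prob.indep_vars_def noise_prob.indep_sets_def)
  next
    case False
    have s': "0 \<le> s i" if "i \<le> n" for i using that
    proof (induction i)
      case (Suc i)
      then show ?case using s(2)[rule_format, of i] by simp
    qed (use s in simp)
    have ev: "{w. \<forall>i<n. ?X i w \<le> b i} \<in> noise_prob.events" for b
    proof -
      have "{w \<in> space noise_space. \<forall>i\<in>{..<n}. ?X i w \<le> b i} \<in> noise_prob.events" by measurable
      then show ?thesis by (simp add: Ball_def)
    qed
    have ev1: "{w. ?X i w \<le> b} \<in> noise_prob.events" for i b
    proof -
      have "{w \<in> space noise_space. ?X i w \<le> b} \<in> noise_prob.events" by measurable
      then show ?thesis by simp
    qed
    let ?E = "\<lambda>i::nat. insert UNIV (range atMost) :: real set set"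
    have marg: "noise_prob.prob {w. ?X i w \<le> a} = measure gauss {z. sqrt (s (Suc i) - s i) * z \<le> a}" if "i < n" for i a
      using brownian_increments_cdf[of "\<lambda>k. if k = 0 then s i else s (Suc i)" 1 "\<lambda>_. a"] s s'[of i] that
      by (simp add: less_imp_le)
    show ?thesis
    proof (subst noise_prob.indep_vars_finite[where E="?E"])
      show "sets (borel :: real measure) = sigma_sets (space borel) (?E i)" if "i \<in> {..<n}" for i
      proof -
        have "sigma_sets UNIV (insert UNIV (range atMost)) = sigma_sets UNIV (range (atMost :: real \<Rightarrow> _))"
          by (rule sigma_sets_eqI) (auto intro: sigma_sets_top)
        then show ?thesis unfolding borel_eq_atMost by (simp add: sets_measure_of)
      qed
      show "Int_stable (?E i)" if "i \<in> {..<n}" for i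
        by (auto simp: Int_stable_def Int_atMost)
      show "\<forall>A\<in>\<Pi> i\<in>{..<n}. ?E i. noise_prob.prob (\<Inter>j\<in>{..<n}. ?X j -` A j \<inter> space noise_space) = (\<Prod>j<n. noise_prob.prob (?X j -` A j \<inter> space noise_space))"
      proof
        fix A assume A: "A \<in> (\<Pi> i\<in>{..<n}. ?E i)"
        \<comment> \<open>half-lines are prescribed for the indices in \<open>J\<close>; the other coordinates are unrestricted\<close>
        define J where "J = {i. i < n \<and> A i \<noteq> UNIV}"
        have "\<exists>a. A i = {..a}" if "i \<in> J" for i using A that by (auto simp: J_def Pi_iff)
        then obtain a where a: "\<And>i. i \<in> J \<Longrightarrow> A i = {..a i}" by metis
        have "(\<lambda>k. noise_prob.prob {w. \<forall>i<n. ?X i w \<le> (if i \<in> J then a i else real k)}) \<longlonglongrightarrow>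
            noise_prob.prob (\<Union>k. {w. \<forall>i<n. ?X i w \<le> (if i \<in> J then a i else real k)})"
        proof (rule noise_prob.finite_Lim_measure_incseq)
          show "range (\<lambda>k. {w. \<forall>i<n. ?X i w \<le> (if i \<in> J then a i else real k)}) \<subseteq> noise_prob.events" by (intro image_subsetI ev)
          show "incseq (\<lambda>k. {w. \<forall>i<n. ?X i w \<le> (if i \<in> J then a i else real k)})"
          proof (intro incseq_SucI subsetI CollectI allI impI)
            fix k w i assume w: "w \<in> {w. \<forall>i<n. ?X i w \<le> (if i \<in> J then a i else real k)}" and i: "i < n"
            have "?X i w \<le> (if i \<in> J then a i else real k)" using w i by blast
            also have "\<dots> \<le> (if i \<in> J then a i else real (Suc k))" by simp
            finally show "?X i w \<le> (if i \<in> J then a i else real (Suc k))" .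
          qed
        qed
        moreover have "(\<Union>k. {w. \<forall>i<n. ?X i w \<le> (if i \<in> J then a i else real k)}) = (\<Inter>j\<in>{..<n}. ?X j -` A j \<inter> space noise_space)"
        proof safe
          fix w j k assume "\<forall>i<n. ?X i w \<le> (if i \<in> J then a i else real k)" "j < n"
          then have "?X j w \<le> (if j \<in> J then a j else real k)" by blast
          then show "w \<in> ?X j -` A j" using a[of j] \<open>j < n\<close> by (cases "j \<in> J") (auto simp: J_def)
        next
          fix w assume w: "w \<in> (\<Inter>j\<in>{..<n}. ?X j -` A j \<inter> space noise_space)"
          obtain k where k: "Max ((\<lambda>i. ?X i w) ` {..<n}) \<le> real k" using real_arch_simple by blast
          have "?X i w \<le> real k" if "i < n" for i
            using Max_ge[of "(\<lambda>i. ?X i w) ` {..<n}" "?X i w"] k that by (intro order_trans[OF _ k] Max_ge) auto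
          then have "\<forall>i<n. ?X i w \<le> (if i \<in> J then a i else real k)" using w a by auto
          then show "w \<in> (\<Union>k. {w. \<forall>i<n. ?X i w \<le> (if i \<in> J then a i else real k)})" by blast
        qed auto
        moreover have "(\<lambda>k. \<Prod>i<n. noise_prob.prob {w. ?X i w \<le> (if i \<in> J then a i else real k)}) \<longlonglongrightarrow>
            (\<Prod>i<n. noise_prob.prob (?X i -` A i \<inter> space noise_space))"
        proof (rule tendsto_prod)
          fix i assume i: "i \<in> {..<n}"
          show "(\<lambda>k. noise_prob.prob {w. ?X i w \<le> (if i \<in> J then a i else real k)}) \<longlonglongrightarrow> noise_prob.prob (?X i -` A i \<inter> space noise_space)"
          proof (cases "i \<in> J")
            case True
            then show ?thesis using a[OF True] by (simp add: vimage_def)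
          next
            case False
            then have "A i = UNIV" using i by (simp add: J_def)
            moreover have "(\<lambda>k. noise_prob.prob {w. ?X i w \<le> real k}) \<longlonglongrightarrow> noise_prob.prob (\<Union>k. {w. ?X i w \<le> real k})"
              by (rule noise_prob.finite_Lim_measure_incseq) (use ev1 in \<open>auto simp: incseq_def intro: order_trans\<close>)
            moreover have "(\<Union>k. {w. ?X i w \<le> real k}) = UNIV" using real_arch_simple by auto
            ultimately show ?thesis using False by simp
          qed
        qed
        moreover have "noise_prob.prob {w. \<forall>i<n. ?X i w \<le> (if i \<in> J then a i else real k)} =
            (\<Prod>i<n. noise_prob.prob {w. ?X i w \<le> (if i \<in> J then a i else real k)})" for k
          using brownian_increments_cdf[of s n "\<lambda>i. if i \<in> J then a i else real k"] s marg by (simp add: less_imp_le)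
        ultimately show "noise_prob.prob (\<Inter>j\<in>{..<n}. ?X j -` A j \<inter> space noise_space) = (\<Prod>j<n. noise_prob.prob (?X j -` A j \<inter> space noise_space))"
          using LIMSEQ_unique by simp
      qed
    qed (use False in auto)
  qed
qed simp

lemma wiener_process_transport:
  assumes W: "wiener_process N \<zeta>" and N: "prob_space N" and f: "f \<in> measurable M N" and M: "prob_space M" "distr M N f = N"
  shows "wiener_process M (\<lambda>t x. \<zeta> t (f x))"
proof -
  interpret N: prob_space N by fact
  interpret M: prob_space M by fact
  have z: "0 \<le> t \<Longrightarrow> \<zeta> t \<in> borel_measurable N" for t using W by (simp add: wiener_process_def)
  have ae: "AE x in M. P (f x)" if "AE x in N. P x" for P
  proof -
    have "AE x in distr M N f. P x" unfolding M(2) by (rule that)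
    then show ?thesis by (rule AE_distrD[OF f])
  qed
  have dist: "distributed M lborel (\<lambda>x. X (f x)) g" if "distributed N lborel X g" for X :: "_ \<Rightarrow> real" and g
  proof -
    have Xm: "X \<in> measurable N lborel" and Xd: "distr N lborel X = density lborel g" and gm: "g \<in> borel_measurable lborel"
      using that by (auto simp: distributed_def)
    have "distr M lborel (\<lambda>x. X (f x)) = distr (distr M N f) lborel X"
      using distr_distr[OF Xm f] by (simp add: comp_def)
    then show ?thesis using Xd M(2) gm measurable_compose[OF f Xm] by (simp add: distributed_def)
  qed
  have ind: "M.indep_vars (\<lambda>_. borel) (\<lambda>i x. X i (f x)) {..<n}" if "N.indep_vars (\<lambda>_. borel) X {..<n}" for X :: "nat \<Rightarrow> _ \<Rightarrow> real" and n :: nat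
  proof (cases "n = 0")
    case True
    then show ?thesis by (simp add: M.indep_vars_def M.indep_sets_def)
  next
    case False
    have Xm: "i < n \<Longrightarrow> X i \<in> borel_measurable N" for i using that by (auto simp: N.indep_vars_def)
    have 1: "distr M borel (\<lambda>x. X i (f x)) = distr N borel (X i)" if "i < n" for i
      using distr_distr[OF Xm[OF that] f] M(2) by (simp add: comp_def)
    have "(\<lambda>x. \<lambda>i\<in>{..<n}. X i x) \<in> measurable N (PiM {..<n} (\<lambda>_. borel))"
      using Xm by (intro measurable_restrict) auto
    from distr_distr[OF this f] have 2: "distr M (PiM {..<n} (\<lambda>_. borel)) (\<lambda>x. \<lambda>i\<in>{..<n}. X i (f x)) = distr N (PiM {..<n} (\<lambda>_. borel)) (\<lambda>x. \<lambda>i\<in>{..<n}. X i x)"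
      using M(2) by (simp add: comp_def)
    have 3: "distr N (PiM {..<n} (\<lambda>_. borel)) (\<lambda>x. \<lambda>i\<in>{..<n}. X i x) = PiM {..<n} (\<lambda>i. distr N borel (X i))"
      using that False Xm by (subst (asm) N.indep_vars_iff_distr_eq_PiM') auto
    show ?thesis
      by (subst M.indep_vars_iff_distr_eq_PiM')
         (use False Xm measurable_compose[OF f] 1 in \<open>auto simp: 2 3 intro!: PiM_cong\<close>)
  qed
  show ?thesis
    using W unfolding wiener_process_def
    by (auto intro!: ae dist ind measurable_compose[OF f])
qed

text \<open>
  The noise is stored in the first component of a path by means of the pairing function; the
  measurable sets of paths are those described by the decoded noise.
\<close>

lemma exists_wiener_on_paths:
  obtains M :: "paths measure" and \<zeta> where "prob_space M" "wiener_process M \<zeta>"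
proof -
  define f :: "paths \<Rightarrow> nat \<times> nat \<Rightarrow> real" where "f x = (\<lambda>p. fst x (prod_encode p))" for x
  define g :: "(nat \<times> nat \<Rightarrow> real) \<Rightarrow> paths" where "g w = (\<lambda>k. w (prod_decode k), \<lambda>_. 0, \<lambda>_. 0)" for w
  have fg: "f (g w) = w" for w by (simp add: f_def g_def)
  define M where "M = distr noise_space (vimage_algebra UNIV f noise_space) g"
  have gm: "g \<in> measurable noise_space (vimage_algebra UNIV f noise_space)"
    by (rule measurable_vimage_algebra2) (auto simp: fg)
  have fm: "f \<in> measurable M noise_space"
    unfolding M_def by (simp add: measurable_vimage_algebra1)
  have M: "prob_space M" unfolding M_def by (rule noise_prob.prob_space_distr[OF gm])
  have "distr M noise_space f = distr noise_space noise_space (f \<circ> g)"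
    unfolding M_def by (rule distr_distr) (use gm in \<open>auto simp: measurable_vimage_algebra1\<close>)
  also have "f \<circ> g = (\<lambda>w. w)" by (auto simp: fg)
  finally have "distr M noise_space f = noise_space" by (simp add: distr_id2)
  from wiener_process_transport[OF wiener_process_brownian noise_prob.prob_space_axioms fm M this] show ?thesis
    using that[OF M] by blast
qed

section \<open>Block decomposition of a lacunary system\<close>

lemma power_difference_bounds:
  fixes x y :: real
  assumes "0 \<le> x" and y: "y = x + 1"
  shows "y ^ n \<le> y ^ Suc n - x ^ Suc n" "y ^ Suc n - x ^ Suc n \<le> real (Suc n) * y ^ n"
proof -
  have "x * x ^ n \<le> x * y ^ n" using assms by (intro mult_left_mono power_mono) auto
  moreover have "y * y ^ n = x * y ^ n + y ^ n" unfolding y by (simp only: distrib_right mult_1_left)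
  ultimately show "y ^ n \<le> y ^ Suc n - x ^ Suc n" unfolding power_Suc by linarith
  show "y ^ Suc n - x ^ Suc n \<le> real (Suc n) * y ^ n"
  proof (induction n)
    case 0
    then show ?case using y by simp
  next
    case (Suc n)
    have "y ^ Suc (Suc n) - x ^ Suc (Suc n) = y * (y ^ Suc n - x ^ Suc n) + x ^ Suc n"
      by (simp add: y algebra_simps)
    also have "\<dots> \<le> y * (real (Suc n) * y ^ n) + y ^ Suc n"
      using Suc assms by (intro add_mono mult_left_mono power_mono) auto
    also have "\<dots> = real (Suc (Suc n)) * y ^ Suc n" by (simp add: algebra_simps)
    finally show ?case .
  qed
qed

text \<open>
  The frequencies \<open>Q k\<close> grow so fast that the sum of all earlier ones is of relative size \<open>1 / k\<close>.
\<close>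

locale lacunary_system =
  fixes X m :: "nat \<Rightarrow> real \<Rightarrow> real" and Q :: "nat \<Rightarrow> nat" and W :: real
  assumes osc: "\<And>k. oscillating (1 / real (Q k)) W (X k) (m k)"
    and Q_pos: "\<And>k. 1 \<le> Q k" and Q_growth: "\<And>k. Suc k * Q k \<le> Q (Suc k)"
begin

lemma W_nonneg: "0 \<le> W" by (rule osc_W_nonneg[OF osc])

lemma X_bound: "\<bar>X k x\<bar> \<le> W" by (rule osc_bound[OF osc])

lemma X_borel [measurable]: "X k \<in> borel_measurable borel" by (rule osc_borel[OF osc])

lemma Q_real: "1 \<le> real (Q k)" using Q_pos[of k] by simp

lemma Q_mono: "i \<le> j \<Longrightarrow> Q i \<le> Q j"
proof (rule lift_Suc_mono_le[of Q])
  fix n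
  have "1 * Q n \<le> Suc n * Q n" by (intro mult_le_mono1) simp
  then show "Q n \<le> Q (Suc n)" using Q_growth[of n] by linarith
qed

lemma Q_ge: "n \<le> Q n"
proof (cases n)
  case (Suc k)
  have "Suc k * 1 \<le> Suc k * Q k" using Q_pos by (intro mult_le_mono2)
  then show ?thesis using Q_growth[of k] unfolding Suc by simp
qed simp

lemma Q_double: "2 * Q n \<le> Q (Suc (Suc n))"
proof -
  have "2 * Q n \<le> Suc (Suc n) * Q (Suc n)" using Q_mono[of n "Suc n"] by (intro mult_le_mono) auto
  then show ?thesis using Q_growth[of "Suc n"] by linarith
qed

lemma Q_ratio_sum: "(\<Sum>k<n. real (Q k)) / real (Q n) \<le> 4 / real (Suc n)"
proof -
  have "(\<Sum>k=1..<Suc n. real (Q (k - 1)) / real (Q (Suc n - 1))) \<le> 4 / real (Suc n)"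
  proof (rule sum_ratios_le)
    show "1 \<le> Q (k - 1)" for k by (rule Q_pos)
    show "k * Q (k - 1) \<le> Q (Suc k - 1)" if "1 \<le> k" for k using Q_growth[of "k - 1"] that by simp
  qed simp
  also have "(\<Sum>k=1..<Suc n. real (Q (k - 1)) / real (Q (Suc n - 1))) = (\<Sum>k<n. real (Q k) / real (Q n))"
    by (rule sum.reindex_bij_witness[of _ Suc "\<lambda>k. k - 1"]) auto
  finally show ?thesis by (simp add: sum_divide_distrib)
qed

text \<open>
  Cells of length \<open>1 / N\<close> on which the summands from index \<open>u\<close> on still oscillate rapidly: either the
  whole circle, or cells at least half as long as the period of the preceding summand.
\<close>

definition admissible :: "nat \<Rightarrow> nat \<Rightarrow> bool" where
  "admissible u N \<longleftrightarrow> N = 1 \<or> (1 \<le> u \<and> 1 \<le> N \<and> N \<le> 2 * Q (u - 1))"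

lemma admissible_pos: "admissible u N \<Longrightarrow> 0 < N"
  by (auto simp: admissible_def)

abbreviation per :: "nat \<Rightarrow> nat \<Rightarrow> nat \<Rightarrow> real" where
  "per u N i \<equiv> 1 / real (Q (u + i)) * real N"

lemma subsystem:
  assumes "0 < N"
  shows "oscillating_sequence (\<lambda>i y. X (u + i) ((a + y) / real N)) (\<lambda>i y. m (u + i) ((a + y) / real N)) (per u N) W b"
  by unfold_locales (use osc_rescale(1)[OF osc] assms W_nonneg in auto)

text \<open>
  The predecessors inside the block contribute at most the sum of all smaller frequencies. The
  term \<open>Suc i * N\<close>, which stems from the length of the cell, is at most twice such a sum.
\<close>

lemma eta_bound:
  assumes N: "admissible u N"
  shows "oscillating_sequence.eta (per u N) i \<le> 12 / real (Suc (u + i))"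
proof -
  have N0: "0 < N" by (rule admissible_pos[OF N])
  interpret O: oscillating_sequence "\<lambda>i y. X (u + i) ((0 + y) / real N)" "\<lambda>i y. m (u + i) ((0 + y) / real N)" "per u N" W "Suc i"
    by (rule subsystem[OF N0])
  let ?n = "u + i"
  let ?q = "real (Q ?n)"
  have q: "1 \<le> ?q" by (rule Q_real)
  have "O.eta i = real N / ?q * ((\<Sum>k<i. real (Q (u + k)) / real N + 1) + 1)"
    unfolding O.eta_def by simp
  also have "\<dots> = ((\<Sum>k<i. real (Q (u + k))) + real (Suc i) * real N) / ?q"
  proof -
    have "(\<Sum>k<i. real (Q (u + k)) / real N + 1) = (\<Sum>k<i. real (Q (u + k))) / real N + real i"
      by (simp add: sum.distrib sum_divide_distrib)
    moreover have "x / y * ((s / x + c) + 1) = (s + (1 + c) * x) / y" if "0 < x" for x y s c :: real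
      using that by (simp add: add_divide_distrib distrib_left distrib_right mult.commute)
    ultimately show ?thesis using N0 by (metis of_nat_0_less_iff of_nat_Suc)
  qed
  also have "\<dots> \<le> 12 / real (Suc ?n)"
  proof -
    have sub: "(\<Sum>k<i. real (Q (u + k))) \<le> (\<Sum>k<?n. real (Q k))"
    proof -
      have "(\<Sum>k<i. real (Q (u + k))) = (\<Sum>k\<in>{u..<u + i}. real (Q k))"
        by (rule sum.reindex_bij_witness[of _ "\<lambda>k. k - u" "\<lambda>k. u + k"]) auto
      also have "\<dots> \<le> (\<Sum>k<?n. real (Q k))" by (rule sum_mono2) auto
      finally show ?thesis .
    qed
    have r4: "(\<Sum>k<?n. real (Q k)) / ?q \<le> 4 / real (Suc ?n)" by (rule Q_ratio_sum)
    have "real (Suc i) * real N / ?q \<le> 8 / real (Suc ?n)"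
      using N unfolding admissible_def
    proof (elim disjE conjE)
      assume N1: "N = 1"
      have "real i \<le> real ?n" by simp
      also have "\<dots> = (\<Sum>k<?n. 1)" by simp
      also have "\<dots> \<le> (\<Sum>k<?n. real (Q k))" using Q_real by (intro sum_mono) auto
      finally have "real i / ?q \<le> 4 / real (Suc ?n)" using r4 q by (meson divide_right_mono of_nat_0_le_iff order_trans)
      moreover have "1 / ?q \<le> 2 / real (Suc ?n)"
      proof -
        have "real (Suc ?n) \<le> 2 * ?q" using Q_ge[of ?n] Q_pos[of ?n] by linarith
        then show ?thesis using q by (simp add: field_simps)
      qed
      moreover have "(1 + x) * 1 / y \<le> 8 / s" if "x / y \<le> 4 / s" "1 / y \<le> 2 / s" "0 < s" for x y s :: real
      proof -
        have "4 / s = 4 * (1 / s)" "2 / s = 2 * (1 / s)" "8 / s = 8 * (1 / s)" "0 < 1 / s" using that by simp_all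
        then show ?thesis using that unfolding mult_1_right add_divide_distrib by linarith
      qed
      ultimately show ?thesis using N1 by (metis of_nat_0_less_iff of_nat_1 of_nat_Suc zero_less_Suc)
    next
      assume u: "1 \<le> u" "N \<le> 2 * Q (u - 1)"
      have "real (Suc i) * real N \<le> real (Suc i) * (2 * real (Q (u - 1)))"
      proof (rule mult_left_mono)
        show "real N \<le> 2 * real (Q (u - 1))" using u(2) by linarith
      qed simp
      also have "\<dots> = 2 * (\<Sum>k\<in>{u - 1..<?n}. real (Q (u - 1)))" using u(1) by simp
      also have "\<dots> \<le> 2 * (\<Sum>k\<in>{u - 1..<?n}. real (Q k))" by (intro mult_left_mono sum_mono) (auto intro: Q_mono)
      also have "\<dots> \<le> 2 * (\<Sum>k<?n. real (Q k))" by (intro mult_left_mono sum_mono2) auto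
      finally have "real (Suc i) * real N / ?q \<le> 2 * ((\<Sum>k<?n. real (Q k)) / ?q)"
        using q by (simp add: divide_right_mono)
      then show ?thesis using r4 by linarith
    qed
    moreover have "(\<Sum>k<i. real (Q (u + k))) / ?q \<le> 4 / real (Suc ?n)"
      using divide_right_mono[OF sub, of ?q] r4 q by linarith
    ultimately show ?thesis by (simp add: add_divide_distrib)
  qed
  finally show ?thesis by simp
qed

definition s2 :: "nat \<Rightarrow> real" where "s2 k = mean_square (1 / real (Q k)) (X k)"

lemma s2_bounds: "0 \<le> s2 k" "s2 k \<le> W\<^sup>2"
  unfolding s2_def using mean_square_bounds[OF osc] by auto

definition C4 :: real where
  "C4 = 16 * W ^ 4 * 12 + (6 * W\<^sup>2 + 4 * W ^ 3) * (W\<^sup>2 * (1 + 5 * 12)) + 4 * W ^ 3 + W ^ 4"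

lemma C4_nonneg: "0 \<le> C4" using W_nonneg by (simp add: C4_def)

definition partial :: "nat \<Rightarrow> real \<Rightarrow> real" where "partial n x = (\<Sum>k<n. X k x)"

lemma partial_borel [measurable]: "partial n \<in> borel_measurable borel"
  unfolding partial_def by measurable

lemma partial_diff: "u \<le> v \<Longrightarrow> partial v x - partial u x = (\<Sum>k<v - u. X (u + k) x)"
proof -
  assume uv: "u \<le> v"
  have "partial v x = partial u x + (\<Sum>k\<in>{u..<v}. X k x)"
    using sum.atLeastLessThan_concat[of 0 u v "\<lambda>k. X k x"] uv by (simp add: partial_def lessThan_atLeast0)
  also have "(\<Sum>k\<in>{u..<v}. X k x) = (\<Sum>k<v - u. X (u + k) x)"
    by (rule sum.reindex_bij_witness[of _ "\<lambda>k. u + k" "\<lambda>k. k - u"]) (use uv in auto)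
  finally show ?thesis by simp
qed

lemma partial_diff_bound: "\<bar>partial v x - partial u x\<bar> \<le> (real u + real v) * W"
proof -
  have *: "\<bar>partial n x\<bar> \<le> real n * W" for n
  proof -
    have "\<bar>partial n x\<bar> \<le> (\<Sum>k<n. W)" unfolding partial_def
      by (rule order_trans[OF sum_abs]) (intro sum_mono X_bound)
    then show ?thesis by simp
  qed
  show ?thesis using *[of u] *[of v] by (simp add: algebra_simps)
qed

lemma partial_fourth_moment:
  assumes "u \<le> v"
  shows "integrable circle (\<lambda>x. (partial v x - partial u x) ^ 4)"
    and "(LINT x|circle. (partial v x - partial u x) ^ 4) \<le> C4 * (real (v - u))\<^sup>2"
proof -
  interpret O: oscillating_sequence "\<lambda>i y. X (u + i) ((0 + y) / real 1)" "\<lambda>i y. m (u + i) ((0 + y) / real 1)" "per u 1" W "v - u"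
    by (rule subsystem) simp
  have S: "O.S (v - u) x = partial v x - partial u x" for x
    unfolding O.S_def partial_diff[OF assms] by simp
  have e: "O.eta i \<le> 12 / real (Suc i)" for i
  proof -
    have "O.eta i \<le> 12 / real (Suc (u + i))" by (rule eta_bound) (simp add: admissible_def)
    also have "\<dots> \<le> 12 / real (Suc i)" by (intro divide_left_mono) auto
    finally show ?thesis .
  qed
  show "(LINT x|circle. (partial v x - partial u x) ^ 4) \<le> C4 * (real (v - u))\<^sup>2"
    using O.fourth_moment(2)[OF e order_refl] unfolding S C4_def ival_eq_circle .
  have "set_integrable lborel {0..<1} (\<lambda>x. (partial v x - partial u x) ^ 4)"
  proof (rule bounded_ival_integrable[where B="((real u + real v) * W) ^ 4"])
    fix x
    have "\<bar>partial v x - partial u x\<bar> ^ 4 \<le> ((real u + real v) * W) ^ 4"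
      by (intro power_mono partial_diff_bound) simp
    then show "\<bar>(partial v x - partial u x) ^ 4\<bar> \<le> ((real u + real v) * W) ^ 4" by (simp add: power_abs)
  qed measurable
  then show "integrable circle (\<lambda>x. (partial v x - partial u x) ^ 4)"
    by (simp add: circle_def integrable_restrict_space set_integrable_def)
qed

lemma partial_second_moment:
  "\<bar>ival 0 1 (\<lambda>x. (partial n x)\<^sup>2) - (\<Sum>k<n. s2 k)\<bar> \<le> 60 * W\<^sup>2 * (\<Sum>i<n. 1 / real (Suc i))"
proof -
  interpret O: oscillating_sequence "\<lambda>i y. X (0 + i) ((0 + y) / real 1)" "\<lambda>i y. m (0 + i) ((0 + y) / real 1)" "per 0 1" W n
    by (rule subsystem) simp
  have S: "O.S n x = partial n x" for x unfolding O.S_def partial_def by simp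
  have v: "O.var i = s2 i" for i unfolding O.var_def s2_def by simp
  have "O.eta i \<le> 12 / real (Suc (0 + i))" for i by (rule eta_bound) (simp add: admissible_def)
  then have "(\<Sum>i<n. O.eta i) \<le> (\<Sum>i<n. 12 * (1 / real (Suc i)))" by (intro sum_mono) simp
  then have "5 * W\<^sup>2 * (\<Sum>i<n. O.eta i) \<le> 5 * W\<^sup>2 * (12 * (\<Sum>i<n. 1 / real (Suc i)))"
    unfolding sum_distrib_left[symmetric] by (intro mult_left_mono) auto
  then show ?thesis using O.second_moment[OF order_refl] unfolding S v by simp
qed

text \<open>
  Block \<open>j\<close> consists of the indices from \<open>K j\<close> up to \<open>K (Suc j)\<close>. The coupling error of block \<open>j\<close> will be
  of order \<open>j\<close> to the power \<open>7\<close>, in total \<open>8\<close>, and the oscillation inside a block of length about \<open>j\<close> to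
  the power \<open>16\<close> is of exponent slightly above \<open>8\<close>. Both are below \<open>17 / 2\<close>, the exponent of the square
  root of \<open>K j\<close>.
\<close>

definition K :: "nat \<Rightarrow> nat" where "K j = j ^ 17"
definition bsize :: "nat \<Rightarrow> nat" where "bsize j = K (Suc j) - K j"

lemma K_0 [simp]: "K 0 = 0" by (simp add: K_def)
lemma K_mono: "i \<le> j \<Longrightarrow> K i \<le> K j" by (simp add: K_def power_mono)
lemma K_Suc: "K (Suc j) = K j + bsize j" using K_mono[of j "Suc j"] by (simp add: bsize_def)

lemma bsize_bounds: "real (Suc j) ^ 16 \<le> real (bsize j)" "real (bsize j) \<le> 17 * real (Suc j) ^ 16" "Suc j ^ 16 \<le> bsize j"
proof -
  have e: "real (bsize j) = real (Suc j) ^ 17 - real j ^ 17"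
    using K_Suc[of j] unfolding K_def by (metis add_diff_cancel_left' of_nat_add of_nat_power)
  have b: "real (Suc j) ^ 16 \<le> real (bsize j) \<and> real (bsize j) \<le> 17 * real (Suc j) ^ 16"
    using power_difference_bounds[of "real j" "real (Suc j)" 16] unfolding e by (simp add: add.commute)
  then show "real (Suc j) ^ 16 \<le> real (bsize j)" "real (bsize j) \<le> 17 * real (Suc j) ^ 16" by auto
  from b show "Suc j ^ 16 \<le> bsize j" by (metis of_nat_le_iff of_nat_power)
qed

lemma bsize_pos: "0 < bsize j" using bsize_bounds(3)[of j] by (metis less_le_trans zero_less_Suc zero_less_power)

definition block :: "nat \<Rightarrow> nat" where "block n = (LEAST j. n < K (Suc j))"

lemma block_bounds: "K (block n) \<le> n" "n < K (Suc (block n))"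
proof -
  have "Suc n ^ 1 \<le> Suc n ^ 17" by (rule power_increasing) auto
  then have ex: "n < K (Suc n)" by (simp add: K_def)
  show "n < K (Suc (block n))" unfolding block_def by (rule LeastI[of _ n]) (rule ex)
  show "K (block n) \<le> n"
  proof (cases "block n")
    case (Suc i)
    then have "\<not> n < K (Suc i)" using not_less_Least[of i "\<lambda>j. n < K (Suc j)"] by (simp add: block_def)
    then show ?thesis using Suc by simp
  qed simp
qed

lemma block_unique:
  assumes "K j \<le> n" "n < K (Suc j)" shows "block n = j"
proof (rule antisym)
  show "block n \<le> j" unfolding block_def by (rule Least_le) (rule assms)
  show "j \<le> block n"
  proof (rule ccontr)
    assume "\<not> j \<le> block n"
    then have "K (Suc (block n)) \<le> K j" by (intro K_mono) simp
    then show False using block_bounds(2)[of n] assms by simp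
  qed
qed

text \<open>
  The artificial variance. Over block \<open>j\<close> it adds up to about \<open>j\<close> to the power \<open>12\<close>: enough to smooth
  the block sum on the scale \<open>j\<close> to the power \<open>6\<close>, yet negligible against the number of indices.
\<close>

definition extra :: "nat \<Rightarrow> real" where "extra k = 1 / real (Suc (block k)) ^ 4"
definition tau :: "nat \<Rightarrow> real" where "tau n = (\<Sum>k<n. s2 k + extra k)"

lemma extra_bounds: "0 < extra k" "extra k \<le> 1"
  by (auto simp: extra_def divide_le_eq one_le_power)

lemma tau_0 [simp]: "tau 0 = 0" by (simp add: tau_def)

lemma tau_increment: assumes "u \<le> v" shows "tau v - tau u = (\<Sum>k<v - u. s2 (u + k) + extra (u + k))"
proof -
  have "tau v = tau u + (\<Sum>k\<in>{u..<v}. s2 k + extra k)"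
    using sum.atLeastLessThan_concat[of 0 u v "\<lambda>k. s2 k + extra k"] assms by (simp add: tau_def lessThan_atLeast0)
  also have "(\<Sum>k\<in>{u..<v}. s2 k + extra k) = (\<Sum>k<v - u. s2 (u + k) + extra (u + k))"
    by (rule sum.reindex_bij_witness[of _ "\<lambda>k. u + k" "\<lambda>k. k - u"]) (use assms in auto)
  finally show ?thesis by simp
qed

lemma tau_strict_mono: "u < v \<Longrightarrow> tau u < tau v"
proof -
  assume uv: "u < v"
  have "0 < (\<Sum>k<v - u. s2 (u + k) + extra (u + k))"
    using uv by (intro sum_pos) (auto intro: add_nonneg_pos s2_bounds extra_bounds simp: lessThan_empty_iff)
  then show ?thesis using tau_increment[of u v] uv by simp
qed

lemma tau_mono: "u \<le> v \<Longrightarrow> tau u \<le> tau v"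
  using tau_strict_mono[of u v] by (cases "u = v") auto

lemma tau_nonneg: "0 \<le> tau n" using tau_mono[of 0 n] by simp

lemma tau_increment_le: "u \<le> v \<Longrightarrow> tau v - tau u \<le> (W\<^sup>2 + 1) * real (v - u)"
proof -
  assume uv: "u \<le> v"
  have "(\<Sum>k<v - u. s2 (u + k) + extra (u + k)) \<le> (\<Sum>k<v - u. W\<^sup>2 + 1)"
    by (intro sum_mono add_mono s2_bounds extra_bounds)
  then show ?thesis using tau_increment[OF uv] by (simp add: mult.commute)
qed

text \<open>
  The standard deviations contributed to block \<open>j\<close> by the artificial variance alone and by the whole
  clock \<open>tau\<close>.
\<close>

definition eps :: "nat \<Rightarrow> real" where "eps j = sqrt (real (bsize j) / real (Suc j) ^ 4)"
definition sigma :: "nat \<Rightarrow> real" where "sigma j = sqrt (tau (K (Suc j)) - tau (K j))"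

lemma eps_bounds: "real (Suc j) ^ 6 \<le> eps j" "eps j \<le> 5 * real (Suc j) ^ 6"
proof -
  let ?J = "real (Suc j)"
  have J: "0 < ?J" by simp
  have e: "?J ^ 16 / ?J ^ 4 = (?J ^ 6)\<^sup>2"
  proof -
    have "y ^ 16 / y ^ 4 = (y ^ 6)\<^sup>2" if "0 < y" for y :: real
      using that by (simp add: field_simps flip: power_add power_mult)
    from this[OF J] show ?thesis .
  qed
  have "(?J ^ 6)\<^sup>2 \<le> real (bsize j) / ?J ^ 4"
    unfolding e[symmetric] using bsize_bounds(1)[of j] J by (intro divide_right_mono) auto
  then show "?J ^ 6 \<le> eps j" unfolding eps_def by (rule real_le_rsqrt)
  have "real (bsize j) / ?J ^ 4 \<le> 17 * ?J ^ 16 / ?J ^ 4"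
    using bsize_bounds(2)[of j] J by (intro divide_right_mono) auto
  also have "\<dots> = 17 * (?J ^ 6)\<^sup>2" by (simp only: times_divide_eq_right[symmetric] e)
  also have "\<dots> \<le> (5 * ?J ^ 6)\<^sup>2" by (simp add: power_mult_distrib)
  finally show "eps j \<le> 5 * ?J ^ 6" unfolding eps_def by (intro real_le_lsqrt) auto
qed

lemma eps_ge_1: "1 \<le> eps j"
proof -
  have "(1::real) \<le> real (Suc j) ^ 6" by (intro one_le_power) simp
  then show ?thesis using eps_bounds(1)[of j] by linarith
qed

lemma sigma_square: "tau (K (Suc j)) - tau (K j) = (eps j)\<^sup>2 + (\<Sum>i<bsize j. s2 (K j + i))"
proof -
  have "tau (K (Suc j)) - tau (K j) = (\<Sum>i<bsize j. s2 (K j + i) + extra (K j + i))"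
    using tau_increment[OF K_mono, of j "Suc j"] by (simp add: K_Suc)
  also have "\<dots> = (\<Sum>i<bsize j. s2 (K j + i)) + (\<Sum>i<bsize j. 1 / real (Suc j) ^ 4)"
  proof -
    have "extra (K j + i) = 1 / real (Suc j) ^ 4" if "i < bsize j" for i
      using block_unique[of j "K j + i"] that by (simp add: extra_def K_Suc)
    then show ?thesis by (simp add: sum.distrib)
  qed
  also have "(\<Sum>i<bsize j. 1 / real (Suc j) ^ 4) = (eps j)\<^sup>2" by (simp add: eps_def)
  finally show ?thesis by simp
qed

lemma sigma_pos: "0 < sigma j"
  unfolding sigma_def using tau_strict_mono[of "K j" "K (Suc j)"] bsize_pos[of j] by (simp add: K_Suc)

lemma sigma_sq: "(sigma j)\<^sup>2 = (eps j)\<^sup>2 + (\<Sum>i<bsize j. s2 (K j + i))"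
  using sigma_pos[of j] sigma_square[of j] tau_strict_mono[of "K j" "K (Suc j)"] bsize_pos[of j]
  by (simp add: sigma_def K_Suc)

definition block_sum :: "nat \<Rightarrow> real \<Rightarrow> real" where
  "block_sum j x = partial (K (Suc j)) x - partial (K j) x"

lemma block_sum_eq: "block_sum j x = (\<Sum>i<bsize j. X (K j + i) x)"
  unfolding block_sum_def using partial_diff[OF K_mono, of j "Suc j"] by (simp add: K_Suc)

lemma growth_bound:
  assumes N: "admissible (K j) N"
  shows "(\<Sum>k<bsize j. 1 / per (K j) N k + 1) \<le> 13 * (real (Q (K (Suc j) - 1)) / real N)"
proof -
  obtain b where b: "bsize j = Suc b" using bsize_pos[of j] by (cases "bsize j") auto
  have N0: "0 < N" by (rule admissible_pos[OF N])
  interpret O: oscillating_sequence "\<lambda>i y. X (K j + i) ((0 + y) / real N)" "\<lambda>i y. m (K j + i) ((0 + y) / real N)" "per (K j) N" W "Suc b"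
    by (rule subsystem[OF N0])
  let ?r = "per (K j) N b"
  have r: "0 < ?r" using O.r_pos[of b] by simp
  have "?r * ((\<Sum>k<b. 1 / per (K j) N k + 1) + 1) \<le> 12 / real (Suc (K j + b))"
    using eta_bound[OF N, of b] unfolding O.eta_def .
  also have "\<dots> \<le> 12 / 1" by (intro divide_left_mono) auto
  finally have "?r * ((\<Sum>k<b. 1 / per (K j) N k + 1) + 1) \<le> 12" by (rule order_trans) simp
  then have "(\<Sum>k<b. 1 / per (K j) N k + 1) + 1 \<le> 12 / ?r"
    unfolding pos_le_divide_eq[OF r] by (simp only: mult.commute)
  then have "(\<Sum>k<bsize j. 1 / per (K j) N k + 1) \<le> 13 * (1 / ?r)" unfolding b by simp
  also have "1 / ?r = real (Q (K (Suc j) - 1)) / real N" using b by (simp add: K_Suc)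
  finally show ?thesis .
qed

definition kappa :: real where "kappa = 4 * W ^ 4 + 16 * W ^ 3 + 8 * W\<^sup>2 + 4 * W"
definition Dcon :: real where "Dcon = kappa * (204 * 2 ^ 16 + 17) + 52 * W"
definition Qcon :: real where "Qcon = 1479 * W\<^sup>2 + 25"
definition Ccon :: real where "Ccon = 5 + 2 * Dcon + 2 * Qcon"

lemma kappa_nonneg: "0 \<le> kappa" using W_nonneg by (simp add: kappa_def)

text \<open>
  Let \<open>J = j + 1\<close>. Smoothing on the scale \<open>eps j\<close>, which is of order \<open>J ^ 6\<close>, the Lindeberg argument
  compares the distribution functions up to \<open>O(1 / J ^ 2)\<close>: the sum of all \<open>eta\<close> over the block is
  bounded, and \<open>J ^ 16 / (eps j) ^ 3\<close> is of order \<open>1 / J ^ 2\<close>. With truncation at \<open>J ^ 9\<close> the quantile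
  coupling then costs \<open>J ^ 6 + J ^ 9 / J ^ 2 + J ^ 16 / J ^ 9\<close> up to constants.
\<close>

lemma block_coupling:
  assumes N: "admissible (K j) N" and M: "0 < M" "Q (K (Suc j) - 1) \<le> N * M"
    and p: "bij_betw p {..<M} {..<M}"
      "\<And>i k. i \<le> k \<Longrightarrow> k < M \<Longrightarrow> block_sum j ((a + real (p i) / real M) / real N) \<le> block_sum j ((a + real (p k) / real M) / real N)"
  shows "integrable gauss (\<lambda>z. \<bar>block_sum j ((a + real (p (quantile_index M z)) / real M) / real N) - sigma j * z\<bar>)"
    and "(\<integral>z. \<bar>block_sum j ((a + real (p (quantile_index M z)) / real M) / real N) - sigma j * z\<bar> \<partial>gauss) \<le> Ccon * real (Suc j) ^ 7"
proof -
  let ?J = "real (Suc j)"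
  let ?b = "bsize j"
  let ?e = "eps j"
  have N0: "0 < N" by (rule admissible_pos[OF N])
  have J: "1 \<le> ?J" by simp
  interpret O: oscillating_sequence "\<lambda>i y. X (K j + i) ((a + y) / real N)" "\<lambda>i y. m (K j + i) ((a + y) / real N)" "per (K j) N" W ?b
    by (rule subsystem[OF N0])
  have S: "O.S ?b y = block_sum j ((a + y) / real N)" for y by (simp add: O.S_def block_sum_eq)
  have v: "O.var i = s2 (K j + i)" for i
    unfolding O.var_def s2_def by (rule osc_rescale(2)[OF osc]) (use N0 in simp)
  have e1: "1 \<le> ?e" by (rule eps_ge_1)
  have e0: "0 < ?e" using e1 by linarith
  have e6: "?J ^ 6 \<le> ?e" by (rule eps_bounds)
  have G: "((\<Sum>i<?b. m (K j + i) ((a + 1) / real N)) - (\<Sum>i<?b. m (K j + i) ((a + 0) / real N))) / real M \<le> 13 * W"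
  proof -
    have "(\<Sum>i<?b. m (K j + i) ((a + 1) / real N)) - (\<Sum>i<?b. m (K j + i) ((a + 0) / real N)) \<le> W * (\<Sum>k<?b. 1 / per (K j) N k + 1)"
      by (rule O.S_growth) simp
    also have "\<dots> \<le> W * (13 * (real (Q (K (Suc j) - 1)) / real N))"
      by (intro mult_left_mono growth_bound[OF N] W_nonneg)
    also have "\<dots> \<le> W * (13 * real M)"
    proof (intro mult_left_mono W_nonneg)
      have "real (Q (K (Suc j) - 1)) \<le> real N * real M" using M(2) by (metis of_nat_le_iff of_nat_mult)
      then show "real (Q (K (Suc j) - 1)) / real N \<le> real M" using N0 by (simp add: divide_le_eq mult.commute)
    qed simp
    finally show ?thesis using M(1) by (simp add: divide_le_eq mult_ac)
  qed
  have etaJ: "(\<Sum>i<?b. O.eta i) \<le> 204 * 2 ^ 16"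
  proof -
    have "(\<Sum>i<?b. O.eta i) \<le> (\<Sum>i<?b. 12 / real (Suc (K j)))"
      by (intro sum_mono order_trans[OF eta_bound[OF N]] divide_left_mono) auto
    also have "\<dots> = 12 * (real ?b / real (Suc (K j)))" by simp
    also have "\<dots> \<le> 12 * (17 * 2 ^ 16)"
    proof (intro mult_left_mono)
      have "?J ^ 16 \<le> 2 ^ 16 * real (Suc (K j))"
      proof (cases "j = 0")
        case False
        then have "?J ^ 16 \<le> (2 * real j) ^ 16" by (intro power_mono) auto
        also have "\<dots> = 2 ^ 16 * real j ^ 16" by (simp add: power_mult_distrib)
        also have "real j ^ 16 \<le> real j ^ 17" using False by (intro power_increasing) auto
        also have "real j ^ 17 \<le> real (Suc (K j))" by (simp add: K_def)
        finally show ?thesis by simp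
      qed simp
      then have "real ?b \<le> 17 * (2 ^ 16 * real (Suc (K j)))" using bsize_bounds(2)[of j] by linarith
      then show "real ?b / real (Suc (K j)) \<le> 17 * 2 ^ 16" by (simp add: divide_le_eq mult.assoc)
    qed simp
    finally show ?thesis by simp
  qed
  have inv_e: "1 / ?e \<le> 1 / ?J ^ 2"
  proof -
    have "?J ^ 2 \<le> ?J ^ 6" using J by (intro power_increasing) auto
    then have "?J ^ 2 \<le> ?e" using e6 by linarith
    moreover have "0 < ?J ^ 2" by simp
    ultimately show ?thesis by (intro divide_left_mono mult_pos_pos e0) auto
  qed
  have be3: "real ?b * (1 / ?e ^ 3) \<le> 17 / ?J ^ 2"
  proof -
    have "?J ^ 18 \<le> ?e ^ 3" using power_mono[OF e6, of 3] by (simp flip: power_mult)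
    then have "1 / ?e ^ 3 \<le> 1 / ?J ^ 18" by (intro divide_left_mono) (use e0 in auto)
    then have "real ?b * (1 / ?e ^ 3) \<le> (17 * ?J ^ 16) * (1 / ?J ^ 18)"
      using bsize_bounds(2)[of j] e0 by (intro mult_mono) auto
    also have "\<dots> = 17 / ?J ^ 2"
    proof -
      have *: "(17 * y ^ 16) * (1 / y ^ 18) = 17 / y ^ 2" if "0 < y" for y :: real
        using that by (simp add: field_simps flip: power_add)
      show ?thesis by (rule *) simp
    qed
    finally show ?thesis .
  qed
  have dcon: "\<bar>(\<Sum>i<M. normal_cdf ((c - block_sum j ((a + real i / real M) / real N)) / ?e)) / real M - normal_cdf (c / sigma j)\<bar> \<le> Dcon / ?J ^ 2" for c
  proof -
    have u0: "0 < ?e\<^sup>2" using e0 by simp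
    have sq: "sqrt (?e\<^sup>2) = ?e" using e0 by simp
    let ?F = "\<lambda>y. Psi c (?e\<^sup>2) (O.S ?b y)"
    have F: "?F y = normal_cdf ((c - block_sum j ((a + y) / real N)) / ?e)" for y
      unfolding Psi_def S sq ..
    have "dominated ?F (\<lambda>y. 4 / ?e * (\<Sum>i<?b. m (K j + i) ((a + y) / real N)))"
      by (rule dominated_lipschitz[where h="Psi c (?e\<^sup>2)" and F="O.S ?b" and S=UNIV])
         (use O.S_dominated[of ?b] e0 lipschitz_of_deriv[OF Psi_derivs(1)[OF u0] Psi_bounds(2)[OF e0 order_refl]] in auto)
    from discretisation_bound(2)[OF this Psi_bounds(1)[OF e0 order_refl] M(1)]
    have "\<bar>(\<Sum>i<M. ?F (real i / real M)) / real M - ival 0 1 ?F\<bar>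
        \<le> (4 / ?e * (\<Sum>i<?b. m (K j + i) ((a + 1) / real N)) - 4 / ?e * (\<Sum>i<?b. m (K j + i) ((a + 0) / real N))) / real M" .
    also have "\<dots> = 4 / ?e * (((\<Sum>i<?b. m (K j + i) ((a + 1) / real N)) - (\<Sum>i<?b. m (K j + i) ((a + 0) / real N))) / real M)"
      by (simp add: right_diff_distrib diff_divide_distrib)
    also have "\<dots> \<le> 4 / ?e * (13 * W)" using G e0 by (intro mult_left_mono) auto
    also have "\<dots> = 52 * W * (1 / ?e)" by simp
    also have "\<dots> \<le> 52 * W * (1 / ?J ^ 2)" using inv_e W_nonneg by (intro mult_left_mono) auto
    finally have d1: "\<bar>(\<Sum>i<M. ?F (real i / real M)) / real M - ival 0 1 ?F\<bar> \<le> 52 * W / ?J ^ 2" by simp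
    have sg: "sqrt (?e\<^sup>2 + (\<Sum>i<?b. O.var i)) = sigma j"
      unfolding v sigma_sq[symmetric] using sigma_pos[of j] by simp
    have "\<bar>ival 0 1 ?F - normal_cdf (c / sigma j)\<bar> \<le> kappa * (\<Sum>i<?b. O.eta i / ?e + 1 / ?e ^ 3)"
      using O.lindeberg[OF e1, of c] unfolding sg kappa_def .
    also have "(\<Sum>i<?b. O.eta i / ?e + 1 / ?e ^ 3) = (\<Sum>i<?b. O.eta i) * (1 / ?e) + real ?b * (1 / ?e ^ 3)"
      by (simp add: sum.distrib sum_divide_distrib)
    also have "\<dots> \<le> (204 * 2 ^ 16) * (1 / ?J ^ 2) + 17 / ?J ^ 2"
      using etaJ inv_e be3 e0 by (intro add_mono mult_mono) auto
    finally have "\<bar>ival 0 1 ?F - normal_cdf (c / sigma j)\<bar> \<le> kappa * ((204 * 2 ^ 16) * (1 / ?J ^ 2) + 17 / ?J ^ 2)"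
      using kappa_nonneg by (simp add: mult_left_mono)
    then have "\<bar>(\<Sum>i<M. ?F (real i / real M)) / real M - normal_cdf (c / sigma j)\<bar> \<le> 52 * W / ?J ^ 2 + kappa * ((204 * 2 ^ 16) * (1 / ?J ^ 2) + 17 / ?J ^ 2)"
      using d1 by linarith
    also have "\<dots> = Dcon / ?J ^ 2" by (simp add: Dcon_def add_divide_distrib algebra_simps)
    finally show ?thesis unfolding F .
  qed
  have Q1: "(\<Sum>i<M. (block_sum j ((a + real i / real M) / real N))\<^sup>2) / real M \<le> Qcon * ?J ^ 16"
  proof -
    have bW: "\<bar>O.S ?b y\<bar> \<le> real ?b * W" for y by (rule O.S_bound) simp
    have bW0: "0 \<le> real ?b * W" using W_nonneg by simp
    have "dominated (\<lambda>y. (O.S ?b y)\<^sup>2) (\<lambda>y. (2 * (real ?b * W)) * (\<Sum>i<?b. m (K j + i) ((a + y) / real N)))"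
    proof (rule dominated_lipschitz[where h="\<lambda>z. z\<^sup>2" and F="O.S ?b" and S="{x. \<bar>x\<bar> \<le> real ?b * W}"])
      fix u v assume uv: "u \<in> {x. \<bar>x\<bar> \<le> real ?b * W}" "v \<in> {x. \<bar>x\<bar> \<le> real ?b * W}"
      have "\<bar>v\<^sup>2 - u\<^sup>2\<bar> = \<bar>v + u\<bar> * \<bar>v - u\<bar>"
        unfolding abs_mult[symmetric] by (simp add: power2_eq_square algebra_simps)
      also have "\<dots> \<le> (2 * (real ?b * W)) * \<bar>v - u\<bar>" using uv by (intro mult_right_mono) auto
      finally show "\<bar>v\<^sup>2 - u\<^sup>2\<bar> \<le> (2 * (real ?b * W)) * \<bar>v - u\<bar>" .
    qed (use O.S_dominated[of ?b] bW bW0 in auto)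
    moreover have "\<bar>(O.S ?b y)\<^sup>2\<bar> \<le> (real ?b * W)\<^sup>2" for y using power_mono[OF bW[of y], of 2] by simp
    ultimately have "\<bar>(\<Sum>i<M. (O.S ?b (real i / real M))\<^sup>2) / real M - ival 0 1 (\<lambda>y. (O.S ?b y)\<^sup>2)\<bar>
       \<le> ((2 * (real ?b * W)) * (\<Sum>i<?b. m (K j + i) ((a + 1) / real N)) - (2 * (real ?b * W)) * (\<Sum>i<?b. m (K j + i) ((a + 0) / real N))) / real M"
      by (rule discretisation_bound(2)) (rule M(1))
    also have "\<dots> = (2 * (real ?b * W)) * (((\<Sum>i<?b. m (K j + i) ((a + 1) / real N)) - (\<Sum>i<?b. m (K j + i) ((a + 0) / real N))) / real M)"
      by (simp add: right_diff_distrib diff_divide_distrib)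
    also have "\<dots> \<le> (2 * (real ?b * W)) * (13 * W)" using G bW0 by (intro mult_left_mono) auto
    finally have "(\<Sum>i<M. (O.S ?b (real i / real M))\<^sup>2) / real M \<le> ival 0 1 (\<lambda>y. (O.S ?b y)\<^sup>2) + 26 * W\<^sup>2 * real ?b"
      by (simp add: power2_eq_square algebra_simps)
    also have "ival 0 1 (\<lambda>y. (O.S ?b y)\<^sup>2) \<le> W\<^sup>2 * (1 + 5 * 12) * real ?b"
    proof (rule O.fourth_moment(1)[OF _ order_refl])
      fix i
      have "O.eta i \<le> 12 / real (Suc (K j + i))" by (rule eta_bound[OF N])
      also have "\<dots> \<le> 12 / real (Suc i)" by (intro divide_left_mono) auto
      finally show "O.eta i \<le> 12 / real (Suc i)" .
    qed
    also have "W\<^sup>2 * (1 + 5 * 12) * real ?b + 26 * W\<^sup>2 * real ?b = 87 * W\<^sup>2 * real ?b" by (simp add: algebra_simps)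
    finally have "(\<Sum>i<M. (O.S ?b (real i / real M))\<^sup>2) / real M \<le> 87 * W\<^sup>2 * real ?b" by simp
    also have "\<dots> \<le> 87 * W\<^sup>2 * (17 * ?J ^ 16)" using bsize_bounds(2)[of j] by (intro mult_left_mono) auto
    also have "\<dots> \<le> Qcon * ?J ^ 16" by (simp add: Qcon_def algebra_simps)
    finally show ?thesis unfolding S .
  qed
  have Q2: "(sigma j)\<^sup>2 \<le> Qcon * ?J ^ 16"
  proof -
    have "(\<Sum>i<?b. s2 (K j + i)) \<le> (\<Sum>i<?b. W\<^sup>2)" by (intro sum_mono s2_bounds)
    also have "\<dots> \<le> 17 * ?J ^ 16 * W\<^sup>2" using bsize_bounds(2)[of j] by (simp add: mult_right_mono)
    finally have 1: "(\<Sum>i<?b. s2 (K j + i)) \<le> 17 * ?J ^ 16 * W\<^sup>2" .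
    have "?e\<^sup>2 \<le> (5 * ?J ^ 6)\<^sup>2" using eps_bounds(2)[of j] e0 by (intro power_mono) auto
    also have "\<dots> = 25 * ?J ^ 12" by (simp add: power_mult_distrib flip: power_mult)
    also have "?J ^ 12 \<le> ?J ^ 16" using J by (intro power_increasing) auto
    finally have 2: "?e\<^sup>2 \<le> 25 * ?J ^ 16" by simp
    have 3: "0 \<le> W\<^sup>2 * ?J ^ 16" by simp
    have "x + y \<le> (1479 * w + 25) * p" if "x \<le> 25 * p" "y \<le> 17 * p * w" "0 \<le> w * p" for x y w p :: real
      using that by (simp add: algebra_simps)
    from this[OF 2 1 3] show ?thesis unfolding sigma_sq Qcon_def .
  qed
  \<comment> \<open>the truncation level of the coupling\<close>
  have A: "0 < ?J ^ 9" by simp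
  note qc = quantile_coupling[OF M(1) sigma_pos[of j] e0 A dcon Q1 Q2 p]
  show "integrable gauss (\<lambda>z. \<bar>block_sum j ((a + real (p (quantile_index M z)) / real M) / real N) - sigma j * z\<bar>)"
    by (rule qc(1))
  have "(\<integral>z. \<bar>block_sum j ((a + real (p (quantile_index M z)) / real M) / real N) - sigma j * z\<bar> \<partial>gauss)
      \<le> ?e + 2 * ?J ^ 9 * (Dcon / ?J ^ 2) + 2 * (Qcon * ?J ^ 16) / ?J ^ 9"
    by (rule qc(2))
  also have "?e + 2 * ?J ^ 9 * (Dcon / ?J ^ 2) + 2 * (Qcon * ?J ^ 16) / ?J ^ 9 = ?e + 2 * Dcon * ?J ^ 7 + 2 * Qcon * ?J ^ 7"
  proof -
    have *: "x + 2 * y ^ 9 * (c / y ^ 2) + 2 * (d * y ^ 16) / y ^ 9 = x + 2 * c * y ^ 7 + 2 * d * y ^ 7"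
      if "0 < y" for x y c d :: real
      using that by (simp add: field_simps flip: power_add)
    show ?thesis by (rule *) simp
  qed
  also have "?e + 2 * Dcon * ?J ^ 7 + 2 * Qcon * ?J ^ 7 \<le> Ccon * ?J ^ 7"
  proof -
    have "?J ^ 6 \<le> ?J ^ 7" using J by (intro power_increasing) auto
    then have "?e \<le> 5 * ?J ^ 7" using eps_bounds(2)[of j] by linarith
    then show ?thesis by (simp add: Ccon_def algebra_simps)
  qed
  finally show "(\<integral>z. \<bar>block_sum j ((a + real (p (quantile_index M z)) / real M) / real N) - sigma j * z\<bar> \<partial>gauss) \<le> Ccon * ?J ^ 7" .
qed

end

section \<open>A uniform point built from independent normal variables\<close>

text \<open>
  A point of the circle is determined by successive subdivision: the \<open>N j\<close> cells of step \<open>j\<close> are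
  divided into \<open>M j\<close> parts each, and the part is selected by a permutation, which may depend on the
  cell, of the uniform index derived from \<open>Z j\<close>. Since \<open>Z j\<close> is independent of the cell, all cells are
  equally likely at every step, whatever the permutations are.
\<close>

locale random_refinement = prob_space P for P :: "'w measure" +
  fixes Z :: "nat \<Rightarrow> 'w \<Rightarrow> real" and M N :: "nat \<Rightarrow> nat" and p :: "nat \<Rightarrow> nat \<Rightarrow> nat \<Rightarrow> nat"
  assumes indep: "indep_vars (\<lambda>_. borel) Z UNIV"
    and Z_distr: "\<And>j. distr P borel (Z j) = gauss"
    and M_pos: "\<And>j. 0 < M j"
    and N_0: "N 0 = 1" and N_Suc: "\<And>j. N (Suc j) = N j * M j" and N_large: "\<And>j. j \<le> N (Suc j)"
    and perm: "\<And>j a. bij_betw (p j a) {..<M j} {..<M j}"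
begin

text \<open>
  The index of the current cell as a function of the sequence of normal values, so that it is
  visibly determined by the first \<open>j\<close> of them.
\<close>

primrec cell :: "nat \<Rightarrow> (nat \<Rightarrow> real) \<Rightarrow> nat" where
  "cell 0 z = 0"
| "cell (Suc j) z = cell j z * M j + p j (cell j z) (quantile_index (M j) (z j))"

definition atom :: "nat \<Rightarrow> 'w \<Rightarrow> nat" where "atom j \<omega> = cell j (\<lambda>i. Z i \<omega>)"

lemma atom_0: "atom 0 \<omega> = 0" by (simp add: atom_def)

lemma atom_Suc: "atom (Suc j) \<omega> = atom j \<omega> * M j + p j (atom j \<omega>) (quantile_index (M j) (Z j \<omega>))"
  by (simp add: atom_def)

lemma Z_borel [measurable]: "Z j \<in> borel_measurable P"
  using indep unfolding indep_vars_def2 by auto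

lemma cell_measurable: "j \<le> n \<Longrightarrow> cell j \<in> measurable (PiM {..<n} (\<lambda>_. borel)) (count_space UNIV)"
proof (induction j)
  case (Suc j)
  note [measurable] = Suc.IH[OF Suc_leD[OF Suc.prems]]
  have [measurable]: "(\<lambda>z. z j) \<in> borel_measurable (PiM {..<n} (\<lambda>_. borel))"
    using Suc.prems by (intro measurable_component_singleton) auto
  show ?case unfolding cell.simps by measurable
next
  case 0
  have "cell 0 = (\<lambda>_. 0)" by (rule ext) simp
  then show ?case by simp
qed

lemma cell_cong: "(\<And>i. i < j \<Longrightarrow> z i = z' i) \<Longrightarrow> cell j z = cell j z'"
  by (induction j) auto

lemma atom_measurable [measurable]: "atom j \<in> measurable P (count_space UNIV)"
proof (induction j)
  case 0
  then show ?case unfolding atom_0 by simp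
next
  case (Suc j)
  note [measurable] = Suc
  show ?case unfolding atom_Suc by measurable
qed

lemma indep_atom: "indep_var borel (\<lambda>\<omega>. real (atom j \<omega>)) borel (Z j)"
proof -
  have [measurable]: "cell j \<in> measurable (PiM {..<j} (\<lambda>_. borel)) (count_space UNIV)"
    by (rule cell_measurable) simp
  have "indep_var borel ((\<lambda>z. real (cell j z)) \<circ> (\<lambda>\<omega>. restrict (\<lambda>i. Z i \<omega>) {..<j}))
     borel ((\<lambda>z. z j) \<circ> (\<lambda>\<omega>. restrict (\<lambda>i. Z i \<omega>) {j}))"
  proof (rule indep_var_compose[OF indep_var_restrict[OF indep]])
    show "(\<lambda>z. real (cell j z)) \<in> borel_measurable (PiM {..<j} (\<lambda>_. borel))" by measurable
    show "(\<lambda>z. z j) \<in> borel_measurable (PiM {j} (\<lambda>_. borel))" by (intro measurable_component_singleton) auto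
  qed auto
  moreover have "(\<lambda>z. real (cell j z)) \<circ> (\<lambda>\<omega>. restrict (\<lambda>i. Z i \<omega>) {..<j}) = (\<lambda>\<omega>. real (atom j \<omega>))"
    by (auto simp: atom_def fun_eq_iff intro!: cell_cong)
  moreover have "(\<lambda>z. z j) \<circ> (\<lambda>\<omega>. restrict (\<lambda>i. Z i \<omega>) {j}) = Z j" by auto
  ultimately show ?thesis by simp
qed

lemma N_pos: "0 < N j"
  by (induction j) (auto simp: N_0 N_Suc M_pos)

lemma p_less: "i < M j \<Longrightarrow> p j a i < M j"
  using bij_betwE[OF perm[of j a]] by auto

lemma digit_less: "p j a (quantile_index (M j) z) < M j"
  by (intro p_less quantile_index_less M_pos)

lemma atom_less: "atom j \<omega> < N j"
proof (induction j)
  case (Suc j)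
  have "atom (Suc j) \<omega> < atom j \<omega> * M j + M j" unfolding atom_Suc using digit_less by simp
  also have "\<dots> = Suc (atom j \<omega>) * M j" by simp
  also have "\<dots> \<le> N j * M j" using Suc by (intro mult_le_mono1) simp
  finally show ?case by (simp add: N_Suc)
qed (simp add: atom_0 N_0)

lemma indep_atom_integral:
  fixes g :: "real \<Rightarrow> real"
  assumes g: "integrable gauss g"
  shows "integrable P (\<lambda>\<omega>. indicator {a} (atom j \<omega>) * g (Z j \<omega>))"
    and "(\<integral>\<omega>. indicator {a} (atom j \<omega>) * g (Z j \<omega>) \<partial>P) = prob {\<omega> \<in> space P. atom j \<omega> = a} * (\<integral>z. g z \<partial>gauss)"
proof -
  have gm [measurable]: "g \<in> borel_measurable borel" using borel_measurable_integrable[OF g] by simp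
  have ind: "indep_var borel ((\<lambda>x. indicator {real a} x :: real) \<circ> (\<lambda>\<omega>. real (atom j \<omega>))) borel (g \<circ> Z j)"
    by (rule indep_var_compose[OF indep_atom]) measurable
  have e: "(\<lambda>x. indicator {real a} x :: real) \<circ> (\<lambda>\<omega>. real (atom j \<omega>)) = (\<lambda>\<omega>. indicator {a} (atom j \<omega>))"
    by (auto simp: indicator_def fun_eq_iff)
  have i1: "integrable P (\<lambda>\<omega>. indicator {a} (atom j \<omega>) :: real)"
  proof (rule integrable_const_bound[where B=1])
    have "(\<lambda>\<omega>. indicator {a} (atom j \<omega>) :: real) = (\<lambda>\<omega>. (\<lambda>k. indicator {a} k) (atom j \<omega>))" by simp
    show "(\<lambda>\<omega>. indicator {a} (atom j \<omega>) :: real) \<in> borel_measurable P"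
      by (rule measurable_compose[OF atom_measurable]) simp
  qed auto
  have i2: "integrable P (g \<circ> Z j)"
    using g unfolding comp_def Z_distr[of j, symmetric] by (rule integrable_distr[rotated]) measurable
  show "integrable P (\<lambda>\<omega>. indicator {a} (atom j \<omega>) * g (Z j \<omega>))"
    using indep_var_integrable[OF ind[unfolded e] i1 i2] by simp
  have "(\<integral>\<omega>. indicator {a} (atom j \<omega>) * g (Z j \<omega>) \<partial>P) = (\<integral>\<omega>. indicator {a} (atom j \<omega>) \<partial>P) * (\<integral>\<omega>. g (Z j \<omega>) \<partial>P)"
    using indep_var_lebesgue_integral[OF ind[unfolded e] i1 i2] by simp
  also have "(\<integral>\<omega>. g (Z j \<omega>) \<partial>P) = (\<integral>z. g z \<partial>gauss)"
    unfolding Z_distr[of j, symmetric] by (rule integral_distr[symmetric]) measurable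
  also have "(\<integral>\<omega>. indicator {a} (atom j \<omega>) \<partial>P) = (\<integral>\<omega>. indicator {\<omega> \<in> space P. atom j \<omega> = a} \<omega> \<partial>P)"
    by (rule Bochner_Integration.integral_cong) (auto simp: indicator_def)
  also have "\<dots> = prob {\<omega> \<in> space P. atom j \<omega> = a}" by simp
  finally show "(\<integral>\<omega>. indicator {a} (atom j \<omega>) * g (Z j \<omega>) \<partial>P) = prob {\<omega> \<in> space P. atom j \<omega> = a} * (\<integral>z. g z \<partial>gauss)" .
qed

lemma atom_prob: "a < N j \<Longrightarrow> prob {\<omega> \<in> space P. atom j \<omega> = a} = 1 / real (N j)"
proof (induction j arbitrary: a)
  case 0
  then show ?case by (simp add: N_0 atom_0 prob_space)
next
  case (Suc j)
  define b d where "b = a div M j" and "d = a mod M j"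
  have b: "b < N j" using Suc.prems M_pos[of j] by (simp add: b_def N_Suc less_mult_imp_div_less)
  have d: "d < M j" using M_pos[of j] by (simp add: d_def)
  have a: "a = b * M j + d" by (simp add: b_def d_def)
  obtain i where i: "i < M j" "p j b i = d"
    using perm[of j b] d unfolding bij_betw_def by (metis imageE lessThan_iff)
  have "atom (Suc j) \<omega> = a \<longleftrightarrow> atom j \<omega> = b \<and> quantile_index (M j) (Z j \<omega>) = i" for \<omega>
  proof
    let ?q = "quantile_index (M j) (Z j \<omega>)"
    have q: "?q < M j" by (rule quantile_index_less[OF M_pos])
    assume "atom (Suc j) \<omega> = a"
    then have e: "atom j \<omega> * M j + p j (atom j \<omega>) ?q = b * M j + d" by (simp add: atom_Suc a)
    have "atom j \<omega> = (atom j \<omega> * M j + p j (atom j \<omega>) ?q) div M j"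
      using digit_less[of j "atom j \<omega>" "Z j \<omega>"] by simp
    also have "\<dots> = b" unfolding e using d by simp
    finally have ab: "atom j \<omega> = b" .
    then have "p j b ?q = p j b i" using e i by simp
    then have "?q = i" using perm[of j b] q i unfolding bij_betw_def inj_on_def by auto
    with ab show "atom j \<omega> = b \<and> ?q = i" by simp
  qed (simp add: atom_Suc a i)
  then have "prob {\<omega> \<in> space P. atom (Suc j) \<omega> = a} = prob {\<omega> \<in> space P. atom j \<omega> = b \<and> quantile_index (M j) (Z j \<omega>) = i}"
    by simp
  also have "\<dots> = (\<integral>\<omega>. indicator {\<omega> \<in> space P. atom j \<omega> = b \<and> quantile_index (M j) (Z j \<omega>) = i} \<omega> \<partial>P)" by simp
  also have "\<dots> = (\<integral>\<omega>. indicator {b} (atom j \<omega>) * indicator {z. quantile_index (M j) z = i} (Z j \<omega>) \<partial>P)"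
    by (rule Bochner_Integration.integral_cong) (auto simp: indicator_def)
  also have "\<dots> = prob {\<omega> \<in> space P. atom j \<omega> = b} * (\<integral>z. indicator {z. quantile_index (M j) z = i} z \<partial>gauss)"
  proof (rule indep_atom_integral(2))
    show "integrable gauss (indicator {z. quantile_index (M j) z = i} :: real \<Rightarrow> real)"
      by (rule finite_measure.integrable_const_bound[OF prob_space.finite_measure[OF prob_space_std_normal], where B=1]) auto
  qed
  also have "(\<integral>z. indicator {z. quantile_index (M j) z = i} z \<partial>gauss) = 1 / real (M j)"
    using quantile_index_prob[OF M_pos i(1)] by simp
  also have "prob {\<omega> \<in> space P. atom j \<omega> = b} = 1 / real (N j)" by (rule Suc.IH[OF b])
  finally show ?case by (simp add: N_Suc)
qed

text \<open>
  Given the cell, \<open>Z j\<close> is still standard normal, so an estimate that holds for each fixed cell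
  holds on average.
\<close>

lemma conditional_coupling:
  fixes g :: "nat \<Rightarrow> real \<Rightarrow> real"
  assumes g: "\<And>a. a < N j \<Longrightarrow> integrable gauss (g a)"
    and C: "\<And>a. a < N j \<Longrightarrow> (\<integral>z. g a z \<partial>gauss) \<le> C"
  shows "integrable P (\<lambda>\<omega>. g (atom j \<omega>) (Z j \<omega>))" and "(\<integral>\<omega>. g (atom j \<omega>) (Z j \<omega>) \<partial>P) \<le> C"
proof -
  have e: "g (atom j \<omega>) (Z j \<omega>) = (\<Sum>a<N j. indicator {a} (atom j \<omega>) * g a (Z j \<omega>))" for \<omega>
  proof -
    have "(\<Sum>a<N j. indicator {a} (atom j \<omega>) * g a (Z j \<omega>)) = (\<Sum>a<N j. if a = atom j \<omega> then g a (Z j \<omega>) else 0)"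
      by (intro sum.cong) (auto simp: indicator_def)
    then show ?thesis using atom_less[of j \<omega>] by (simp add: sum.delta)
  qed
  show "integrable P (\<lambda>\<omega>. g (atom j \<omega>) (Z j \<omega>))"
    unfolding e by (intro Bochner_Integration.integrable_sum indep_atom_integral(1) g) simp
  have "(\<integral>\<omega>. g (atom j \<omega>) (Z j \<omega>) \<partial>P) = (\<Sum>a<N j. 1 / real (N j) * (\<integral>z. g a z \<partial>gauss))"
    unfolding e
    by (subst Bochner_Integration.integral_sum)
       (auto intro!: sum.cong indep_atom_integral(1) g simp: indep_atom_integral(2)[OF g] atom_prob simp del: sum_mult_indicator)
  also have "\<dots> \<le> (\<Sum>a<N j. 1 / real (N j) * C)" by (intro sum_mono mult_left_mono C) auto
  also have "\<dots> = C" using N_pos[of j] by simp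
  finally show "(\<integral>\<omega>. g (atom j \<omega>) (Z j \<omega>) \<partial>P) \<le> C" .
qed

definition point :: "'w \<Rightarrow> real" where "point \<omega> = lim (\<lambda>j. real (atom j \<omega>) / real (N j))"

lemma N_tendsto: "(\<lambda>j. 1 / real (N j)) \<longlonglongrightarrow> 0"
proof (rule LIMSEQ_imp_Suc, rule tendsto_sandwich[OF _ _ tendsto_const lim_const_over_n[of 1]])
  show "eventually (\<lambda>j. 1 / real (N (Suc j)) \<le> 1 / real j) sequentially"
    using eventually_gt_at_top[of 0] by eventually_elim (use N_large N_pos in \<open>auto intro!: divide_left_mono\<close>)
qed auto

lemma point_bounds: "real (atom j \<omega>) / real (N j) \<le> point \<omega>" "point \<omega> \<le> (real (atom j \<omega>) + 1) / real (N j)"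
  and point_limit: "(\<lambda>j. real (atom j \<omega>) / real (N j)) \<longlonglongrightarrow> point \<omega>"
proof -
  let ?a = "\<lambda>j. real (atom j \<omega>) / real (N j)" and ?b = "\<lambda>j. (real (atom j \<omega>) + 1) / real (N j)"
  have inc: "incseq ?a"
  proof (rule incseq_SucI)
    fix j
    have "?a j = real (atom j \<omega> * M j) / real (N (Suc j))" using M_pos[of j] by (simp add: N_Suc)
    also have "\<dots> \<le> ?a (Suc j)" unfolding atom_Suc by (intro divide_right_mono) auto
    finally show "?a j \<le> ?a (Suc j)" .
  qed
  have dec: "decseq ?b"
  proof (rule decseq_SucI)
    fix j
    have "real (atom (Suc j) \<omega>) + 1 \<le> (real (atom j \<omega>) + 1) * real (M j)"
    proof -
      have "atom (Suc j) \<omega> + 1 \<le> (atom j \<omega> + 1) * M j" using digit_less[of j "atom j \<omega>" "Z j \<omega>"] by (simp add: atom_Suc)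
      then have "real (atom (Suc j) \<omega> + 1) \<le> real ((atom j \<omega> + 1) * M j)" by (simp only: of_nat_le_iff)
      then show ?thesis by (simp add: algebra_simps)
    qed
    then have "?b (Suc j) \<le> (real (atom j \<omega>) + 1) * real (M j) / real (N (Suc j))" by (intro divide_right_mono) auto
    also have "\<dots> = ?b j" using M_pos[of j] by (simp add: N_Suc)
    finally show "?b (Suc j) \<le> ?b j" .
  qed
  have le1: "?a j \<le> 1" for j using atom_less[of j \<omega>] by (simp add: divide_le_eq)
  have "convergent ?a"
    using incseq_convergent[OF inc, of 1] le1 by (metis convergent_def)
  then show a: "?a \<longlonglongrightarrow> point \<omega>" unfolding point_def by (simp add: convergent_LIMSEQ_iff)
  have b: "?b \<longlonglongrightarrow> point \<omega>" using tendsto_add[OF a N_tendsto] by (simp add: add_divide_distrib)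
  show "?a j \<le> point \<omega>" by (rule incseq_le[OF inc a])
  show "point \<omega> \<le> ?b j" by (rule decseq_ge[OF dec b])
qed

lemma point_borel [measurable]: "point \<in> borel_measurable P"
  by (rule borel_measurable_LIMSEQ_real[OF point_limit]) measurable

lemma atom_prob_less: "k \<le> N j \<Longrightarrow> prob {\<omega> \<in> space P. atom j \<omega> < k} = real k / real (N j)"
proof (induction k)
  case (Suc k)
  have "{\<omega> \<in> space P. atom j \<omega> < Suc k} = {\<omega> \<in> space P. atom j \<omega> < k} \<union> {\<omega> \<in> space P. atom j \<omega> = k}" by auto
  moreover have "prob ({\<omega> \<in> space P. atom j \<omega> < k} \<union> {\<omega> \<in> space P. atom j \<omega> = k}) =
     prob {\<omega> \<in> space P. atom j \<omega> < k} + prob {\<omega> \<in> space P. atom j \<omega> = k}"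
    by (rule finite_measure_Union) auto
  ultimately show ?case using Suc atom_prob[of k j] by (simp add: add_divide_distrib)
qed simp

text \<open>
  The event that the point lies below \<open>t\<close> is enclosed between two events about the cell of step \<open>j\<close>,
  whose probabilities differ from \<open>t\<close> by at most \<open>1 / N j\<close>.
\<close>

lemma point_cdf:
  assumes "0 \<le> t" "t \<le> 1"
  shows "prob {\<omega> \<in> space P. point \<omega> \<le> t} = t"
proof (rule antisym)
  let ?k = "\<lambda>j. nat \<lfloor>real (N j) * t\<rfloor>"
  have k: "real (?k j) \<le> real (N j) * t" "real (N j) * t \<le> real (?k j) + 1" for j
    using assms(1) by (auto simp: of_nat_nat)
  have kN: "?k j \<le> N j" for j
  proof -
    have "real (N j) * t \<le> real (N j)" using assms by (simp add: mult_left_le)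
    then show ?thesis using k(1)[of j] by linarith
  qed
  have up: "prob {\<omega> \<in> space P. point \<omega> \<le> t} \<le> t + 1 / real (N j)" for j
  proof -
    have "prob {\<omega> \<in> space P. point \<omega> \<le> t} \<le> prob {\<omega> \<in> space P. atom j \<omega> < min (Suc (?k j)) (N j)}"
    proof (rule finite_measure_mono)
      show "{\<omega> \<in> space P. point \<omega> \<le> t} \<subseteq> {\<omega> \<in> space P. atom j \<omega> < min (Suc (?k j)) (N j)}"
      proof safe
        fix \<omega> assume "point \<omega> \<le> t"
        then have "real (atom j \<omega>) / real (N j) \<le> t" using point_bounds(1)[of j \<omega>] by linarith
        then have "real (atom j \<omega>) \<le> real (N j) * t" using N_pos[of j] by (simp add: divide_le_eq mult.commute)
        then have "atom j \<omega> < Suc (?k j)" by linarith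
        then show "atom j \<omega> < min (Suc (?k j)) (N j)" using atom_less by simp
      qed
    qed measurable
    also have "\<dots> = real (min (Suc (?k j)) (N j)) / real (N j)" by (rule atom_prob_less) simp
    also have "\<dots> \<le> (real (N j) * t + 1) / real (N j)" using k(1)[of j] by (intro divide_right_mono) auto
    also have "\<dots> = t + 1 / real (N j)" using N_pos[of j] by (simp add: add_divide_distrib)
    finally show ?thesis .
  qed
  have lo: "t - 1 / real (N j) \<le> prob {\<omega> \<in> space P. point \<omega> \<le> t}" for j
  proof -
    have "t - 1 / real (N j) = (real (N j) * t - 1) / real (N j)" using N_pos[of j] by (simp add: diff_divide_distrib)
    also have "\<dots> \<le> real (?k j) / real (N j)" using k(2)[of j] by (intro divide_right_mono) auto
    also have "\<dots> = prob {\<omega> \<in> space P. atom j \<omega> < ?k j}" by (rule atom_prob_less[OF kN, symmetric])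
    also have "\<dots> \<le> prob {\<omega> \<in> space P. point \<omega> \<le> t}"
    proof (rule finite_measure_mono)
      show "{\<omega> \<in> space P. atom j \<omega> < ?k j} \<subseteq> {\<omega> \<in> space P. point \<omega> \<le> t}"
      proof safe
        fix \<omega> assume "atom j \<omega> < ?k j"
        then have "real (atom j \<omega>) + 1 \<le> real (?k j)" by linarith
        then have "(real (atom j \<omega>) + 1) / real (N j) \<le> (real (N j) * t) / real (N j)"
          using k(1)[of j] by (intro divide_right_mono) auto
        then show "point \<omega> \<le> t" using point_bounds(2)[of \<omega> j] N_pos[of j] by simp
      qed
    qed measurable
    finally show ?thesis .
  qed
  show "prob {\<omega> \<in> space P. point \<omega> \<le> t} \<le> t"
    using tendsto_le[OF _ tendsto_add[OF tendsto_const[of t] N_tendsto] tendsto_const[of "prob {\<omega> \<in> space P. point \<omega> \<le> t}"]] up by simp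
  show "t \<le> prob {\<omega> \<in> space P. point \<omega> \<le> t}"
    using tendsto_le[OF _ tendsto_const[of "prob {\<omega> \<in> space P. point \<omega> \<le> t}"] tendsto_diff[OF tendsto_const[of t] N_tendsto]] lo by simp
qed

lemma id_circle_measurable [measurable]: "(\<lambda>x. x) \<in> borel_measurable circle"
  unfolding circle_def by (rule measurable_restrict_space1) simp

lemma point_distr: "distr P borel point = distr circle borel (\<lambda>x. x)"
proof (rule cdf_unique)
  interpret C: prob_space circle by (rule prob_space_circle)
  interpret Cd: prob_space "distr circle borel (\<lambda>x. x)" by (rule C.prob_space_distr) measurable
  show "real_distribution (distr P borel point)" by (rule real_distribution_distr) measurable
  show "real_distribution (distr circle borel (\<lambda>x. x))" by (rule C.real_distribution_distr) measurable
  show "cdf (distr P borel point) = cdf (distr circle borel (\<lambda>x. x))"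
  proof
    fix t
    have l: "cdf (distr P borel point) t = prob {\<omega> \<in> space P. point \<omega> \<le> t}"
      by (simp add: cdf_def measure_distr vimage_def Int_def conj_commute)
    have r: "cdf (distr circle borel (\<lambda>x. x)) t = measure lborel ({0..<1} \<inter> {..t})"
    proof -
      have "cdf (distr circle borel (\<lambda>x. x)) t = measure circle ({..t} \<inter> {0..<1})"
        unfolding cdf_def by (subst measure_distr) (use id_circle_measurable in \<open>auto simp: circle_def space_restrict_space intro!: arg_cong2[where f=measure]\<close>)
      also have "\<dots> = measure lborel ({..t} \<inter> {0..<1})"
        unfolding circle_def by (rule measure_restrict_space) auto
      finally show ?thesis by (simp only: Int_commute)
    qed
    have p01: "0 \<le> point \<omega>" "point \<omega> \<le> 1" for \<omega>
      using point_bounds(1)[of 0 \<omega>] point_bounds(2)[of \<omega> 0] by (auto simp: atom_0 N_0)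
    consider "t < 0" | "0 \<le> t" "t < 1" | "1 \<le> t" by linarith
    then show "cdf (distr P borel point) t = cdf (distr circle borel (\<lambda>x. x)) t"
    proof cases
      case 1
      have a: "{\<omega> \<in> space P. point \<omega> \<le> t} = {}" and b: "{0..<1} \<inter> {..t} = {}" using 1 by (auto simp: not_le intro: less_le_trans[OF _ p01(1)])
      show ?thesis unfolding l r a b by simp
    next
      case 2
      then have b: "{0..<1} \<inter> {..t} = {0..t}" by auto
      show ?thesis unfolding l r b using point_cdf[of t] 2 by simp
    next
      case 3
      have a: "{\<omega> \<in> space P. point \<omega> \<le> t} = space P" and b: "{0..<1} \<inter> {..t} = {0..<1::real}" using 3 by (auto intro: order_trans[OF p01(2)])
      show ?thesis unfolding l r a b by (simp add: prob_space)
    qed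
  qed
qed

lemma point_AE: "AE \<omega> in P. point \<omega> \<notin> \<rat>"
proof -
  have c: "countable (\<rat> :: real set)" by (rule countable_rat)
  have [measurable]: "(\<rat> :: real set) \<in> sets borel" by (rule sets.countable) (use c in auto)
  have "AE x in lborel. x \<notin> (\<rat> :: real set)" by (rule AE_not_in) (use c countable_imp_null_set_lborel in auto)
  then have "AE x in circle. x \<notin> (\<rat> :: real set)" unfolding circle_def by (subst AE_restrict_space_iff) auto
  then have "AE x in distr circle borel (\<lambda>x. x). x \<notin> (\<rat> :: real set)" by (subst AE_distr_iff) auto
  then show ?thesis unfolding point_distr[symmetric] by (subst (asm) AE_distr_iff) auto
qed

text \<open>
  The limit point may take the value \<open>1\<close>, on a null set; it is moved into the half-open interval.
\<close>

definition upoint :: "'w \<Rightarrow> real" where "upoint \<omega> = (if point \<omega> < 1 then point \<omega> else 0)"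

lemma upoint_measurable [measurable]: "upoint \<in> measurable P circle"
  unfolding circle_def
proof (rule measurable_restrict_space2)
  show "upoint \<in> measurable P lborel" unfolding upoint_def by measurable
  show "upoint \<in> space P \<rightarrow> {0..<1}" using point_bounds(1)[of 0] by (auto simp: upoint_def atom_0 N_0)
qed

text \<open>
  Only rational points are end points of cells; any other point lies in the interior of all its
  cells and thus determines them.
\<close>

lemma upoint_AE: "AE \<omega> in P. \<forall>j. \<lfloor>real (N j) * upoint \<omega>\<rfloor> = int (atom j \<omega>)"
  and upoint_eq_AE: "AE \<omega> in P. upoint \<omega> = point \<omega>"
proof -
  have *: "upoint \<omega> = point \<omega> \<and> (\<forall>j. \<lfloor>real (N j) * upoint \<omega>\<rfloor> = int (atom j \<omega>))" if r: "point \<omega> \<notin> \<rat>" for \<omega>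
  proof -
    have ne: "point \<omega> \<noteq> real a / real b" for a b
      using r by (metis Rats_divide Rats_of_nat)
    have "point \<omega> \<le> 1" using point_bounds(2)[of \<omega> 0] by (simp add: atom_0 N_0)
    moreover have "point \<omega> \<noteq> 1" using ne[of 1 1] by simp
    ultimately have u: "upoint \<omega> = point \<omega>" by (simp add: upoint_def)
    moreover have "\<lfloor>real (N j) * point \<omega>\<rfloor> = int (atom j \<omega>)" for j
    proof (rule floor_unique)
      show "of_int (int (atom j \<omega>)) \<le> real (N j) * point \<omega>"
        using point_bounds(1)[of j \<omega>] N_pos[of j] by (simp add: divide_le_eq mult.commute)
      have "point \<omega> < (real (atom j \<omega>) + 1) / real (N j)"
        using point_bounds(2)[of \<omega> j] ne[of "Suc (atom j \<omega>)" "N j"] by (simp add: add.commute)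
      then show "real (N j) * point \<omega> < of_int (int (atom j \<omega>)) + 1"
        using N_pos[of j] by (simp add: less_divide_eq mult.commute)
    qed
    ultimately show ?thesis by simp
  qed
  show "AE \<omega> in P. \<forall>j. \<lfloor>real (N j) * upoint \<omega>\<rfloor> = int (atom j \<omega>)" using point_AE by eventually_elim (use * in blast)
  show "AE \<omega> in P. upoint \<omega> = point \<omega>" using point_AE by eventually_elim (use * in blast)
qed

lemma upoint_distr: "distr P circle upoint = circle"
proof (rule measure_eqI)
  fix A assume "A \<in> sets (distr P circle upoint)"
  then have A: "A \<in> sets circle" by simp
  then have AB: "A \<in> sets borel" "A \<subseteq> {0..<1}" by (auto simp: circle_def sets_restrict_space)
  note [measurable] = A AB(1)
  have "emeasure (distr P circle upoint) A = emeasure P {\<omega> \<in> space P. upoint \<omega> \<in> A}"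
    by (subst emeasure_distr) (auto simp: vimage_def Int_def conj_commute)
  also have "\<dots> = emeasure P {\<omega> \<in> space P. point \<omega> \<in> A}"
  proof (rule emeasure_eq_AE)
    show "AE \<omega> in P. (\<omega> \<in> {\<omega> \<in> space P. upoint \<omega> \<in> A}) = (\<omega> \<in> {\<omega> \<in> space P. point \<omega> \<in> A})"
      using upoint_eq_AE by eventually_elim auto
  qed (measurable, measurable)
  also have "\<dots> = emeasure (distr P borel point) A"
    by (subst emeasure_distr) (auto simp: vimage_def Int_def conj_commute)
  also have "\<dots> = emeasure circle A"
    unfolding point_distr by (subst emeasure_distr) (use A AB in \<open>auto simp: sets.Int_space_eq2\<close>)
  finally show "emeasure (distr P circle upoint) A = emeasure circle A" .
qed simp

end

lemma (in prob_space) indep_vars_UNIV: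
  fixes X :: "nat \<Rightarrow> 'a \<Rightarrow> 'b"
  assumes "\<And>n. indep_vars M' X {..<n}"
  shows "indep_vars M' X UNIV"
  unfolding indep_vars_def2 indep_sets_def
proof (intro conjI ballI allI impI)
  fix i :: nat
  have i: "i \<in> {..<Suc i}" by simp
  show "random_variable (M' i) (X i)" using assms[of "Suc i"] i unfolding indep_vars_def2 by blast
  show "{X i -` A \<inter> space M |A. A \<in> sets (M' i)} \<subseteq> events"
    using assms[of "Suc i"] i unfolding indep_vars_def2 indep_sets_def by blast
next
  fix J :: "nat set" and A
  assume J: "J \<subseteq> UNIV" "J \<noteq> {}" "finite J" and A: "A \<in> (\<Pi> i\<in>J. {X i -` B \<inter> space M |B. B \<in> sets (M' i)})"
  obtain n where "J \<subseteq> {..<n}" using finite_nat_iff_bounded J(3) by blast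
  then show "prob (\<Inter>j\<in>J. A j) = (\<Prod>j\<in>J. prob (A j))"
    using assms[of n] J A unfolding indep_vars_def2 indep_sets_def by blast
qed

section \<open>Strong approximation of a lacunary system\<close>

lemma AE_summable_weighted:
  fixes f :: "nat \<Rightarrow> 'a \<Rightarrow> real"
  assumes i: "\<And>n. integrable M (f n)" and nn: "\<And>n x. 0 \<le> f n x"
    and C: "\<And>n. (\<integral>x. f n x \<partial>M) \<le> C * real (Suc n) powr a" and ab: "a + 1 < b"
  shows "AE x in M. summable (\<lambda>n. f n x / real (Suc n) powr b)"
proof (rule AE_summable_of_integrals)
  show "integrable M (\<lambda>x. f n x / real (Suc n) powr b)" for n using i by simp
  show "0 \<le> f n x / real (Suc n) powr b" for n x using nn by simp
  show "summable (\<lambda>n. \<integral>x. f n x / real (Suc n) powr b \<partial>M)"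
  proof (rule summable_comparison_test')
    have "summable (\<lambda>n. real (Suc n) powr (a - b))"
      unfolding summable_Suc_iff[of "\<lambda>n. real n powr (a - b)"] summable_real_powr_iff using ab by simp
    then show "summable (\<lambda>n. C * real (Suc n) powr (a - b))" by (rule summable_mult)
    fix n
    have "0 \<le> (\<integral>x. f n x \<partial>M)" using nn by simp
    then have "norm (\<integral>x. f n x / real (Suc n) powr b \<partial>M) = (\<integral>x. f n x \<partial>M) / real (Suc n) powr b" by simp
    also have "\<dots> \<le> C * real (Suc n) powr a / real (Suc n) powr b" by (intro divide_right_mono C) simp
    also have "\<dots> = C * real (Suc n) powr (a - b)" by (simp add: powr_diff)
    finally show "norm (\<integral>x. f n x / real (Suc n) powr b \<partial>M) \<le> C * real (Suc n) powr (a - b)" .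
  qed
qed

lemma wiener_fourth_moment:
  assumes "prob_space P" and w: "wiener_process P \<zeta>" and st: "0 \<le> s" "s \<le> t"
  shows "integrable P (\<lambda>\<omega>. (\<zeta> t \<omega> - \<zeta> s \<omega>) ^ 4)" and "(\<integral>\<omega>. (\<zeta> t \<omega> - \<zeta> s \<omega>) ^ 4 \<partial>P) = 3 * (t - s)\<^sup>2"
proof -
  interpret prob_space P by fact
  have "integrable P (\<lambda>\<omega>. (\<zeta> t \<omega> - \<zeta> s \<omega>) ^ 4) \<and> (\<integral>\<omega>. (\<zeta> t \<omega> - \<zeta> s \<omega>) ^ 4 \<partial>P) = 3 * (t - s)\<^sup>2"
  proof (cases "s = t")
    case False
    define r where "r = sqrt (t - s)"
    have r: "0 < r" "r ^ 4 = (t - s)\<^sup>2"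
      using st False by (auto simp: r_def power4_eq_xxxx power2_eq_square)
    have "distributed P lborel (\<lambda>\<omega>. \<zeta> t \<omega> - \<zeta> s \<omega>) (normal_density 0 r)"
      using w st False unfolding wiener_process_def r_def by auto
    then have d: "distributed P lborel (\<lambda>\<omega>. (\<zeta> t \<omega> - \<zeta> s \<omega> - 0) / r) std_normal_density"
      by (simp only: normal_standard_normal_convert[OF r(1)])
    let ?Z = "\<lambda>\<omega>. (\<zeta> t \<omega> - \<zeta> s \<omega> - 0) / r"
    have Zm: "?Z \<in> measurable P lborel" by (rule distributed_measurable[OF d])
    have e: "distr P lborel ?Z = gauss" by (rule distributed_distr_eq_density[OF d])
    have z: "(\<zeta> t \<omega> - \<zeta> s \<omega>) ^ 4 = r ^ 4 * ?Z \<omega> ^ 4" for \<omega> using r(1) by (simp add: power_divide)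
    have i: "integrable P (\<lambda>\<omega>. ?Z \<omega> ^ 4)"
      by (rule integrable_distr[OF Zm, of "\<lambda>x. x ^ 4"]) (unfold e, rule integrable_std_normal_distribution_moment)
    have "(\<integral>\<omega>. ?Z \<omega> ^ 4 \<partial>P) = (\<integral>x. x ^ 4 \<partial>gauss)"
      unfolding e[symmetric] by (rule integral_distr[OF Zm, symmetric]) simp
    also have "\<dots> = 3" using std_normal_distribution_even_moments(1)[of 2] by (simp add: fact_numeral)
    finally have "(\<integral>\<omega>. ?Z \<omega> ^ 4 \<partial>P) = 3" .
    then show ?thesis unfolding z using i r(2) by simp
  qed simp
  then show "integrable P (\<lambda>\<omega>. (\<zeta> t \<omega> - \<zeta> s \<omega>) ^ 4)" "(\<integral>\<omega>. (\<zeta> t \<omega> - \<zeta> s \<omega>) ^ 4 \<partial>P) = 3 * (t - s)\<^sup>2" by auto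
qed

context lacunary_system
begin

text \<open>
  The number of levels is logarithmic in the length of the block, so its third power is absorbed
  into a factor \<open>J\<close> to the power \<open>1 / 2\<close>.
\<close>

lemma block_levels:
  obtains r where "bsize j < 2 ^ r" "real r ^ 3 * 4 ^ r \<le> 1156 * 225 ^ 3 * real (Suc j) powr (65 / 2)"
proof -
  define J where "J = real (Suc j)"
  have J: "1 \<le> J" by (simp add: J_def)
  define L where "L = J powr (1 / 6)"
  have L: "1 \<le> L" unfolding L_def using J by (intro ge_one_powr_ge_zero) auto
  obtain n where n: "2 ^ n \<le> bsize j" "bsize j < 2 ^ Suc n"
    using ex_power_ivl1[of 2 "bsize j"] bsize_pos[of j] by auto
  have "(2::real) ^ n \<le> real (bsize j)" using n(1) by (metis of_nat_le_iff of_nat_numeral of_nat_power)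
  also have "\<dots> \<le> 17 * J ^ 16" unfolding J_def by (rule bsize_bounds)
  finally have up: "(2::real) ^ n \<le> 17 * J ^ 16" .
  have "real n * ln 2 = ln ((2::real) ^ n)" by (simp add: ln_realpow)
  also have "\<dots> \<le> ln (17 * J ^ 16)" using up J by (subst ln_le_cancel_iff) auto
  also have "\<dots> = ln 17 + 16 * ln J" using J by (simp add: ln_mult ln_realpow)
  also have "ln 17 \<le> (16::real)" using ln_le_minus_one[of "17::real"] by simp
  also have "ln J \<le> 6 * L" using ln_powr_bound[of J "1 / 6"] J by (simp add: L_def)
  finally have "real n * ln 2 \<le> 16 + 16 * (6 * L)" by simp
  moreover have "real n * (1 / 2) \<le> real n * ln 2" using ln2_ge_two_thirds by (intro mult_left_mono) auto
  ultimately have "real (Suc n) \<le> 225 * L" using L by simp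
  then have "real (Suc n) ^ 3 \<le> (225 * L) ^ 3" by (intro power_mono) auto
  also have "\<dots> = 225 ^ 3 * J powr (1 / 2)"
    using J by (simp add: power_mult_distrib L_def powr_power)
  finally have r3: "real (Suc n) ^ 3 \<le> 225 ^ 3 * J powr (1 / 2)" .
  have "(4::real) ^ Suc n = (2 * 2 ^ n)\<^sup>2" by (simp add: power_mult_distrib flip: power_mult) (simp add: power_mult[symmetric] mult.commute[of n] power_mult)
  also have "\<dots> \<le> (2 * (17 * J ^ 16))\<^sup>2" using up by (intro power_mono mult_left_mono) auto
  also have "\<dots> = 1156 * J powr 32" using J by (simp add: power_mult_distrib powr_numeral flip: power_mult)
  finally have r4: "(4::real) ^ Suc n \<le> 1156 * J powr 32" .
  have "real (Suc n) ^ 3 * 4 ^ Suc n \<le> (225 ^ 3 * J powr (1 / 2)) * (1156 * J powr 32)"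
    by (rule mult_mono[OF r3 r4]) auto
  also have "\<dots> = 1156 * 225 ^ 3 * (J powr (1 / 2) * J powr 32)" by simp
  also have "J powr (1 / 2) * J powr 32 = J powr (65 / 2)" by (simp flip: powr_add)
  finally show ?thesis using that[OF n(2)] unfolding J_def by simp
qed

definition levels :: "nat \<Rightarrow> nat" where
  "levels j = (SOME r. bsize j < 2 ^ r \<and> real r ^ 3 * 4 ^ r \<le> 1156 * 225 ^ 3 * real (Suc j) powr (65 / 2))"

lemma levels: "bsize j < 2 ^ levels j" "real (levels j) ^ 3 * 4 ^ levels j \<le> 1156 * 225 ^ 3 * real (Suc j) powr (65 / 2)"
proof -
  have "bsize j < 2 ^ levels j \<and> real (levels j) ^ 3 * 4 ^ levels j \<le> 1156 * 225 ^ 3 * real (Suc j) powr (65 / 2)"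
    unfolding levels_def by (rule someI_ex) (metis block_levels)
  then show "bsize j < 2 ^ levels j" "real (levels j) ^ 3 * 4 ^ levels j \<le> 1156 * 225 ^ 3 * real (Suc j) powr (65 / 2)" by auto
qed

lemma chain_oscillation:
  assumes c: "summable (\<lambda>j. chain_sum (levels j) (\<lambda>n. S (K j + n)) / real (Suc j) powr (168 / 5))"
  obtains A where "0 \<le> A" "\<And>n. \<bar>S n - S (K (block n))\<bar> \<le> A * real (Suc (block n)) powr (42 / 5)"
proof -
  let ?c = "\<lambda>j. chain_sum (levels j) (\<lambda>n. S (K j + n)) / real (Suc j) powr (168 / 5)"
  define A where "A = suminf ?c + 1"
  have nn: "0 \<le> ?c j" for j using chain_sum_nonneg by simp
  have A1: "1 \<le> A" using suminf_nonneg[OF c nn] by (simp add: A_def)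
  have "\<bar>S n - S (K (block n))\<bar> \<le> A * real (Suc (block n)) powr (42 / 5)" for n
  proof -
    let ?j = "block n"
    define w where "w = real (Suc ?j) powr (42 / 5)"
    have w: "0 < w" "real (Suc ?j) powr (168 / 5) = w ^ 4" by (auto simp: w_def powr_power)
    have n: "n - K ?j < 2 ^ levels ?j"
      using block_bounds[of n] levels(1)[of ?j] unfolding K_Suc by linarith
    have "?c ?j \<le> suminf ?c" using sum_le_suminf[OF c, of "{?j}"] nn by auto
    then have "?c ?j \<le> A" by (simp add: A_def)
    then have "chain_sum (levels ?j) (\<lambda>n. S (K ?j + n)) \<le> A * w ^ 4"
      using w by (simp add: pos_divide_le_eq)
    moreover have "(S n - S (K ?j)) ^ 4 \<le> chain_sum (levels ?j) (\<lambda>n. S (K ?j + n))"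
      using chain_sum_bound[OF n, of "\<lambda>n. S (K ?j + n)"] block_bounds(1)[of n] by simp
    ultimately have "(S n - S (K ?j)) ^ 4 \<le> A * w ^ 4" by simp
    also have "\<dots> \<le> A ^ 4 * w ^ 4" using A1 power_increasing[of 1 4 A] by (intro mult_right_mono) auto
    finally have "\<bar>S n - S (K ?j)\<bar> ^ 4 \<le> (A * w) ^ 4" by (simp add: power_mult_distrib power_even_abs)
    then have "\<bar>S n - S (K ?j)\<bar> \<le> A * w" using power_mono_iff[of "\<bar>S n - S (K ?j)\<bar>" "A * w" 4] A1 w by simp
    then show ?thesis by (simp only: w_def)
  qed
  then show ?thesis using that[of A] A1 by auto
qed

text \<open>
  As the weights increase, summability of the weighted block errors bounds their sum over the
  first \<open>j\<close> blocks by a constant times the weight of block \<open>j\<close>. The weight has exponent \<open>42 / 5\<close> in \<open>j\<close>,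
  that is \<open>42 / 85\<close> in \<open>n\<close>.
\<close>

lemma assemble_blocks:
  assumes z: "S 0 = B 0"
    and d: "summable (\<lambda>j. \<bar>(S (K (Suc j)) - S (K j)) - (B (K (Suc j)) - B (K j))\<bar> / real (Suc j) powr (42 / 5))"
    and c1: "summable (\<lambda>j. chain_sum (levels j) (\<lambda>n. S (K j + n)) / real (Suc j) powr (168 / 5))"
    and c2: "summable (\<lambda>j. chain_sum (levels j) (\<lambda>n. B (K j + n)) / real (Suc j) powr (168 / 5))"
  shows "\<exists>C. \<forall>n\<ge>1. \<bar>S n - B n\<bar> \<le> C * real n powr (42 / 85)"
proof -
  obtain A1 where A1: "0 \<le> A1" "\<And>n. \<bar>S n - S (K (block n))\<bar> \<le> A1 * real (Suc (block n)) powr (42 / 5)"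
    using chain_oscillation[OF c1] by blast
  obtain A2 where A2: "0 \<le> A2" "\<And>n. \<bar>B n - B (K (block n))\<bar> \<le> A2 * real (Suc (block n)) powr (42 / 5)"
    using chain_oscillation[OF c2] by blast
  let ?d = "\<lambda>j. \<bar>(S (K (Suc j)) - S (K j)) - (B (K (Suc j)) - B (K j))\<bar>"
  let ?w = "\<lambda>j. real (Suc j) powr (42 / 5)"
  define A where "A = (\<Sum>j. ?d j / ?w j)"
  have A0: "0 \<le> A" unfolding A_def by (rule suminf_nonneg[OF d]) simp
  have ends: "\<bar>S (K j) - B (K j)\<bar> \<le> A * ?w j" for j
  proof -
    have "S (K j) - B (K j) = (\<Sum>i<j. (S (K (Suc i)) - S (K i)) - (B (K (Suc i)) - B (K i)))"
      by (induction j) (use z in auto)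
    then have "\<bar>S (K j) - B (K j)\<bar> \<le> (\<Sum>i<j. ?d i)" by (simp only: sum_abs)
    also have "\<dots> \<le> (\<Sum>i<j. ?d i / ?w i * ?w j)"
    proof (rule sum_mono)
      fix i assume "i \<in> {..<j}"
      then have "?w i \<le> ?w j" by (intro powr_mono2) auto
      then have "?d i / ?w i * ?w i \<le> ?d i / ?w i * ?w j" by (intro mult_left_mono) auto
      then show "?d i \<le> ?d i / ?w i * ?w j" by simp
    qed
    also have "\<dots> = (\<Sum>i<j. ?d i / ?w i) * ?w j" by (simp only: sum_distrib_right)
    also have "\<dots> \<le> A * ?w j" unfolding A_def by (intro mult_right_mono sum_le_suminf d) auto
    finally show ?thesis .
  qed
  have "\<bar>S n - B n\<bar> \<le> (A + A1 + A2) * 2 powr (42 / 5) * real n powr (42 / 85)" if n: "1 \<le> n" for n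
  proof -
    let ?j = "block n"
    have "\<bar>S n - B n\<bar> \<le> \<bar>S (K ?j) - B (K ?j)\<bar> + \<bar>S n - S (K ?j)\<bar> + \<bar>B n - B (K ?j)\<bar>" by linarith
    also have "\<dots> \<le> A * ?w ?j + A1 * ?w ?j + A2 * ?w ?j" by (intro add_mono ends A1 A2)
    also have "\<dots> = (A + A1 + A2) * ?w ?j" by (simp only: distrib_right)
    also have "\<dots> \<le> (A + A1 + A2) * (2 * real n powr (1 / 17)) powr (42 / 5)"
    proof (intro mult_left_mono powr_mono2)
      have "real ?j ^ 17 \<le> real n" using block_bounds(1)[of n] unfolding K_def by (metis of_nat_le_iff of_nat_power)
      then have "(real ?j ^ 17) powr (1 / 17) \<le> real n powr (1 / 17)" by (intro powr_mono2) auto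
      moreover have "(real ?j ^ 17) powr (1 / 17) = real ?j"
      proof (cases "?j = 0")
        case False
        then have "real ?j ^ 17 = real ?j powr 17" by (subst powr_numeral) auto
        then show ?thesis by (simp only: powr_powr) simp
      qed simp
      moreover have "1 \<le> real n powr (1 / 17)" using n by (intro ge_one_powr_ge_zero) auto
      ultimately show "real (Suc ?j) \<le> 2 * real n powr (1 / 17)" by simp
    qed (use A0 A1 A2 in auto)
    also have "\<dots> = (A + A1 + A2) * 2 powr (42 / 5) * real n powr (42 / 85)"
      by (simp add: powr_mult powr_powr)
    finally show ?thesis .
  qed
  then show ?thesis by blast
qed

text \<open>
  Each number of cells is a multiple of the preceding one and lies between the largest frequency
  of the block just finished and twice that frequency: the cells resolve this block and are coarse
  for the next one.
\<close>

primrec cells :: "nat \<Rightarrow> nat" where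
  "cells 0 = 1"
| "cells (Suc j) = cells j * nat \<lceil>real (Q (K (Suc j) - 1)) / real (cells j)\<rceil>"

definition splits :: "nat \<Rightarrow> nat" where
  "splits j = nat \<lceil>real (Q (K (Suc j) - 1)) / real (cells j)\<rceil>"

lemma cells_Suc: "cells (Suc j) = cells j * splits j"
  by (simp add: splits_def)

lemma cells_pos: "0 < cells j"
proof (induction j)
  case (Suc j)
  have "0 < real (Q (K (Suc j) - 1)) / real (cells j)" using Suc Q_pos[of "K (Suc j) - 1"] by simp
  then have "0 < \<lceil>real (Q (K (Suc j) - 1)) / real (cells j)\<rceil>" by linarith
  then show ?case using Suc by simp
qed simp

lemma splits_pos: "0 < splits j"
  using cells_pos[of "Suc j"] unfolding cells_Suc by simp

lemma cells_lower: "Q (K (Suc j) - 1) \<le> cells (Suc j)"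
proof -
  have "real (Q (K (Suc j) - 1)) / real (cells j) \<le> real (splits j)" unfolding splits_def by linarith
  then have "real (Q (K (Suc j) - 1)) \<le> real (cells j) * real (splits j)"
    using cells_pos[of j] by (simp add: divide_le_eq mult.commute)
  then show ?thesis unfolding cells_Suc by (metis of_nat_le_iff of_nat_mult)
qed

lemma cells_upper: "cells (Suc j) \<le> Q (K (Suc j) - 1) + cells j"
proof -
  have "0 < real (Q (K (Suc j) - 1)) / real (cells j)" using cells_pos[of j] Q_pos[of "K (Suc j) - 1"] by simp
  then have "real (splits j) \<le> real (Q (K (Suc j) - 1)) / real (cells j) + 1" unfolding splits_def by linarith
  then have "real (cells j) * real (splits j) \<le> real (cells j) * (real (Q (K (Suc j) - 1)) / real (cells j) + 1)"
    by (intro mult_left_mono) auto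
  also have "\<dots> = real (Q (K (Suc j) - 1)) + real (cells j)" using cells_pos[of j] by (simp add: distrib_left)
  finally show ?thesis unfolding cells_Suc by (metis of_nat_add of_nat_le_iff of_nat_mult)
qed

lemma cells_le: "cells j \<le> Q (K (Suc j) - 1)"
proof (induction j)
  case 0
  then show ?case using Q_pos by simp
next
  case (Suc j)
  have "2 ^ 16 \<le> Suc (Suc j) ^ 16" by (intro power_mono) auto
  then have b: "2 \<le> bsize (Suc j)" using bsize_bounds(3)[of "Suc j"] by simp
  have "cells (Suc j) \<le> 2 * Q (K (Suc j) - 1)" using cells_upper[of j] Suc by simp
  also have "\<dots> \<le> Q (Suc (Suc (K (Suc j) - 1)))" by (rule Q_double)
  also have "\<dots> \<le> Q (K (Suc (Suc j)) - 1)"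
  proof (rule Q_mono)
    have "1 \<le> K (Suc j)" by (simp add: K_def)
    then show "Suc (Suc (K (Suc j) - 1)) \<le> K (Suc (Suc j)) - 1" using b unfolding K_Suc[of "Suc j"] by linarith
  qed
  finally show ?case .
qed

lemma cells_admissible: "admissible (K j) (cells j)"
proof (cases j)
  case (Suc i)
  have "cells (Suc i) \<le> 2 * Q (K (Suc i) - 1)" using cells_upper[of i] cells_le[of i] by simp
  moreover have "1 \<le> K (Suc i)" by (simp add: K_def)
  ultimately show ?thesis using cells_pos[of "Suc i"] unfolding Suc admissible_def by linarith
qed (simp add: admissible_def)

lemma cells_large: "j \<le> cells (Suc j)"
proof -
  have "Suc j ^ 1 \<le> Suc j ^ 17" by (rule power_increasing) auto
  then have "j \<le> K (Suc j) - 1" by (simp add: K_def)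
  also have "\<dots> \<le> Q (K (Suc j) - 1)" by (rule Q_ge)
  also have "\<dots> \<le> cells (Suc j)" by (rule cells_lower)
  finally show ?thesis .
qed

abbreviation cell_value :: "nat \<Rightarrow> nat \<Rightarrow> nat \<Rightarrow> real" where
  "cell_value j a i \<equiv> block_sum j ((real a + real i / real (splits j)) / real (cells j))"

text \<open>
  Sorting the subcells by the value of the block sum makes the selected value a nondecreasing
  function of the normal variable, as the quantile coupling requires.
\<close>

definition ordering :: "nat \<Rightarrow> nat \<Rightarrow> nat \<Rightarrow> nat" where
  "ordering j a = (SOME p. bij_betw p {..<splits j} {..<splits j} \<and>
     (\<forall>i k. i \<le> k \<longrightarrow> k < splits j \<longrightarrow> cell_value j a (p i) \<le> cell_value j a (p k)))"

lemma ordering: "bij_betw (ordering j a) {..<splits j} {..<splits j}"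
    "\<And>i k. i \<le> k \<Longrightarrow> k < splits j \<Longrightarrow> cell_value j a (ordering j a i) \<le> cell_value j a (ordering j a k)"
proof -
  have "\<exists>p. bij_betw p {..<splits j} {..<splits j} \<and>
     (\<forall>i k. i \<le> k \<longrightarrow> k < splits j \<longrightarrow> cell_value j a (p i) \<le> cell_value j a (p k))"
  proof (rule sorting_permutation[of "splits j" "cell_value j a"])
    fix p assume "bij_betw p {..<splits j} {..<splits j}"
      "\<And>i k. i \<le> k \<Longrightarrow> k < splits j \<Longrightarrow> cell_value j a (p i) \<le> cell_value j a (p k)"
    then show ?thesis by blast
  qed
  then have "bij_betw (ordering j a) {..<splits j} {..<splits j} \<and>
     (\<forall>i k. i \<le> k \<longrightarrow> k < splits j \<longrightarrow> cell_value j a (ordering j a i) \<le> cell_value j a (ordering j a k))"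
    unfolding ordering_def by (rule someI_ex)
  then show "bij_betw (ordering j a) {..<splits j} {..<splits j}"
    "\<And>i k. i \<le> k \<Longrightarrow> k < splits j \<Longrightarrow> cell_value j a (ordering j a i) \<le> cell_value j a (ordering j a k)" by auto
qed

lemma block_sum_borel [measurable]: "block_sum j \<in> borel_measurable borel"
  unfolding block_sum_def by measurable

lemma block_sum_bound: "\<bar>block_sum j x\<bar> \<le> (real (K j) + real (K (Suc j))) * W"
  unfolding block_sum_def by (rule partial_diff_bound)

lemma block_discretisation:
  assumes "0 < N" "Q (K (Suc j) - 1) \<le> N"
  shows "ival 0 1 (\<lambda>x. \<bar>block_sum j x - block_sum j (of_int \<lfloor>real N * x\<rfloor> / real N)\<bar>) \<le> 13 * W"
proof -
  interpret O: oscillating_sequence "\<lambda>i y. X (K j + i) ((0 + y) / real 1)" "\<lambda>i y. m (K j + i) ((0 + y) / real 1)" "per (K j) 1" W "bsize j"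
    by (rule subsystem) simp
  have S: "O.S (bsize j) y = block_sum j y" for y unfolding O.S_def block_sum_eq by simp
  have g: "(\<Sum>i<bsize j. m (K j + i) ((0 + 1) / real 1)) - (\<Sum>i<bsize j. m (K j + i) ((0 + 0) / real 1)) \<le> W * (13 * real N)"
  proof -
    have "(\<Sum>i<bsize j. m (K j + i) ((0 + 1) / real 1)) - (\<Sum>i<bsize j. m (K j + i) ((0 + 0) / real 1)) \<le> W * (\<Sum>k<bsize j. 1 / per (K j) 1 k + 1)"
      by (rule O.S_growth) simp
    also have "\<dots> \<le> W * (13 * (real (Q (K (Suc j) - 1)) / real 1))"
      by (intro mult_left_mono growth_bound W_nonneg) (simp add: admissible_def)
    also have "\<dots> \<le> W * (13 * real N)" using assms by (intro mult_left_mono W_nonneg) auto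
    finally show ?thesis .
  qed
  have "ival 0 1 (\<lambda>x. \<bar>block_sum j x - block_sum j (of_int \<lfloor>real N * x\<rfloor> / real N)\<bar>)
    \<le> ((\<Sum>i<bsize j. m (K j + i) ((0 + 1) / real 1)) - (\<Sum>i<bsize j. m (K j + i) ((0 + 0) / real 1))) / real N"
    using discretisation_bound(1)[OF O.S_dominated[OF order_refl] O.S_bound[OF order_refl] assms(1)] unfolding S .
  also have "\<dots> \<le> W * (13 * real N) / real N" by (intro divide_right_mono g) simp
  also have "\<dots> = 13 * W" using assms(1) by simp
  finally show ?thesis .
qed

text \<open>
  Four errors have to be summable after division by the weights: the coupling error with exponent
  \<open>7\<close>, the bounded discretisation error, and the two chain sums with exponent \<open>65 / 2\<close>. For the first
  two the weight has exponent \<open>42 / 5 > 7 + 1\<close>, for the chain sums, which are of fourth order,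
  \<open>168 / 5 > 65 / 2 + 1\<close>.
\<close>

lemma strong_approximation:
  fixes P :: "'w measure"
  assumes "prob_space P" and w: "wiener_process P \<zeta>"
  obtains y where "y \<in> measurable P circle" "distr P circle y = circle"
    "AE \<omega> in P. \<exists>C. \<forall>n\<ge>1. \<bar>partial n (y \<omega>) - \<zeta> (tau n) \<omega>\<bar> \<le> C * real n powr (42 / 85)"
proof -
  interpret P: prob_space P by fact
  have Km: "K i < K (Suc i)" for i using bsize_pos[of i] by (simp add: K_Suc)
  have zm [measurable]: "\<zeta> (tau n) \<in> borel_measurable P" for n using w tau_nonneg unfolding wiener_process_def by blast
  define G where "G j \<omega> = \<zeta> (tau (K (Suc j))) \<omega> - \<zeta> (tau (K j)) \<omega>" for j \<omega>
  define Z where "Z j \<omega> = G j \<omega> / sigma j" for j \<omega>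
  have Gm [measurable]: "G j \<in> borel_measurable P" for j unfolding G_def by measurable
  have ZG: "sigma j * Z j \<omega> = G j \<omega>" for j \<omega> using sigma_pos[of j] by (simp add: Z_def)
  have indG: "P.indep_vars (\<lambda>_. borel) G {..<n}" for n
    using w tau_strict_mono[OF Km] unfolding wiener_process_def G_def[abs_def] by (elim conjE allE[of _ n] allE[of _ "\<lambda>i. tau (K i)"]) (simp add: K_0)
  have indZ: "P.indep_vars (\<lambda>_. borel) Z UNIV"
  proof -
    have "P.indep_vars (\<lambda>_. borel) (\<lambda>j \<omega>. (\<lambda>g. g / sigma j) (G j \<omega>)) UNIV"
      by (rule P.indep_vars_compose2[OF P.indep_vars_UNIV[OF indG]]) measurable
    then show ?thesis by (simp add: Z_def[abs_def])
  qed
  have Zd: "distr P borel (Z j) = gauss" for j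
  proof -
    have "distributed P lborel (G j) (normal_density 0 (sigma j))"
      using w tau_strict_mono[OF Km[of j]] tau_nonneg unfolding wiener_process_def sigma_def G_def[abs_def] by blast
    then have "distributed P lborel (\<lambda>\<omega>. (G j \<omega> - 0) / sigma j) std_normal_density"
      by (simp only: P.normal_standard_normal_convert[OF sigma_pos])
    from distributed_distr_eq_density[OF this] have "distr P lborel (\<lambda>\<omega>. (G j \<omega> - 0) / sigma j) = gauss" .
    moreover have "distr P lborel (\<lambda>\<omega>. (G j \<omega> - 0) / sigma j) = distr P borel (Z j)"
      by (rule distr_cong) (auto simp: Z_def)
    ultimately show ?thesis by simp
  qed
  interpret R: random_refinement P Z splits cells ordering
    by unfold_locales (use indZ Zd splits_pos cells_Suc cells_large ordering(1) in \<open>auto simp del: cells.simps(2)\<close>)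
  define y where "y = R.upoint"
  note R.id_circle_measurable [measurable del]
  have ym [measurable]: "y \<in> measurable P circle" unfolding y_def by (rule R.upoint_measurable)
  have yd: "distr P circle y = circle" unfolding y_def by (rule R.upoint_distr)
  have yb [measurable]: "y \<in> borel_measurable P" using measurable_compose[OF ym R.id_circle_measurable] by simp
  have transfer: "(\<integral>\<omega>. f (y \<omega>) \<partial>P) = ival 0 1 f" if [measurable]: "f \<in> borel_measurable borel" for f :: "real \<Rightarrow> real"
  proof -
    have "f \<in> borel_measurable circle" using measurable_compose[OF R.id_circle_measurable that] by simp
    then have "(\<integral>\<omega>. f (y \<omega>) \<partial>P) = (LINT x|distr P circle y. f x)" by (rule integral_distr[OF ym, symmetric])
    then show ?thesis by (simp only: yd ival_eq_circle)
  qed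
  let ?atom = "\<lambda>j \<omega>. real (R.atom j \<omega>) / real (cells j)"
  have atom_Suc: "?atom (Suc j) \<omega> = (real (R.atom j \<omega>) + real (ordering j (R.atom j \<omega>) (quantile_index (splits j) (Z j \<omega>))) / real (splits j)) / real (cells j)" for j \<omega>
    using splits_pos[of j] cells_pos[of j] unfolding R.atom_Suc cells_Suc by (simp add: field_simps)
  have Ccon0: "0 \<le> Ccon" using W_nonneg kappa_nonneg by (simp add: Ccon_def Dcon_def Qcon_def)
  have s1: "AE \<omega> in P. summable (\<lambda>j. \<bar>block_sum j (?atom (Suc j) \<omega>) - G j \<omega>\<bar> / real (Suc j) powr (42 / 5))"
  proof (rule AE_summable_weighted[where a=7 and C=Ccon])
    fix j
    let ?g = "\<lambda>a z. \<bar>cell_value j a (ordering j a (quantile_index (splits j) z)) - sigma j * z\<bar>"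
    have e: "\<bar>block_sum j (?atom (Suc j) \<omega>) - G j \<omega>\<bar> = ?g (R.atom j \<omega>) (Z j \<omega>)" for \<omega>
      unfolding atom_Suc ZG ..
    have lo: "Q (K (Suc j) - 1) \<le> cells j * splits j" using cells_lower[of j] unfolding cells_Suc .
    have b1: "integrable gauss (?g a)" for a
      by (rule block_coupling(1)[OF cells_admissible splits_pos lo ordering])
    have b2: "(\<integral>z. ?g a z \<partial>gauss) \<le> Ccon * real (Suc j) ^ 7" for a
      by (rule block_coupling(2)[OF cells_admissible splits_pos lo ordering])
    show "integrable P (\<lambda>\<omega>. \<bar>block_sum j (?atom (Suc j) \<omega>) - G j \<omega>\<bar>)"
      unfolding e by (rule R.conditional_coupling(1)[OF b1 b2])
    have "(\<integral>\<omega>. \<bar>block_sum j (?atom (Suc j) \<omega>) - G j \<omega>\<bar> \<partial>P) \<le> Ccon * real (Suc j) ^ 7"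
      unfolding e by (rule R.conditional_coupling(2)[OF b1 b2])
    also have "real (Suc j) ^ 7 = real (Suc j) powr 7" by (subst powr_numeral) auto
    finally show "(\<integral>\<omega>. \<bar>block_sum j (?atom (Suc j) \<omega>) - G j \<omega>\<bar> \<partial>P) \<le> Ccon * real (Suc j) powr 7" .
  qed auto
  let ?D = "\<lambda>j x. \<bar>block_sum j x - block_sum j (of_int \<lfloor>real (cells (Suc j)) * x\<rfloor> / real (cells (Suc j)))\<bar>"
  have s2: "AE \<omega> in P. summable (\<lambda>j. ?D j (y \<omega>) / real (Suc j) powr (42 / 5))"
  proof (rule AE_summable_weighted[where a=0 and C="13 * W"])
    fix j
    have [measurable]: "(\<lambda>x. real_of_int \<lfloor>real (cells (Suc j)) * x\<rfloor> / real (cells (Suc j))) \<in> borel_measurable borel"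
      by measurable
    have Dm: "?D j \<in> borel_measurable borel"
      by (intro borel_measurable_abs borel_measurable_diff block_sum_borel measurable_compose[OF _ block_sum_borel]) measurable
    have [measurable]: "(\<lambda>\<omega>. ?D j (y \<omega>)) \<in> borel_measurable P" by (rule measurable_compose[OF yb Dm])
    show "integrable P (\<lambda>\<omega>. ?D j (y \<omega>))"
    proof (rule P.integrable_const_bound[where B="2 * ((real (K j) + real (K (Suc j))) * W)"])
      show "AE \<omega> in P. norm (?D j (y \<omega>)) \<le> 2 * ((real (K j) + real (K (Suc j))) * W)"
      proof (rule AE_I2)
        fix \<omega>
        show "norm (?D j (y \<omega>)) \<le> 2 * ((real (K j) + real (K (Suc j))) * W)"
          using block_sum_bound[of j "y \<omega>"] block_sum_bound[of j "of_int \<lfloor>real (cells (Suc j)) * y \<omega>\<rfloor> / real (cells (Suc j))"]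
          unfolding real_norm_def by linarith
      qed
    qed (rule measurable_compose[OF yb Dm])
    have "(\<integral>\<omega>. ?D j (y \<omega>) \<partial>P) \<le> 13 * W"
      unfolding transfer[OF Dm] by (rule block_discretisation[OF cells_pos cells_lower])
    then show "(\<integral>\<omega>. ?D j (y \<omega>) \<partial>P) \<le> 13 * W * real (Suc j) powr 0" by simp
  qed auto
  have levels': "C * real (levels j) ^ 3 * 4 ^ levels j \<le> C * (1156 * 225 ^ 3) * real (Suc j) powr (65 / 2)" if "0 \<le> C" for C j
    using mult_left_mono[OF levels(2) that] by (simp only: mult.assoc)
  have s3: "AE \<omega> in P. summable (\<lambda>j. chain_sum (levels j) (\<lambda>n. partial (K j + n) (y \<omega>)) / real (Suc j) powr (168 / 5))"
  proof (rule AE_summable_weighted[where a="65 / 2" and C="C4 * (1156 * 225 ^ 3)"])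
    fix j
    have i: "integrable P (\<lambda>\<omega>. (partial v (y \<omega>) - partial u (y \<omega>)) ^ 4)" if "u \<le> v" for u v
    proof (rule integrable_distr[OF ym, of "\<lambda>x. (partial v x - partial u x) ^ 4", unfolded yd])
      show "integrable circle (\<lambda>x. (partial v x - partial u x) ^ 4)" by (rule partial_fourth_moment(1)[OF that])
    qed
    have c: "(\<integral>\<omega>. (partial v (y \<omega>) - partial u (y \<omega>)) ^ 4 \<partial>P) \<le> C4 * (real (v - u))\<^sup>2" if "u \<le> v" for u v
      using partial_fourth_moment(2)[OF that] transfer[of "\<lambda>x. (partial v x - partial u x) ^ 4"] unfolding ival_eq_circle by simp
    show "integrable P (\<lambda>\<omega>. chain_sum (levels j) (\<lambda>n. partial (K j + n) (y \<omega>)))"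
      by (rule chain_sum_integral(1)[where Y="\<lambda>n \<omega>. partial n (y \<omega>)", OF i c C4_nonneg])
    have "(\<integral>\<omega>. chain_sum (levels j) (\<lambda>n. partial (K j + n) (y \<omega>)) \<partial>P) \<le> C4 * real (levels j) ^ 3 * 4 ^ levels j"
      by (rule chain_sum_integral(2)[where Y="\<lambda>n \<omega>. partial n (y \<omega>)", OF i c C4_nonneg])
    then show "(\<integral>\<omega>. chain_sum (levels j) (\<lambda>n. partial (K j + n) (y \<omega>)) \<partial>P) \<le> C4 * (1156 * 225 ^ 3) * real (Suc j) powr (65 / 2)"
      using levels'[OF C4_nonneg, of j] by linarith
  qed (auto intro: chain_sum_nonneg)
  have s4: "AE \<omega> in P. summable (\<lambda>j. chain_sum (levels j) (\<lambda>n. \<zeta> (tau (K j + n)) \<omega>) / real (Suc j) powr (168 / 5))"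
  proof (rule AE_summable_weighted[where a="65 / 2" and C="3 * (W\<^sup>2 + 1)\<^sup>2 * (1156 * 225 ^ 3)"])
    fix j
    have i: "integrable P (\<lambda>\<omega>. (\<zeta> (tau v) \<omega> - \<zeta> (tau u) \<omega>) ^ 4)" if "u \<le> v" for u v
      by (rule wiener_fourth_moment(1)[OF assms tau_nonneg tau_mono[OF that]])
    have c: "(\<integral>\<omega>. (\<zeta> (tau v) \<omega> - \<zeta> (tau u) \<omega>) ^ 4 \<partial>P) \<le> 3 * (W\<^sup>2 + 1)\<^sup>2 * (real (v - u))\<^sup>2" if "u \<le> v" for u v
    proof -
      have "(tau v - tau u)\<^sup>2 \<le> ((W\<^sup>2 + 1) * real (v - u))\<^sup>2"
        using tau_increment_le[OF that] tau_mono[OF that] by (intro power_mono) auto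
      then show ?thesis unfolding wiener_fourth_moment(2)[OF assms tau_nonneg tau_mono[OF that]]
        by (simp add: power_mult_distrib)
    qed
    have nn: "0 \<le> 3 * (W\<^sup>2 + 1)\<^sup>2" by simp
    show "integrable P (\<lambda>\<omega>. chain_sum (levels j) (\<lambda>n. \<zeta> (tau (K j + n)) \<omega>))"
      by (rule chain_sum_integral(1)[where Y="\<lambda>n. \<zeta> (tau n)", OF i c nn])
    have "(\<integral>\<omega>. chain_sum (levels j) (\<lambda>n. \<zeta> (tau (K j + n)) \<omega>) \<partial>P) \<le> 3 * (W\<^sup>2 + 1)\<^sup>2 * real (levels j) ^ 3 * 4 ^ levels j"
      by (rule chain_sum_integral(2)[where Y="\<lambda>n. \<zeta> (tau n)", OF i c nn])
    then show "(\<integral>\<omega>. chain_sum (levels j) (\<lambda>n. \<zeta> (tau (K j + n)) \<omega>) \<partial>P) \<le> 3 * (W\<^sup>2 + 1)\<^sup>2 * (1156 * 225 ^ 3) * real (Suc j) powr (65 / 2)"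
      using levels'[OF nn, of j] by linarith
  qed (auto intro: chain_sum_nonneg)
  have z0: "AE \<omega> in P. \<zeta> 0 \<omega> = 0" using w unfolding wiener_process_def by blast
  have "AE \<omega> in P. \<exists>C. \<forall>n\<ge>1. \<bar>partial n (y \<omega>) - \<zeta> (tau n) \<omega>\<bar> \<le> C * real n powr (42 / 85)"
    using s1 s2 s3 s4 z0 R.upoint_AE
  proof eventually_elim
    case (elim \<omega>)
    show ?case
    proof (rule assemble_blocks)
      show "partial 0 (y \<omega>) = \<zeta> (tau 0) \<omega>" using elim(5) by (simp add: partial_def)
      show "summable (\<lambda>j. \<bar>(partial (K (Suc j)) (y \<omega>) - partial (K j) (y \<omega>)) - (\<zeta> (tau (K (Suc j))) \<omega> - \<zeta> (tau (K j)) \<omega>)\<bar> / real (Suc j) powr (42 / 5))"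
      proof (rule summable_comparison_test'[OF summable_add[OF elim(1) elim(2)]])
        fix j
        have a: "of_int \<lfloor>real (cells (Suc j)) * y \<omega>\<rfloor> / real (cells (Suc j)) = ?atom (Suc j) \<omega>"
          using elim(6) unfolding y_def[symmetric] by (simp only: of_int_of_nat_eq)
        have "\<bar>block_sum j (y \<omega>) - G j \<omega>\<bar> \<le> \<bar>block_sum j (?atom (Suc j) \<omega>) - G j \<omega>\<bar> + ?D j (y \<omega>)"
          unfolding a by linarith
        then have "\<bar>block_sum j (y \<omega>) - G j \<omega>\<bar> / real (Suc j) powr (42 / 5) \<le>
           (\<bar>block_sum j (?atom (Suc j) \<omega>) - G j \<omega>\<bar> + ?D j (y \<omega>)) / real (Suc j) powr (42 / 5)"
          by (intro divide_right_mono) auto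
        then show "norm (\<bar>(partial (K (Suc j)) (y \<omega>) - partial (K j) (y \<omega>)) - (\<zeta> (tau (K (Suc j))) \<omega> - \<zeta> (tau (K j)) \<omega>)\<bar> / real (Suc j) powr (42 / 5))
          \<le> \<bar>block_sum j (?atom (Suc j) \<omega>) - G j \<omega>\<bar> / real (Suc j) powr (42 / 5) + ?D j (y \<omega>) / real (Suc j) powr (42 / 5)"
          unfolding block_sum_def[of j "y \<omega>"] G_def add_divide_distrib by simp
      qed
      show "summable (\<lambda>j. chain_sum (levels j) (\<lambda>n. partial (K j + n) (y \<omega>)) / real (Suc j) powr (168 / 5))" by (rule elim(3))
      show "summable (\<lambda>j. chain_sum (levels j) (\<lambda>n. \<zeta> (tau (K j + n)) \<omega>) / real (Suc j) powr (168 / 5))" by (rule elim(4))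
    qed
  qed
  then show ?thesis using that ym yd by blast
qed

end

section \<open>Perturbation of a lacunary system\<close>

lemma cesaro_null:
  fixes a :: "nat \<Rightarrow> real"
  assumes "a \<longlonglongrightarrow> 0"
  shows "(\<lambda>n. (\<Sum>k<n. a k) / real n) \<longlonglongrightarrow> 0"
proof (rule LIMSEQ_I)
  fix e :: real assume e: "0 < e"
  obtain N where N: "\<And>k. N \<le> k \<Longrightarrow> \<bar>a k\<bar> < e / 2"
    using LIMSEQ_D[OF assms, of "e / 2"] e by auto
  define A where "A = (\<Sum>k<N. \<bar>a k\<bar>)"
  obtain n0 :: nat where n0: "2 * A / e < real n0" using reals_Archimedean2 by blast
  have "norm ((\<Sum>k<n. a k) / real n - 0) < e" if n: "Suc (max N n0) \<le> n" for n
  proof -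
    have "\<bar>\<Sum>k<n. a k\<bar> \<le> (\<Sum>k<n. \<bar>a k\<bar>)" by (rule sum_abs)
    also have "\<dots> = A + (\<Sum>k\<in>{N..<n}. \<bar>a k\<bar>)"
      unfolding A_def using n sum.atLeastLessThan_concat[of 0 N n "\<lambda>k. \<bar>a k\<bar>"] by (simp add: lessThan_atLeast0)
    also have "(\<Sum>k\<in>{N..<n}. \<bar>a k\<bar>) \<le> (\<Sum>k\<in>{N..<n}. e / 2)" using N by (intro sum_mono less_imp_le) auto
    also have "\<dots> \<le> real n * (e / 2)" using e by (simp add: mult_right_mono)
    finally have "\<bar>\<Sum>k<n. a k\<bar> \<le> A + real n * (e / 2)" by simp
    moreover have "2 * A < real n0 * e" using n0 e by (simp add: pos_divide_less_eq)
    moreover have "real n0 * e \<le> real n * e" using n e by (intro mult_right_mono) auto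
    ultimately have "\<bar>\<Sum>k<n. a k\<bar> < e * real n" by (simp add: mult.commute)
    then show ?thesis using n by (simp add: pos_divide_less_eq)
  qed
  then show "\<exists>no. \<forall>n\<ge>no. norm ((\<Sum>k<n. a k) / real n - 0) < e" by blast
qed

text \<open>
  The law of \<open>\<rho> n * Z n\<close> is explicit and converges. The test functions are uniformly continuous, so
  the almost sure closeness of \<open>H n\<close> to \<open>\<rho> n * Z n\<close> suffices.
\<close>

lemma normal_limit_from_coupling:
  fixes P :: "'w measure"
  assumes "prob_space P" and H: "\<And>n. H n \<in> borel_measurable P" and Z: "\<And>n. Z n \<in> borel_measurable P"
    and Zd: "\<And>n. 1 \<le> n \<Longrightarrow> distr P borel (Z n) = gauss"
    and rho: "\<rho> \<longlonglongrightarrow> (1::real)" and close: "AE \<omega> in P. (\<lambda>n::nat. H n \<omega> - \<rho> n * Z n \<omega>) \<longlonglongrightarrow> 0"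
  shows "weak_conv_m (\<lambda>n. distr P borel (H n)) gauss"
proof (rule integral_cts_step_conv_imp_weak_conv)
  interpret prob_space P by fact
  interpret G: prob_space gauss by (rule prob_space_std_normal)
  note [measurable] = H Z
  show "real_distribution (distr P borel (H n))" for n by (rule real_distribution_distr) measurable
  show "real_distribution gauss" by (rule real_dist_normal_dist)
  fix x y :: real assume xy: "x < y"
  define f where "f = cts_step x y"
  have uc: "uniformly_continuous_on UNIV f" unfolding f_def by (rule cts_step_uniformly_continuous[OF xy])
  then have cont: "continuous_on UNIV f" by (rule uniformly_continuous_imp_continuous)
  have fm [measurable]: "f \<in> borel_measurable borel" by (rule borel_measurable_continuous_onI[OF cont])
  have fb: "\<bar>f z\<bar> \<le> 1" for z using xy by (auto simp: f_def cts_step_def divide_le_eq)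
  have "(\<lambda>n. \<integral>\<omega>. f (H n \<omega>) - f (\<rho> n * Z n \<omega>) \<partial>P) \<longlonglongrightarrow> (\<integral>\<omega>. 0 \<partial>P)"
  proof (rule integral_dominated_convergence[where w="\<lambda>_. 2"])
    show "AE \<omega> in P. (\<lambda>n. f (H n \<omega>) - f (\<rho> n * Z n \<omega>)) \<longlonglongrightarrow> 0"
      using close
    proof eventually_elim
      case (elim \<omega>)
      then have "(\<lambda>n. dist (H n \<omega>) (\<rho> n * Z n \<omega>)) \<longlonglongrightarrow> 0" by (simp add: dist_real_def tendsto_rabs_zero)
      then have "(\<lambda>n. dist (f (H n \<omega>)) (f (\<rho> n * Z n \<omega>))) \<longlonglongrightarrow> 0"
        using uc unfolding uniformly_continuous_on_sequentially by auto
      then show ?case by (simp add: dist_real_def tendsto_rabs_zero_iff)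
    qed
    show "AE \<omega> in P. norm (f (H n \<omega>) - f (\<rho> n * Z n \<omega>)) \<le> 2" for n
      using fb by (intro AE_I2) (metis abs_triangle_ineq4 add_mono one_add_one order_trans real_norm_def)
  qed auto
  then have 1: "(\<lambda>n. \<integral>\<omega>. f (H n \<omega>) - f (\<rho> n * Z n \<omega>) \<partial>P) \<longlonglongrightarrow> 0" by simp
  have 2: "(\<lambda>n. \<integral>z. f (\<rho> n * z) \<partial>gauss) \<longlonglongrightarrow> (\<integral>z. f z \<partial>gauss)"
  proof (rule integral_dominated_convergence[where w="\<lambda>_. 1"])
    show "AE z in gauss. (\<lambda>n. f (\<rho> n * z)) \<longlonglongrightarrow> f z"
    proof (rule AE_I2)
      fix z
      have "(\<lambda>n. \<rho> n * z) \<longlonglongrightarrow> 1 * z" by (intro tendsto_mult rho tendsto_const)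
      moreover have "isCont f z" using cont by (simp add: continuous_on_eq_continuous_at)
      ultimately show "(\<lambda>n. f (\<rho> n * z)) \<longlonglongrightarrow> f z" using isCont_tendsto_compose[of z f] by simp
    qed
  qed (use fb in auto)
  have e: "(\<integral>\<omega>. f (H n \<omega>) \<partial>P) = (\<integral>\<omega>. f (H n \<omega>) - f (\<rho> n * Z n \<omega>) \<partial>P) + (\<integral>z. f (\<rho> n * z) \<partial>gauss)" if "1 \<le> n" for n
  proof -
    have i: "integrable P (\<lambda>\<omega>. f (h \<omega>))" if [measurable]: "h \<in> borel_measurable P" for h
      using fb by (intro integrable_const_bound[where B=1]) auto
    have "(\<integral>z. f (\<rho> n * z) \<partial>gauss) = (\<integral>\<omega>. f (\<rho> n * Z n \<omega>) \<partial>P)"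
      unfolding Zd[OF that, symmetric] by (rule integral_distr) measurable
    then show ?thesis using i[of "H n"] i[of "\<lambda>\<omega>. \<rho> n * Z n \<omega>"] by simp
  qed
  have "(\<lambda>n. \<integral>\<omega>. f (H n \<omega>) \<partial>P) \<longlonglongrightarrow> 0 + (\<integral>z. f z \<partial>gauss)"
  proof (rule Lim_transform_eventually[OF tendsto_add[OF 1 2]])
    show "eventually (\<lambda>n. (\<integral>\<omega>. f (H n \<omega>) - f (\<rho> n * Z n \<omega>) \<partial>P) + (\<integral>z. f (\<rho> n * z) \<partial>gauss) = (\<integral>\<omega>. f (H n \<omega>) \<partial>P)) sequentially"
      using eventually_ge_at_top[of 1] by eventually_elim (use e in auto)
  qed
  moreover have "integral\<^sup>L (distr P borel (H n)) f = (\<integral>\<omega>. f (H n \<omega>) \<partial>P)" for n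
    by (rule integral_distr) measurable
  ultimately show "(\<lambda>n. integral\<^sup>L (distr P borel (H n)) (cts_step x y)) \<longlonglongrightarrow> integral\<^sup>L gauss (cts_step x y)"
    by (simp add: f_def)
qed

text \<open>
  \<open>T k\<close> stands for the actual ergodic sum and \<open>X k\<close> for its periodic approximation.
\<close>

locale perturbed_system = lacunary_system +
  fixes T :: "nat \<Rightarrow> real \<Rightarrow> real" and \<beta> c :: real
  assumes T_borel [measurable]: "\<And>k. T k \<in> borel_measurable borel"
    and T_close: "\<And>k x. \<bar>T k x - X k x\<bar> \<le> 2 * W"
    and T_L1: "\<And>k. ival 0 1 (\<lambda>x. \<bar>T k x - X k x\<bar>) \<le> W * real (Suc k) powr (- \<beta>)"
    and beta: "1 < \<beta>" and c_pos: "0 < c" and var_lower: "\<And>n. c * real n \<le> (\<Sum>k<n. s2 k)"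
begin

abbreviation dev :: "nat \<Rightarrow> real \<Rightarrow> real" where "dev k x \<equiv> T k x - X k x"
definition total :: "nat \<Rightarrow> real \<Rightarrow> real" where "total n x = (\<Sum>k<n. T k x)"
definition drift :: "nat \<Rightarrow> real \<Rightarrow> real" where "drift n x = (\<Sum>k<n. dev k x)"

lemma total_eq: "total n x = partial n x + drift n x"
  by (simp add: total_def partial_def drift_def sum_subtractf)

lemma total_borel [measurable]: "total n \<in> borel_measurable borel" unfolding total_def by measurable
lemma drift_borel [measurable]: "drift n \<in> borel_measurable borel" unfolding drift_def by measurable

lemma drift_bound: "\<bar>drift n x\<bar> \<le> 2 * W * real n"
proof -
  have "\<bar>drift n x\<bar> \<le> (\<Sum>k<n. 2 * W)" unfolding drift_def
    by (rule order_trans[OF sum_abs]) (intro sum_mono T_close)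
  then show ?thesis by (simp add: mult.commute)
qed

lemma partial_bound: "\<bar>partial n x\<bar> \<le> real n * W"
  using partial_diff_bound[of n x 0] by (simp add: partial_def)

lemma square_integrable: "set_integrable lborel {0..<1} (\<lambda>x. (f x)\<^sup>2)"
  if "f \<in> borel_measurable borel" "\<And>x. \<bar>f x\<bar> \<le> B" for f :: "real \<Rightarrow> real"
proof (rule bounded_ival_integrable[where B="B\<^sup>2"])
  show "\<bar>(f x)\<^sup>2\<bar> \<le> B\<^sup>2" for x using power_mono[OF that(2)[of x], of 2] by simp
qed (use that(1) in measurable)

text \<open>
  A new deviation is multiplied by a factor that is at most of order \<open>n\<close>, so its contribution is its
  \<open>L\<^sup>1\<close> norm times \<open>n\<close>; since \<open>\<beta> > 1\<close>, this tends to zero.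
\<close>

lemma drift_second_moment:
  "ival 0 1 (\<lambda>x. (drift n x)\<^sup>2) \<le> 4 * W\<^sup>2 * (\<Sum>k<n. real (Suc k) powr (1 - \<beta>))"
proof (induction n)
  case 0
  then show ?case by (simp add: drift_def set_lebesgue_integral_def)
next
  case (Suc n)
  have ib: "set_integrable lborel {0..<1} (\<lambda>x. \<bar>dev n x\<bar>)"
    by (rule bounded_ival_integrable[where B="2 * W"]) (use T_close in auto)
  have pt: "(drift (Suc n) x)\<^sup>2 \<le> (drift n x)\<^sup>2 + 4 * W * real (Suc n) * \<bar>dev n x\<bar>" for x
  proof -
    have "(drift (Suc n) x)\<^sup>2 = (drift n x)\<^sup>2 + (2 * drift n x + dev n x) * dev n x"
      by (simp add: drift_def power2_eq_square algebra_simps)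
    also have "(2 * drift n x + dev n x) * dev n x \<le> \<bar>2 * drift n x + dev n x\<bar> * \<bar>dev n x\<bar>"
      by (metis abs_ge_self abs_mult)
    also have "\<dots> \<le> (4 * W * real (Suc n)) * \<bar>dev n x\<bar>"
    proof (rule mult_right_mono)
      show "\<bar>2 * drift n x + dev n x\<bar> \<le> 4 * W * real (Suc n)"
        using drift_bound[of n x] T_close[of n x] W_nonneg by (simp add: algebra_simps)
    qed simp
    finally show ?thesis by simp
  qed
  have i1: "set_integrable lborel {0..<1} (\<lambda>x. (drift n x)\<^sup>2)" for n
    by (rule square_integrable[OF drift_borel drift_bound])
  have "ival 0 1 (\<lambda>x. (drift (Suc n) x)\<^sup>2) \<le> ival 0 1 (\<lambda>x. (drift n x)\<^sup>2 + 4 * W * real (Suc n) * \<bar>dev n x\<bar>)"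
    by (rule set_integral_mono) (use i1 ib pt in \<open>auto intro!: set_integral_add set_integrable_mult_right\<close>)
  also have "\<dots> = ival 0 1 (\<lambda>x. (drift n x)\<^sup>2) + 4 * W * real (Suc n) * ival 0 1 (\<lambda>x. \<bar>dev n x\<bar>)"
    using i1 ib by (subst set_integral_add) auto
  also have "\<dots> \<le> 4 * W\<^sup>2 * (\<Sum>k<n. real (Suc k) powr (1 - \<beta>)) + 4 * W * real (Suc n) * (W * real (Suc n) powr (- \<beta>))"
    using W_nonneg by (intro add_mono Suc mult_left_mono T_L1) auto
  also have "4 * W * real (Suc n) * (W * real (Suc n) powr (- \<beta>)) = 4 * W\<^sup>2 * real (Suc n) powr (1 - \<beta>)"
  proof -
    have "real (Suc n) * real (Suc n) powr (- \<beta>) = real (Suc n) powr (1 - \<beta>)"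
      by (subst powr_mult_base) auto
    moreover have "4 * W * s * (W * p) = 4 * W\<^sup>2 * (s * p)" for s p by (simp add: power2_eq_square)
    ultimately show ?thesis by metis
  qed
  finally show ?case by (simp add: distrib_left)
qed

lemma null_power: "(\<lambda>k. real (Suc k) powr (- a)) \<longlonglongrightarrow> 0" if "0 < a"
  by (rule LIMSEQ_Suc[where f="\<lambda>k. real k powr (- a)"]) (rule tendsto_neg_powr[OF _ filterlim_real_sequentially], use that in simp)

definition variance :: "nat \<Rightarrow> real" where "variance n = ival 0 1 (\<lambda>x. (total n x)\<^sup>2)"

text \<open>
  The mixed term is split by Young's inequality with a weight \<open>d\<close> that tends to zero more slowly
  than the averaged second moment \<open>b\<close> of the perturbation.
\<close>

lemma variance_deviation: "(\<lambda>n. (variance n - (\<Sum>k<n. s2 k)) / real n) \<longlonglongrightarrow> 0"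
proof -
  define b where "b n = 4 * W\<^sup>2 * ((\<Sum>k<n. real (Suc k) powr (1 - \<beta>)) / real n) + 1 / real n" for n
  define h where "h n = 60 * W\<^sup>2 * ((\<Sum>i<n. 1 / real (Suc i)) / real n)" for n
  have b0: "b \<longlonglongrightarrow> 0"
  proof -
    have "(\<lambda>k. real (Suc k) powr (1 - \<beta>)) \<longlonglongrightarrow> 0" using null_power[of "\<beta> - 1"] beta by simp
    from tendsto_add[OF tendsto_mult[OF tendsto_const[of "4 * W\<^sup>2"] cesaro_null[OF this]] lim_1_over_n]
    show ?thesis unfolding b_def by simp
  qed
  have h0: "h \<longlonglongrightarrow> 0"
  proof -
    have "(\<lambda>k. 1 / real (Suc k)) \<longlonglongrightarrow> 0" by (rule LIMSEQ_Suc[OF lim_1_over_n])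
    from tendsto_mult[OF tendsto_const[of "60 * W\<^sup>2"] cesaro_null[OF this]] show ?thesis unfolding h_def by simp
  qed
  have le: "\<bar>(variance n - (\<Sum>k<n. s2 k)) / real n\<bar> \<le> sqrt (b n) * (61 * W\<^sup>2) + b n + sqrt (b n) + h n" if n: "1 \<le> n" for n
  proof -
    let ?S = "ival 0 1 (\<lambda>x. (partial n x)\<^sup>2)" and ?E = "ival 0 1 (\<lambda>x. (drift n x)\<^sup>2)"
    have bn: "1 / real n \<le> b n" unfolding b_def by (simp add: sum_nonneg)
    then have bpos: "0 < b n" using n by (meson less_le_trans of_nat_0_less_iff zero_less_divide_1_iff zero_less_one order_less_le_trans)
    define d where "d = sqrt (b n)"
    have d: "0 < d" "d * d = b n" using bpos by (auto simp: d_def)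
    have E: "?E \<le> b n * real n"
    proof -
      have "4 * W\<^sup>2 * (\<Sum>k<n. real (Suc k) powr (1 - \<beta>)) = (b n - 1 / real n) * real n"
        using n by (simp add: b_def)
      also have "\<dots> \<le> b n * real n" by (intro mult_right_mono) auto
      finally show ?thesis using drift_second_moment[of n] by linarith
    qed
    have iS: "set_integrable lborel {0..<1} (\<lambda>x. (partial n x)\<^sup>2)" by (rule square_integrable[OF partial_borel partial_bound])
    have iE: "set_integrable lborel {0..<1} (\<lambda>x. (drift n x)\<^sup>2)" by (rule square_integrable[OF drift_borel drift_bound])
    have "\<bar>total n x\<bar> \<le> real n * W + 2 * W * real n" for x
      unfolding total_eq using partial_bound[of n x] drift_bound[of n x] by linarith
    then have iT: "set_integrable lborel {0..<1} (\<lambda>x. (total n x)\<^sup>2)" by (rule square_integrable[OF total_borel])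
    have pt: "\<bar>(total n x)\<^sup>2 - (partial n x)\<^sup>2\<bar> \<le> d * (partial n x)\<^sup>2 + (1 / d + 1) * (drift n x)\<^sup>2" for x
    proof -
      have young: "2 * \<bar>p * e\<bar> \<le> d * p\<^sup>2 + 1 / d * e\<^sup>2" for p e :: real
      proof -
        have "0 \<le> (d * \<bar>p\<bar> - \<bar>e\<bar>)\<^sup>2 / d" using d by simp
        also have "(d * a - b)\<^sup>2 / d = d * a\<^sup>2 + 1 / d * b\<^sup>2 - 2 * (a * b)" for a b
          using d(1) by (simp add: power2_eq_square field_simps)
        finally show ?thesis by (simp add: abs_mult)
      qed
      have "(total n x)\<^sup>2 - (partial n x)\<^sup>2 = 2 * (partial n x * drift n x) + (drift n x)\<^sup>2"
        unfolding total_eq by (simp add: power2_sum)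
      then have "\<bar>(total n x)\<^sup>2 - (partial n x)\<^sup>2\<bar> \<le> 2 * \<bar>partial n x * drift n x\<bar> + (drift n x)\<^sup>2"
        using abs_triangle_ineq[of "2 * (partial n x * drift n x)" "(drift n x)\<^sup>2"] by simp
      then show ?thesis using young[of "partial n x" "drift n x"] by (simp add: distrib_right)
    qed
    have "variance n - ?S = ival 0 1 (\<lambda>x. (total n x)\<^sup>2 - (partial n x)\<^sup>2)"
      unfolding variance_def using iT iS by simp
    then have "\<bar>variance n - ?S\<bar> \<le> ival 0 1 (\<lambda>x. \<bar>(total n x)\<^sup>2 - (partial n x)\<^sup>2\<bar>)"
      using set_integral_norm_bound[OF set_integral_diff(1)[OF iT iS]] by simp
    also have "\<dots> \<le> ival 0 1 (\<lambda>x. d * (partial n x)\<^sup>2 + (1 / d + 1) * (drift n x)\<^sup>2)"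
      by (rule set_integral_mono) (use iT iS iE pt in \<open>auto intro!: set_integral_add set_integral_diff set_integrable_abs set_integrable_mult_right\<close>)
    also have "\<dots> = d * ?S + (1 / d + 1) * ?E"
      using iS iE by (subst set_integral_add) auto
    also have "\<dots> \<le> d * (61 * W\<^sup>2 * real n) + (1 / d + 1) * (b n * real n)"
    proof (intro add_mono mult_left_mono E)
      have "(\<Sum>k<n. s2 k) \<le> (\<Sum>k<n. W\<^sup>2)" by (intro sum_mono s2_bounds)
      moreover have "60 * W\<^sup>2 * (\<Sum>i<n. 1 / real (Suc i)) \<le> 60 * W\<^sup>2 * (\<Sum>i<n. 1)" by (intro mult_left_mono sum_mono) auto
      moreover have "x \<le> 61 * w * r" if "s \<le> r * w" "a \<le> 60 * w * r" "\<bar>x - s\<bar> \<le> a" for x s a w r :: real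
      proof -
        have "61 * w * r = 60 * w * r + r * w" by simp
        then show ?thesis using that by linarith
      qed
      ultimately show "?S \<le> 61 * W\<^sup>2 * real n"
        using partial_second_moment[of n] by (metis sum_constant card_lessThan mult_1_right)
    qed (use d in auto)
    also have "\<dots> = (d * (61 * W\<^sup>2) + b n + d) * real n"
    proof -
      have "1 / d * b n = d" using d by (simp add: field_simps flip: d(2))
      then have "(1 / d + 1) * b n = d + b n" by (simp only: distrib_right mult_1)
      then have "(1 / d + 1) * (b n * real n) = (d + b n) * real n" by (simp only: mult.assoc[symmetric])
      then show ?thesis by (simp add: algebra_simps)
    qed
    finally have "\<bar>variance n - ?S\<bar> \<le> (d * (61 * W\<^sup>2) + b n + d) * real n" .
    moreover have "\<bar>?S - (\<Sum>k<n. s2 k)\<bar> \<le> h n * real n"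
      using partial_second_moment[of n] n by (simp add: h_def)
    ultimately have "\<bar>variance n - (\<Sum>k<n. s2 k)\<bar> \<le> (d * (61 * W\<^sup>2) + b n + d) * real n + h n * real n" by linarith
    also have "\<dots> = (d * (61 * W\<^sup>2) + b n + d + h n) * real n" by (simp only: distrib_right)
    finally show ?thesis unfolding d_def[symmetric] using n by (simp add: pos_divide_le_eq)
  qed
  have "(\<lambda>n. sqrt (b n) * (61 * W\<^sup>2) + b n + sqrt (b n) + h n) \<longlonglongrightarrow> sqrt 0 * (61 * W\<^sup>2) + 0 + sqrt 0 + 0"
    by (intro tendsto_add tendsto_mult tendsto_const tendsto_real_sqrt b0 h0)
  then have lim: "(\<lambda>n. sqrt (b n) * (61 * W\<^sup>2) + b n + sqrt (b n) + h n) \<longlonglongrightarrow> 0" by simp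
  show ?thesis
  proof (rule Lim_null_comparison[OF _ lim])
    show "eventually (\<lambda>n. norm ((variance n - (\<Sum>k<n. s2 k)) / real n) \<le> sqrt (b n) * (61 * W\<^sup>2) + b n + sqrt (b n) + h n) sequentially"
      by (rule eventually_sequentiallyI[of 1]) (simp only: le real_norm_def)
  qed
qed

lemma ratio_tendsto_1:
  assumes "(\<lambda>n. (f n - (\<Sum>k<n. s2 k)) / real n) \<longlonglongrightarrow> 0"
  shows "(\<lambda>n. f n / (\<Sum>k<n. s2 k)) \<longlonglongrightarrow> 1"
proof -
  let ?s = "\<lambda>n. \<Sum>k<n. s2 k"
  have s: "0 < ?s n" "real n / ?s n \<le> 1 / c" if "1 \<le> n" for n
  proof -
    have "0 < c * real n" using that c_pos by simp
    with var_lower[of n] show p: "0 < ?s n" by linarith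
    show "real n / ?s n \<le> 1 / c" using var_lower[of n] p c_pos by (simp add: field_simps)
  qed
  have "(\<lambda>n. f n / ?s n - 1) \<longlonglongrightarrow> 0"
  proof (rule Lim_null_comparison)
    show "eventually (\<lambda>n. norm (f n / ?s n - 1) \<le> \<bar>(f n - ?s n) / real n\<bar> * (1 / c)) sequentially"
    proof (rule eventually_sequentiallyI[of 1])
      fix n :: nat assume n: "1 \<le> n"
      have "f n / ?s n - 1 = (f n - ?s n) / real n * (real n / ?s n)" using s(1)[OF n] n by (simp add: field_simps)
      then have "norm (f n / ?s n - 1) = \<bar>(f n - ?s n) / real n\<bar> * (real n / ?s n)"
        using s(1)[OF n] by (simp add: abs_mult)
      also have "\<dots> \<le> \<bar>(f n - ?s n) / real n\<bar> * (1 / c)" by (intro mult_left_mono s(2) n) simp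
      finally show "norm (f n / ?s n - 1) \<le> \<bar>(f n - ?s n) / real n\<bar> * (1 / c)" .
    qed
    show "(\<lambda>n. \<bar>(f n - ?s n) / real n\<bar> * (1 / c)) \<longlonglongrightarrow> 0"
      using tendsto_mult[OF tendsto_rabs_zero[OF assms] tendsto_const[of "1 / c"]] by simp
  qed
  then show ?thesis by (simp add: LIM_zero_iff)
qed

lemma variance_ratio: "(\<lambda>n. variance n / (\<Sum>k<n. s2 k)) \<longlonglongrightarrow> 1"
  by (rule ratio_tendsto_1[OF variance_deviation])

lemma extra_tendsto: "extra \<longlonglongrightarrow> 0"
proof (rule Lim_null_comparison)
  show "eventually (\<lambda>k. norm (extra k) \<le> real k powr (- (4 / 17))) sequentially"
  proof (rule eventually_sequentiallyI[of 1])
    fix k :: nat assume k: "1 \<le> k"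
    define J where "J = real (Suc (block k))"
    have J: "0 < J" by (simp add: J_def)
    have "real k \<le> J ^ 17" using block_bounds(2)[of k] unfolding K_def J_def
      by (metis less_imp_le of_nat_le_iff of_nat_power)
    also have "J ^ 17 = J powr 17" using J by (subst powr_numeral) auto
    finally have "(J powr 17) powr (- (4 / 17)) \<le> real k powr (- (4 / 17))" using k by (intro powr_mono2') auto
    moreover have "(J powr 17) powr (- (4 / 17)) = extra k"
    proof -
      have "(J powr 17) powr (- (4 / 17)) = J powr (- 4)" by (simp add: powr_powr)
      also have "\<dots> = 1 / J ^ 4" using J by (simp add: powr_minus_divide powr_numeral)
      finally show ?thesis by (simp add: extra_def J_def)
    qed
    ultimately show "norm (extra k) \<le> real k powr (- (4 / 17))" using extra_bounds(1)[of k] by simp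
  qed
  show "(\<lambda>k. real k powr (- (4 / 17))) \<longlonglongrightarrow> 0"
    by (rule tendsto_neg_powr[OF _ filterlim_real_sequentially]) simp
qed

lemma tau_ratio: "(\<lambda>n. tau n / variance n) \<longlonglongrightarrow> 1"
proof -
  have "(\<lambda>n. (tau n - (\<Sum>k<n. s2 k)) / real n) \<longlonglongrightarrow> 0"
    using cesaro_null[OF extra_tendsto] by (simp add: tau_def sum.distrib)
  from tendsto_divide[OF ratio_tendsto_1[OF this] variance_ratio]
  have "(\<lambda>n. (tau n / (\<Sum>k<n. s2 k)) / (variance n / (\<Sum>k<n. s2 k))) \<longlonglongrightarrow> 1" by simp
  moreover have "eventually (\<lambda>n. (tau n / (\<Sum>k<n. s2 k)) / (variance n / (\<Sum>k<n. s2 k)) = tau n / variance n) sequentially"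
  proof (rule eventually_sequentiallyI[of 1])
    fix n :: nat assume "1 \<le> n"
    then have "0 < (\<Sum>k<n. s2 k)" using var_lower[of n] c_pos by (meson less_le_trans mult_pos_pos of_nat_0_less_iff zero_less_one)
    then show "(tau n / (\<Sum>k<n. s2 k)) / (variance n / (\<Sum>k<n. s2 k)) = tau n / variance n" by simp
  qed
  ultimately show ?thesis by (rule Lim_transform_eventually)
qed

lemma variance_lower: "eventually (\<lambda>n. c / 2 * real n \<le> variance n) sequentially"
proof -
  have "eventually (\<lambda>n. 1 / 2 < variance n / (\<Sum>k<n. s2 k)) sequentially"
    by (rule order_tendstoD(1)[OF variance_ratio]) simp
  then show ?thesis using eventually_ge_at_top[of 1]
  proof eventually_elim
    case (elim n)
    then have p: "0 < (\<Sum>k<n. s2 k)" using var_lower[of n] c_pos by (meson less_le_trans mult_pos_pos of_nat_0_less_iff zero_less_one)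
    then have "1 / 2 * (\<Sum>k<n. s2 k) < variance n" using elim by (simp add: pos_less_divide_eq)
    then show ?case using var_lower[of n] by simp
  qed
qed

lemma drift_bounded_AE: "AE x in circle. \<exists>C. \<forall>n. \<bar>drift n x\<bar> \<le> C"
proof -
  have "AE x in circle. summable (\<lambda>k. \<bar>dev k x\<bar> / real (Suc k) powr 0)"
  proof (rule AE_summable_of_integrals)
    fix k
    have "set_integrable lborel {0..<1} (\<lambda>x. \<bar>dev k x\<bar>)"
      by (rule bounded_ival_integrable[where B="2 * W"]) (use T_close in auto)
    then show "integrable circle (\<lambda>x. \<bar>dev k x\<bar> / real (Suc k) powr 0)"
      by (simp add: circle_def integrable_restrict_space set_integrable_def)
  next
    show "summable (\<lambda>k. LINT x|circle. \<bar>dev k x\<bar> / real (Suc k) powr 0)"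
    proof (rule summable_comparison_test')
      have "summable (\<lambda>k. real (Suc k) powr (- \<beta>))"
        unfolding summable_Suc_iff[of "\<lambda>k. real k powr (- \<beta>)"] summable_real_powr_iff using beta by simp
      then show "summable (\<lambda>k. W * real (Suc k) powr (- \<beta>))" by (rule summable_mult)
      fix k
      have "norm (LINT x|circle. \<bar>dev k x\<bar> / real (Suc k) powr 0) = (LINT x|circle. \<bar>dev k x\<bar>)"
        by (simp add: abs_of_nonneg)
      also have "\<dots> \<le> W * real (Suc k) powr (- \<beta>)" unfolding ival_eq_circle by (rule T_L1)
      finally show "norm (LINT x|circle. \<bar>dev k x\<bar> / real (Suc k) powr 0) \<le> W * real (Suc k) powr (- \<beta>)" .
    qed
  qed simp
  then show ?thesis
  proof eventually_elim
    case (elim x)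
    then have s: "summable (\<lambda>k. \<bar>dev k x\<bar>)" by simp
    have "\<bar>drift n x\<bar> \<le> (\<Sum>k. \<bar>dev k x\<bar>)" for n
    proof -
      have "\<bar>drift n x\<bar> \<le> (\<Sum>k<n. \<bar>dev k x\<bar>)" unfolding drift_def by (rule sum_abs)
      also have "\<dots> \<le> (\<Sum>k. \<bar>dev k x\<bar>)" by (rule sum_le_suminf[OF s]) auto
      finally show ?thesis .
    qed
    then show ?case by blast
  qed
qed

theorem perturbed_approximation:
  fixes P :: "'w measure"
  assumes "prob_space P" and w: "wiener_process P \<zeta>"
  obtains y where "y \<in> measurable P circle" "distr P circle y = circle"
    "AE \<omega> in P. \<exists>C. \<forall>n\<ge>1. \<bar>total n (y \<omega>) - \<zeta> (tau n) \<omega>\<bar> \<le> C * real n powr (42 / 85)"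
proof -
  obtain y where y: "y \<in> measurable P circle" "distr P circle y = circle"
    and ap: "AE \<omega> in P. \<exists>C. \<forall>n\<ge>1. \<bar>partial n (y \<omega>) - \<zeta> (tau n) \<omega>\<bar> \<le> C * real n powr (42 / 85)"
    using strong_approximation[OF assms] by blast
  have "AE \<omega> in P. \<exists>C. \<forall>n. \<bar>drift n (y \<omega>)\<bar> \<le> C"
  proof (rule AE_distrD[OF y(1)])
    show "AE x in distr P circle y. \<exists>C. \<forall>n. \<bar>drift n x\<bar> \<le> C" unfolding y(2) by (rule drift_bounded_AE)
  qed
  with ap have "AE \<omega> in P. \<exists>C. \<forall>n\<ge>1. \<bar>total n (y \<omega>) - \<zeta> (tau n) \<omega>\<bar> \<le> C * real n powr (42 / 85)"
  proof eventually_elim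
    case (elim \<omega>)
    then obtain C D where C: "\<And>n. 1 \<le> n \<Longrightarrow> \<bar>partial n (y \<omega>) - \<zeta> (tau n) \<omega>\<bar> \<le> C * real n powr (42 / 85)"
      and D: "\<And>n. \<bar>drift n (y \<omega>)\<bar> \<le> D" by blast
    have "\<bar>total n (y \<omega>) - \<zeta> (tau n) \<omega>\<bar> \<le> (C + D) * real n powr (42 / 85)" if n: "1 \<le> n" for n
    proof -
      have "0 \<le> D" using D[of 0] by (simp add: drift_def)
      moreover have "1 \<le> real n powr (42 / 85)" using n by (intro ge_one_powr_ge_zero) auto
      ultimately have "D \<le> D * real n powr (42 / 85)" using mult_left_mono[of 1 "real n powr (42 / 85)" D] by simp
      then show ?thesis using C[OF n] D[of n] unfolding total_eq distrib_right by linarith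
    qed
    then show ?case by blast
  qed
  with y show ?thesis using that by blast
qed

end

section \<open>The invariance principle\<close>

context perturbed_system
begin

lemma l2norm_total: "l2norm (total n) = sqrt (variance n)"
  by (simp add: l2norm_def variance_def ival_eq_circle)

lemma variance_nonneg: "0 \<le> variance n"
proof -
  have "0 \<le> (LINT x|circle. (total n x)\<^sup>2)" by simp
  then show ?thesis by (simp only: variance_def ival_eq_circle)
qed

lemma l2norm_total_square: "(l2norm (total n))\<^sup>2 = variance n"
  using variance_nonneg by (simp add: l2norm_total)

text \<open>
  After normalisation the error of the approximation is of order \<open>n\<close> to the power
  \<open>42 / 85 - 1 / 2 = - 1 / 170\<close>.
\<close>

lemma total_central_limit:
  "weak_conv_m (\<lambda>n. distr circle borel (\<lambda>x. total n x / l2norm (total n))) gauss"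
proof -
  obtain P :: "paths measure" and \<zeta> where P: "prob_space P" and w: "wiener_process P \<zeta>"
    by (rule exists_wiener_on_paths)
  interpret P: prob_space P by (rule P)
  obtain y where ym [measurable]: "y \<in> measurable P circle" and yd: "distr P circle y = circle"
    and ap: "AE \<omega> in P. \<exists>C. \<forall>n\<ge>1. \<bar>total n (y \<omega>) - \<zeta> (tau n) \<omega>\<bar> \<le> C * real n powr (42 / 85)"
    by (rule perturbed_approximation[OF P w])
  have zm [measurable]: "\<zeta> (tau n) \<in> borel_measurable P" for n using w tau_nonneg unfolding wiener_process_def by blast
  have zm0 [measurable]: "\<zeta> 0 \<in> borel_measurable P" using w unfolding wiener_process_def by blast
  have totm [measurable]: "total n \<in> borel_measurable circle" for n
    unfolding circle_def by (rule measurable_restrict_space1) simp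
  define Z where "Z n \<omega> = (\<zeta> (tau n) \<omega> - \<zeta> 0 \<omega> - 0) / sqrt (tau n)" for n \<omega>
  have Zm [measurable]: "Z n \<in> borel_measurable P" for n unfolding Z_def by measurable
  have tau_pos: "0 < tau n" if "1 \<le> n" for n using tau_strict_mono[of 0 n] that by simp
  have Zd: "distr P borel (Z n) = gauss" if n: "1 \<le> n" for n
  proof -
    have "distributed P lborel (\<lambda>\<omega>. \<zeta> (tau n) \<omega> - \<zeta> 0 \<omega>) (normal_density 0 (sqrt (tau n - 0)))"
      using w tau_pos[OF n] unfolding wiener_process_def by blast
    then have "distributed P lborel (\<lambda>\<omega>. (\<zeta> (tau n) \<omega> - \<zeta> 0 \<omega> - 0) / sqrt (tau n - 0)) std_normal_density"
      using tau_pos[OF n] by (subst (asm) P.normal_standard_normal_convert) auto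
    from distributed_distr_eq_density[OF this]
    have "distr P lborel (Z n) = gauss" by (simp add: Z_def[abs_def])
    moreover have "distr P lborel (Z n) = distr P borel (Z n)" by (rule distr_cong) auto
    ultimately show ?thesis by simp
  qed
  define H where "H n \<omega> = total n (y \<omega>) / l2norm (total n)" for n \<omega>
  define \<rho> where "\<rho> n = sqrt (tau n / variance n)" for n
  have Hm [measurable]: "H n \<in> borel_measurable P" for n
    unfolding H_def using measurable_compose[OF ym totm] by measurable
  have rho: "\<rho> \<longlonglongrightarrow> 1"
    using tendsto_real_sqrt[OF tau_ratio] unfolding \<rho>_def by simp
  have z0: "AE \<omega> in P. \<zeta> 0 \<omega> = 0" using w unfolding wiener_process_def by blast
  have close: "AE \<omega> in P. (\<lambda>n. H n \<omega> - \<rho> n * Z n \<omega>) \<longlonglongrightarrow> 0"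
    using ap z0
  proof eventually_elim
    case (elim \<omega>)
    then obtain C where C: "\<And>n. 1 \<le> n \<Longrightarrow> \<bar>total n (y \<omega>) - \<zeta> (tau n) \<omega>\<bar> \<le> C * real n powr (42 / 85)" by blast
    show ?case
    proof (rule Lim_null_comparison)
      show "eventually (\<lambda>n. norm (H n \<omega> - \<rho> n * Z n \<omega>) \<le> C / sqrt (c / 2) * real n powr (- (1 / 170))) sequentially"
        using variance_lower eventually_ge_at_top[of 1]
      proof eventually_elim
        case n: (elim n)
        have cn: "0 < c / 2 * real n" using n c_pos by simp
        then have v: "0 < sqrt (variance n)" using n(1) by simp
        have "\<rho> n * Z n \<omega> = \<zeta> (tau n) \<omega> / sqrt (variance n)"
          using tau_pos[OF n(2)] elim(2) by (simp add: \<rho>_def Z_def real_sqrt_divide)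
        then have "H n \<omega> - \<rho> n * Z n \<omega> = (total n (y \<omega>) - \<zeta> (tau n) \<omega>) / sqrt (variance n)"
          by (simp add: H_def l2norm_total diff_divide_distrib)
        then have "norm (H n \<omega> - \<rho> n * Z n \<omega>) = \<bar>total n (y \<omega>) - \<zeta> (tau n) \<omega>\<bar> / sqrt (variance n)"
          using v by simp
        also have "\<dots> \<le> (C * real n powr (42 / 85)) / sqrt (c / 2 * real n)"
          by (rule frac_le) (use C[OF n(2)] cn n(1) in auto)
        also have "\<dots> = C / sqrt (c / 2) * (real n powr (42 / 85) / sqrt (real n))"
          unfolding real_sqrt_mult by simp
        also have "real n powr (42 / 85) / sqrt (real n) = real n powr (- (1 / 170))"
          using n(2) by (simp add: powr_half_sqrt[symmetric] powr_diff[symmetric])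
        finally show ?case .
      qed
      have "(\<lambda>n. real n powr (- (1 / 170))) \<longlonglongrightarrow> 0"
        by (rule tendsto_neg_powr[OF _ filterlim_real_sequentially]) simp
      from tendsto_mult[OF tendsto_const[of "C / sqrt (c / 2)"] this]
      show "(\<lambda>n. C / sqrt (c / 2) * real n powr (- (1 / 170))) \<longlonglongrightarrow> 0" by simp
    qed
  qed
  have "distr P borel (H n) = distr circle borel (\<lambda>x. total n x / l2norm (total n))" for n
  proof -
    have "distr circle borel (\<lambda>x. total n x / l2norm (total n)) = distr (distr P circle y) borel (\<lambda>x. total n x / l2norm (total n))"
      by (simp only: yd)
    also have "\<dots> = distr P borel ((\<lambda>x. total n x / l2norm (total n)) \<circ> y)"
      by (rule distr_distr) measurable
    also have "(\<lambda>x. total n x / l2norm (total n)) \<circ> y = H n" by (auto simp: H_def)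
    finally show ?thesis by simp
  qed
  then show ?thesis using normal_limit_from_coupling[OF P Hm Zm Zd rho close] by simp
qed

lemma total_invariance_principle:
  "\<exists>(M::paths measure) (Y::nat \<Rightarrow> paths \<Rightarrow> real) (\<zeta>::real \<Rightarrow> paths \<Rightarrow> real) (\<tau>::nat \<Rightarrow> paths \<Rightarrow> real).
     prob_space M \<and> same_law M Y circle total \<and> wiener_process M \<zeta> \<and>
     (\<forall>n\<ge>1. \<tau> n \<in> borel_measurable M) \<and>
     (\<forall>\<omega>\<in>space M. \<forall>n\<ge>1. 0 \<le> \<tau> n \<omega> \<and> \<tau> n \<omega> \<le> \<tau> (Suc n) \<omega>) \<and>
     (AE \<omega> in M. (\<lambda>n. Y n \<omega> - \<zeta> (\<tau> n \<omega>) \<omega>) \<in> o(\<lambda>n. real n powr (1/2 - 1/1000))) \<and>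
     (AE \<omega> in M. (\<lambda>n. \<tau> n \<omega> / (l2norm (total n))\<^sup>2) \<longlonglongrightarrow> 1)"
proof -
  obtain P :: "paths measure" and \<zeta> where P: "prob_space P" and w: "wiener_process P \<zeta>"
    by (rule exists_wiener_on_paths)
  obtain y where ym [measurable]: "y \<in> measurable P circle" and yd: "distr P circle y = circle"
    and ap: "AE \<omega> in P. \<exists>C. \<forall>n\<ge>1. \<bar>total n (y \<omega>) - \<zeta> (tau n) \<omega>\<bar> \<le> C * real n powr (42 / 85)"
    by (rule perturbed_approximation[OF P w])
  have totm [measurable]: "total n \<in> borel_measurable circle" for n
    unfolding circle_def by (rule measurable_restrict_space1) simp
  have Ym: "(\<lambda>\<omega>. total n (y \<omega>)) \<in> borel_measurable P" for n
    by (rule measurable_compose[OF ym totm])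
  have "same_law P (\<lambda>n \<omega>. total n (y \<omega>)) circle total"
  proof -
    have tm: "(\<lambda>x. \<lambda>n\<in>{1..}. total n x) \<in> measurable circle (PiM {1..} (\<lambda>_. borel))"
      by (rule measurable_restrict) measurable
    have "distr (distr P circle y) (PiM {1..} (\<lambda>_. borel)) (\<lambda>x. \<lambda>n\<in>{1..}. total n x) =
       distr P (PiM {1..} (\<lambda>_. borel)) ((\<lambda>x. \<lambda>n\<in>{1..}. total n x) \<circ> y)"
      by (rule distr_distr[OF tm ym])
    then show ?thesis unfolding same_law_def using Ym totm by (simp add: yd comp_def)
  qed
  moreover have "AE \<omega> in P. (\<lambda>n. total n (y \<omega>) - \<zeta> (tau n) \<omega>) \<in> o(\<lambda>n. real n powr (1/2 - 1/1000))"
    using ap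
  proof eventually_elim
    case (elim \<omega>)
    then obtain C where C: "\<And>n. 1 \<le> n \<Longrightarrow> \<bar>total n (y \<omega>) - \<zeta> (tau n) \<omega>\<bar> \<le> C * real n powr (42 / 85)" by blast
    have "(\<lambda>n. total n (y \<omega>) - \<zeta> (tau n) \<omega>) \<in> O(\<lambda>n. real n powr (42 / 85))"
      by (rule bigoI[where c=C], rule eventually_sequentiallyI[of 1]) (use C in auto)
    moreover have "(\<lambda>n::nat. real n powr (42 / 85)) \<in> o(\<lambda>n. real n powr (1/2 - 1/1000))"
      using powr_smallo_iff[OF filterlim_real_sequentially, of "42 / 85" "1/2 - 1/1000"] by simp
    ultimately show ?case by (rule landau_o.big_small_trans)
  qed
  moreover have "(\<lambda>n. tau n / (l2norm (total n))\<^sup>2) \<longlonglongrightarrow> 1"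
    using tau_ratio by (simp only: l2norm_total_square)
  ultimately show ?thesis
    using P w tau_nonneg tau_mono
    by (intro exI[of _ P] exI[of _ "\<lambda>n \<omega>. total n (y \<omega>)"] exI[of _ \<zeta>] exI[of _ "\<lambda>n _. tau n"]) auto
qed

end

text \<open>
  The lower bound for the partial quotients gives both the lacunary growth of the denominators and
  the summable \<open>L\<^sup>1\<close> distance to the rational sums.
\<close>

lemma invariance_principle_for_denominators:
  fixes \<alpha> \<beta> c :: real and t L :: "nat \<Rightarrow> nat" and \<phi> :: "real \<Rightarrow> real"
  assumes al: "0 < \<alpha>" "\<alpha> < 1" "\<alpha> \<notin> \<rat>" and t: "strict_mono_on {1..} t"
    and L: "\<And>n. L n = (\<Sum>k=1..n. cf_den \<alpha> (t k))" and beta: "\<beta> > 1"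
    and quot: "\<And>k. 1 \<le> k \<Longrightarrow> real (cf_quot \<alpha> (t k + 1)) \<ge> real k powr \<beta>"
    and phi: "bv_centered \<phi>" and c: "c > 0"
    and low: "\<And>n. 1 \<le> n \<Longrightarrow> (\<Sum>k=1..n. (l2norm (hat_sum \<phi> (cf_den \<alpha> (t k))))\<^sup>2) \<ge> c * real n"
  obtains X m Q W T where "perturbed_system X m Q W T \<beta> c"
    "perturbed_system.total T = (\<lambda>n. ergodic_sum \<alpha> \<phi> (L n))"
    "(\<lambda>n. \<Sum>k<n. lacunary_system.s2 X Q k) = (\<lambda>n. \<Sum>k=1..n. (l2norm (hat_sum \<phi> (cf_den \<alpha> (t k))))\<^sup>2)"
proof -
  have per: "\<phi> (x + 1) = \<phi> x" for x using phi by (simp add: bv_centered_def periodic1_def)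
  have mean: "ival 0 1 \<phi> = 0" using phi unfolding bv_centered_def ival_eq_circle by blast
  obtain W m where d: "dominated \<phi> m" and sh: "\<And>x. m (x + 1) = m x + W"
    using bv_periodic_dominated[of \<phi>] phi unfolding bv_centered_def by metis
  note [measurable] = dominated_borel[OF d]
  define Q where "Q k = cf_den \<alpha> (t (Suc k))" for k
  define X where "X k = rational_sum \<phi> (Q k) (real (L k) * \<alpha>)" for k
  define mm where "mm k = rational_sum m (Q k) (real (L k) * \<alpha>)" for k
  define T where "T k x = ergodic_sum \<alpha> \<phi> (Q k) (x + real (L k) * \<alpha>)" for k x
  have Q1: "1 \<le> Q k" for k unfolding Q_def using cf_den_ge[OF al] by blast
  have Qr: "0 < real (Q k)" for k using Q1[of k] by simp
  have kQ: "real (Suc k) powr \<beta> * real (Q k) \<le> real (cf_den \<alpha> (Suc (t (Suc k))))" for k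
  proof -
    have "real (Suc k) powr \<beta> * real (Q k) \<le> real (cf_quot \<alpha> (Suc (t (Suc k)))) * real (Q k)"
      using quot[of "Suc k"] by (intro mult_right_mono) auto
    also have "\<dots> \<le> real (cf_den \<alpha> (Suc (t (Suc k))))"
      unfolding Q_def using cf_den_Suc[OF al, of "t (Suc k)"] by (metis of_nat_le_iff of_nat_mult)
    finally show ?thesis .
  qed
  have growth: "Suc k * Q k \<le> Q (Suc k)" for k
  proof -
    have "real (Suc k) powr 1 \<le> real (Suc k) powr \<beta>" using beta by (intro powr_mono) auto
    then have "real (Suc k) * real (Q k) \<le> real (Suc k) powr \<beta> * real (Q k)" by (intro mult_right_mono) auto
    also note kQ
    also have "cf_den \<alpha> (Suc (t (Suc k))) \<le> Q (Suc k)"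
      unfolding Q_def by (rule cf_den_mono[OF al]) (use strict_mono_onD[OF t, of "Suc k" "Suc (Suc k)"] in simp)
    finally show ?thesis by (metis of_nat_le_iff of_nat_mult)
  qed
  have osc: "oscillating (1 / real (Q k)) W (X k) (mm k)" for k
    unfolding X_def mm_def using Q1[of k] by (intro rational_sum_oscillating(1)[OF per d sh mean]) simp
  interpret S: lacunary_system X mm Q W
    by unfold_locales (rule osc Q1 growth)+
  have s2: "S.s2 k = (l2norm (hat_sum \<phi> (cf_den \<alpha> (t (Suc k)))))\<^sup>2" for k
    unfolding S.s2_def X_def using hat_sum_norm[OF per d sh mean, of "Q k"] Q1[of k] by (simp add: Q_def)
  have s2sum: "(\<Sum>k<n. S.s2 k) = (\<Sum>k=1..n. (l2norm (hat_sum \<phi> (cf_den \<alpha> (t k))))\<^sup>2)" for n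
    unfolding s2 by (rule sum.reindex_bij_witness[of _ "\<lambda>k. k - 1" Suc]) auto
  let ?e = "\<lambda>k. 1 / real (cf_den \<alpha> (Suc (t (Suc k))))"
  have den_pos: "0 < real (cf_den \<alpha> n)" for n using cf_den_ge[OF al, of n] by simp
  have near: "\<bar>real (Q k) * \<alpha> - real (cf_num \<alpha> (t (Suc k)))\<bar> \<le> ?e k" for k
    unfolding Q_def by (rule cf_approximation[OF al])
  have e_le: "?e k \<le> 1 / real (Q k)" for k
    unfolding Q_def using cf_den_mono[OF al, of "t (Suc k)" "Suc (t (Suc k))"] den_pos[of "t (Suc k)"] by (intro divide_left_mono) auto
  have co: "coprime (cf_num \<alpha> (t (Suc k))) (Q k)" for k unfolding Q_def by (rule cf_coprime[OF al])
  have q0: "0 < Q k" for k using Q1[of k] by simp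
  interpret F: perturbed_system X mm Q W T \<beta> c
  proof unfold_locales
    show "T k \<in> borel_measurable borel" for k unfolding T_def ergodic_sum_def by measurable
    show "\<bar>T k x - X k x\<bar> \<le> 2 * W" for k x
      unfolding T_def X_def by (rule ergodic_sum_vs_rational_sum(1)[OF per d sh q0 co near e_le])
    show "ival 0 1 (\<lambda>x. \<bar>T k x - X k x\<bar>) \<le> W * real (Suc k) powr (- \<beta>)" for k
    proof -
      have "ival 0 1 (\<lambda>x. \<bar>T k x - X k x\<bar>) \<le> W * (real (Q k) * ?e k)"
        unfolding T_def X_def by (rule ergodic_sum_vs_rational_sum(2)[OF per d sh q0 co near e_le])
      also have "\<dots> \<le> W * real (Suc k) powr (- \<beta>)"
      proof (rule mult_left_mono[OF _ S.W_nonneg])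
        have "0 < real (Suc k) powr \<beta>" by simp
        then show "real (Q k) * ?e k \<le> real (Suc k) powr (- \<beta>)"
          using kQ[of k] den_pos[of "Suc (t (Suc k))"] by (simp add: powr_minus_divide field_simps)
      qed
      finally show ?thesis .
    qed
    show "1 < \<beta>" "0 < c" using beta c by auto
    show "c * real n \<le> (\<Sum>k<n. S.s2 k)" for n
      unfolding s2sum using low[of n] by (cases "n = 0") auto
  qed
  have "F.total n x = ergodic_sum \<alpha> \<phi> (L n) x" for n x
  proof (induction n)
    case 0
    then show ?case by (simp add: F.total_def L ergodic_sum_def)
  next
    case (Suc n)
    have L': "L (Suc n) = L n + Q n" by (simp add: L Q_def)
    have "ergodic_sum \<alpha> \<phi> (L (Suc n)) x = ergodic_sum \<alpha> \<phi> (L n) x + (\<Sum>j\<in>{L n..<L n + Q n}. \<phi> (x + real j * \<alpha>))"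
      unfolding ergodic_sum_def L' using sum.atLeastLessThan_concat[of 0 "L n" "L n + Q n" "\<lambda>j. \<phi> (x + real j * \<alpha>)"]
      by (simp add: lessThan_atLeast0)
    also have "(\<Sum>j\<in>{L n..<L n + Q n}. \<phi> (x + real j * \<alpha>)) = T n x"
      unfolding T_def ergodic_sum_def
      by (rule sum.reindex_bij_witness[of _ "\<lambda>j. L n + j" "\<lambda>j. j - L n"]) (auto simp: algebra_simps of_nat_diff)
    finally show ?case using Suc by (simp add: F.total_def)
  qed
  then have tot: "F.total = (\<lambda>n. ergodic_sum \<alpha> \<phi> (L n))" by (intro ext)
  have "(\<lambda>n. \<Sum>k<n. S.s2 k) = (\<lambda>n. \<Sum>k=1..n. (l2norm (hat_sum \<phi> (cf_den \<alpha> (t k))))\<^sup>2)" by (intro ext s2sum)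
  then show ?thesis by (rule that[OF F.perturbed_system_axioms tot])
qed

theorem theorem2p1:
  shows "\<exists>lam::real. lam > 0 \<and>
    (\<forall>(\<alpha>::real) (t::nat \<Rightarrow> nat) (\<beta>::real) (L::nat \<Rightarrow> nat).
       0 < \<alpha> \<longrightarrow> \<alpha> < 1 \<longrightarrow> \<alpha> \<notin> \<rat> \<longrightarrow>
       strict_mono_on {1..} t \<longrightarrow> (\<forall>k\<ge>1. t k \<ge> 1) \<longrightarrow>
       (\<forall>n. L n = (\<Sum>k=1..n. cf_den \<alpha> (t k))) \<longrightarrow>
       \<beta> > 1 \<longrightarrow> (\<forall>k\<ge>1. real (cf_quot \<alpha> (t k + 1)) \<ge> real k powr \<beta>) \<longrightarrow>
       (\<forall>(\<phi>::real \<Rightarrow> real) (c::real).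
          bv_centered \<phi> \<longrightarrow> c > 0 \<longrightarrow>
          (\<forall>n\<ge>1. (\<Sum>k=1..n. (l2norm (hat_sum \<phi> (cf_den \<alpha> (t k))))\<^sup>2) \<ge> c * real n) \<longrightarrow>
          ((\<lambda>n. (l2norm (ergodic_sum \<alpha> \<phi> (L n)))\<^sup>2 /
                (\<Sum>k=1..n. (l2norm (hat_sum \<phi> (cf_den \<alpha> (t k))))\<^sup>2)) \<longlonglongrightarrow> 1) \<and>
          weak_conv_m
            (\<lambda>n. distr circle borel
               (\<lambda>x. ergodic_sum \<alpha> \<phi> (L n) x / l2norm (ergodic_sum \<alpha> \<phi> (L n))))
            std_normal_distribution \<and>
          (\<exists>(M::paths measure) (Y::nat \<Rightarrow> paths \<Rightarrow> real) (\<zeta>::real \<Rightarrow> paths \<Rightarrow> real)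
             (\<tau>::nat \<Rightarrow> paths \<Rightarrow> real).
             prob_space M \<and>
             same_law M Y circle (\<lambda>n. ergodic_sum \<alpha> \<phi> (L n)) \<and>
             wiener_process M \<zeta> \<and>
             (\<forall>n\<ge>1. \<tau> n \<in> borel_measurable M) \<and>
             (\<forall>\<omega>\<in>space M. \<forall>n\<ge>1. 0 \<le> \<tau> n \<omega> \<and> \<tau> n \<omega> \<le> \<tau> (Suc n) \<omega>) \<and>
             (AE \<omega> in M. (\<lambda>n. Y n \<omega> - \<zeta> (\<tau> n \<omega>) \<omega>) \<in> o(\<lambda>n. real n powr (1/2 - lam))) \<and>
             (AE \<omega> in M.
                (\<lambda>n. \<tau> n \<omega> / (l2norm (ergodic_sum \<alpha> \<phi> (L n)))\<^sup>2) \<longlonglongrightarrow> 1))))"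
\<comment> \<open>any constant below \<open>1 / 2 - 42 / 85 = 1 / 170\<close> is possible\<close>
proof (intro exI[of _ "1 / 1000 :: real"] conjI[of "0 < (1 / 1000 :: real)"] allI impI)
  fix \<alpha> \<beta> c :: real and t L :: "nat \<Rightarrow> nat" and \<phi> :: "real \<Rightarrow> real"
  assume al: "0 < \<alpha>" "\<alpha> < 1" "\<alpha> \<notin> \<rat>" and t: "strict_mono_on {1..} t" and t1: "\<forall>k\<ge>1. t k \<ge> 1"
    and L: "\<forall>n. L n = (\<Sum>k=1..n. cf_den \<alpha> (t k))"
    and beta: "\<beta> > 1" and quot: "\<forall>k\<ge>1. real (cf_quot \<alpha> (t k + 1)) \<ge> real k powr \<beta>"
    and phi: "bv_centered \<phi>" and c: "c > 0"
    and low: "\<forall>n\<ge>1. (\<Sum>k=1..n. (l2norm (hat_sum \<phi> (cf_den \<alpha> (t k))))\<^sup>2) \<ge> c * real n"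
  obtain X m Q W T where sys: "perturbed_system X m Q W T \<beta> c"
    and total: "perturbed_system.total T = (\<lambda>n. ergodic_sum \<alpha> \<phi> (L n))"
    and s2: "(\<lambda>n. \<Sum>k<n. lacunary_system.s2 X Q k) = (\<lambda>n. \<Sum>k=1..n. (l2norm (hat_sum \<phi> (cf_den \<alpha> (t k))))\<^sup>2)"
    by (rule invariance_principle_for_denominators[OF al t L[rule_format] beta quot[rule_format] phi c low[rule_format]])
  interpret F: perturbed_system X m Q W T \<beta> c by (rule sys)
  have s2n: "(\<Sum>k<n. F.s2 k) = (\<Sum>k=1..n. (l2norm (hat_sum \<phi> (cf_den \<alpha> (t k))))\<^sup>2)" for n
    using s2 by (rule fun_cong)
  show "((\<lambda>n. (l2norm (ergodic_sum \<alpha> \<phi> (L n)))\<^sup>2 /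
                (\<Sum>k=1..n. (l2norm (hat_sum \<phi> (cf_den \<alpha> (t k))))\<^sup>2)) \<longlonglongrightarrow> 1) \<and>
          weak_conv_m
            (\<lambda>n. distr circle borel
               (\<lambda>x. ergodic_sum \<alpha> \<phi> (L n) x / l2norm (ergodic_sum \<alpha> \<phi> (L n))))
            std_normal_distribution \<and>
          (\<exists>(M::paths measure) (Y::nat \<Rightarrow> paths \<Rightarrow> real) (\<zeta>::real \<Rightarrow> paths \<Rightarrow> real)
             (\<tau>::nat \<Rightarrow> paths \<Rightarrow> real).
             prob_space M \<and>
             same_law M Y circle (\<lambda>n. ergodic_sum \<alpha> \<phi> (L n)) \<and>
             wiener_process M \<zeta> \<and>
             (\<forall>n\<ge>1. \<tau> n \<in> borel_measurable M) \<and>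
             (\<forall>\<omega>\<in>space M. \<forall>n\<ge>1. 0 \<le> \<tau> n \<omega> \<and> \<tau> n \<omega> \<le> \<tau> (Suc n) \<omega>) \<and>
             (AE \<omega> in M. (\<lambda>n. Y n \<omega> - \<zeta> (\<tau> n \<omega>) \<omega>) \<in> o(\<lambda>n. real n powr (1/2 - 1/1000))) \<and>
             (AE \<omega> in M.
                (\<lambda>n. \<tau> n \<omega> / (l2norm (ergodic_sum \<alpha> \<phi> (L n)))\<^sup>2) \<longlonglongrightarrow> 1))"
    using F.variance_ratio F.total_central_limit F.total_invariance_principle
    unfolding F.l2norm_total_square[symmetric] s2n total by blast
qed simp

end
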